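(* Let $X$ be a projective variety over an algebraically closed field of characteristic zero and let $E$ be a vector bundle on $X$. For all $c\geq 1$ we have $\mathbb{B}^{\otimes}(E)=\mathbb{B}^{\otimes}(T^cE)$, and $$\mathbb{B}_{+}(E)=\mathbb{B}_{+}(S^cE)=\mathbb{B}_{+}(T^cE),\qquad \mathbb{B}_{-}(E)=\mathbb{B}_{-}(S^cE)=\mathbb{B}_{-}(T^cE).$$ In particular, for any $c\geq 1$: $T^cE$ is V-big if and only if $E$ is V-big if and only if $S^cE$ is V-big; and $T^cE$ is V-psef if and only if $E$ is V-psef if and only if $S^cE$ is V-psef.
   Context: A vector bundle is a locally free sheaf of finite positive rank. Write $S^m=\mathrm{Sym}^m$ and $T^mE=E^{\otimes m}$. For a vector bundle $V$ on $X$, $\mathrm{Bs}(V)$ is the set of $x\in X$ such that $H^0(X,V)\to V(x)=V\otimes\kappa(x)$ is not surjective. Put $\mathbb{B}^{\otimes}(V)=\bigcap_{m\geq 1}\mathrm{Bs}(T^mV)$. For any ample line bundle $A$ on $X$ (the definitions do not depend on the choice), the augmented and diminished base loci are $$\mathbb{B}_+(V)=\bigcap_{q\geq 1}\bigcap_{m\geq 1}\mathrm{Bs}(S^mS^qV\otimes A^{-m}),\qquad \mathbb{B}_-(V)=\bigcup_{q\geq 1}\bigcap_{m\geq 1}\mathrm{Bs}(S^mS^qV\otimes A^{m}).$$ $V$ is V-big if $\mathbb{B}_+(V)\neq X$ and V-psef if $\mathbb{B}_-(V)\neq X$. *)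

theory Defs
  imports
    "HOL-Analysis.Abstract_Topology"
    "HOL-Library.Poly_Mapping"
    "HOL-Computational_Algebra.Polynomial"
    "HOL-Algebra.Module"
    "HOL-Algebra.QuotRing"
    "HOL-Algebra.Subrings"
begin

section \<open>Modules over a commutative ring\<close>

text \<open>
  The record type of modules in HOL-Algebra extends that of rings; its fields \<open>mult\<close> and
  \<open>one\<close> play no role for a module and are left undefined below.
\<close>

definition mspan :: "('r, 'x) ring_scheme \<Rightarrow> ('r, 'm, 'y) module_scheme \<Rightarrow> 'm set \<Rightarrow> 'm set" where
  "mspan R M S = \<Inter>{H. submodule H R M \<and> S \<subseteq> H}"

definition linear_maps ::
  "('r, 'x) ring_scheme \<Rightarrow> ('r, 'm, 'y) module_scheme \<Rightarrow> ('r, 'n, 'z) module_scheme \<Rightarrow> ('m \<Rightarrow> 'n) set" where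
  "linear_maps R M N = {f \<in> carrier M \<rightarrow>\<^sub>E carrier N.
     (\<forall>u\<in>carrier M. \<forall>v\<in>carrier M. f (u \<oplus>\<^bsub>M\<^esub> v) = f u \<oplus>\<^bsub>N\<^esub> f v) \<and>
     (\<forall>a\<in>carrier R. \<forall>u\<in>carrier M. f (a \<odot>\<^bsub>M\<^esub> u) = a \<odot>\<^bsub>N\<^esub> f u)}"

definition self_module :: "('r, 'x) ring_scheme \<Rightarrow> ('r, 'r) module" where
  "self_module R = \<lparr>carrier = carrier R, mult = (\<otimes>\<^bsub>R\<^esub>), one = \<one>\<^bsub>R\<^esub>, zero = \<zero>\<^bsub>R\<^esub>,
     add = (\<oplus>\<^bsub>R\<^esub>), smult = (\<otimes>\<^bsub>R\<^esub>)\<rparr>"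

definition dual_module :: "('r, 'x) ring_scheme \<Rightarrow> ('r, 'm, 'y) module_scheme \<Rightarrow> ('r, 'm \<Rightarrow> 'r) module" where
  "dual_module R M = \<lparr>carrier = linear_maps R M (self_module R), mult = undefined, one = undefined,
     zero = (\<lambda>u\<in>carrier M. \<zero>\<^bsub>R\<^esub>),
     add = (\<lambda>f g. \<lambda>u\<in>carrier M. f u \<oplus>\<^bsub>R\<^esub> g u),
     smult = (\<lambda>a f. \<lambda>u\<in>carrier M. a \<otimes>\<^bsub>R\<^esub> f u)\<rparr>"

definition quot_module :: "('r, 'm, 'y) module_scheme \<Rightarrow> 'm set \<Rightarrow> ('r, 'm set) module" where
  "quot_module M H = \<lparr>carrier = a_rcosets\<^bsub>M\<^esub> H, mult = undefined, one = undefined,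
     zero = H, add = set_add M,
     smult = (\<lambda>a C. \<Union>u\<in>C. H +>\<^bsub>M\<^esub> (a \<odot>\<^bsub>M\<^esub> u))\<rparr>"

definition free_module :: "('r, 'x) ring_scheme \<Rightarrow> 'g set \<Rightarrow> ('r, 'g \<Rightarrow> 'r) module" where
  "free_module R G = \<lparr>
     carrier = {f. range f \<subseteq> carrier R \<and> finite {g. f g \<noteq> \<zero>\<^bsub>R\<^esub>} \<and> {g. f g \<noteq> \<zero>\<^bsub>R\<^esub>} \<subseteq> G},
     mult = undefined, one = undefined,
     zero = (\<lambda>_. \<zero>\<^bsub>R\<^esub>),
     add = (\<lambda>f f' g. f g \<oplus>\<^bsub>R\<^esub> f' g),
     smult = (\<lambda>a f g. a \<otimes>\<^bsub>R\<^esub> f g)\<rparr>"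

definition gen :: "('r, 'x) ring_scheme \<Rightarrow> 'g \<Rightarrow> 'g \<Rightarrow> 'r" where
  "gen R g = (\<lambda>h. if h = g then \<one>\<^bsub>R\<^esub> else \<zero>\<^bsub>R\<^esub>)"

subsection \<open>Binary tensor product\<close>

definition tensor_rels ::
  "('r, 'x) ring_scheme \<Rightarrow> ('r, 'm, 'y) module_scheme \<Rightarrow> ('r, 'n, 'z) module_scheme \<Rightarrow> ('m \<times> 'n \<Rightarrow> 'r) set" where
  "tensor_rels R M N = (let F = free_module R (carrier M \<times> carrier N) in
     {gen R (u \<oplus>\<^bsub>M\<^esub> u', v) \<ominus>\<^bsub>F\<^esub> (gen R (u, v) \<oplus>\<^bsub>F\<^esub> gen R (u', v)) | u u' v.
        u \<in> carrier M \<and> u' \<in> carrier M \<and> v \<in> carrier N} \<union>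
     {gen R (u, v \<oplus>\<^bsub>N\<^esub> v') \<ominus>\<^bsub>F\<^esub> (gen R (u, v) \<oplus>\<^bsub>F\<^esub> gen R (u, v')) | u v v'.
        u \<in> carrier M \<and> v \<in> carrier N \<and> v' \<in> carrier N} \<union>
     {gen R (a \<odot>\<^bsub>M\<^esub> u, v) \<ominus>\<^bsub>F\<^esub> a \<odot>\<^bsub>F\<^esub> gen R (u, v) | a u v.
        a \<in> carrier R \<and> u \<in> carrier M \<and> v \<in> carrier N} \<union>
     {gen R (u, a \<odot>\<^bsub>N\<^esub> v) \<ominus>\<^bsub>F\<^esub> a \<odot>\<^bsub>F\<^esub> gen R (u, v) | a u v.
        a \<in> carrier R \<and> u \<in> carrier M \<and> v \<in> carrier N})"

definition tensor_kernel where
  "tensor_kernel R M N = mspan R (free_module R (carrier M \<times> carrier N)) (tensor_rels R M N)"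

definition tensor_module ::
  "('r, 'x) ring_scheme \<Rightarrow> ('r, 'm, 'y) module_scheme \<Rightarrow> ('r, 'n, 'z) module_scheme
    \<Rightarrow> ('r, ('m \<times> 'n \<Rightarrow> 'r) set) module" where
  "tensor_module R M N =
     quot_module (free_module R (carrier M \<times> carrier N)) (tensor_kernel R M N)"

definition pure_tensor ::
  "('r, 'x) ring_scheme \<Rightarrow> ('r, 'm, 'y) module_scheme \<Rightarrow> ('r, 'n, 'z) module_scheme
    \<Rightarrow> 'm \<Rightarrow> 'n \<Rightarrow> ('m \<times> 'n \<Rightarrow> 'r) set" where
  "pure_tensor R M N u v =
     tensor_kernel R M N +>\<^bsub>free_module R (carrier M \<times> carrier N)\<^esub> gen R (u, v)"

subsection \<open>Tensor and symmetric powers\<close>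

definition tuples :: "('r, 'm, 'y) module_scheme \<Rightarrow> nat \<Rightarrow> 'm list set" where
  "tuples M m = {us. length us = m \<and> set us \<subseteq> carrier M}"

definition multilinear_rels ::
  "('r, 'x) ring_scheme \<Rightarrow> ('r, 'm, 'y) module_scheme \<Rightarrow> nat \<Rightarrow> ('m list \<Rightarrow> 'r) set" where
  "multilinear_rels R M m = (let F = free_module R (tuples M m) in
     {gen R (us[i := u \<oplus>\<^bsub>M\<^esub> v]) \<ominus>\<^bsub>F\<^esub> (gen R (us[i := u]) \<oplus>\<^bsub>F\<^esub> gen R (us[i := v])) | us i u v.
        us \<in> tuples M m \<and> i < m \<and> u \<in> carrier M \<and> v \<in> carrier M} \<union>
     {gen R (us[i := a \<odot>\<^bsub>M\<^esub> u]) \<ominus>\<^bsub>F\<^esub> a \<odot>\<^bsub>F\<^esub> gen R (us[i := u]) | us i a u.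
        us \<in> tuples M m \<and> i < m \<and> a \<in> carrier R \<and> u \<in> carrier M})"

definition permutation_rels ::
  "('r, 'x) ring_scheme \<Rightarrow> ('r, 'm, 'y) module_scheme \<Rightarrow> nat \<Rightarrow> ('m list \<Rightarrow> 'r) set" where
  "permutation_rels R M m = (let F = free_module R (tuples M m) in
     {gen R us \<ominus>\<^bsub>F\<^esub> gen R vs | us vs. us \<in> tuples M m \<and> vs \<in> tuples M m \<and> mset us = mset vs})"

definition tpow_kernel where
  "tpow_kernel R M m = mspan R (free_module R (tuples M m)) (multilinear_rels R M m)"

definition spow_kernel where
  "spow_kernel R M m =
     mspan R (free_module R (tuples M m)) (multilinear_rels R M m \<union> permutation_rels R M m)"

definition tpow_module ::
  "('r, 'x) ring_scheme \<Rightarrow> ('r, 'm, 'y) module_scheme \<Rightarrow> nat \<Rightarrow> ('r, ('m list \<Rightarrow> 'r) set) module" where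
  "tpow_module R M m = quot_module (free_module R (tuples M m)) (tpow_kernel R M m)"

definition spow_module ::
  "('r, 'x) ring_scheme \<Rightarrow> ('r, 'm, 'y) module_scheme \<Rightarrow> nat \<Rightarrow> ('r, ('m list \<Rightarrow> 'r) set) module" where
  "spow_module R M m = quot_module (free_module R (tuples M m)) (spow_kernel R M m)"

definition tpow_pure ::
  "('r, 'x) ring_scheme \<Rightarrow> ('r, 'm, 'y) module_scheme \<Rightarrow> nat \<Rightarrow> 'm list \<Rightarrow> ('m list \<Rightarrow> 'r) set" where
  "tpow_pure R M m us = tpow_kernel R M m +>\<^bsub>free_module R (tuples M m)\<^esub> gen R us"

definition spow_pure ::
  "('r, 'x) ring_scheme \<Rightarrow> ('r, 'm, 'y) module_scheme \<Rightarrow> nat \<Rightarrow> 'm list \<Rightarrow> ('m list \<Rightarrow> 'r) set" where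
  "spow_pure R M m us = spow_kernel R M m +>\<^bsub>free_module R (tuples M m)\<^esub> gen R us"

section \<open>Ringed spaces and sheaves of modules\<close>

text \<open>
  A sheaf is given by its stalks together with, for each open \<open>U\<close>, the set of its sections, a
  section being identified with the family of its germs \<open>\<lambda>x\<in>U. s x\<close>. The sheaf
  condition, the existence of sections through every germ, and the condition that sections with
  the same germ at a point agree near that point make this equivalent to the description by
  presheaves satisfying the gluing axiom: the given sets are then the stalks (up to unique
  isomorphism).
\<close>

definition sheaf_of_germs :: "'p topology \<Rightarrow> ('p \<Rightarrow> 'm set) \<Rightarrow> ('p set \<Rightarrow> ('p \<Rightarrow> 'm) set) \<Rightarrow> bool" where
  "sheaf_of_germs T S \<Gamma> \<longleftrightarrow>
     (\<forall>U. openin T U \<longrightarrow> \<Gamma> U \<subseteq> (\<Pi>\<^sub>E x\<in>U. S x)) \<and>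
     (\<forall>U V s. openin T U \<and> openin T V \<and> V \<subseteq> U \<and> s \<in> \<Gamma> U \<longrightarrow> restrict s V \<in> \<Gamma> V) \<and>
     (\<forall>U s. openin T U \<and> s \<in> (\<Pi>\<^sub>E x\<in>U. S x) \<and>
        (\<forall>x\<in>U. \<exists>V. openin T V \<and> x \<in> V \<and> V \<subseteq> U \<and> restrict s V \<in> \<Gamma> V) \<longrightarrow> s \<in> \<Gamma> U) \<and>
     (\<forall>x\<in>topspace T. \<forall>u\<in>S x. \<exists>U. openin T U \<and> x \<in> U \<and> (\<exists>s\<in>\<Gamma> U. s x = u)) \<and>
     (\<forall>U x s t. openin T U \<and> x \<in> U \<and> s \<in> \<Gamma> U \<and> t \<in> \<Gamma> U \<and> s x = t x \<longrightarrow>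
        (\<exists>V. openin T V \<and> x \<in> V \<and> V \<subseteq> U \<and> restrict s V = restrict t V))"

record ('p, 'r) rspace =
  pts :: "'p topology"
  stalk :: "'p \<Rightarrow> 'r ring"
  sects :: "'p set \<Rightarrow> ('p \<Rightarrow> 'r) set"

record ('p, 'r, 'm) mod_sheaf =
  mstalk :: "'p \<Rightarrow> ('r, 'm) module"
  msects :: "'p set \<Rightarrow> ('p \<Rightarrow> 'm) set"

definition germ_ring :: "('p, 'r) rspace \<Rightarrow> 'p set \<Rightarrow> ('p \<Rightarrow> 'r) ring" where
  "germ_ring X U = \<lparr>carrier = (\<Pi>\<^sub>E x\<in>U. carrier (stalk X x)),
     mult = (\<lambda>f g. \<lambda>x\<in>U. f x \<otimes>\<^bsub>stalk X x\<^esub> g x),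
     one = (\<lambda>x\<in>U. \<one>\<^bsub>stalk X x\<^esub>),
     zero = (\<lambda>x\<in>U. \<zero>\<^bsub>stalk X x\<^esub>),
     add = (\<lambda>f g. \<lambda>x\<in>U. f x \<oplus>\<^bsub>stalk X x\<^esub> g x)\<rparr>"

definition section_ring :: "('p, 'r) rspace \<Rightarrow> 'p set \<Rightarrow> ('p \<Rightarrow> 'r) ring" where
  "section_ring X U = (germ_ring X U)\<lparr>carrier := sects X U\<rparr>"

definition germ_module :: "('p \<Rightarrow> ('r, 'm) module) \<Rightarrow> 'p set \<Rightarrow> ('p \<Rightarrow> 'r, 'p \<Rightarrow> 'm) module" where
  "germ_module N U = \<lparr>carrier = (\<Pi>\<^sub>E x\<in>U. carrier (N x)), mult = undefined, one = undefined,
     zero = (\<lambda>x\<in>U. \<zero>\<^bsub>N x\<^esub>),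
     add = (\<lambda>s t. \<lambda>x\<in>U. s x \<oplus>\<^bsub>N x\<^esub> t x),
     smult = (\<lambda>f s. \<lambda>x\<in>U. f x \<odot>\<^bsub>N x\<^esub> s x)\<rparr>"

definition ringed_space :: "('p, 'r) rspace \<Rightarrow> bool" where
  "ringed_space X \<longleftrightarrow>
     sheaf_of_germs (pts X) (\<lambda>x. carrier (stalk X x)) (sects X) \<and>
     (\<forall>x\<in>topspace (pts X). cring (stalk X x)) \<and>
     (\<forall>U. openin (pts X) U \<longrightarrow> subring (sects X U) (germ_ring X U))"

definition sheaf_of_modules :: "('p, 'r) rspace \<Rightarrow> ('p, 'r, 'm) mod_sheaf \<Rightarrow> bool" where
  "sheaf_of_modules X M \<longleftrightarrow>
     sheaf_of_germs (pts X) (\<lambda>x. carrier (mstalk M x)) (msects M) \<and>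
     (\<forall>x\<in>topspace (pts X). module (stalk X x) (mstalk M x)) \<and>
     (\<forall>U. openin (pts X) U \<longrightarrow> submodule (msects M U) (section_ring X U) (germ_module (mstalk M) U))"

definition iso_mod_sheaf_on ::
  "('p, 'r) rspace \<Rightarrow> 'p set \<Rightarrow> ('p, 'r, 'm) mod_sheaf \<Rightarrow> ('p, 'r, 'n) mod_sheaf \<Rightarrow> bool" where
  "iso_mod_sheaf_on X U M N \<longleftrightarrow> (\<exists>\<phi>.
     (\<forall>x\<in>U. \<phi> x \<in> linear_maps (stalk X x) (mstalk M x) (mstalk N x) \<and>
        bij_betw (\<phi> x) (carrier (mstalk M x)) (carrier (mstalk N x))) \<and>
     (\<forall>V. openin (pts X) V \<and> V \<subseteq> U \<longrightarrow> (\<lambda>s. \<lambda>x\<in>V. \<phi> x (s x)) ` msects M V = msects N V))"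

definition free_sheaf :: "('p, 'r) rspace \<Rightarrow> nat \<Rightarrow> ('p, 'r, nat \<Rightarrow> 'r) mod_sheaf" where
  "free_sheaf X r = \<lparr>mstalk = (\<lambda>x. free_module (stalk X x) {..<r}),
     msects = (\<lambda>U. {s \<in> (\<Pi>\<^sub>E x\<in>U. carrier (free_module (stalk X x) {..<r})).
        \<forall>i<r. (\<lambda>x\<in>U. s x i) \<in> sects X U})\<rparr>"

definition locally_free :: "('p, 'r) rspace \<Rightarrow> nat \<Rightarrow> ('p, 'r, 'm) mod_sheaf \<Rightarrow> bool" where
  "locally_free X r M \<longleftrightarrow> sheaf_of_modules X M \<and>
     (\<forall>x\<in>topspace (pts X). \<exists>U. openin (pts X) U \<and> x \<in> U \<and> iso_mod_sheaf_on X U (free_sheaf X r) M)"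

definition vector_bundle :: "('p, 'r) rspace \<Rightarrow> ('p, 'r, 'm) mod_sheaf \<Rightarrow> bool" where
  "vector_bundle X E \<longleftrightarrow> (\<exists>r\<ge>1. locally_free X r E)"

definition line_bundle :: "('p, 'r) rspace \<Rightarrow> ('p, 'r, 'm) mod_sheaf \<Rightarrow> bool" where
  "line_bundle X L \<longleftrightarrow> locally_free X 1 L"

subsection \<open>Operations on sheaves of modules\<close>

text \<open>
  The sheaf with stalks \<open>N x\<close> whose sections are locally linear combinations, over the
  regular functions, of the given generators \<open>G V\<close>. For \<open>G V\<close> the pure tensors of sections over
  \<open>V\<close> this is the sheafification of the presheaf tensor product.
\<close>

definition generated_sheaf ::
  "('p, 'r) rspace \<Rightarrow> ('p \<Rightarrow> ('r, 'm) module) \<Rightarrow> ('p set \<Rightarrow> ('p \<Rightarrow> 'm) set) \<Rightarrow> ('p, 'r, 'm) mod_sheaf" where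
  "generated_sheaf X N G = \<lparr>mstalk = N,
     msects = (\<lambda>U. {s \<in> (\<Pi>\<^sub>E x\<in>U. carrier (N x)).
        \<forall>x\<in>U. \<exists>V. openin (pts X) V \<and> x \<in> V \<and> V \<subseteq> U \<and>
          restrict s V \<in> mspan (section_ring X V) (germ_module N V) (G V)})\<rparr>"

definition tensor_sheaf ::
  "('p, 'r) rspace \<Rightarrow> ('p, 'r, 'm) mod_sheaf \<Rightarrow> ('p, 'r, 'n) mod_sheaf
    \<Rightarrow> ('p, 'r, ('m \<times> 'n \<Rightarrow> 'r) set) mod_sheaf" where
  "tensor_sheaf X M N = generated_sheaf X
     (\<lambda>x. tensor_module (stalk X x) (mstalk M x) (mstalk N x))
     (\<lambda>V. {\<lambda>x\<in>V. pure_tensor (stalk X x) (mstalk M x) (mstalk N x) (s x) (t x) | s t.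
        s \<in> msects M V \<and> t \<in> msects N V})"

definition tpow ::
  "('p, 'r) rspace \<Rightarrow> nat \<Rightarrow> ('p, 'r, 'm) mod_sheaf \<Rightarrow> ('p, 'r, ('m list \<Rightarrow> 'r) set) mod_sheaf" where
  "tpow X m M = generated_sheaf X
     (\<lambda>x. tpow_module (stalk X x) (mstalk M x) m)
     (\<lambda>V. {\<lambda>x\<in>V. tpow_pure (stalk X x) (mstalk M x) m (map (\<lambda>s. s x) ss) | ss.
        length ss = m \<and> set ss \<subseteq> msects M V})"

definition spow ::
  "('p, 'r) rspace \<Rightarrow> nat \<Rightarrow> ('p, 'r, 'm) mod_sheaf \<Rightarrow> ('p, 'r, ('m list \<Rightarrow> 'r) set) mod_sheaf" where
  "spow X m M = generated_sheaf X
     (\<lambda>x. spow_module (stalk X x) (mstalk M x) m)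
     (\<lambda>V. {\<lambda>x\<in>V. spow_pure (stalk X x) (mstalk M x) m (map (\<lambda>s. s x) ss) | ss.
        length ss = m \<and> set ss \<subseteq> msects M V})"

text \<open>
  The sheaf of homomorphisms to the structure sheaf. Taking the dual of the stalk as the stalk of
  the dual is correct for locally free sheaves of finite rank, the only ones it is used for.
\<close>

definition dual_sheaf :: "('p, 'r) rspace \<Rightarrow> ('p, 'r, 'm) mod_sheaf \<Rightarrow> ('p, 'r, 'm \<Rightarrow> 'r) mod_sheaf" where
  "dual_sheaf X M = \<lparr>mstalk = (\<lambda>x. dual_module (stalk X x) (mstalk M x)),
     msects = (\<lambda>U. {\<phi> \<in> (\<Pi>\<^sub>E x\<in>U. carrier (dual_module (stalk X x) (mstalk M x))).
        \<forall>V s. openin (pts X) V \<and> V \<subseteq> U \<and> s \<in> msects M V \<longrightarrow> (\<lambda>x\<in>V. \<phi> x (s x)) \<in> sects X V})\<rparr>"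

subsection \<open>Fibres and base loci\<close>

definition max_ideal :: "('p, 'r) rspace \<Rightarrow> 'p \<Rightarrow> 'r set" where
  "max_ideal X x = carrier (stalk X x) - Units (stalk X x)"

definition residue_field :: "('p, 'r) rspace \<Rightarrow> 'p \<Rightarrow> ('r, 'r set) module" where
  "residue_field X x = quot_module (self_module (stalk X x)) (max_ideal X x)"

definition fibre ::
  "('p, 'r) rspace \<Rightarrow> ('p, 'r, 'm) mod_sheaf \<Rightarrow> 'p \<Rightarrow> ('r, ('m \<times> 'r set \<Rightarrow> 'r) set) module" where
  "fibre X M x = tensor_module (stalk X x) (mstalk M x) (residue_field X x)"

definition fibre_value ::
  "('p, 'r) rspace \<Rightarrow> ('p, 'r, 'm) mod_sheaf \<Rightarrow> 'p \<Rightarrow> ('p \<Rightarrow> 'm) \<Rightarrow> ('m \<times> 'r set \<Rightarrow> 'r) set" where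
  "fibre_value X M x s = pure_tensor (stalk X x) (mstalk M x) (residue_field X x)
     (s x) (max_ideal X x +>\<^bsub>stalk X x\<^esub> \<one>\<^bsub>stalk X x\<^esub>)"

abbreviation global_sections :: "('p, 'r) rspace \<Rightarrow> ('p, 'r, 'm) mod_sheaf \<Rightarrow> ('p \<Rightarrow> 'm) set" where
  "global_sections X M \<equiv> msects M (topspace (pts X))"

text \<open>
  Points are scheme-theoretic points, so surjectivity of the evaluation map means that the global
  sections span the fibre over the residue field. (The span over the local ring is the span over
  the residue field.) At a closed point of a projective variety over an algebraically closed
  field, the residue field is the ground field and this is surjectivity of the evaluation map.
\<close>

definition Bs :: "('p, 'r) rspace \<Rightarrow> ('p, 'r, 'm) mod_sheaf \<Rightarrow> 'p set" where
  "Bs X V = {x \<in> topspace (pts X).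
     mspan (stalk X x) (fibre X V x) (fibre_value X V x ` global_sections X V) \<noteq> carrier (fibre X V x)}"

definition B_tensor :: "('p, 'r) rspace \<Rightarrow> ('p, 'r, 'm) mod_sheaf \<Rightarrow> 'p set" where
  "B_tensor X V = (\<Inter>m\<in>{1..}. Bs X (tpow X m V))"

definition B_plus :: "('p, 'r) rspace \<Rightarrow> ('p, 'r, 'a) mod_sheaf \<Rightarrow> ('p, 'r, 'm) mod_sheaf \<Rightarrow> 'p set" where
  "B_plus X A V = (\<Inter>q\<in>{1..}. \<Inter>m\<in>{1..}.
     Bs X (tensor_sheaf X (spow X m (spow X q V)) (tpow X m (dual_sheaf X A))))"

definition B_minus :: "('p, 'r) rspace \<Rightarrow> ('p, 'r, 'a) mod_sheaf \<Rightarrow> ('p, 'r, 'm) mod_sheaf \<Rightarrow> 'p set" where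
  "B_minus X A V = (\<Union>q\<in>{1..}. \<Inter>m\<in>{1..}.
     Bs X (tensor_sheaf X (spow X m (spow X q V)) (tpow X m A)))"

definition V_big :: "('p, 'r) rspace \<Rightarrow> ('p, 'r, 'a) mod_sheaf \<Rightarrow> ('p, 'r, 'm) mod_sheaf \<Rightarrow> bool" where
  "V_big X A V \<longleftrightarrow> B_plus X A V \<noteq> topspace (pts X)"

definition V_psef :: "('p, 'r) rspace \<Rightarrow> ('p, 'r, 'a) mod_sheaf \<Rightarrow> ('p, 'r, 'm) mod_sheaf \<Rightarrow> bool" where
  "V_psef X A V \<longleftrightarrow> B_minus X A V \<noteq> topspace (pts X)"

section \<open>Spectra, projective varieties and ampleness\<close>

text \<open>
  Rings of fractions: \<open>D\<close> is the set of admissible pairs (numerator, denominator), and two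
  fractions are identified if the cross difference is killed modulo \<open>I\<close> by a denominator.
\<close>

definition frac :: "('a, 'x) ring_scheme \<Rightarrow> 'a set \<Rightarrow> ('a \<times> 'a) set \<Rightarrow> 'a \<Rightarrow> 'a \<Rightarrow> ('a \<times> 'a) set" where
  "frac R I D a b = {(c, d) \<in> D. \<exists>t\<in>snd ` D.
     t \<otimes>\<^bsub>R\<^esub> (a \<otimes>\<^bsub>R\<^esub> d \<ominus>\<^bsub>R\<^esub> c \<otimes>\<^bsub>R\<^esub> b) \<in> I}"

definition frac_ring :: "('a, 'x) ring_scheme \<Rightarrow> 'a set \<Rightarrow> ('a \<times> 'a) set \<Rightarrow> ('a \<times> 'a) set ring" where
  "frac_ring R I D = \<lparr>carrier = {frac R I D a b | a b. (a, b) \<in> D},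
     mult = (\<lambda>u v. \<Union>(a, b)\<in>u. \<Union>(c, d)\<in>v. frac R I D (a \<otimes>\<^bsub>R\<^esub> c) (b \<otimes>\<^bsub>R\<^esub> d)),
     one = frac R I D \<one>\<^bsub>R\<^esub> \<one>\<^bsub>R\<^esub>,
     zero = frac R I D \<zero>\<^bsub>R\<^esub> \<one>\<^bsub>R\<^esub>,
     add = (\<lambda>u v. \<Union>(a, b)\<in>u. \<Union>(c, d)\<in>v.
        frac R I D (a \<otimes>\<^bsub>R\<^esub> d \<oplus>\<^bsub>R\<^esub> c \<otimes>\<^bsub>R\<^esub> b) (b \<otimes>\<^bsub>R\<^esub> d))\<rparr>"

text \<open>
  The ringed space with underlying set \<open>Z\<close>, a set of prime ideals, with the Zariski
  topology, whose sections are locally given by a single fraction.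
\<close>

definition frac_space ::
  "('a, 'x) ring_scheme \<Rightarrow> 'a set \<Rightarrow> 'a set set \<Rightarrow> ('a set \<Rightarrow> ('a \<times> 'a) set)
    \<Rightarrow> ('a set, ('a \<times> 'a) set) rspace" where
  "frac_space R I Z D = (let T = topology_generated_by {{p \<in> Z. f \<notin> p} | f. f \<in> carrier R} in
     \<lparr>pts = T,
      stalk = (\<lambda>p. frac_ring R I (D p)),
      sects = (\<lambda>U. {s \<in> (\<Pi>\<^sub>E p\<in>U. carrier (frac_ring R I (D p))).
        \<forall>p\<in>U. \<exists>V a b. openin T V \<and> p \<in> V \<and> V \<subseteq> U \<and>
          (\<forall>q\<in>V. (a, b) \<in> D q \<and> s q = frac R I (D q) a b)})\<rparr>)"

definition Spec :: "('a, 'x) ring_scheme \<Rightarrow> ('a set, ('a \<times> 'a) set) rspace" where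
  "Spec R = frac_space R {\<zero>\<^bsub>R\<^esub>} {p. primeideal p R} (\<lambda>p. carrier R \<times> (carrier R - p))"

type_synonym 'k polyn = "(nat \<Rightarrow>\<^sub>0 nat) \<Rightarrow>\<^sub>0 'k"

definition poly_ring :: "nat \<Rightarrow> 'k::field polyn ring" where
  "poly_ring n = \<lparr>carrier = {f. \<forall>\<alpha>\<in>Poly_Mapping.keys f. Poly_Mapping.keys \<alpha> \<subseteq> {..n}},
     mult = (*), one = 1, zero = 0, add = (+)\<rparr>"

definition polyn_var :: "nat \<Rightarrow> 'k::field polyn" where
  "polyn_var i = Poly_Mapping.single (Poly_Mapping.single i 1) 1"

definition homog :: "nat \<Rightarrow> 'k::field polyn \<Rightarrow> bool" where
  "homog d f \<longleftrightarrow> (\<forall>\<alpha>\<in>Poly_Mapping.keys f. (\<Sum>i\<in>Poly_Mapping.keys \<alpha>. Poly_Mapping.lookup \<alpha> i) = d)"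

text \<open>The points of projective space: homogeneous primes not containing the irrelevant ideal.\<close>

definition homog_prime :: "nat \<Rightarrow> 'k::field polyn set \<Rightarrow> bool" where
  "homog_prime n Q \<longleftrightarrow> primeideal Q (poly_ring n) \<and>
     Idl\<^bsub>poly_ring n\<^esub> {f \<in> Q. \<exists>d. homog d f} = Q \<and>
     \<not> polyn_var ` {..n} \<subseteq> Q"

text \<open>\<open>Proj\<close> of the graded ring \<open>k[x\<^sub>0, \<dots>, x\<^sub>n] / P\<close>, expressed by polynomials modulo \<open>P\<close>.\<close>

definition Proj :: "nat \<Rightarrow> 'k::field polyn set \<Rightarrow> ('k polyn set, ('k polyn \<times> 'k polyn) set) rspace" where
  "Proj n P = frac_space (poly_ring n) P {Q. homog_prime n Q \<and> P \<subseteq> Q}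
     (\<lambda>Q. {(f, g). f \<in> carrier (poly_ring n) \<and> g \<in> carrier (poly_ring n) - Q \<and>
        (\<exists>d. homog d f \<and> homog d g)})"

definition iso_rspace :: "('p, 'r) rspace \<Rightarrow> ('q, 's) rspace \<Rightarrow> bool" where
  "iso_rspace X Y \<longleftrightarrow> (\<exists>h \<phi>. homeomorphic_map (pts X) (pts Y) h \<and>
     (\<forall>x\<in>topspace (pts X). \<phi> x \<in> ring_iso (stalk Y (h x)) (stalk X x)) \<and>
     (\<forall>U. openin (pts X) U \<longrightarrow> (\<lambda>t. \<lambda>x\<in>U. \<phi> x (t (h x))) ` sects Y (h ` U) = sects X U))"

text \<open>
  \<open>X\<close> is a projective variety over \<open>'k\<close>: an integral closed subscheme of some projective space
  over \<open>'k\<close>, up to isomorphism.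
\<close>

definition projective_variety :: "'k::field itself \<Rightarrow> ('p, 'r) rspace \<Rightarrow> bool" where
  "projective_variety _ X \<longleftrightarrow> ringed_space X \<and>
     (\<exists>n (P :: 'k polyn set). homog_prime n P \<and> iso_rspace X (Proj n P))"

definition open_subspace :: "('p, 'r) rspace \<Rightarrow> 'p set \<Rightarrow> ('p, 'r) rspace" where
  "open_subspace X U = X\<lparr>pts := subtopology (pts X) U\<rparr>"

definition affine_open :: "('p, 'r) rspace \<Rightarrow> 'p set \<Rightarrow> bool" where
  "affine_open X U \<longleftrightarrow> openin (pts X) U \<and>
     iso_rspace (open_subspace X U) (Spec (section_ring X U))"

definition nonvanishing :: "('p, 'r) rspace \<Rightarrow> ('p, 'r, 'm) mod_sheaf \<Rightarrow> ('p \<Rightarrow> 'm) \<Rightarrow> 'p set" where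
  "nonvanishing X L s = {x \<in> topspace (pts X). fibre_value X L x s \<noteq> \<zero>\<^bsub>fibre X L x\<^esub>}"

text \<open>
  Ampleness (on a scheme): \<open>X\<close> is quasi-compact and every point lies in an affine nonvanishing
  locus of a global section of a positive power.
\<close>

definition ample_line_bundle :: "('p, 'r) rspace \<Rightarrow> ('p, 'r, 'm) mod_sheaf \<Rightarrow> bool" where
  "ample_line_bundle X A \<longleftrightarrow> line_bundle X A \<and> compact_space (pts X) \<and>
     (\<forall>x\<in>topspace (pts X). \<exists>m\<ge>1. \<exists>s\<in>global_sections X (tpow X m A).
        x \<in> nonvanishing X (tpow X m A) s \<and> affine_open X (nonvanishing X (tpow X m A) s))"

end

theory Submission
  imports Defs "HOL-Combinatorics.Permutations"
begin

text \<open>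
  Over the local ring at \<open>x\<close>, the point \<open>x\<close> lies outside \<open>Bs V\<close> iff the germs at \<open>x\<close> of the global
  sections generate the stalk of \<open>V\<close> modulo the maximal ideal. This property passes to
  quotients of \<open>V\<close>, and sections can be multiplied. Each of \<open>E\<close>, \<open>S\<^sup>c E\<close>, \<open>T\<^sup>c E\<close> and their iterated
  symmetric powers is, for some \<open>w\<close>, a quotient of \<open>T\<^sup>w E\<close> with quotient \<open>S\<^sup>w E\<close>. Everything therefore
  reduces to the converse passage: if \<open>S\<^sup>N E \<otimes> T\<^sup>n B\<close> is generated at \<open>x\<close>, so is
  \<open>T\<^sup>k\<^sup>N E \<otimes> T\<^sup>k\<^sup>n B\<close> for all large \<open>k\<close>.

  For this, symmetrization \<open>S\<^sup>N E \<rightarrow> T\<^sup>N E\<close> produces sections of \<open>T\<^sup>k\<^sup>N E\<close>, which may be permuted and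
  multiplied. In characteristic zero they generate all tensors \<open>e \<otimes> \<dots> \<otimes> e\<close> with \<open>N\<close> factors. If
  \<open>e \<otimes> r\<close> has been generated, then multiplying it by the symmetrization of
  \<open>z \<cdot> e\<^bsup>N-1\<^esup>\<close> generates, up to a unit, the sum of the tensors obtained from \<open>e\<^bsup>N+1\<^esup> \<otimes> r\<close> by
  replacing one of its first \<open>N\<close> factors by \<open>z\<close>. Permuting, the same holds for any \<open>N\<close> of the
  first \<open>N + 1\<close> positions; so, modulo what is generated, the position of \<open>z\<close> does not matter, and \<open>N\<close>
  times such a tensor is generated. Hence every word in the generators of the stalk of \<open>E\<close> with
  enough occurrences of one letter is reached, and long words have such a letter.

  Powers of the ample bundle that are left over are absorbed by multiplication or contraction with a
  section of \<open>T\<^sup>j A\<close> that does not vanish at \<open>x\<close>.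
\<close>

section \<open>Linear maps and spans\<close>

text \<open>The obstacle: sections of S^N E yield only symmetric tensors in T^N E, and these do not
  span it once N and the rank are at least 2. Only products of several of them, closed up under all
  permutations of the factors, can fill a tensor power; hence the passage to a multiple k * N of the
  weight. The bound on k comes from counting letters in two ways and depends on N and on the number
  of generators of the stalk. It may depend on the point, because membership in each locus is
  decided one point at a time. The factor k multiplies the exponent of the twist as well. To compare
  sheaves of weights w and w', the exponents of the iterated symmetric powers are chosen so that the
  weights agree exactly. The power of A is then off by a multiple of j, where some section of T^j A
  is nonzero at the point. For the augmented locus there is too much of the dual of A, which the
  section contracts away; for the diminished locus too little of A, which the section supplies. The
  integers inverted are N and certain numbers of permutations of N letters.\<close>

lemma module_cring: "module R M \<Longrightarrow> cring R"
  and module_abelian_group: "module R M \<Longrightarrow> abelian_group M"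
  and module_abelian_monoid: "module R M \<Longrightarrow> abelian_monoid M"
  by (auto simp: module_def abelian_group_def)

lemma cring_abelian_group: "cring R \<Longrightarrow> abelian_group R"
  and cring_ring: "cring R \<Longrightarrow> ring R"
  and cring_monoid: "cring R \<Longrightarrow> Group.comm_monoid R"
  by (auto simp: cring_def ring_def)

lemmas abelian_facts =
  abelian_monoid.zero_closed[OF abelian_group.axioms(1)]
  abelian_monoid.a_closed[OF abelian_group.axioms(1)]
  abelian_monoid.l_zero[OF abelian_group.axioms(1)]
  abelian_monoid.r_zero[OF abelian_group.axioms(1)]
  abelian_group.a_inv_closed abelian_group.r_neg abelian_group.l_neg abelian_group.minus_closed

lemmas abelian_ac = abelian_monoid.a_ac[OF abelian_group.axioms(1)]

lemma abelian_diff_zero: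
  assumes "abelian_group M" "u \<in> carrier M" "v \<in> carrier M" "u \<ominus>\<^bsub>M\<^esub> v = \<zero>\<^bsub>M\<^esub>"
  shows "u = v"
proof -
  interpret abelian_group M by fact
  have "u = (u \<ominus>\<^bsub>M\<^esub> v) \<oplus>\<^bsub>M\<^esub> v"
    using assms(2,3) by (simp add: a_minus_def a_assoc l_neg)
  then show ?thesis
    using assms by simp
qed

text \<open>Cited by position below: (1), (2), (8), (9) are closure under zero, sum, difference and
  scalars; (4) is neutrality of zero on the right; (10), (12), (13) are distributivity over scalars
  and the action of one and of zero. In \<open>cring_facts\<close> the first eight are the same, (9)
  and (10) are closure under product and one.\<close>

lemmas module_facts = abelian_facts[OF module_abelian_group]
  module.smult_closed module.smult_l_distr module.smult_r_distr module.smult_one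
  module.smult_l_null module.smult_r_null

lemmas module_ac = abelian_ac[OF module_abelian_group]

lemmas module_finsum_empty = abelian_monoid.finsum_empty[OF module_abelian_monoid]
lemmas module_finsum_insert = abelian_monoid.finsum_insert[OF module_abelian_monoid]
lemmas module_finsum_closed = abelian_monoid.finsum_closed[OF module_abelian_monoid]

lemmas cring_mult_facts = comm_monoid.axioms(1)[THEN monoid.m_closed]
  comm_monoid.axioms(1)[THEN monoid.one_closed]
  comm_monoid.axioms(1)[THEN monoid.l_one]
  comm_monoid.axioms(1)[THEN monoid.r_one]

lemmas cring_facts = abelian_facts[OF cring_abelian_group] cring_mult_facts[OF cring_monoid]
  ring.ring_simprules(24,25)[OF cring_ring]

lemmas cring_m_ac = comm_monoid.m_ac[OF cring_monoid]

text \<open>In contrast to \<open>linear_maps\<close>, values outside the carrier are unconstrained,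
  so plain lambda terms are linear maps and compose without \<open>restrict\<close>.\<close>

definition lin ::
  "('r, 'x) ring_scheme \<Rightarrow> ('r, 'm, 'y) module_scheme \<Rightarrow> ('r, 'n, 'z) module_scheme \<Rightarrow> ('m \<Rightarrow> 'n) \<Rightarrow> bool" where
  "lin R M N f \<longleftrightarrow> f \<in> carrier M \<rightarrow> carrier N \<and>
     (\<forall>u\<in>carrier M. \<forall>v\<in>carrier M. f (u \<oplus>\<^bsub>M\<^esub> v) = f u \<oplus>\<^bsub>N\<^esub> f v) \<and>
     (\<forall>a\<in>carrier R. \<forall>u\<in>carrier M. f (a \<odot>\<^bsub>M\<^esub> u) = a \<odot>\<^bsub>N\<^esub> f u)"

lemma linI:
  assumes "\<And>u. u \<in> carrier M \<Longrightarrow> f u \<in> carrier N"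
    and "\<And>u v. u \<in> carrier M \<Longrightarrow> v \<in> carrier M \<Longrightarrow> f (u \<oplus>\<^bsub>M\<^esub> v) = f u \<oplus>\<^bsub>N\<^esub> f v"
    and "\<And>a u. a \<in> carrier R \<Longrightarrow> u \<in> carrier M \<Longrightarrow> f (a \<odot>\<^bsub>M\<^esub> u) = a \<odot>\<^bsub>N\<^esub> f u"
  shows "lin R M N f"
  using assms by (auto simp: lin_def)

lemma lin_closed: "lin R M N f \<Longrightarrow> u \<in> carrier M \<Longrightarrow> f u \<in> carrier N"
  and lin_add: "lin R M N f \<Longrightarrow> u \<in> carrier M \<Longrightarrow> v \<in> carrier M \<Longrightarrow> f (u \<oplus>\<^bsub>M\<^esub> v) = f u \<oplus>\<^bsub>N\<^esub> f v"
  and lin_smult: "lin R M N f \<Longrightarrow> a \<in> carrier R \<Longrightarrow> u \<in> carrier M \<Longrightarrow> f (a \<odot>\<^bsub>M\<^esub> u) = a \<odot>\<^bsub>N\<^esub> f u"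
  by (auto simp: lin_def)

lemma lin_zero:
  assumes "module R M" "module R N" "lin R M N f"
  shows "f \<zero>\<^bsub>M\<^esub> = \<zero>\<^bsub>N\<^esub>"
proof -
  note [simp] = module_facts[OF assms(1)] module_facts[OF assms(2)] cring_facts[OF module_cring[OF assms(1)]]
  have "f \<zero>\<^bsub>M\<^esub> = f (\<zero>\<^bsub>R\<^esub> \<odot>\<^bsub>M\<^esub> \<zero>\<^bsub>M\<^esub>)"
    by simp
  also have "\<dots> = \<zero>\<^bsub>R\<^esub> \<odot>\<^bsub>N\<^esub> f \<zero>\<^bsub>M\<^esub>"
    using assms(3) by (intro lin_smult) auto
  finally show ?thesis
    using lin_closed[OF assms(3)] by simp
qed

lemma lin_neg:
  assumes "module R M" "module R N" "lin R M N f" "u \<in> carrier M"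
  shows "f (\<ominus>\<^bsub>M\<^esub> u) = \<ominus>\<^bsub>N\<^esub> f u"
proof -
  note [simp] = module_facts[OF assms(1)] module_facts[OF assms(2)] cring_facts[OF module_cring[OF assms(1)]]
  have "f (\<ominus>\<^bsub>M\<^esub> u) = f ((\<ominus>\<^bsub>R\<^esub> \<one>\<^bsub>R\<^esub>) \<odot>\<^bsub>M\<^esub> u)"
    using assms(4) by (simp add: module.smult_l_minus[OF assms(1)])
  also have "\<dots> = (\<ominus>\<^bsub>R\<^esub> \<one>\<^bsub>R\<^esub>) \<odot>\<^bsub>N\<^esub> f u"
    using assms by (intro lin_smult) auto
  finally show ?thesis
    using lin_closed[OF assms(3,4)] by (simp add: module.smult_l_minus[OF assms(2)])
qed

lemma lin_diff:
  assumes "module R M" "module R N" "lin R M N f" "u \<in> carrier M" "v \<in> carrier M"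
  shows "f (u \<ominus>\<^bsub>M\<^esub> v) = f u \<ominus>\<^bsub>N\<^esub> f v"
  using assms by (simp add: a_minus_def lin_add lin_neg module_facts)

lemma lin_id: "lin R M M (\<lambda>u. u)"
  by (rule linI) auto

lemma lin_comp: "lin R M N f \<Longrightarrow> lin R N L g \<Longrightarrow> lin R M L (\<lambda>u. g (f u))"
  by (auto simp: lin_def Pi_iff)

lemma lin_cong:
  assumes "module R M" "lin R M N f" "\<And>u. u \<in> carrier M \<Longrightarrow> f u = g u"
  shows "lin R M N g"
  using assms(2,3) module_facts[OF assms(1)] by (intro linI) (auto simp: lin_def Pi_iff)

lemma lin_sum:
  assumes "module R M" "module R N" "lin R M N f" "lin R M N g"
  shows "lin R M N (\<lambda>u. f u \<oplus>\<^bsub>N\<^esub> g u)"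
  using assms by (intro linI) (auto simp: lin_def Pi_iff module_facts[OF assms(2)] module_ac[OF assms(2)])

lemma lin_scale:
  assumes "module R M" "module R N" "lin R M N f" "a \<in> carrier R"
  shows "lin R M N (\<lambda>u. a \<odot>\<^bsub>N\<^esub> f u)"
proof (rule linI)
  fix b u assume "b \<in> carrier R" "u \<in> carrier M"
  then show "a \<odot>\<^bsub>N\<^esub> f (b \<odot>\<^bsub>M\<^esub> u) = b \<odot>\<^bsub>N\<^esub> (a \<odot>\<^bsub>N\<^esub> f u)"
    using assms by (simp add: lin_smult lin_closed module.smult_assoc1[OF assms(2), symmetric]
      cring_m_ac[OF module_cring[OF assms(1)]])
qed (use assms in \<open>auto simp: lin_closed lin_add module_facts\<close>)

lemma lin_zero_map: "module R M \<Longrightarrow> module R N \<Longrightarrow> lin R M N (\<lambda>u. \<zero>\<^bsub>N\<^esub>)"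
  by (rule linI) (auto simp: module_facts)

lemma lin_finsum_maps:
  assumes "module R M" "module R N" "finite A" "\<And>a. a \<in> A \<Longrightarrow> lin R M N (f a)"
  shows "lin R M N (\<lambda>u. \<Oplus>\<^bsub>N\<^esub>a\<in>A. f a u)"
  using assms(3,4)
proof (induction A)
  case empty
  show ?case
    by (simp add: lin_zero_map assms(1,2) module_finsum_empty[OF assms(2)])
next
  case (insert a A)
  have "lin R M N (\<lambda>u. f a u \<oplus>\<^bsub>N\<^esub> (\<Oplus>\<^bsub>N\<^esub>a\<in>A. f a u))"
    using insert by (intro lin_sum assms(1,2)) auto
  then show ?case
    by (rule lin_cong[OF assms(1)])
      (use insert in \<open>auto simp: lin_def Pi_iff intro!: module_finsum_insert[OF assms(2), symmetric]\<close>)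
qed

lemma lin_finsum:
  assumes "module R M" "module R N" "lin R M N f" "finite A" "\<And>a. a \<in> A \<Longrightarrow> u a \<in> carrier M"
  shows "f (\<Oplus>\<^bsub>M\<^esub>a\<in>A. u a) = (\<Oplus>\<^bsub>N\<^esub>a\<in>A. f (u a))"
  using assms(4,5)
proof (induction A)
  case empty
  show ?case
    using lin_zero[OF assms(1-3)] by (simp add: module_finsum_empty[OF assms(1)] module_finsum_empty[OF assms(2)])
next
  case (insert a A)
  have *: "u \<in> A \<rightarrow> carrier M" "(\<lambda>a. f (u a)) \<in> A \<rightarrow> carrier N"
    using insert assms(3) by (auto simp: lin_def)
  then show ?case
    using insert assms(3)
    by (simp add: lin_add lin_closed module_finsum_insert[OF assms(1)] module_finsum_insert[OF assms(2)]
      module_finsum_closed[OF assms(1)])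
qed

section \<open>Submodules and spans\<close>

lemma submodI:
  assumes "module R M" "H \<subseteq> carrier M" "\<zero>\<^bsub>M\<^esub> \<in> H"
    and "\<And>u v. u \<in> H \<Longrightarrow> v \<in> H \<Longrightarrow> u \<oplus>\<^bsub>M\<^esub> v \<in> H"
    and sm: "\<And>a u. a \<in> carrier R \<Longrightarrow> u \<in> H \<Longrightarrow> a \<odot>\<^bsub>M\<^esub> u \<in> H"
  shows "submodule H R M"
proof (rule module.submoduleI[OF assms(1)])
  fix u assume u: "u \<in> H"
  note [simp] = module_facts[OF assms(1)] cring_facts[OF module_cring[OF assms(1)]]
  have "(\<ominus>\<^bsub>R\<^esub> \<one>\<^bsub>R\<^esub>) \<odot>\<^bsub>M\<^esub> u \<in> H"
    using u by (intro sm) auto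
  then show "\<ominus>\<^bsub>M\<^esub> u \<in> H"
    using u assms(2) module.smult_l_minus[OF assms(1), of "\<one>\<^bsub>R\<^esub>" u] by auto
qed (use assms in auto)

lemma submod_sub: "submodule H R M \<Longrightarrow> H \<subseteq> carrier M"
  using submodule.axioms(1) subgroup.subset by fastforce

lemma submod_carrier: "submodule H R M \<Longrightarrow> u \<in> H \<Longrightarrow> u \<in> carrier M"
  using submod_sub by blast

lemma submod_zero: "submodule H R M \<Longrightarrow> \<zero>\<^bsub>M\<^esub> \<in> H"
  using submodule.axioms(1) subgroup.one_closed by fastforce

lemma submod_add: "submodule H R M \<Longrightarrow> u \<in> H \<Longrightarrow> v \<in> H \<Longrightarrow> u \<oplus>\<^bsub>M\<^esub> v \<in> H"
  using submodule.axioms(1) subgroup.m_closed by fastforce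

lemma submod_smult: "submodule H R M \<Longrightarrow> a \<in> carrier R \<Longrightarrow> u \<in> H \<Longrightarrow> a \<odot>\<^bsub>M\<^esub> u \<in> H"
  by (simp add: submodule.smult_closed)

lemma submod_finsum:
  assumes "module R M" "submodule H R M" "finite A" "\<And>a. a \<in> A \<Longrightarrow> u a \<in> H"
  shows "(\<Oplus>\<^bsub>M\<^esub>a\<in>A. u a) \<in> H"
  using assms(3,4)
proof (induction A)
  case empty
  show ?case
    using submod_zero[OF assms(2)] by (simp add: module_finsum_empty[OF assms(1)])
next
  case (insert a A)
  have "u \<in> insert a A \<rightarrow> carrier M"
    using insert submod_carrier[OF assms(2)] by auto
  then show ?case
    using insert by (simp add: submod_add[OF assms(2)] module_finsum_insert[OF assms(1)] Pi_iff)
qed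

lemma carrier_submod: "module R M \<Longrightarrow> submodule (carrier M) R M"
  by (rule module.carrier_is_submodule)

lemma mspan_incl: "S \<subseteq> mspan R M S"
  by (auto simp: mspan_def)

lemma mspan_least: "submodule H R M \<Longrightarrow> S \<subseteq> H \<Longrightarrow> mspan R M S \<subseteq> H"
  by (auto simp: mspan_def)

lemma mspan_sub: "module R M \<Longrightarrow> S \<subseteq> carrier M \<Longrightarrow> mspan R M S \<subseteq> carrier M"
  by (intro mspan_least carrier_submod)

lemma mspan_submodule:
  assumes "module R M" "S \<subseteq> carrier M"
  shows "submodule (mspan R M S) R M"
  using assms
  by (intro submodI mspan_sub) (auto simp: mspan_def intro: submod_zero submod_add submod_smult)

lemma mspan_eqI:
  assumes "module R M" "S \<subseteq> carrier M" "carrier M \<subseteq> mspan R M S"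
  shows "mspan R M S = carrier M"
  using mspan_sub[OF assms(1,2)] assms(3) by auto

lemma lin_vimage_submodule:
  assumes "module R M" "module R N" "lin R M N f" "submodule K R N"
  shows "submodule {u \<in> carrier M. f u \<in> K} R M"
  using assms module_facts[OF assms(1)]
  by (intro submodI) (auto simp: lin_add lin_smult lin_zero intro: submod_zero submod_add submod_smult)

lemma lin_image_submodule:
  assumes "module R M" "module R N" "lin R M N f" "submodule K R M"
  shows "submodule (f ` K) R N"
proof (rule submodI)
  show "f ` K \<subseteq> carrier N"
    using assms(3) submod_sub[OF assms(4)] by (auto simp: lin_def)
  show "\<zero>\<^bsub>N\<^esub> \<in> f ` K"
    using lin_zero[OF assms(1-3)] submod_zero[OF assms(4)] by (metis imageI)
  fix u v assume "u \<in> f ` K" "v \<in> f ` K"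
  then show "u \<oplus>\<^bsub>N\<^esub> v \<in> f ` K"
    using lin_add[OF assms(3)] submod_carrier[OF assms(4)] submod_add[OF assms(4)] by (smt (verit) imageE imageI)
next
  fix a u assume "a \<in> carrier R" "u \<in> f ` K"
  then show "a \<odot>\<^bsub>N\<^esub> u \<in> f ` K"
    using lin_smult[OF assms(3)] submod_carrier[OF assms(4)] submod_smult[OF assms(4)] by (smt (verit) imageE imageI)
qed (fact assms)

lemma lin_mspan_sub:
  assumes "module R M" "module R N" "lin R M N f" "submodule K R N" "S \<subseteq> carrier M"
    and "\<And>u. u \<in> S \<Longrightarrow> f u \<in> K" and "u \<in> mspan R M S"
  shows "f u \<in> K"
proof -
  have "mspan R M S \<subseteq> {u \<in> carrier M. f u \<in> K}"
    using assms by (intro mspan_least lin_vimage_submodule) auto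
  then show ?thesis
    using assms(7) by auto
qed

text \<open>The equalizer of two linear maps is a submodule.\<close>

lemma lin_eq_on_mspan:
  assumes "module R M" "module R N" "lin R M N f" "lin R M N g" "S \<subseteq> carrier M"
    and "\<And>u. u \<in> S \<Longrightarrow> f u = g u" and "u \<in> mspan R M S"
  shows "f u = g u"
proof -
  have "mspan R M S \<subseteq> {u \<in> carrier M. f u = g u}"
    using assms module_facts[OF assms(1)]
    by (intro mspan_least submodI) (auto simp: lin_add lin_smult lin_zero[OF assms(1,2)])
  then show ?thesis
    using assms(7) by auto
qed

text \<open>The image is a submodule containing a generating set. Most surjectivity claims on stalks
  are reduced to this form.\<close>

lemma lin_surj_mspan:
  assumes "module R M" "module R N" "lin R M N f" "N' \<subseteq> f ` carrier M" "mspan R N N' = carrier N"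
  shows "f ` carrier M = carrier N"
  using mspan_least[OF lin_image_submodule[OF assms(1-3) carrier_submod[OF assms(1)]] assms(4)]
    assms(3,5) by (auto simp: lin_def)

section \<open>Quotients and presentations\<close>

lemma quot_module_simps:
  "zero (quot_module M H) = H" "add (quot_module M H) = set_add M"
  "carrier (quot_module M H) = a_rcosets\<^bsub>M\<^esub> H"
  by (auto simp: quot_module_def)

context
  fixes R :: "('r, 'x) ring_scheme" and M :: "('r, 'm, 'y) module_scheme" and H
  assumes M: "module R M" and H: "submodule H R M"
begin

interpretation M: module R M by (fact M)

lemma submod_abelian_subgroup: "abelian_subgroup H M"
  using H submodule.axioms(1) by (intro abelian_subgroupI3 additive_subgroupI M.abelian_group_axioms) blast

interpretation H: abelian_subgroup H M by (fact submod_abelian_subgroup)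

lemma quot_carrierE:
  assumes "C \<in> carrier (quot_module M H)"
  obtains u where "u \<in> carrier M" "C = H +>\<^bsub>M\<^esub> u"
  using assms by (auto simp: A_RCOSETS_def' quot_module_simps)

lemma quot_coset_carrier: "u \<in> carrier M \<Longrightarrow> H +>\<^bsub>M\<^esub> u \<in> carrier (quot_module M H)"
  by (auto simp: A_RCOSETS_def' quot_module_simps)

lemma quot_coset_eq_iff:
  assumes "u \<in> carrier M" "v \<in> carrier M"
  shows "H +>\<^bsub>M\<^esub> u = H +>\<^bsub>M\<^esub> v \<longleftrightarrow> u \<ominus>\<^bsub>M\<^esub> v \<in> H"
  using assms H.a_rcos_module_minus[of v u] H.a_rcos_self H.a_repr_independence'
  by (metis a_minus_def H.a_rcos_module)

lemma quot_add: "u \<in> carrier M \<Longrightarrow> v \<in> carrier M \<Longrightarrow>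
    (H +>\<^bsub>M\<^esub> u) \<oplus>\<^bsub>quot_module M H\<^esub> (H +>\<^bsub>M\<^esub> v) = H +>\<^bsub>M\<^esub> (u \<oplus>\<^bsub>M\<^esub> v)"
  by (simp add: H.a_rcos_sum quot_module_simps)

text \<open>The union in the definition of the scalar action runs over all representatives of the
  coset; they all give the same coset, so the union collapses.\<close>

lemma quot_smult:
  assumes "a \<in> carrier R" "u \<in> carrier M"
  shows "a \<odot>\<^bsub>quot_module M H\<^esub> (H +>\<^bsub>M\<^esub> u) = H +>\<^bsub>M\<^esub> (a \<odot>\<^bsub>M\<^esub> u)"
proof -
  have "H +>\<^bsub>M\<^esub> (a \<odot>\<^bsub>M\<^esub> v) = H +>\<^bsub>M\<^esub> (a \<odot>\<^bsub>M\<^esub> u)" if "v \<in> H +>\<^bsub>M\<^esub> u" for v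
  proof -
    have v: "v \<in> carrier M"
      using that assms H.a_elemrcos_carrier by blast
    have "v \<ominus>\<^bsub>M\<^esub> u \<in> H"
      using that assms v by (metis quot_coset_eq_iff H.a_repr_independence')
    then have "a \<odot>\<^bsub>M\<^esub> (v \<ominus>\<^bsub>M\<^esub> u) \<in> H"
      using H assms by (intro submod_smult)
    then have "a \<odot>\<^bsub>M\<^esub> v \<ominus>\<^bsub>M\<^esub> a \<odot>\<^bsub>M\<^esub> u \<in> H"
      using assms v by (simp add: a_minus_def M.smult_r_distr M.smult_r_minus)
    then show ?thesis
      using assms v by (simp add: quot_coset_eq_iff)
  qed
  moreover have "u \<in> H +>\<^bsub>M\<^esub> u"
    using assms by (simp add: H.a_rcos_self)
  ultimately have "(\<Union>v\<in>H +>\<^bsub>M\<^esub> u. H +>\<^bsub>M\<^esub> (a \<odot>\<^bsub>M\<^esub> v)) = H +>\<^bsub>M\<^esub> (a \<odot>\<^bsub>M\<^esub> u)"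
    by (intro SUP_eq_const) blast+
  then show ?thesis
    unfolding quot_module_def by (simp only: module.simps)
qed

lemma quot_module_module: "module R (quot_module M H)"
proof (rule moduleI)
  have Hz: "H +>\<^bsub>M\<^esub> \<zero>\<^bsub>M\<^esub> = H"
    by (rule M.a_coset_add_zero[OF H.a_subset])
  show "abelian_group (quot_module M H)"
  proof (rule abelian_groupI)
    fix C assume "C \<in> carrier (quot_module M H)"
    then obtain u where u: "u \<in> carrier M" "C = H +>\<^bsub>M\<^esub> u"
      by (rule quot_carrierE)
    show "\<zero>\<^bsub>quot_module M H\<^esub> \<oplus>\<^bsub>quot_module M H\<^esub> C = C"
      using u Hz quot_add[of "\<zero>\<^bsub>M\<^esub>" u] by (simp add: quot_module_simps)
    have "(H +>\<^bsub>M\<^esub> (\<ominus>\<^bsub>M\<^esub> u)) \<oplus>\<^bsub>quot_module M H\<^esub> C = \<zero>\<^bsub>quot_module M H\<^esub>"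
      using u Hz quot_add[of "\<ominus>\<^bsub>M\<^esub> u" u] by (simp add: M.l_neg quot_module_simps)
    then show "\<exists>D\<in>carrier (quot_module M H). D \<oplus>\<^bsub>quot_module M H\<^esub> C = \<zero>\<^bsub>quot_module M H\<^esub>"
      using u quot_coset_carrier by blast
  next
    show "\<zero>\<^bsub>quot_module M H\<^esub> \<in> carrier (quot_module M H)"
      using quot_coset_carrier[of "\<zero>\<^bsub>M\<^esub>"] Hz by (simp add: quot_module_simps)
  qed (elim quot_carrierE; simp add: quot_add quot_coset_carrier M.a_ac)+
  show "cring R"
    by (rule M.R.cring_axioms)
qed (elim quot_carrierE; simp add: quot_smult quot_add quot_coset_carrier
    M.smult_l_distr M.smult_r_distr M.smult_assoc1)+

lemma quot_lin: "lin R M (quot_module M H) (\<lambda>u. H +>\<^bsub>M\<^esub> u)"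
  by (rule linI) (simp_all add: quot_smult quot_add quot_coset_carrier)

lemma quot_coset_zero_iff: "u \<in> carrier M \<Longrightarrow> H +>\<^bsub>M\<^esub> u = H \<longleftrightarrow> u \<in> H"
proof -
  assume u: "u \<in> carrier M"
  then have "u \<ominus>\<^bsub>M\<^esub> \<zero>\<^bsub>M\<^esub> = u"
    by (simp add: a_minus_def M.add.inv_one)
  then show ?thesis
    using quot_coset_eq_iff[OF u M.zero_closed] M.a_coset_add_zero[OF H.a_subset] by simp
qed

text \<open>The induced map evaluates \<open>f\<close> at a chosen representative; since
  \<open>f\<close> kills \<open>H\<close>, the choice has no influence.\<close>

lemma quot_lift:
  assumes "module R N" "lin R M N f" "\<And>u. u \<in> H \<Longrightarrow> f u = \<zero>\<^bsub>N\<^esub>"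
  shows "\<exists>g. lin R (quot_module M H) N g \<and> (\<forall>u\<in>carrier M. g (H +>\<^bsub>M\<^esub> u) = f u)"
proof -
  define g where "g = (\<lambda>C. f (SOME u. u \<in> carrier M \<and> C = H +>\<^bsub>M\<^esub> u))"
  have g: "g (H +>\<^bsub>M\<^esub> u) = f u" if u: "u \<in> carrier M" for u
  proof -
    define v where "v = (SOME v. v \<in> carrier M \<and> H +>\<^bsub>M\<^esub> u = H +>\<^bsub>M\<^esub> v)"
    have "\<exists>v. v \<in> carrier M \<and> H +>\<^bsub>M\<^esub> u = H +>\<^bsub>M\<^esub> v"
      using u by blast
    from someI_ex[OF this] have v: "v \<in> carrier M \<and> H +>\<^bsub>M\<^esub> u = H +>\<^bsub>M\<^esub> v"
      unfolding v_def .
    then have "u \<ominus>\<^bsub>M\<^esub> v \<in> H"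
      using u quot_coset_eq_iff by blast
    then have "f u \<ominus>\<^bsub>N\<^esub> f v = \<zero>\<^bsub>N\<^esub>"
      using assms u v lin_diff[OF M assms(1,2)] by metis
    then have "f u = f v"
      using lin_closed[OF assms(2)] u v by (metis abelian_diff_zero module_abelian_group assms(1))
    then show ?thesis
      by (simp add: g_def v_def)
  qed
  have "lin R (quot_module M H) N g"
    by (rule linI; elim quot_carrierE) (simp_all add: quot_smult quot_add g lin_closed[OF assms(2)] lin_add[OF assms(2)] lin_smult[OF assms(2)])
  then show ?thesis
    using g by blast
qed

end

section \<open>Free modules and modules given by generators and relations\<close>

lemma free_module_simps:
  "f \<in> carrier (free_module R G) \<longleftrightarrow>
     (\<forall>g. f g \<in> carrier R) \<and> finite {g. f g \<noteq> \<zero>\<^bsub>R\<^esub>} \<and> {g. f g \<noteq> \<zero>\<^bsub>R\<^esub>} \<subseteq> G"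
  "\<zero>\<^bsub>free_module R G\<^esub> = (\<lambda>_. \<zero>\<^bsub>R\<^esub>)"
  "f \<oplus>\<^bsub>free_module R G\<^esub> f' = (\<lambda>g. f g \<oplus>\<^bsub>R\<^esub> f' g)"
  "a \<odot>\<^bsub>free_module R G\<^esub> f = (\<lambda>g. a \<otimes>\<^bsub>R\<^esub> f g)"
  by (auto simp: free_module_def)

lemma free_module_closed:
  assumes "cring R" "f \<in> carrier (free_module R G)" "f' \<in> carrier (free_module R G)" "a \<in> carrier R"
  shows "(\<lambda>g. f g \<oplus>\<^bsub>R\<^esub> f' g) \<in> carrier (free_module R G)"
    and "(\<lambda>g. a \<otimes>\<^bsub>R\<^esub> f g) \<in> carrier (free_module R G)"
    and "(\<lambda>g. \<ominus>\<^bsub>R\<^esub> f g) \<in> carrier (free_module R G)"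
proof -
  note [simp] = cring_facts[OF assms(1)]
  have fin: "finite {g. f g \<noteq> \<zero>\<^bsub>R\<^esub>}" "finite {g. f' g \<noteq> \<zero>\<^bsub>R\<^esub>}"
    using assms by (auto simp: free_module_simps)
  have sub: "{g. f g \<noteq> \<zero>\<^bsub>R\<^esub>} \<subseteq> G" "{g. f' g \<noteq> \<zero>\<^bsub>R\<^esub>} \<subseteq> G" and cl: "\<And>g. f g \<in> carrier R" "\<And>g. f' g \<in> carrier R"
    using assms by (auto simp: free_module_simps)
  have "{g. f g \<oplus>\<^bsub>R\<^esub> f' g \<noteq> \<zero>\<^bsub>R\<^esub>} \<subseteq> {g. f g \<noteq> \<zero>\<^bsub>R\<^esub>} \<union> {g. f' g \<noteq> \<zero>\<^bsub>R\<^esub>}"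
    by auto
  then show "(\<lambda>g. f g \<oplus>\<^bsub>R\<^esub> f' g) \<in> carrier (free_module R G)"
    using fin sub cl unfolding free_module_simps by (auto intro: finite_subset)
  have "{g. a \<otimes>\<^bsub>R\<^esub> f g \<noteq> \<zero>\<^bsub>R\<^esub>} \<subseteq> {g. f g \<noteq> \<zero>\<^bsub>R\<^esub>}"
    using assms(4) by (auto simp: cl)
  then show "(\<lambda>g. a \<otimes>\<^bsub>R\<^esub> f g) \<in> carrier (free_module R G)"
    using fin sub cl assms(4) unfolding free_module_simps by (auto intro: finite_subset)
  have "{g. \<ominus>\<^bsub>R\<^esub> f g \<noteq> \<zero>\<^bsub>R\<^esub>} \<subseteq> {g. f g \<noteq> \<zero>\<^bsub>R\<^esub>}"
    using ring.ring_simprules(21)[OF cring_ring[OF assms(1)]] by auto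
  then show "(\<lambda>g. \<ominus>\<^bsub>R\<^esub> f g) \<in> carrier (free_module R G)"
    using fin sub cl unfolding free_module_simps by (auto intro: finite_subset)
qed

lemma free_module_module:
  assumes R: "cring R"
  shows "module R (free_module R G)"
proof (rule moduleI[OF R])
  note [simp] = cring_facts[OF R] ring.ring_simprules(13,23)[OF cring_ring[OF R]]
    and cl = free_module_closed[OF R] and ac = abelian_ac[OF cring_abelian_group[OF R]] cring_m_ac[OF R]
  have z: "\<zero>\<^bsub>free_module R G\<^esub> \<in> carrier (free_module R G)"
    by (auto simp: free_module_simps)
  show "abelian_group (free_module R G)"
  proof (rule abelian_groupI)
    fix f assume f: "f \<in> carrier (free_module R G)"
    show "\<exists>f'\<in>carrier (free_module R G). f' \<oplus>\<^bsub>free_module R G\<^esub> f = \<zero>\<^bsub>free_module R G\<^esub>"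
      using f cl(3)[OF f f, of "\<one>\<^bsub>R\<^esub>"]
      by (intro bexI[of _ "\<lambda>g. \<ominus>\<^bsub>R\<^esub> f g"]) (auto simp: free_module_simps(1) free_module_simps(2-4))
  next
    fix f f' assume "f \<in> carrier (free_module R G)" "f' \<in> carrier (free_module R G)"
    then show "f \<oplus>\<^bsub>free_module R G\<^esub> f' \<in> carrier (free_module R G)"
      using cl(1)[of f G f' "\<one>\<^bsub>R\<^esub>"] by (simp add: free_module_simps(3))
  qed (use z in \<open>auto simp: free_module_simps ac\<close>)
  fix a f assume "a \<in> carrier R" "f \<in> carrier (free_module R G)"
  then show "a \<odot>\<^bsub>free_module R G\<^esub> f \<in> carrier (free_module R G)"
    using cl(2)[of f G f a] by (simp add: free_module_simps(4))
qed (use assms in \<open>auto simp: free_module_simps cring_facts[OF R] ring.ring_simprules(13,23)[OF cring_ring[OF R]] cring_m_ac[OF R]\<close>)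

lemma gen_carrier: "cring R \<Longrightarrow> g \<in> G \<Longrightarrow> gen R g \<in> carrier (free_module R G)"
  by (auto simp: free_module_simps gen_def cring_facts)

text \<open>Induction on a finite set containing the support: splitting off the coefficient at one
  element leaves a function supported on a smaller set.\<close>

lemma free_module_span:
  assumes R: "cring R" and f: "f \<in> carrier (free_module R G)"
  shows "f \<in> mspan R (free_module R G) (gen R ` G)"
proof -
  let ?F = "free_module R G"
  note [simp] = cring_facts[OF R] ring.ring_simprules(13,23)[OF cring_ring[OF R]]
  have S: "submodule (mspan R ?F (gen R ` G)) R ?F"
    by (rule mspan_submodule[OF free_module_module[OF R]]) (auto intro: gen_carrier[OF R])
  have "f \<in> mspan R ?F (gen R ` G)"
    if "finite A" "A \<subseteq> G" "f \<in> carrier ?F" "{g. f g \<noteq> \<zero>\<^bsub>R\<^esub>} \<subseteq> A" for A f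
    using that
  proof (induction A arbitrary: f)
    case empty
    then have "f = \<zero>\<^bsub>?F\<^esub>"
      by (auto simp: free_module_simps fun_eq_iff)
    then show ?case
      using submod_zero[OF S] by simp
  next
    case (insert x A)
    let ?f = "\<lambda>g. if g = x then \<zero>\<^bsub>R\<^esub> else f g"
    have cl: "\<And>g. f g \<in> carrier R"
      using insert.prems by (auto simp: free_module_simps)
    have "?f \<in> mspan R ?F (gen R ` G)"
    proof (rule insert.IH)
      have "{g. ?f g \<noteq> \<zero>\<^bsub>R\<^esub>} \<subseteq> {g. f g \<noteq> \<zero>\<^bsub>R\<^esub>}"
        by auto
      then show "?f \<in> carrier ?F"
        using insert.prems unfolding free_module_simps by (auto intro: finite_subset)
    qed (use insert.prems in auto)
    moreover have "f x \<odot>\<^bsub>?F\<^esub> gen R x \<in> mspan R ?F (gen R ` G)"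
      by (rule submod_smult[OF S cl subsetD[OF mspan_incl]]) (use insert.prems in auto)
    ultimately have "?f \<oplus>\<^bsub>?F\<^esub> (f x \<odot>\<^bsub>?F\<^esub> gen R x) \<in> mspan R ?F (gen R ` G)"
      by (rule submod_add[OF S])
    also have "?f \<oplus>\<^bsub>?F\<^esub> (f x \<odot>\<^bsub>?F\<^esub> gen R x) = f"
      using cl by (auto simp: free_module_simps gen_def fun_eq_iff)
    finally show "f \<in> mspan R ?F (gen R ` G)" .
  qed
  then show ?thesis
    using f by (auto simp: free_module_simps)
qed

text \<open>The map that the universal property of the free module attaches to \<open>h\<close>.
  Summing over the support keeps the sum finite although the basis, a set of pairs or tuples of
  module elements, is usually infinite.\<close>

definition free_lift :: "('r, 'x) ring_scheme \<Rightarrow> ('r, 'n, 'z) module_scheme \<Rightarrow> ('g \<Rightarrow> 'n) \<Rightarrow> ('g \<Rightarrow> 'r) \<Rightarrow> 'n" where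
  "free_lift R N h f = (\<Oplus>\<^bsub>N\<^esub>g\<in>{g. f g \<noteq> \<zero>\<^bsub>R\<^esub>}. f g \<odot>\<^bsub>N\<^esub> h g)"

context
  fixes R :: "('r, 'x) ring_scheme" and N :: "('r, 'n, 'z) module_scheme" and h :: "'g \<Rightarrow> 'n" and G
  assumes N: "module R N" and h: "\<And>g. g \<in> G \<Longrightarrow> h g \<in> carrier N"
begin

text \<open>Allows two elements with different supports to be summed over one common index set, as
  additivity requires.\<close>

lemma free_lift_eq:
  assumes "finite A" "A \<subseteq> G" "{g. f g \<noteq> \<zero>\<^bsub>R\<^esub>} \<subseteq> A" "\<And>g. f g \<in> carrier R"
  shows "free_lift R N h f = (\<Oplus>\<^bsub>N\<^esub>g\<in>A. f g \<odot>\<^bsub>N\<^esub> h g)"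
proof -
  interpret abelian_monoid N
    by (rule module_abelian_monoid[OF N])
  show ?thesis
    unfolding free_lift_def
    by (rule add.finprod_mono_neutral_cong_left)
      (use assms h in \<open>auto simp: module_facts[OF N] subset_iff\<close>)
qed

lemma free_lift_lin: "lin R (free_module R G) N (free_lift R N h)"
proof -
  interpret abelian_monoid N
    by (rule module_abelian_monoid[OF N])
  note R = module_cring[OF N]
  let ?F = "free_module R G"
  note cl = free_module_closed[OF R] module.smult_closed[OF N]
  show ?thesis
  proof (rule linI)
    fix u assume u: "u \<in> carrier ?F"
    then have "\<And>g. g \<in> {g. u g \<noteq> \<zero>\<^bsub>R\<^esub>} \<Longrightarrow> u g \<in> carrier R \<and> h g \<in> carrier N"
      using h by (auto simp: free_module_simps)
    then show "free_lift R N h u \<in> carrier N"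
      unfolding free_lift_def using cl(4) by (intro finsum_closed) auto
    fix v assume v: "v \<in> carrier ?F"
    define A where "A = {g. u g \<noteq> \<zero>\<^bsub>R\<^esub>} \<union> {g. v g \<noteq> \<zero>\<^bsub>R\<^esub>}"
    have A: "finite A" "A \<subseteq> G" "{g. u g \<noteq> \<zero>\<^bsub>R\<^esub>} \<subseteq> A" "{g. v g \<noteq> \<zero>\<^bsub>R\<^esub>} \<subseteq> A"
      and cuv: "\<And>g. u g \<in> carrier R" "\<And>g. v g \<in> carrier R"
      using u v by (auto simp: A_def free_module_simps)
    have "{g. u g \<oplus>\<^bsub>R\<^esub> v g \<noteq> \<zero>\<^bsub>R\<^esub>} \<subseteq> A"
      by (auto simp: A_def cring_facts[OF R])
    then have "free_lift R N h (u \<oplus>\<^bsub>?F\<^esub> v) = (\<Oplus>\<^bsub>N\<^esub>g\<in>A. (u g \<oplus>\<^bsub>R\<^esub> v g) \<odot>\<^bsub>N\<^esub> h g)"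
      using A cuv by (subst free_lift_eq[of A]) (auto simp: free_module_simps cring_facts[OF R])
    also have "\<dots> = (\<Oplus>\<^bsub>N\<^esub>g\<in>A. u g \<odot>\<^bsub>N\<^esub> h g \<oplus>\<^bsub>N\<^esub> v g \<odot>\<^bsub>N\<^esub> h g)"
      using A cuv h cl(4) by (intro finsum_cong') (auto simp: module.smult_l_distr[OF N])
    also have "\<dots> = (\<Oplus>\<^bsub>N\<^esub>g\<in>A. u g \<odot>\<^bsub>N\<^esub> h g) \<oplus>\<^bsub>N\<^esub> (\<Oplus>\<^bsub>N\<^esub>g\<in>A. v g \<odot>\<^bsub>N\<^esub> h g)"
      using A cuv h cl(4) by (intro finsum_addf) auto
    finally show "free_lift R N h (u \<oplus>\<^bsub>?F\<^esub> v) = free_lift R N h u \<oplus>\<^bsub>N\<^esub> free_lift R N h v"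
      using A cuv by (simp add: free_lift_eq[of A])
  next
    fix a u assume a: "a \<in> carrier R" and u: "u \<in> carrier ?F"
    define A where "A = {g. u g \<noteq> \<zero>\<^bsub>R\<^esub>}"
    have A: "finite A" "A \<subseteq> G" "{g. u g \<noteq> \<zero>\<^bsub>R\<^esub>} \<subseteq> A" and cu: "\<And>g. u g \<in> carrier R"
      using u by (auto simp: A_def free_module_simps)
    have "{g. a \<otimes>\<^bsub>R\<^esub> u g \<noteq> \<zero>\<^bsub>R\<^esub>} \<subseteq> A"
      using a ring.ring_simprules(24,25)[OF cring_ring[OF R]] by (auto simp: A_def)
    then have "free_lift R N h (a \<odot>\<^bsub>?F\<^esub> u) = (\<Oplus>\<^bsub>N\<^esub>g\<in>A. (a \<otimes>\<^bsub>R\<^esub> u g) \<odot>\<^bsub>N\<^esub> h g)"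
      using A cu a by (subst free_lift_eq[of A]) (auto simp: free_module_simps cring_facts[OF R])
    also have "\<dots> = (\<Oplus>\<^bsub>N\<^esub>g\<in>A. a \<odot>\<^bsub>N\<^esub> (u g \<odot>\<^bsub>N\<^esub> h g))"
      using A cu h a cl(4) by (intro finsum_cong') (auto simp: module.smult_assoc1[OF N])
    also have "\<dots> = a \<odot>\<^bsub>N\<^esub> (\<Oplus>\<^bsub>N\<^esub>g\<in>A. u g \<odot>\<^bsub>N\<^esub> h g)"
      using A cu h a cl(4) by (intro module.finsum_smult_ldistr[OF N, symmetric]) auto
    finally show "free_lift R N h (a \<odot>\<^bsub>?F\<^esub> u) = a \<odot>\<^bsub>N\<^esub> free_lift R N h u"
      using A cu by (simp add: free_lift_eq[of A])
  qed
qed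

lemma free_lift_gen: "g \<in> G \<Longrightarrow> free_lift R N h (gen R g) = h g"
  using h[of g] cring_facts[OF module_cring[OF N]] module_facts[OF N]
  by (subst free_lift_eq[of "{g}"])
    (auto simp: gen_def module_finsum_insert[OF N] module_finsum_empty[OF N])

end

text \<open>Tensor products, tensor powers and symmetric powers are all of this shape, so generation
  by the classes and the universal property are proved once.\<close>

abbreviation presented where
  "presented R G Rel \<equiv> quot_module (free_module R G) (mspan R (free_module R G) Rel)"

abbreviation pcls where
  "pcls R G Rel g \<equiv> mspan R (free_module R G) Rel +>\<^bsub>free_module R G\<^esub> gen R g"

lemma presented_module:
  "cring R \<Longrightarrow> Rel \<subseteq> carrier (free_module R G) \<Longrightarrow> module R (presented R G Rel)"
  by (intro quot_module_module mspan_submodule free_module_module)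

lemma pcls_carrier:
  assumes "cring R" "Rel \<subseteq> carrier (free_module R G)" "g \<in> G"
  shows "pcls R G Rel g \<in> carrier (presented R G Rel)"
  using assms by (intro quot_coset_carrier[OF free_module_module mspan_submodule] free_module_module gen_carrier)

lemma presented_span:
  assumes R: "cring R" and Rel: "Rel \<subseteq> carrier (free_module R G)"
  shows "mspan R (presented R G Rel) (pcls R G Rel ` G) = carrier (presented R G Rel)"
proof (rule mspan_eqI)
  let ?F = "free_module R G" and ?H = "mspan R (free_module R G) Rel"
  note F = free_module_module[OF R, of G]
  note H = mspan_submodule[OF F Rel]
  show Q: "module R (presented R G Rel)"
    by (rule presented_module[OF R Rel])
  show *: "pcls R G Rel ` G \<subseteq> carrier (presented R G Rel)"
    by (auto intro: pcls_carrier[OF R Rel])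
  show "carrier (presented R G Rel) \<subseteq> mspan R (presented R G Rel) (pcls R G Rel ` G)"
  proof
    fix C assume "C \<in> carrier (presented R G Rel)"
    then obtain f where f: "f \<in> carrier ?F" "C = ?H +>\<^bsub>?F\<^esub> f"
      by (rule quot_carrierE[OF F H])
    have G: "gen R ` G \<subseteq> carrier ?F"
      by (auto intro: gen_carrier[OF R])
    have K: "?H +>\<^bsub>?F\<^esub> u \<in> mspan R (presented R G Rel) (pcls R G Rel ` G)" if "u \<in> gen R ` G" for u
      using that by (auto intro: subsetD[OF mspan_incl])
    show "C \<in> mspan R (presented R G Rel) (pcls R G Rel ` G)"
      unfolding f(2) by (rule lin_mspan_sub[OF F Q quot_lin[OF F H] mspan_submodule[OF Q *] G K free_module_span[OF R f(1)]])
  qed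
qed

lemma presented_lift:
  assumes "module R N" "Rel \<subseteq> carrier (free_module R G)" "\<And>g. g \<in> G \<Longrightarrow> h g \<in> carrier N"
    and rel: "\<And>\<rho>. \<rho> \<in> Rel \<Longrightarrow> free_lift R N h \<rho> = \<zero>\<^bsub>N\<^esub>"
  shows "\<exists>f. lin R (presented R G Rel) N f \<and> (\<forall>g\<in>G. f (pcls R G Rel g) = h g)"
proof -
  let ?F = "free_module R G"
  note R = module_cring[OF assms(1)]
  note F = free_module_module[OF R, of G]
  note H = mspan_submodule[OF F assms(2)]
  note L = free_lift_lin[of R N G h, OF assms(1,3)]
  have "free_lift R N h u = \<zero>\<^bsub>N\<^esub>" if "u \<in> mspan R ?F Rel" for u
    using lin_mspan_sub[OF F assms(1) L, of "{\<zero>\<^bsub>N\<^esub>}" Rel u] assms(1,2) rel that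
      submodI[OF assms(1), of "{\<zero>\<^bsub>N\<^esub>}"] module_facts[OF assms(1)] by auto
  then obtain f where f: "lin R (presented R G Rel) N f"
      "\<And>u. u \<in> carrier ?F \<Longrightarrow> f (mspan R ?F Rel +>\<^bsub>?F\<^esub> u) = free_lift R N h u"
    using quot_lift[OF F H assms(1) L] by blast
  have "f (pcls R G Rel g) = h g" if "g \<in> G" for g
    using f(2)[OF gen_carrier[OF R that]] free_lift_gen[of R N G h, OF assms(1,3) that] by simp
  then show ?thesis
    using f(1) by blast
qed

lemma presented_eqI:
  assumes "cring R" "Rel \<subseteq> carrier (free_module R G)" "x \<in> carrier (free_module R G)" "y \<in> carrier (free_module R G)"
    and "x \<ominus>\<^bsub>free_module R G\<^esub> y \<in> Rel"
  shows "mspan R (free_module R G) Rel +>\<^bsub>free_module R G\<^esub> x = mspan R (free_module R G) Rel +>\<^bsub>free_module R G\<^esub> y"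
  using quot_coset_eq_iff[OF free_module_module mspan_submodule[OF free_module_module], of R Rel G x y]
    assms mspan_incl[of Rel R "free_module R G"] by blast

lemma mspan_carrier: "module R M \<Longrightarrow> mspan R M (carrier M) = carrier M"
  by (intro mspan_eqI mspan_incl order.refl)

section \<open>Tensor and symmetric powers\<close>

definition multilin where
  "multilin R M m N h \<longleftrightarrow> (\<forall>us\<in>tuples M m. h us \<in> carrier N) \<and>
     (\<forall>us\<in>tuples M m. \<forall>i<m. lin R M N (\<lambda>u. h (us[i := u])))"

definition symm_on where
  "symm_on M m h \<longleftrightarrow> (\<forall>us\<in>tuples M m. \<forall>vs. mset us = mset vs \<longrightarrow> h us = h vs)"

lemma multilinI:
  assumes "\<And>us. us \<in> tuples M m \<Longrightarrow> h us \<in> carrier N"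
    and "\<And>us i. us \<in> tuples M m \<Longrightarrow> i < m \<Longrightarrow> lin R M N (\<lambda>u. h (us[i := u]))"
  shows "multilin R M m N h"
  using assms by (auto simp: multilin_def)

lemma multilin_closed: "multilin R M m N h \<Longrightarrow> us \<in> tuples M m \<Longrightarrow> h us \<in> carrier N"
  and multilin_lin: "multilin R M m N h \<Longrightarrow> us \<in> tuples M m \<Longrightarrow> i < m \<Longrightarrow> lin R M N (\<lambda>u. h (us[i := u]))"
  by (auto simp: multilin_def)

lemma tuples_update: "us \<in> tuples M m \<Longrightarrow> u \<in> carrier M \<Longrightarrow> us[i := u] \<in> tuples M m"
  using set_update_subset_insert[of us i u] by (auto simp: tuples_def)

lemma tuples_length: "us \<in> tuples M m \<Longrightarrow> length us = m"
  and tuples_nth: "us \<in> tuples M m \<Longrightarrow> i < m \<Longrightarrow> us ! i \<in> carrier M"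
  by (auto simp: tuples_def)

lemma tuples_append: "us \<in> tuples M m \<Longrightarrow> vs \<in> tuples M n \<Longrightarrow> us @ vs \<in> tuples M (m + n)"
  by (auto simp: tuples_def)

lemma tuples_mset: "us \<in> tuples M m \<Longrightarrow> mset us = mset vs \<Longrightarrow> vs \<in> tuples M m"
  by (auto simp: tuples_def dest: mset_eq_setD mset_eq_length)

text \<open>The flag selects symmetric powers (\<open>True\<close>) or tensor powers
  (\<open>False\<close>), so that products, spans and lifts are treated uniformly for both.\<close>

definition pw_rels where
  "pw_rels b R M m = multilinear_rels R M m \<union> (if b then permutation_rels R M m else {})"

definition pw :: "bool \<Rightarrow> ('r, 'x) ring_scheme \<Rightarrow> ('r, 'm, 'y) module_scheme \<Rightarrow> nat \<Rightarrow> ('r, ('m list \<Rightarrow> 'r) set) module" where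
  "pw b R M m = presented R (tuples M m) (pw_rels b R M m)"

definition pwp :: "bool \<Rightarrow> ('r, 'x) ring_scheme \<Rightarrow> ('r, 'm, 'y) module_scheme \<Rightarrow> nat \<Rightarrow> 'm list \<Rightarrow> ('m list \<Rightarrow> 'r) set" where
  "pwp b R M m us = pcls R (tuples M m) (pw_rels b R M m) us"

lemma tpow_module_pw: "tpow_module R M m = pw False R M m"
  and spow_module_pw: "spow_module R M m = pw True R M m"
  and tpow_pure_pwp: "tpow_pure R M m us = pwp False R M m us"
  and spow_pure_pwp: "spow_pure R M m us = pwp True R M m us"
  by (simp_all add: tpow_module_def spow_module_def tpow_pure_def spow_pure_def pw_def pwp_def
      pw_rels_def tpow_kernel_def spow_kernel_def)

context
  fixes R :: "('r, 'x) ring_scheme" and M :: "('r, 'm, 'y) module_scheme"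
  assumes M: "module R M"
begin

lemma pw_rels_carrier: "pw_rels b R M m \<subseteq> carrier (free_module R (tuples M m))"
proof -
  note F = free_module_module[OF module_cring[OF M], of "tuples M m"]
  note G = gen_carrier[OF module_cring[OF M], where G = "tuples M m"]
  show ?thesis
    unfolding pw_rels_def multilinear_rels_def permutation_rels_def Let_def
    by (auto intro!: G module_facts(8)[OF F] module_facts(2)[OF F] module_facts(9)[OF F] tuples_update
      simp: module_facts(2)[OF M] module_facts(9)[OF M])
qed

lemma pw_module: "module R (pw b R M m)"
  unfolding pw_def by (rule presented_module[OF module_cring[OF M] pw_rels_carrier])

lemma pwp_closed: "us \<in> tuples M m \<Longrightarrow> pwp b R M m us \<in> carrier (pw b R M m)"
  unfolding pw_def pwp_def by (rule pcls_carrier[OF module_cring[OF M] pw_rels_carrier])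

lemma pwp_multilin: "multilin R M m (pw b R M m) (pwp b R M m)"
proof (rule multilinI)
  fix us i assume us: "us \<in> tuples M m" and i: "i < m"
  note F = free_module_module[OF module_cring[OF M], of "tuples M m"]
  note G = gen_carrier[OF module_cring[OF M], of _ "tuples M m"]
  note eq = presented_eqI[OF module_cring[OF M] pw_rels_carrier]
  note H = mspan_submodule[OF F pw_rels_carrier]
  note ql = quot_lin[OF F H]
  show "lin R M (pw b R M m) (\<lambda>u. pwp b R M m (us[i := u]))"
  proof (rule linI)
    fix u v assume u: "u \<in> carrier M" and v: "v \<in> carrier M"
    note Gu = G[OF tuples_update[OF us u, of i]] and Gv = G[OF tuples_update[OF us v, of i]]
      and Guv = G[OF tuples_update[OF us module_facts(2)[OF M u v], of i]]
    have "gen R (us[i := u \<oplus>\<^bsub>M\<^esub> v]) \<ominus>\<^bsub>free_module R (tuples M m)\<^esub>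
        (gen R (us[i := u]) \<oplus>\<^bsub>free_module R (tuples M m)\<^esub> gen R (us[i := v])) \<in> pw_rels b R M m"
      using us i u v unfolding pw_rels_def multilinear_rels_def Let_def by blast
    from eq[OF Guv module_facts(2)[OF F Gu Gv] this]
    show "pwp b R M m (us[i := u \<oplus>\<^bsub>M\<^esub> v]) = pwp b R M m (us[i := u]) \<oplus>\<^bsub>pw b R M m\<^esub> pwp b R M m (us[i := v])"
      unfolding pwp_def pw_def using lin_add[OF ql Gu Gv] by simp
  next
    fix a u assume a: "a \<in> carrier R" and u: "u \<in> carrier M"
    note Gu = G[OF tuples_update[OF us u, of i]]
      and Gau = G[OF tuples_update[OF us module_facts(9)[OF M a u], of i]]
    have "gen R (us[i := a \<odot>\<^bsub>M\<^esub> u]) \<ominus>\<^bsub>free_module R (tuples M m)\<^esub>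
        (a \<odot>\<^bsub>free_module R (tuples M m)\<^esub> gen R (us[i := u])) \<in> pw_rels b R M m"
      using us i a u unfolding pw_rels_def multilinear_rels_def Let_def by blast
    from eq[OF Gau module_facts(9)[OF F a Gu] this]
    show "pwp b R M m (us[i := a \<odot>\<^bsub>M\<^esub> u]) = a \<odot>\<^bsub>pw b R M m\<^esub> pwp b R M m (us[i := u])"
      unfolding pwp_def pw_def using lin_smult[OF ql a Gu] by simp
  qed (simp add: us tuples_update pwp_closed)
qed (rule pwp_closed)

lemma pwp_symm: "symm_on M m (pwp True R M m)"
  unfolding symm_on_def
proof (intro ballI allI impI)
  fix us vs assume us: "us \<in> tuples M m" and eq: "mset us = mset vs"
  note vs = tuples_mset[OF us eq]
  have "gen R us \<ominus>\<^bsub>free_module R (tuples M m)\<^esub> gen R vs \<in> pw_rels True R M m"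
    using us vs eq unfolding pw_rels_def permutation_rels_def Let_def by auto
  then show "pwp True R M m us = pwp True R M m vs"
    unfolding pwp_def
    by (intro presented_eqI[OF module_cring[OF M] pw_rels_carrier] gen_carrier[OF module_cring[OF M]] us vs)
qed

lemma pw_span: "mspan R (pw b R M m) (pwp b R M m ` tuples M m) = carrier (pw b R M m)"
  using presented_span[OF module_cring[OF M] pw_rels_carrier[of b m]] by (simp add: pw_def pwp_def[abs_def])

lemma pwp_image_sub: "A \<subseteq> tuples M m \<Longrightarrow> pwp b R M m ` A \<subseteq> carrier (pw b R M m)"
  by (auto intro: pwp_closed)

text \<open>The universal property. Each relation is a difference of two elements on which
  \<open>h\<close> takes the same value: by linearity in a slot, or by symmetry when
  \<open>b\<close> holds.\<close>

lemma pw_lift: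
  assumes N: "module R N" and h: "multilin R M m N h" and s: "b \<Longrightarrow> symm_on M m h"
  obtains f where "lin R (pw b R M m) N f" "\<And>us. us \<in> tuples M m \<Longrightarrow> f (pwp b R M m us) = h us"
proof -
  let ?F = "free_module R (tuples M m)"
  note F = free_module_module[OF module_cring[OF M], of "tuples M m"]
  note G = gen_carrier[OF module_cring[OF M], of _ "tuples M m"]
  note L = free_lift_lin[of R N "tuples M m" h, OF N multilin_closed[OF h]]
  note Lg = free_lift_gen[of R N "tuples M m" h, OF N multilin_closed[OF h]]
  have "free_lift R N h \<rho> = \<zero>\<^bsub>N\<^esub>" if \<rho>: "\<rho> \<in> pw_rels b R M m" for \<rho>
  proof -
    have diff: "free_lift R N h (x \<ominus>\<^bsub>?F\<^esub> y) = \<zero>\<^bsub>N\<^esub>"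
      if "x \<in> carrier ?F" "y \<in> carrier ?F" "free_lift R N h x = free_lift R N h y" for x y
      using lin_diff[OF F N L that(1,2)] that lin_closed[OF L that(2)]
      by (simp add: a_minus_def module_facts[OF N])
    from \<rho> consider
      us i u v where "\<rho> = gen R (us[i := u \<oplus>\<^bsub>M\<^esub> v]) \<ominus>\<^bsub>?F\<^esub> (gen R (us[i := u]) \<oplus>\<^bsub>?F\<^esub> gen R (us[i := v]))"
        "us \<in> tuples M m" "i < m" "u \<in> carrier M" "v \<in> carrier M"
      | us i a u where "\<rho> = gen R (us[i := a \<odot>\<^bsub>M\<^esub> u]) \<ominus>\<^bsub>?F\<^esub> a \<odot>\<^bsub>?F\<^esub> gen R (us[i := u])"
        "us \<in> tuples M m" "i < m" "a \<in> carrier R" "u \<in> carrier M"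
      | us vs where "b" "\<rho> = gen R us \<ominus>\<^bsub>?F\<^esub> gen R vs" "us \<in> tuples M m" "vs \<in> tuples M m" "mset us = mset vs"
      unfolding pw_rels_def multilinear_rels_def permutation_rels_def Let_def by (auto split: if_splits)
    then show ?thesis
    proof cases
      case 1
      note t = tuples_update[OF 1(2)]
      show ?thesis
        unfolding 1(1) using lin_add[OF multilin_lin[OF h 1(2,3)] 1(4,5)] 1
        by (intro diff) (simp_all add: t G Lg lin_add[OF L] module_facts[OF F] module_facts[OF M])
    next
      case 2
      note t = tuples_update[OF 2(2)]
      show ?thesis
        unfolding 2(1) using lin_smult[OF multilin_lin[OF h 2(2,3)] 2(4,5)] 2
        by (intro diff) (simp_all add: t G Lg lin_smult[OF L] module_facts[OF F] module_facts[OF M])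
    next
      case 3
      have "h us = h vs"
        using s[OF 3(1)] 3(3,5) unfolding symm_on_def by blast
      then show ?thesis
        unfolding 3(2) using 3(3,4) by (intro diff) (simp_all add: G Lg)
    qed
  qed
  then obtain f where f: "lin R (presented R (tuples M m) (pw_rels b R M m)) N f"
      "\<forall>us\<in>tuples M m. f (pcls R (tuples M m) (pw_rels b R M m) us) = h us"
    using presented_lift[OF N pw_rels_carrier[of b m], of h] multilin_closed[OF h] by blast
  show thesis
  proof (rule that[of f])
    show "lin R (pw b R M m) N f"
      using f(1) by (simp add: pw_def)
    show "f (pwp b R M m us) = h us" if "us \<in> tuples M m" for us
      using bspec[OF f(2) that] by (simp add: pwp_def)
  qed
qed

lemma pw_ext:
  assumes N: "module R N" and f: "lin R (pw b R M m) N f" and g: "lin R (pw b R M m) N g"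
    and eq: "\<And>us. us \<in> tuples M m \<Longrightarrow> f (pwp b R M m us) = g (pwp b R M m us)"
    and p: "p \<in> carrier (pw b R M m)"
  shows "f p = g p"
  by (rule lin_eq_on_mspan[OF pw_module N f g pwp_image_sub[OF order.refl]])
    (use eq p pw_span in auto)

lemma pw_sub:
  assumes N: "module R N" and f: "lin R (pw b R M m) N f" and K: "submodule K R N"
    and eq: "\<And>us. us \<in> tuples M m \<Longrightarrow> f (pwp b R M m us) \<in> K"
    and p: "p \<in> carrier (pw b R M m)"
  shows "f p \<in> K"
  by (rule lin_mspan_sub[OF pw_module N f K pwp_image_sub[OF order.refl]])
    (use eq p pw_span in auto)

text \<open>One slot at a time, an entry from \<open>S\<close> is replaced by an arbitrary entry,
  using linearity in that slot.\<close>

lemma multilin_mspan: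
  assumes N: "module R N" and h: "multilin R M m N h" and K: "submodule K R N"
    and S: "S \<subseteq> carrier M" "mspan R M S = carrier M"
    and hK: "\<And>us. length us = m \<Longrightarrow> set us \<subseteq> S \<Longrightarrow> h us \<in> K"
    and us: "us \<in> tuples M m"
  shows "h us \<in> K"
proof -
  \<comment> \<open>The first \<open>k\<close> entries are already arbitrary, the others still lie
    in \<open>S\<close>. At \<open>k = m\<close> this is the claim.\<close>
  have "h us \<in> K" if "k \<le> m" "us \<in> tuples M m" "set (drop k us) \<subseteq> S" for k us
    using that
  proof (induction k arbitrary: us)
    case 0
    then show ?case
      using hK by (simp add: tuples_def)
  next
    case (Suc k)
    have k: "k < m" "k < length us"
      using Suc.prems by (auto simp: tuples_def)
    have "h (us[k := us ! k]) \<in> K"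
    proof (rule lin_mspan_sub[OF M N multilin_lin[OF h Suc.prems(2) k(1)] K S(1)])
      fix u assume u: "u \<in> S"
      have "drop k (us[k := u]) = u # drop (Suc k) us"
        using k by (simp add: Cons_nth_drop_Suc[symmetric])
      then show "h (us[k := u]) \<in> K"
        using Suc.prems u S(1) k by (intro Suc.IH tuples_update) auto
    next
      show "us ! k \<in> mspan R M S"
        using S(2) tuples_nth[OF Suc.prems(2) k(1)] by simp
    qed
    then show ?case
      by simp
  qed
  from this[of m us] us show ?thesis
    by (simp add: tuples_def)
qed

lemma pw_span_set:
  assumes S: "S \<subseteq> carrier M" "mspan R M S = carrier M"
  shows "mspan R (pw b R M m) (pwp b R M m ` {us. length us = m \<and> set us \<subseteq> S}) = carrier (pw b R M m)"
    (is "mspan _ _ (_ ` ?A) = _")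
proof (rule mspan_eqI[OF pw_module])
  have A: "?A \<subseteq> tuples M m"
    using S(1) by (auto simp: tuples_def)
  then show A': "pwp b R M m ` ?A \<subseteq> carrier (pw b R M m)"
    by (rule pwp_image_sub)
  note H = mspan_submodule[OF pw_module A']
  have "pwp b R M m us \<in> mspan R (pw b R M m) (pwp b R M m ` ?A)" if "us \<in> tuples M m" for us
    by (rule multilin_mspan[OF pw_module pwp_multilin H S _ that]) (auto intro: subsetD[OF mspan_incl])
  then show "carrier (pw b R M m) \<subseteq> mspan R (pw b R M m) (pwp b R M m ` ?A)"
    using mspan_least[OF H, of "pwp b R M m ` tuples M m"] pw_span by auto
qed

end

section \<open>Bilinear maps and tensor products\<close>

definition bilin where
  "bilin R M N L f \<longleftrightarrow> (\<forall>v\<in>carrier N. lin R M L (\<lambda>u. f u v)) \<and> (\<forall>u\<in>carrier M. lin R N L (f u))"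

lemma bilinI:
  assumes "\<And>v. v \<in> carrier N \<Longrightarrow> lin R M L (\<lambda>u. f u v)" "\<And>u. u \<in> carrier M \<Longrightarrow> lin R N L (\<lambda>v. f u v)"
  shows "bilin R M N L f"
  using assms by (simp add: bilin_def)

lemma bilin_lin1: "bilin R M N L f \<Longrightarrow> v \<in> carrier N \<Longrightarrow> lin R M L (\<lambda>u. f u v)"
  and bilin_lin2: "bilin R M N L f \<Longrightarrow> u \<in> carrier M \<Longrightarrow> lin R N L (\<lambda>v. f u v)"
  and bilin_closed: "bilin R M N L f \<Longrightarrow> u \<in> carrier M \<Longrightarrow> v \<in> carrier N \<Longrightarrow> f u v \<in> carrier L"
  by (auto simp: bilin_def lin_def)

abbreviation pt where "pt \<equiv> pure_tensor"

lemma tensor_module_presented: "tensor_module R M N = presented R (carrier M \<times> carrier N) (tensor_rels R M N)"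
  and pure_tensor_pcls: "pure_tensor R M N u v = pcls R (carrier M \<times> carrier N) (tensor_rels R M N) (u, v)"
  by (simp_all add: tensor_module_def pure_tensor_def tensor_kernel_def)

context
  fixes R :: "('r, 'x) ring_scheme" and M :: "('r, 'm, 'y) module_scheme" and N :: "('r, 'n, 'z) module_scheme"
  assumes M: "module R M" and N: "module R N"
begin

lemma tensor_rels_carrier: "tensor_rels R M N \<subseteq> carrier (free_module R (carrier M \<times> carrier N))"
proof -
  note F = free_module_module[OF module_cring[OF M], of "carrier M \<times> carrier N"]
  note G = gen_carrier[OF module_cring[OF M], where G = "carrier M \<times> carrier N"]
  show ?thesis
    unfolding tensor_rels_def Let_def
    by (auto intro!: G module_facts(8)[OF F] module_facts(2)[OF F] module_facts(9)[OF F]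
      simp: module_facts(2)[OF M] module_facts(9)[OF M] module_facts(2)[OF N] module_facts(9)[OF N])
qed

lemma tensor_module_module: "module R (tensor_module R M N)"
  unfolding tensor_module_presented by (rule presented_module[OF module_cring[OF M] tensor_rels_carrier])

lemma pt_closed: "u \<in> carrier M \<Longrightarrow> v \<in> carrier N \<Longrightarrow> pt R M N u v \<in> carrier (tensor_module R M N)"
  unfolding tensor_module_presented pure_tensor_pcls
  by (rule pcls_carrier[OF module_cring[OF M] tensor_rels_carrier]) simp

lemma pt_bilin: "bilin R M N (tensor_module R M N) (pt R M N)"
proof (rule bilinI)
  let ?F = "free_module R (carrier M \<times> carrier N)"
  note F = free_module_module[OF module_cring[OF M], of "carrier M \<times> carrier N"]
  have G: "gen R (u, v) \<in> carrier ?F" if "u \<in> carrier M" "v \<in> carrier N" for u v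
    using gen_carrier[OF module_cring[OF M], of "(u, v)" "carrier M \<times> carrier N"] that by simp
  note eq = presented_eqI[OF module_cring[OF M] tensor_rels_carrier]
  note H = mspan_submodule[OF F tensor_rels_carrier]
  note ql = quot_lin[OF F H]
  note Ma = module_facts(2)[OF M] and Ms = module_facts(9)[OF M] and Na = module_facts(2)[OF N] and Ns = module_facts(9)[OF N]
    and Fa = module_facts(2)[OF F] and Fs = module_facts(9)[OF F]
  show "lin R M (tensor_module R M N) (\<lambda>u. pt R M N u v)" if v: "v \<in> carrier N" for v
  proof (rule linI)
    fix u u' assume u: "u \<in> carrier M" "u' \<in> carrier M"
    have "gen R (u \<oplus>\<^bsub>M\<^esub> u', v) \<ominus>\<^bsub>?F\<^esub> (gen R (u, v) \<oplus>\<^bsub>?F\<^esub> gen R (u', v)) \<in> tensor_rels R M N"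
      using u v unfolding tensor_rels_def Let_def by blast
    from eq[OF G[OF Ma[OF u] v] Fa[OF G[OF u(1) v] G[OF u(2) v]] this]
    show "pt R M N (u \<oplus>\<^bsub>M\<^esub> u') v = pt R M N u v \<oplus>\<^bsub>tensor_module R M N\<^esub> pt R M N u' v"
      unfolding tensor_module_presented pure_tensor_pcls using lin_add[OF ql G[OF u(1) v] G[OF u(2) v]] by simp
  next
    fix a u assume a: "a \<in> carrier R" and u: "u \<in> carrier M"
    have "gen R (a \<odot>\<^bsub>M\<^esub> u, v) \<ominus>\<^bsub>?F\<^esub> (a \<odot>\<^bsub>?F\<^esub> gen R (u, v)) \<in> tensor_rels R M N"
      using u v a unfolding tensor_rels_def Let_def by blast
    from eq[OF G[OF Ms[OF a u] v] Fs[OF a G[OF u v]] this]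
    show "pt R M N (a \<odot>\<^bsub>M\<^esub> u) v = a \<odot>\<^bsub>tensor_module R M N\<^esub> pt R M N u v"
      unfolding tensor_module_presented pure_tensor_pcls using lin_smult[OF ql a G[OF u v]] by simp
  qed (simp add: v pt_closed)
  show "lin R N (tensor_module R M N) (\<lambda>v. pt R M N u v)" if u: "u \<in> carrier M" for u
  proof (rule linI)
    fix v v' assume v: "v \<in> carrier N" "v' \<in> carrier N"
    have "gen R (u, v \<oplus>\<^bsub>N\<^esub> v') \<ominus>\<^bsub>?F\<^esub> (gen R (u, v) \<oplus>\<^bsub>?F\<^esub> gen R (u, v')) \<in> tensor_rels R M N"
      using u v unfolding tensor_rels_def Let_def by blast
    from eq[OF G[OF u Na[OF v]] Fa[OF G[OF u v(1)] G[OF u v(2)]] this]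
    show "pt R M N u (v \<oplus>\<^bsub>N\<^esub> v') = pt R M N u v \<oplus>\<^bsub>tensor_module R M N\<^esub> pt R M N u v'"
      unfolding tensor_module_presented pure_tensor_pcls using lin_add[OF ql G[OF u v(1)] G[OF u v(2)]] by simp
  next
    fix a v assume a: "a \<in> carrier R" and v: "v \<in> carrier N"
    have "gen R (u, a \<odot>\<^bsub>N\<^esub> v) \<ominus>\<^bsub>?F\<^esub> (a \<odot>\<^bsub>?F\<^esub> gen R (u, v)) \<in> tensor_rels R M N"
      using u v a unfolding tensor_rels_def Let_def by blast
    from eq[OF G[OF u Ns[OF a v]] Fs[OF a G[OF u v]] this]
    show "pt R M N u (a \<odot>\<^bsub>N\<^esub> v) = a \<odot>\<^bsub>tensor_module R M N\<^esub> pt R M N u v"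
      unfolding tensor_module_presented pure_tensor_pcls using lin_smult[OF ql a G[OF u v]] by simp
  qed (simp add: u pt_closed)
qed

lemma tensor_lift:
  assumes L: "module R L" and h: "bilin R M N L h"
  obtains f where "lin R (tensor_module R M N) L f"
    "\<And>u v. u \<in> carrier M \<Longrightarrow> v \<in> carrier N \<Longrightarrow> f (pt R M N u v) = h u v"
proof -
  let ?F = "free_module R (carrier M \<times> carrier N)" and ?h = "\<lambda>(u, v). h u v"
  note F = free_module_module[OF module_cring[OF M], of "carrier M \<times> carrier N"]
  have G: "gen R (u, v) \<in> carrier ?F" if "u \<in> carrier M" "v \<in> carrier N" for u v
    using gen_carrier[OF module_cring[OF M], of "(u, v)" "carrier M \<times> carrier N"] that by simp
  have hc: "?h g \<in> carrier L" if "g \<in> carrier M \<times> carrier N" for g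
    using that bilin_closed[OF h] by auto
  note Lf = free_lift_lin[of R L "carrier M \<times> carrier N" ?h, OF L hc]
  have Lg: "free_lift R L ?h (gen R (u, v)) = h u v" if "u \<in> carrier M" "v \<in> carrier N" for u v
    using free_lift_gen[of R L "carrier M \<times> carrier N" ?h "(u, v)", OF L hc] that by simp
  note facts = module_facts[OF F] module_facts[OF M] module_facts[OF N]
  have "free_lift R L ?h \<rho> = \<zero>\<^bsub>L\<^esub>" if \<rho>: "\<rho> \<in> tensor_rels R M N" for \<rho>
  proof -
    have diff: "free_lift R L ?h (x \<ominus>\<^bsub>?F\<^esub> y) = \<zero>\<^bsub>L\<^esub>"
      if "x \<in> carrier ?F" "y \<in> carrier ?F" "free_lift R L ?h x = free_lift R L ?h y" for x y
      using lin_diff[OF F L Lf that(1,2)] that lin_closed[OF Lf that(2)]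
      by (simp add: a_minus_def module_facts[OF L])
    from \<rho> consider
      u u' v where "\<rho> = gen R (u \<oplus>\<^bsub>M\<^esub> u', v) \<ominus>\<^bsub>?F\<^esub> (gen R (u, v) \<oplus>\<^bsub>?F\<^esub> gen R (u', v))"
        "u \<in> carrier M" "u' \<in> carrier M" "v \<in> carrier N"
      | u v v' where "\<rho> = gen R (u, v \<oplus>\<^bsub>N\<^esub> v') \<ominus>\<^bsub>?F\<^esub> (gen R (u, v) \<oplus>\<^bsub>?F\<^esub> gen R (u, v'))"
        "u \<in> carrier M" "v \<in> carrier N" "v' \<in> carrier N"
      | a u v where "\<rho> = gen R (a \<odot>\<^bsub>M\<^esub> u, v) \<ominus>\<^bsub>?F\<^esub> a \<odot>\<^bsub>?F\<^esub> gen R (u, v)"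
        "a \<in> carrier R" "u \<in> carrier M" "v \<in> carrier N"
      | a u v where "\<rho> = gen R (u, a \<odot>\<^bsub>N\<^esub> v) \<ominus>\<^bsub>?F\<^esub> a \<odot>\<^bsub>?F\<^esub> gen R (u, v)"
        "a \<in> carrier R" "u \<in> carrier M" "v \<in> carrier N"
      unfolding tensor_rels_def Let_def by blast
    then show ?thesis
    proof cases
      case 1
      show ?thesis
        unfolding 1(1) using lin_add[OF bilin_lin1[OF h 1(4)] 1(2,3)] 1
        by (intro diff) (simp_all add: G Lg lin_add[OF Lf] facts)
    next
      case 2
      show ?thesis
        unfolding 2(1) using lin_add[OF bilin_lin2[OF h 2(2)] 2(3,4)] 2
        by (intro diff) (simp_all add: G Lg lin_add[OF Lf] facts)
    next
      case 3
      show ?thesis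
        unfolding 3(1) using lin_smult[OF bilin_lin1[OF h 3(4)] 3(2,3)] 3
        by (intro diff) (simp_all add: G Lg lin_smult[OF Lf] facts)
    next
      case 4
      show ?thesis
        unfolding 4(1) using lin_smult[OF bilin_lin2[OF h 4(3)] 4(2,4)] 4
        by (intro diff) (simp_all add: G Lg lin_smult[OF Lf] facts)
    qed
  qed
  then obtain f where f: "lin R (presented R (carrier M \<times> carrier N) (tensor_rels R M N)) L f"
      "\<forall>g\<in>carrier M \<times> carrier N. f (pcls R (carrier M \<times> carrier N) (tensor_rels R M N) g) = ?h g"
    using presented_lift[OF L tensor_rels_carrier, of ?h] hc by blast
  show thesis
  proof (rule that[of f])
    show "f (pt R M N u v) = h u v" if "u \<in> carrier M" "v \<in> carrier N" for u v
      using bspec[OF f(2), of "(u, v)"] that by (simp add: pure_tensor_pcls)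
  qed (use f(1) in \<open>simp add: tensor_module_presented\<close>)
qed

lemma tensor_span_set:
  assumes S: "S \<subseteq> carrier M" "mspan R M S = carrier M" and T: "T \<subseteq> carrier N" "mspan R N T = carrier N"
  shows "mspan R (tensor_module R M N) {pt R M N u v | u v. u \<in> S \<and> v \<in> T} = carrier (tensor_module R M N)"
    (is "mspan _ _ ?A = _")
proof (rule mspan_eqI[OF tensor_module_module])
  show A: "?A \<subseteq> carrier (tensor_module R M N)"
    using S T by (auto intro!: pt_closed)
  note H = mspan_submodule[OF tensor_module_module A]
  have 1: "pt R M N u v \<in> mspan R (tensor_module R M N) ?A" if u: "u \<in> S" and v: "v \<in> carrier N" for u v
  proof (rule lin_mspan_sub[OF N tensor_module_module bilin_lin2[OF pt_bilin subsetD[OF S(1) u]] H T(1)])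
    show "pt R M N u w \<in> mspan R (tensor_module R M N) ?A" if "w \<in> T" for w
      using u that by (intro subsetD[OF mspan_incl]) auto
  qed (use v T in simp)
  have 2: "pt R M N u v \<in> mspan R (tensor_module R M N) ?A" if u: "u \<in> carrier M" and v: "v \<in> carrier N" for u v
  proof (rule lin_mspan_sub[OF M tensor_module_module bilin_lin1[OF pt_bilin v] H S(1)])
    show "pt R M N w v \<in> mspan R (tensor_module R M N) ?A" if "w \<in> S" for w
      using v that by (rule 1[rotated])
  qed (use u S in simp)
  have "carrier (tensor_module R M N) =
      mspan R (tensor_module R M N) ((\<lambda>(u, v). pt R M N u v) ` (carrier M \<times> carrier N))"
    using presented_span[OF module_cring[OF M] tensor_rels_carrier]
    by (simp add: tensor_module_presented pure_tensor_pcls[abs_def] image_def split_def)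
  also have "\<dots> \<subseteq> mspan R (tensor_module R M N) ?A"
    using 2 by (intro mspan_least[OF H]) auto
  finally show "carrier (tensor_module R M N) \<subseteq> mspan R (tensor_module R M N) ?A" .
qed

lemmas tensor_span = tensor_span_set[OF order.refl mspan_carrier[OF M]]

end

text \<open>For fixed arguments from \<open>N\<close>, additivity and homogeneity in the second
  argument are equations between maps that are linear in the first one. Hence they may be checked on
  generators of \<open>Q\<close>. This is how well-definedness in two variables is obtained without
  presenting a product of two modules.\<close>

lemma bilin_family:
  assumes Q: "module R Q" and N: "module R N" and L: "module R L"
    and G: "G \<subseteq> carrier Q" "mspan R Q G = carrier Q"
    and g: "\<And>v. v \<in> carrier N \<Longrightarrow> lin R Q L (g v)"
    and gG: "\<And>p. p \<in> G \<Longrightarrow> lin R N L (\<lambda>v. g v p)"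
  shows "bilin R Q N L (\<lambda>p v. g v p)"
proof (rule bilinI)
  fix p assume p: "p \<in> carrier Q"
  then have pG: "p \<in> mspan R Q G"
    using G by simp
  show "lin R N L (\<lambda>v. g v p)"
  proof (rule linI)
    fix v v' assume v: "v \<in> carrier N" "v' \<in> carrier N"
    show "g (v \<oplus>\<^bsub>N\<^esub> v') p = g v p \<oplus>\<^bsub>L\<^esub> g v' p"
      by (rule lin_eq_on_mspan[OF Q L g lin_sum[OF Q L g g] G(1) _ pG])
        (use v lin_add[OF gG v] in \<open>simp_all add: module_facts[OF N]\<close>)
  next
    fix a v assume a: "a \<in> carrier R" and v: "v \<in> carrier N"
    show "g (a \<odot>\<^bsub>N\<^esub> v) p = a \<odot>\<^bsub>L\<^esub> g v p"
      by (rule lin_eq_on_mspan[OF Q L g lin_scale[OF Q L g] G(1) _ pG])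
        (use a v lin_smult[OF gG a v] in \<open>simp_all add: module_facts[OF N]\<close>)
  qed (use g p in \<open>auto intro: lin_closed\<close>)
qed (rule g)

text \<open>Pure tensors are inserted twice. For fixed \<open>p\<close> and \<open>b\<close> the
  product is a linear map \<open>h p b\<close> on the right-hand tensor product; its dependence on
  \<open>p\<close> and \<open>b\<close> is bilinear because it is so on pure tensors, and the
  resulting map lifts to the left-hand tensor product.\<close>

lemma tensor_mult:
  assumes P: "module R P" and B: "module R B" and T: "module R T" and C: "module R C"
    and T': "module R T'" and C': "module R C'"
    and f: "bilin R P T T' f" and g: "bilin R B C C' g"
  shows "\<exists>F. bilin R (tensor_module R P B) (tensor_module R T C) (tensor_module R T' C') F \<and>
    (\<forall>p\<in>carrier P. \<forall>b\<in>carrier B. \<forall>t\<in>carrier T. \<forall>c\<in>carrier C.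
      F (pt R P B p b) (pt R T C t c) = pt R T' C' (f p t) (g b c))"
proof -
  let ?Q = "tensor_module R T C" and ?L = "tensor_module R T' C'" and ?PB = "tensor_module R P B"
  note Q = tensor_module_module[OF T C] and L = tensor_module_module[OF T' C'] and PB = tensor_module_module[OF P B]
  note ptb = pt_bilin[OF T' C']
  have "\<exists>h. lin R ?Q ?L h \<and> (\<forall>t\<in>carrier T. \<forall>c\<in>carrier C. h (pt R T C t c) = pt R T' C' (f p t) (g b c))"
    if p: "p \<in> carrier P" and b: "b \<in> carrier B" for p b
  proof -
    have "bilin R T C ?L (\<lambda>t c. pt R T' C' (f p t) (g b c))"
      by (intro bilinI lin_comp[OF bilin_lin2[OF f p] bilin_lin1[OF ptb]]
          lin_comp[OF bilin_lin2[OF g b] bilin_lin2[OF ptb]] bilin_closed[OF g b] bilin_closed[OF f p])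
    from tensor_lift[OF T C L this] show ?thesis
      by metis
  qed
  then obtain h where h: "\<And>p b. p \<in> carrier P \<Longrightarrow> b \<in> carrier B \<Longrightarrow> lin R ?Q ?L (h p b)"
    and hp: "\<And>p b t c. p \<in> carrier P \<Longrightarrow> b \<in> carrier B \<Longrightarrow> t \<in> carrier T \<Longrightarrow> c \<in> carrier C \<Longrightarrow>
      h p b (pt R T C t c) = pt R T' C' (f p t) (g b c)"
    by metis
  note span = tensor_span[OF T C order.refl mspan_carrier[OF C]]
  have sub: "{pt R T C u v |u v. u \<in> carrier T \<and> v \<in> carrier C} \<subseteq> carrier ?Q"
    by (auto intro: pt_closed[OF T C])
  have hb1: "bilin R ?Q P ?L (\<lambda>y p. h p b y)" if b: "b \<in> carrier B" for b
  proof (rule bilin_family[OF Q P L sub span h[OF _ b]])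
    fix y assume "y \<in> {pt R T C u v |u v. u \<in> carrier T \<and> v \<in> carrier C}"
    then obtain t c where y: "y = pt R T C t c" "t \<in> carrier T" "c \<in> carrier C"
      by blast
    have "lin R P ?L (\<lambda>p. pt R T' C' (f p t) (g b c))"
      by (intro lin_comp[OF bilin_lin1[OF f y(2)] bilin_lin1[OF ptb]] bilin_closed[OF g b y(3)])
    then show "lin R P ?L (\<lambda>p. h p b y)"
      by (rule lin_cong[OF P]) (simp add: y hp b)
  qed
  have hb2: "bilin R ?Q B ?L (\<lambda>y b. h p b y)" if p: "p \<in> carrier P" for p
  proof (rule bilin_family[OF Q B L sub span h[OF p]])
    fix y assume "y \<in> {pt R T C u v |u v. u \<in> carrier T \<and> v \<in> carrier C}"
    then obtain t c where y: "y = pt R T C t c" "t \<in> carrier T" "c \<in> carrier C"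
      by blast
    have "lin R B ?L (\<lambda>b. pt R T' C' (f p t) (g b c))"
      by (intro lin_comp[OF bilin_lin1[OF g y(3)] bilin_lin2[OF ptb]] bilin_closed[OF f p y(2)])
    then show "lin R B ?L (\<lambda>b. h p b y)"
      by (rule lin_cong[OF B]) (simp add: y hp p)
  qed
  have "\<exists>k. lin R ?PB ?L k \<and> (\<forall>p\<in>carrier P. \<forall>b\<in>carrier B. k (pt R P B p b) = h p b y)"
    if y: "y \<in> carrier ?Q" for y
  proof -
    have "bilin R P B ?L (\<lambda>p b. h p b y)"
      by (intro bilinI bilin_lin2[OF hb1 y] bilin_lin2[OF hb2 y])
    from tensor_lift[OF P B L this] show ?thesis
      by metis
  qed
  then obtain k where k: "\<And>y. y \<in> carrier ?Q \<Longrightarrow> lin R ?PB ?L (k y)"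
    and kp: "\<And>y p b. y \<in> carrier ?Q \<Longrightarrow> p \<in> carrier P \<Longrightarrow> b \<in> carrier B \<Longrightarrow> k y (pt R P B p b) = h p b y"
    by metis
  have "bilin R ?PB ?Q ?L (\<lambda>q y. k y q)"
  proof (rule bilin_family[OF PB Q L _ tensor_span[OF P B order.refl mspan_carrier[OF B]] k])
    fix q assume "q \<in> {pt R P B u v |u v. u \<in> carrier P \<and> v \<in> carrier B}"
    then obtain p b where q: "q = pt R P B p b" "p \<in> carrier P" "b \<in> carrier B"
      by blast
    show "lin R ?Q ?L (\<lambda>y. k y q)"
      by (rule lin_cong[OF Q h[OF q(2,3)]]) (simp add: q kp)
  qed (auto intro: pt_closed[OF P B])
  then show ?thesis
    by (intro exI[of _ "\<lambda>q y. k y q"]) (simp add: kp hp pt_closed[OF T C])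
qed

lemma tensor_map:
  assumes M: "module R M" and N: "module R N" and M': "module R M'" and N': "module R N'"
    and f: "lin R M M' f" and g: "lin R N N' g"
  shows "\<exists>F. lin R (tensor_module R M N) (tensor_module R M' N') F \<and>
    (\<forall>u\<in>carrier M. \<forall>v\<in>carrier N. F (pt R M N u v) = pt R M' N' (f u) (g v))"
proof -
  have "bilin R M N (tensor_module R M' N') (\<lambda>u v. pt R M' N' (f u) (g v))"
    by (intro bilinI lin_comp[OF f bilin_lin1[OF pt_bilin[OF M' N']]] lin_closed[OF g]
        lin_comp[OF g bilin_lin2[OF pt_bilin[OF M' N']]] lin_closed[OF f])
  from tensor_lift[OF M N tensor_module_module[OF M' N'] this] show ?thesis
    by metis
qed

text \<open>A map of two tuples is first lifted in the second tuple. The result, at a fixed element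
  \<open>y\<close> of the second power, is multilinear (and symmetric) in the first tuple because
  this holds at the classes of tuples, which generate; so it lifts again.\<close>

lemma pw_pw_bilin:
  assumes M: "module R M" and N: "module R N" and L: "module R L"
    and h1: "\<And>vs. vs \<in> tuples N n \<Longrightarrow> multilin R M m L (\<lambda>us. h us vs)"
    and h2: "\<And>us. us \<in> tuples M m \<Longrightarrow> multilin R N n L (h us)"
    and s1: "\<And>vs. b \<Longrightarrow> vs \<in> tuples N n \<Longrightarrow> symm_on M m (\<lambda>us. h us vs)"
    and s2: "\<And>us. b' \<Longrightarrow> us \<in> tuples M m \<Longrightarrow> symm_on N n (h us)"
  shows "\<exists>f. bilin R (pw b R M m) (pw b' R N n) L f \<and>
    (\<forall>us\<in>tuples M m. \<forall>vs\<in>tuples N n. f (pwp b R M m us) (pwp b' R N n vs) = h us vs)"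
proof -
  let ?P = "pw b R M m" and ?Q = "pw b' R N n"
  note P = pw_module[OF M, of b m] and Q = pw_module[OF N, of b' n]
  have "\<exists>g. lin R ?Q L g \<and> (\<forall>vs\<in>tuples N n. g (pwp b' R N n vs) = h us vs)" if "us \<in> tuples M m" for us
    using pw_lift[OF N L h2[OF that] s2[OF _ that]] by metis
  then obtain g where g: "\<And>us. us \<in> tuples M m \<Longrightarrow> lin R ?Q L (g us)"
    and gp: "\<And>us vs. us \<in> tuples M m \<Longrightarrow> vs \<in> tuples N n \<Longrightarrow> g us (pwp b' R N n vs) = h us vs"
    by metis
  have "\<exists>k. lin R ?P L k \<and> (\<forall>us\<in>tuples M m. k (pwp b R M m us) = g us y)" if y: "y \<in> carrier ?Q" for y
  proof -
    have ml: "multilin R M m L (\<lambda>us. g us y)"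
    proof (rule multilinI)
      fix us i assume us: "us \<in> tuples M m" and i: "i < m"
      have "bilin R ?Q M L (\<lambda>y u. g (us[i := u]) y)"
      proof (rule bilin_family[OF Q M L pwp_image_sub[OF N order.refl] pw_span[OF N]])
        fix p assume "p \<in> pwp b' R N n ` tuples N n"
        then obtain vs where p: "p = pwp b' R N n vs" "vs \<in> tuples N n"
          by blast
        show "lin R M L (\<lambda>u. g (us[i := u]) p)"
          by (rule lin_cong[OF M multilin_lin[OF h1[OF p(2)] us i]]) (simp add: p gp tuples_update us)
      qed (intro g tuples_update us)
      from bilin_lin2[OF this y] show "lin R M L (\<lambda>u. g (us[i := u]) y)" .
    qed (rule lin_closed[OF g y])
    have sy: "symm_on M m (\<lambda>us. g us y)" if b
      unfolding symm_on_def
    proof (intro ballI allI impI)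
      fix us us' assume us: "us \<in> tuples M m" and eq: "mset us = mset us'"
      note us' = tuples_mset[OF us eq]
      show "g us y = g us' y"
      proof (rule pw_ext[OF N L g[OF us] g[OF us'] _ y])
        fix vs assume vs: "vs \<in> tuples N n"
        show "g us (pwp b' R N n vs) = g us' (pwp b' R N n vs)"
        proof -
          have "h us vs = h us' vs"
            using s1[OF that vs] us eq unfolding symm_on_def by blast
          then show ?thesis
            by (simp add: gp us us' vs)
        qed
      qed
    qed
    from pw_lift[OF M L ml sy] show ?thesis
      by metis
  qed
  then obtain k where k: "\<And>y. y \<in> carrier ?Q \<Longrightarrow> lin R ?P L (k y)"
    and kp: "\<And>y us. y \<in> carrier ?Q \<Longrightarrow> us \<in> tuples M m \<Longrightarrow> k y (pwp b R M m us) = g us y"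
    by metis
  have "bilin R ?P ?Q L (\<lambda>p y. k y p)"
  proof (rule bilin_family[OF P Q L pwp_image_sub[OF M order.refl] pw_span[OF M] k])
    fix p assume "p \<in> pwp b R M m ` tuples M m"
    then obtain us where p: "p = pwp b R M m us" "us \<in> tuples M m"
      by blast
    show "lin R ?Q L (\<lambda>y. k y p)"
      by (rule lin_cong[OF Q g[OF p(2)]]) (simp add: p kp)
  qed
  then show ?thesis
    by (intro exI[of _ "\<lambda>p y. k y p"]) (simp add: kp gp pwp_closed[OF N])
qed

text \<open>Covers permuting the entries as well as adjoining constant entries on either side:
  changing one entry before \<open>F\<close> changes exactly one entry after it.\<close>

lemma multilin_reindex:
  assumes M: "module R M" and h: "multilin R M m N h"
    and F: "\<And>us. us \<in> tuples M n \<Longrightarrow> F us \<in> tuples M m"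
    and Fu: "\<And>us i. us \<in> tuples M n \<Longrightarrow> i < n \<Longrightarrow> \<exists>j<m. \<forall>u\<in>carrier M. F (us[i := u]) = (F us)[j := u]"
  shows "multilin R M n N (\<lambda>us. h (F us))"
proof (rule multilinI)
  fix us i assume us: "us \<in> tuples M n" and i: "i < n"
  obtain j where j: "j < m" "\<And>u. u \<in> carrier M \<Longrightarrow> F (us[i := u]) = (F us)[j := u]"
    using Fu[OF us i] by blast
  show "lin R M N (\<lambda>u. h (F (us[i := u])))"
    by (rule lin_cong[OF M multilin_lin[OF h F[OF us] j(1)]]) (simp add: j)
qed (intro multilin_closed[OF h] F)

lemma multilin_append_left:
  assumes M: "module R M" and h: "multilin R M (m + n) N h" and us: "us \<in> tuples M m"
  shows "multilin R M n N (\<lambda>vs. h (us @ vs))"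
proof (rule multilin_reindex[OF M h])
  fix vs i assume "vs \<in> tuples M n" "i < n"
  then show "\<exists>j<m + n. \<forall>u\<in>carrier M. us @ vs[i := u] = (us @ vs)[j := u]"
    using tuples_length[OF us] by (intro exI[of _ "m + i"]) (simp add: list_update_append)
qed (rule tuples_append[OF us])

lemma multilin_append_right:
  assumes M: "module R M" and h: "multilin R M (m + n) N h" and vs: "vs \<in> tuples M n"
  shows "multilin R M m N (\<lambda>us. h (us @ vs))"
proof (rule multilin_reindex[OF M h])
  fix us i assume "us \<in> tuples M m" "i < m"
  then show "\<exists>j<m + n. \<forall>u\<in>carrier M. us[i := u] @ vs = (us @ vs)[j := u]"
    by (intro exI[of _ i]) (auto simp: list_update_append dest: tuples_length)
qed (rule tuples_append[OF _ vs])

text \<open>As \<open>permute_list f xs ! j = xs ! f j\<close>, the entry at \<open>i\<close>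
  reappears at the place that \<open>f\<close> sends to \<open>i\<close>.\<close>

lemma permute_list_update:
  assumes f: "f permutes {..<length xs}" and i: "i < length xs"
  shows "permute_list f (xs[i := u]) = (permute_list f xs)[Hilbert_Choice.inv f i := u]"
proof (rule nth_equalityI)
  fix j assume "j < length (permute_list f (xs[i := u]))"
  then have j: "j < length xs"
    by simp
  have fj: "f j < length xs"
    using permutes_in_image[OF f, of j] j by simp
  have "f j = i \<longleftrightarrow> j = Hilbert_Choice.inv f i"
    using permutes_inverses[OF f] by metis
  then show "permute_list f (xs[i := u]) ! j = (permute_list f xs)[Hilbert_Choice.inv f i := u] ! j"
    using f j fj i permutes_inv[OF f] permutes_in_image[OF permutes_inv[OF f], of i]
    by (auto simp: permute_list_nth nth_list_update)
qed simp

lemma permute_list_tuples: "f permutes {..<m} \<Longrightarrow> us \<in> tuples M m \<Longrightarrow> permute_list f us \<in> tuples M m"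
  by (auto simp: tuples_def)

lemma multilin_permute:
  assumes M: "module R M" and h: "multilin R M m N h" and f: "f permutes {..<m}"
  shows "multilin R M m N (\<lambda>us. h (permute_list f us))"
proof (rule multilin_reindex[OF M h])
  fix us i assume us: "us \<in> tuples M m" and i: "i < m"
  have "Hilbert_Choice.inv f i < m"
    using permutes_in_image[OF permutes_inv[OF f], of i] i by simp
  then show "\<exists>j<m. \<forall>u\<in>carrier M. permute_list f (us[i := u]) = (permute_list f us)[j := u]"
    using permute_list_update[of f us i] f i tuples_length[OF us] by auto
qed (rule permute_list_tuples[OF f])

lemma multilin_finsum:
  assumes M: "module R M" and N: "module R N" and A: "finite A" and h: "\<And>a. a \<in> A \<Longrightarrow> multilin R M m N (h a)"
  shows "multilin R M m N (\<lambda>us. \<Oplus>\<^bsub>N\<^esub>a\<in>A. h a us)"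
proof (rule multilinI)
  fix us i assume us: "us \<in> tuples M m" and i: "i < m"
  show "lin R M N (\<lambda>u. \<Oplus>\<^bsub>N\<^esub>a\<in>A. h a (us[i := u]))"
    by (rule lin_finsum_maps[OF M N A multilin_lin[OF h us i]])
next
  fix us assume "us \<in> tuples M m"
  then show "(\<Oplus>\<^bsub>N\<^esub>a\<in>A. h a us) \<in> carrier N"
    using multilin_closed[OF h] by (intro module_finsum_closed[OF N]) auto
qed

section \<open>Products, permutations and symmetrization of tensors\<close>

lemma pw_mult:
  assumes M: "module R M"
  shows "\<exists>f. bilin R (pw b R M m) (pw b R M n) (pw b R M (m + n)) f \<and>
    (\<forall>us\<in>tuples M m. \<forall>vs\<in>tuples M n. f (pwp b R M m us) (pwp b R M n vs) = pwp b R M (m + n) (us @ vs))"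
proof (rule pw_pw_bilin[OF M M pw_module[OF M]])
  show "symm_on M m (\<lambda>us. pwp b R M (m + n) (us @ vs))" if b and vs: "vs \<in> tuples M n" for vs
    using that pwp_symm[OF M, of "m + n"] unfolding symm_on_def by (auto simp: tuples_append)
  show "symm_on M n (\<lambda>vs. pwp b R M (m + n) (us @ vs))" if b and us: "us \<in> tuples M m" for us
    using that pwp_symm[OF M, of "m + n"] unfolding symm_on_def by (auto simp: tuples_append)
qed (rule multilin_append_right[OF M pwp_multilin[OF M]] multilin_append_left[OF M pwp_multilin[OF M]]; assumption)+

lemma pw_permute:
  assumes M: "module R M" and f: "f permutes {..<m}"
  shows "\<exists>g. lin R (pw False R M m) (pw False R M m) g \<and>
    (\<forall>us\<in>tuples M m. g (pwp False R M m us) = pwp False R M m (permute_list f us))"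
  using pw_lift[OF M pw_module[OF M] multilin_permute[OF M pwp_multilin[OF M] f], of False] by metis

text \<open>The symmetrization of the word \<open>us\<close>, without division by m!, multiplied on
  the right by the word \<open>vs\<close>.\<close>

definition sym_sum where
  "sym_sum R M m n us vs =
     (\<Oplus>\<^bsub>pw False R M (m + n)\<^esub>f\<in>{f. f permutes {..<m}}. pwp False R M (m + n) (permute_list f us @ vs))"

text \<open>Rearranging \<open>us\<close> by \<open>g\<close> replaces each permutation
  \<open>f\<close> by the composite of \<open>g\<close> and \<open>f\<close>, which only reorders
  the sum over the symmetric group.\<close>

lemma symm_on_sym_sum:
  assumes M: "module R M" and vs: "vs \<in> tuples M n"
  shows "symm_on M m (\<lambda>us. sym_sum R M m n us vs)"
  unfolding symm_on_def
proof (intro ballI allI impI)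
  fix us us' assume us: "us \<in> tuples M m" and eq: "mset us = mset us'"
  let ?A = "{f. f permutes {..<m}}"
  note us' = tuples_mset[OF us eq]
  interpret L: abelian_monoid "pw False R M (m + n)"
    by (rule module_abelian_monoid[OF pw_module[OF M]])
  obtain g where g: "g permutes {..<length us'}" "permute_list g us' = us"
    using mset_eq_permutation[OF eq] by blast
  then have g': "g permutes {..<m}"
    using tuples_length[OF us'] by simp
  have cl: "(\<lambda>f. pwp False R M (m + n) (permute_list f us' @ vs)) \<in> ?A \<rightarrow> carrier (pw False R M (m + n))"
    by (auto intro!: pwp_closed[OF M] tuples_append permute_list_tuples us' vs)
  have bij: "(\<lambda>f. g \<circ> f) ` ?A = ?A"
  proof
    show "(\<lambda>f. g \<circ> f) ` ?A \<subseteq> ?A"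
      using g' by (auto intro: permutes_compose)
    show "?A \<subseteq> (\<lambda>f. g \<circ> f) ` ?A"
    proof
      fix f assume "f \<in> ?A"
      then have "Hilbert_Choice.inv g \<circ> f \<in> ?A"
        using g' by (auto intro!: permutes_compose permutes_inv)
      moreover have "f = g \<circ> (Hilbert_Choice.inv g \<circ> f)"
        using permutes_inv_o(1)[OF g'] by (simp add: comp_assoc[symmetric])
      ultimately show "f \<in> (\<lambda>f. g \<circ> f) ` ?A"
        by blast
    qed
  qed
  have inj: "inj_on (\<lambda>f. g \<circ> f) ?A"
    using permutes_inj[OF g'] by (auto simp: inj_on_def fun_eq_iff dest: injD)
  have "sym_sum R M m n us' vs =
      (\<Oplus>\<^bsub>pw False R M (m + n)\<^esub>f\<in>?A. pwp False R M (m + n) (permute_list (g \<circ> f) us' @ vs))"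
    unfolding sym_sum_def
    using L.finsum_reindex[of "\<lambda>f. pwp False R M (m + n) (permute_list f us' @ vs)" "\<lambda>f. g \<circ> f" ?A] cl bij inj
    by simp
  also have "\<dots> = sym_sum R M m n us vs"
    unfolding sym_sum_def
  proof (rule L.finsum_cong')
    fix f assume "f \<in> ?A"
    then show "pwp False R M (m + n) (permute_list (g \<circ> f) us' @ vs) = pwp False R M (m + n) (permute_list f us @ vs)"
      using permute_list_compose[of f us' g] g tuples_length[OF us'] by simp
  qed (auto intro!: pwp_closed[OF M] tuples_append permute_list_tuples us vs)
  finally show "sym_sum R M m n us vs = sym_sum R M m n us' vs"
    by simp
qed

text \<open>The left factor enters symmetrically and may therefore be taken from the symmetric
  power. Elements of S^m, in particular germs of its sections, thus act as multipliers on tensor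
  powers.\<close>

lemma pw_sym_mult:
  assumes M: "module R M"
  shows "\<exists>f. bilin R (pw True R M m) (pw False R M n) (pw False R M (m + n)) f \<and>
    (\<forall>us\<in>tuples M m. \<forall>vs\<in>tuples M n. f (pwp True R M m us) (pwp False R M n vs) = sym_sum R M m n us vs)"
proof (rule pw_pw_bilin[OF M M pw_module[OF M]])
  have fin: "finite {f. f permutes {..<m}}"
    by (rule finite_permutations) simp
  show "multilin R M m (pw False R M (m + n)) (\<lambda>us. sym_sum R M m n us vs)" if vs: "vs \<in> tuples M n" for vs
    unfolding sym_sum_def
    by (intro multilin_finsum M pw_module fin multilin_permute[OF M multilin_append_right[OF M pwp_multilin[OF M] vs]]) simp
  show "multilin R M n (pw False R M (m + n)) (sym_sum R M m n us)" if us: "us \<in> tuples M m" for us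
    unfolding sym_sum_def[abs_def]
    by (intro multilin_finsum M pw_module fin multilin_append_left[OF M pwp_multilin[OF M] permute_list_tuples[OF _ us]]) simp
qed (simp_all add: symm_on_sym_sum M)

section \<open>Maps between iterated powers\<close>

definition is_mult where
  "is_mult b R M mul \<longleftrightarrow> (\<forall>m n. bilin R (pw b R M m) (pw b R M n) (pw b R M (m + n)) (mul m n) \<and>
    (\<forall>us\<in>tuples M m. \<forall>vs\<in>tuples M n. mul m n (pwp b R M m us) (pwp b R M n vs) = pwp b R M (m + n) (us @ vs)))"

lemma is_mult_bilin: "is_mult b R M mul \<Longrightarrow> bilin R (pw b R M m) (pw b R M n) (pw b R M (m + n)) (mul m n)"
  and is_mult_pure: "is_mult b R M mul \<Longrightarrow> us \<in> tuples M m \<Longrightarrow> vs \<in> tuples M n \<Longrightarrow>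
    mul m n (pwp b R M m us) (pwp b R M n vs) = pwp b R M (m + n) (us @ vs)"
  by (auto simp: is_mult_def)

lemma ex_is_mult: "module R M \<Longrightarrow> \<exists>mul. is_mult b R M mul"
  using pw_mult[of R M b] unfolding is_mult_def by metis

text \<open>A product nested to the right. The degrees are explicit because \<open>mul\<close> is a
  family indexed by them; \<open>e\<close> is the empty product, of degree 0.\<close>

primrec mult_list where
  "mult_list mul d e w [] = e"
| "mult_list mul d e w (v # vs) = mul w (length vs * w) (d v) (mult_list mul d e w vs)"

context
  fixes b :: bool and R :: "('r, 'x) ring_scheme" and M :: "('r, 'm, 'y) module_scheme" and V :: "('r, 'v, 'z) module_scheme"
    and d and w :: nat and mul
  assumes M: "module R M" and V: "module R V" and d: "lin R V (pw b R M w) d" and mul: "is_mult b R M mul"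
begin

abbreviation (input) "mlist \<equiv> mult_list mul d (pwp b R M 0 []) w"

lemma mult_list_closed: "vs \<in> tuples V q \<Longrightarrow> mlist vs \<in> carrier (pw b R M (q * w))"
proof (induction vs arbitrary: q)
  case Nil
  then show ?case
    using pwp_closed[OF M, of "[]" 0] by (auto simp: tuples_def)
next
  case (Cons v vs)
  then obtain p where p: "q = Suc p" "vs \<in> tuples V p" "v \<in> carrier V" "length vs = p"
    by (auto simp: tuples_def)
  show ?case
    using bilin_closed[OF is_mult_bilin[OF mul] lin_closed[OF d p(3)] Cons.IH[OF p(2)]] p by simp
qed

lemma mult_list_multilin: "multilin R V q (pw b R M (q * w)) mlist"
proof (rule multilinI)
  fix vs i assume "vs \<in> tuples V q" "i < q"
  then show "lin R V (pw b R M (q * w)) (\<lambda>v. mlist (vs[i := v]))"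
  proof (induction vs arbitrary: q i)
    case Nil
    then show ?case
      by (simp add: tuples_def)
  next
    case (Cons x vs)
    then obtain p where p: "q = Suc p" "vs \<in> tuples V p" "x \<in> carrier V" "length vs = p"
      by (auto simp: tuples_def)
    show ?case
    proof (cases i)
      case 0
      then show ?thesis
        using lin_comp[OF d bilin_lin1[OF is_mult_bilin[OF mul] mult_list_closed[OF p(2)]]] p by simp
    next
      case (Suc j)
      then have j: "j < p"
        using Cons.prems p by simp
      show ?thesis
        using lin_comp[OF Cons.IH[OF p(2) j] bilin_lin2[OF is_mult_bilin[OF mul] lin_closed[OF d p(3)]]] p Suc
        by simp
    qed
  qed
qed (rule mult_list_closed)

text \<open>For classes of tuples both sides are concatenations with the same multiset of entries.
  The identity extends by linearity in one factor after the other, the last factor first.\<close>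

lemma mult_left_commute:
  assumes b "p \<in> carrier (pw b R M m)" "p' \<in> carrier (pw b R M m')" "z \<in> carrier (pw b R M n)"
  shows "mul m (m' + n) p (mul m' n p' z) = mul m' (m + n) p' (mul m n p z)"
proof -
  note mb = is_mult_bilin[OF mul] and P = pwp_closed[OF M]
  \<comment> \<open>The degree is an argument of \<open>pw\<close>, so the two sides lie in the same
    module only after this rewriting.\<close>
  have t: "m' + (m + n) = m + (m' + n)"
    by simp
  note [simp] = is_mult_pure[OF mul] tuples_append
  have mb': "bilin R (pw b R M m') (pw b R M (m + n)) (pw b R M (m + (m' + n))) (mul m' (m + n))"
    using mb[of m' "m + n"] unfolding t .
  have 1: "mul m (m' + n) (pwp b R M m us) (mul m' n (pwp b R M m' us') z) =
      mul m' (m + n) (pwp b R M m' us') (mul m n (pwp b R M m us) z)"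
    if us: "us \<in> tuples M m" and us': "us' \<in> tuples M m'" for us us'
  proof (rule pw_ext[OF M pw_module[OF M, of b "m + (m' + n)"] _ _ _ assms(4)])
    show "lin R (pw b R M n) (pw b R M (m + (m' + n))) (\<lambda>z. mul m (m' + n) (pwp b R M m us) (mul m' n (pwp b R M m' us') z))"
      by (rule lin_comp[OF bilin_lin2[OF mb P[OF us']] bilin_lin2[OF mb P[OF us]]])
    show "lin R (pw b R M n) (pw b R M (m + (m' + n))) (\<lambda>z. mul m' (m + n) (pwp b R M m' us') (mul m n (pwp b R M m us) z))"
      by (rule lin_comp[OF bilin_lin2[OF mb P[OF us]] bilin_lin2[OF mb' P[OF us']]])
    fix vs assume vs: "vs \<in> tuples M n"
    have "pwp b R M (m + (m' + n)) (us @ us' @ vs) = pwp b R M (m + (m' + n)) (us' @ us @ vs)"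
      using pwp_symm[OF M, of "m + (m' + n)"] assms(1) us us' vs unfolding symm_on_def by simp
    then show "mul m (m' + n) (pwp b R M m us) (mul m' n (pwp b R M m' us') (pwp b R M n vs)) =
        mul m' (m + n) (pwp b R M m' us') (mul m n (pwp b R M m us) (pwp b R M n vs))"
      using us us' vs by (simp add: t)
  qed
  have 2: "mul m (m' + n) (pwp b R M m us) (mul m' n p' z) = mul m' (m + n) p' (mul m n (pwp b R M m us) z)"
    if us: "us \<in> tuples M m" for us
    by (rule pw_ext[OF M pw_module[OF M, of b "m + (m' + n)"] _ _ _ assms(3)])
      (intro lin_comp[OF bilin_lin1[OF mb assms(4)] bilin_lin2[OF mb P[OF us]]]
        bilin_lin1[OF mb' bilin_closed[OF mb P[OF us] assms(4)]] 1[OF us])+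
  show ?thesis
    by (rule pw_ext[OF M pw_module[OF M, of b "m + (m' + n)"] _ _ _ assms(2)])
      (intro lin_comp[OF bilin_lin1[OF mb assms(4)] bilin_lin2[OF mb' assms(3)]]
        bilin_lin1[OF mb bilin_closed[OF mb assms(3,4)]] 2)+
qed

text \<open>Left commutativity lets any entry be moved to the front of the product. Two lists with
  the same multiset are then compared by induction on the first, bringing its head to the front of
  the second.\<close>

lemma mult_list_symm:
  assumes b
  shows "symm_on V q mlist"
proof -
  have move: "mlist (xs @ v # ys) = mlist (v # xs @ ys)" if "set (xs @ v # ys) \<subseteq> carrier V" for xs v ys
    using that
  proof (induction xs)
    case (Cons x xs)
    have x: "x \<in> carrier V" and v: "v \<in> carrier V" and xy: "xs @ ys \<in> tuples V (length (xs @ ys))"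
      using Cons.prems by (auto simp: tuples_def)
    have "mlist ((x # xs) @ v # ys) = mul w (w + length (xs @ ys) * w) (d x) (mul w (length (xs @ ys) * w) (d v) (mlist (xs @ ys)))"
      using Cons by simp
    also have "\<dots> = mul w (w + length (xs @ ys) * w) (d v) (mul w (length (xs @ ys) * w) (d x) (mlist (xs @ ys)))"
      by (rule mult_left_commute[OF assms lin_closed[OF d x] lin_closed[OF d v] mult_list_closed[OF xy]])
    finally show ?case
      by simp
  qed simp
  have "mlist us = mlist vs" if "set us \<subseteq> carrier V" "mset us = mset vs" for us vs
    using that
  proof (induction us arbitrary: vs)
    case (Cons u us)
    have "u \<in> set vs"
      using Cons.prems(2) by (metis list.set_intros(1) set_mset_mset)
    then obtain xs ys where vs: "vs = xs @ u # ys"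
      by (meson split_list)
    have "mset us = mset (xs @ ys)"
      using Cons.prems(2) vs by simp
    then have "mlist us = mlist (xs @ ys)" "length us = length (xs @ ys)"
      using Cons mset_eq_length[of us "xs @ ys"] by auto
    moreover have "set vs \<subseteq> carrier V"
      using Cons.prems mset_eq_setD by blast
    ultimately show ?case
      using move[of xs u ys] vs by simp
  qed simp
  then show ?thesis
    by (simp add: symm_on_def tuples_def)
qed

text \<open>A word of length \<open>q * w\<close> is cut after every \<open>w\<close> letters; each
  block has a preimage under \<open>d\<close>.\<close>

lemma mult_list_surj:
  assumes "d ` carrier V = carrier (pw b R M w)" "us \<in> tuples M (q * w)"
  shows "\<exists>vs\<in>tuples V q. mlist vs = pwp b R M (q * w) us"
  using assms(2)
proof (induction q arbitrary: us)
  case 0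
  then show ?case
    by (auto simp: tuples_def)
next
  case (Suc q)
  define us1 us2 where "us1 = take w us" and "us2 = drop w us"
  have us: "us = us1 @ us2" "us1 \<in> tuples M w" "us2 \<in> tuples M (q * w)"
    using Suc.prems by (auto simp: us1_def us2_def tuples_def dest: in_set_takeD in_set_dropD)
  obtain vs where vs: "vs \<in> tuples V q" "mlist vs = pwp b R M (q * w) us2"
    using Suc.IH[OF us(3)] by blast
  have "pwp b R M w us1 \<in> d ` carrier V"
    unfolding assms(1) by (rule pwp_closed[OF M us(2)])
  then obtain v where v: "v \<in> carrier V" "d v = pwp b R M w us1"
    by auto
  show ?case
    using vs v us is_mult_pure[OF mul us(2,3)] tuples_length[OF vs(1)]
    by (intro bexI[of _ "v # vs"]) (auto simp: tuples_def)
qed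

end

section \<open>Cutting a word into blocks of equal length\<close>

definition chunks where
  "chunks w q us = map (\<lambda>j. take w (drop (j * w) us)) [0..<q]"

lemma chunks_map: "chunks w q (map f us) = map (map f) (chunks w q us)"
  by (simp add: chunks_def take_map drop_map)

lemma set_chunks: "c \<in> set (chunks w q us) \<Longrightarrow> set c \<subseteq> set us"
  by (auto simp: chunks_def dest!: in_set_takeD in_set_dropD)

lemma chunks_length: "c \<in> set (chunks w q us) \<Longrightarrow> length us = q * w \<Longrightarrow> length c = w"
proof -
  assume "c \<in> set (chunks w q us)" and l: "length us = q * w"
  then obtain j where j: "j < q" "c = take w (drop (j * w) us)"
    by (auto simp: chunks_def)
  have "Suc j * w \<le> q * w"
    using j by (intro mult_le_mono1) simp
  then show "length c = w"
    using j l by simp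
qed

lemma chunks_tuples: "us \<in> tuples M (q * w) \<Longrightarrow> c \<in> set (chunks w q us) \<Longrightarrow> c \<in> tuples M w"
  using set_chunks[of c w q us] chunks_length[of c w q us] by (auto simp: tuples_def)

lemma chunks_concat: "(\<And>c. c \<in> set cs \<Longrightarrow> length c = w) \<Longrightarrow> chunks w (length cs) (concat cs) = cs"
proof (induction cs)
  case Nil
  then show ?case
    by (simp add: chunks_def)
next
  case (Cons c cs)
  have "chunks w (Suc (length cs)) (c @ concat cs) = c # chunks w (length cs) (concat cs)"
    using Cons.prems by (simp add: chunks_def upt_conv_Cons map_Suc_upt[symmetric] del: upt_Suc map_Suc_upt)
  then show ?case
    using Cons by simp
qed

text \<open>An entry influences one block only, at one place in it. This is what makes blockwise
  maps multilinear in the letters.\<close>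

lemma chunks_update:
  assumes l: "length us = q * w" and i: "i < q * w"
  shows "chunks w q (us[i := x]) = (chunks w q us)[i div w := (chunks w q us ! (i div w))[i mod w := x]]"
proof -
  have w: "w > 0"
    using i by (cases w) auto
  have iq: "i div w < q"
    using i by (simp add: less_mult_imp_div_less)
  show ?thesis
  proof (rule nth_equalityI)
    fix j assume "j < length (chunks w q (us[i := x]))"
    then have j: "j < q"
      by (simp add: chunks_def)
    have jw: "Suc j * w \<le> q * w"
      using j by (intro mult_le_mono1) simp
    have jl: "j * w \<le> length us"
      using j l by simp
    have "take w (drop (j * w) (us[i := x])) =
        (if j = i div w then (take w (drop (j * w) us))[i mod w := x] else take w (drop (j * w) us))"
    proof (rule nth_equalityI)
      fix k assume "k < length (take w (drop (j * w) (us[i := x])))"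
      then have k: "k < w" "j * w + k < length us"
        by auto
      \<comment> \<open>Uniqueness of division with remainder, as \<open>k < w\<close>.\<close>
      have e: "j * w + k = i \<longleftrightarrow> j = i div w \<and> k = i mod w"
        using k(1) div_mult_mod_eq[of i w] by auto
      show "take w (drop (j * w) (us[i := x])) ! k =
        (if j = i div w then (take w (drop (j * w) us))[i mod w := x] else take w (drop (j * w) us)) ! k"
      proof (cases "j * w + k = i")
        case True
        have "length (take w (drop (j * w) us)) = w"
          using jw l by simp
        then show ?thesis
          using True e k(1) i l jl nth_list_update_eq[of k "take w (drop (j * w) us)" x] by simp
      next
        case False
        then have "j \<noteq> i div w \<or> k \<noteq> i mod w"
          using e by blast
        then show ?thesis
          using False k i l jl by auto
      qed
    qed simp
    then show "chunks w q (us[i := x]) ! j = (chunks w q us)[i div w := (chunks w q us ! (i div w))[i mod w := x]] ! j"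
      using j iq by (auto simp: chunks_def nth_list_update)
  qed (simp add: chunks_def)
qed

context
  fixes b :: bool and R :: "('r, 'x) ring_scheme" and M :: "('r, 'm, 'y) module_scheme" and V :: "('r, 'v, 'z) module_scheme"
    and u and w :: nat
  assumes M: "module R M" and V: "module R V" and u: "lin R (pw False R M w) V u"
begin

lemma chunk_map_tuples: "us \<in> tuples M (q * w) \<Longrightarrow> map (\<lambda>c. u (pwp False R M w c)) (chunks w q us) \<in> tuples V q"
  using chunks_tuples[of us M q w] lin_closed[OF u pwp_closed[OF M]]
  by (auto simp: tuples_def[of V] chunks_def[of w q us])

text \<open>In a single letter, the map is a composite of three linear ones: the letter inside its
  block, then \<open>u\<close>, then the block inside the power of \<open>V\<close>.\<close>

lemma chunk_multilin:
  "multilin R M (q * w) (pw b R V q) (\<lambda>us. pwp b R V q (map (\<lambda>c. u (pwp False R M w c)) (chunks w q us)))"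
proof (rule multilinI)
  fix us i assume us: "us \<in> tuples M (q * w)" and i: "i < q * w"
  define vs where "vs = map (\<lambda>c. u (pwp False R M w c)) (chunks w q us)"
  define c where "c = chunks w q us ! (i div w)"
  have w: "w > 0"
    using i by (cases w) auto
  have iq: "i div w < q"
    using i by (simp add: less_mult_imp_div_less)
  have "c \<in> set (chunks w q us)"
    unfolding c_def by (rule nth_mem) (simp add: chunks_def iq)
  then have c: "c \<in> tuples M w"
    by (rule chunks_tuples[OF us])
  have vs: "vs \<in> tuples V q"
    unfolding vs_def by (rule chunk_map_tuples[OF us])
  have "lin R M (pw b R V q) (\<lambda>x. pwp b R V q (vs[i div w := u (pwp False R M w (c[i mod w := x]))]))"
    using w by (intro lin_comp[OF lin_comp[OF multilin_lin[OF pwp_multilin[OF M] c] u] multilin_lin[OF pwp_multilin[OF V] vs iq]]) simp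
  then show "lin R M (pw b R V q) (\<lambda>x. pwp b R V q (map (\<lambda>c. u (pwp False R M w c)) (chunks w q (us[i := x]))))"
    using chunks_update[OF tuples_length[OF us] i] by (simp add: vs_def c_def map_update)
qed (intro pwp_closed[OF V] chunk_map_tuples)

lemma chunk_map_lift:
  "\<exists>f. lin R (pw False R M (q * w)) (pw b R V q) f \<and> (\<forall>us\<in>tuples M (q * w).
    f (pwp False R M (q * w) us) = pwp b R V q (map (\<lambda>c. u (pwp False R M w c)) (chunks w q us)))"
  using pw_lift[OF M pw_module[OF V] chunk_multilin, of False] by metis

text \<open>The elements \<open>u\<close> of pure tensors generate \<open>V\<close>, so words in
  them generate the power; such a word is the image of the concatenation of the chosen
  blocks.\<close>

lemma chunk_map_surj:
  assumes f: "lin R (pw False R M (q * w)) (pw b R V q) f"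
    and fp: "\<And>us. us \<in> tuples M (q * w) \<Longrightarrow>
      f (pwp False R M (q * w) us) = pwp b R V q (map (\<lambda>c. u (pwp False R M w c)) (chunks w q us))"
    and s: "u ` carrier (pw False R M w) = carrier V"
  shows "f ` carrier (pw False R M (q * w)) = carrier (pw b R V q)"
proof -
  let ?S = "u ` pwp False R M w ` tuples M w"
  have S: "?S \<subseteq> carrier V"
    by (auto intro!: lin_closed[OF u] pwp_closed[OF M])
  have "carrier V \<subseteq> mspan R V ?S"
  proof
    fix v assume "v \<in> carrier V"
    then obtain p where p: "p \<in> carrier (pw False R M w)" "v = u p"
      using s by auto
    have "u p \<in> mspan R V ?S"
      by (rule pw_sub[OF M V u mspan_submodule[OF V S] _ p(1)]) (auto intro: subsetD[OF mspan_incl])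
    then show "v \<in> mspan R V ?S"
      using p by simp
  qed
  note span = pw_span_set[OF V S mspan_eqI[OF V S this], of b q]
  show ?thesis
  proof (rule lin_surj_mspan[OF pw_module[OF M] pw_module[OF V] f _ span], rule image_subsetI)
    fix vs assume "vs \<in> {us. length us = q \<and> set us \<subseteq> ?S}"
    then have vs: "length vs = q" "\<forall>v\<in>set vs. \<exists>c. c \<in> tuples M w \<and> v = u (pwp False R M w c)"
      by auto
    then obtain g where g: "\<forall>v\<in>set vs. g v \<in> tuples M w \<and> v = u (pwp False R M w (g v))"
      by metis
    let ?us = "concat (map g vs)"
    have len: "length c = w" if "c \<in> set (map g vs)" for c
      using that g by (auto simp: tuples_def)
    have ch: "chunks w q ?us = map g vs"
      using chunks_concat[of "map g vs" w] len vs by simp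
    have "map length (map g vs) = replicate q w"
      using len vs by (intro replicate_eqI) auto
    then have "length ?us = q * w"
      by (simp add: length_concat sum_list_replicate)
    moreover have "set ?us \<subseteq> carrier M"
      using g by (auto simp: tuples_def)
    ultimately have us: "?us \<in> tuples M (q * w)"
      by (simp add: tuples_def)
    have "map (\<lambda>c. u (pwp False R M w c)) (chunks w q ?us) = vs"
      unfolding ch using g by (simp add: map_idI comp_def)
    then have "f (pwp False R M (q * w) ?us) = pwp b R V q vs"
      using fp[OF us] by simp
    then show "pwp b R V q vs \<in> f ` carrier (pw False R M (q * w))"
      using pwp_closed[OF M us, of False] by (metis imageI)
  qed
qed

end

section \<open>Powers of degree one and the projection from tensor to symmetric powers\<close>

context
  fixes R :: "('r, 'x) ring_scheme" and M :: "('r, 'm, 'y) module_scheme"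
  assumes M: "module R M"
begin

lemma tuples_1: "us \<in> tuples M (Suc 0) \<longleftrightarrow> (\<exists>u\<in>carrier M. us = [u])"
  by (auto simp: tuples_def length_Suc_conv)

lemma pw_one_lift: "\<exists>f. lin R (pw False R M 1) M f \<and> (\<forall>us\<in>tuples M 1. f (pwp False R M 1 us) = hd us)"
proof -
  have "multilin R M 1 M hd"
    by (rule multilinI) (auto simp: tuples_1 lin_id)
  from pw_lift[OF M M this, of False] show ?thesis
    by metis
qed

lemma pw_one_lin: "lin R M (pw b R M 1) (\<lambda>u. pwp b R M 1 [u])"
  using multilin_lin[OF pwp_multilin[OF M], of "[\<zero>\<^bsub>M\<^esub>]" 1 0 b] module_facts(1)[OF M] by (simp add: tuples_1)

lemma pw_one_surj: "(\<lambda>u. pwp b R M 1 [u]) ` carrier M = carrier (pw b R M 1)"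
  by (rule lin_surj_mspan[OF M pw_module[OF M] pw_one_lin _ pw_span[OF M]]) (auto simp: tuples_1)

lemma pw_quot_lift: "\<exists>f. lin R (pw False R M m) (pw True R M m) f \<and>
    (\<forall>us\<in>tuples M m. f (pwp False R M m us) = pwp True R M m us)"
  using pw_lift[OF M pw_module[OF M] pwp_multilin[OF M], of False m True] by metis

end

section \<open>Tensor powers and products of symmetric tensors\<close>

lemma finsum_const_smult:
  assumes M: "module R M" and A: "finite A" and t: "t \<in> carrier M"
  shows "(\<Oplus>\<^bsub>M\<^esub>a\<in>A. t) = (add_pow R (card A) \<one>\<^bsub>R\<^esub>) \<odot>\<^bsub>M\<^esub> t"
  using A
proof (induction A)
  case empty
  interpret R: abelian_monoid R
    by (rule abelian_group.axioms(1)[OF cring_abelian_group[OF module_cring[OF M]]])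
  show ?case
    by (simp add: module_finsum_empty[OF M] module_facts[OF M] t)
next
  case (insert a A)
  interpret R: abelian_monoid R
    by (rule abelian_group.axioms(1)[OF cring_abelian_group[OF module_cring[OF M]]])
  have "(\<Oplus>\<^bsub>M\<^esub>a\<in>insert a A. t) = t \<oplus>\<^bsub>M\<^esub> (\<Oplus>\<^bsub>M\<^esub>a\<in>A. t)"
    using insert t by (intro module_finsum_insert[OF M]) auto
  also have "\<dots> = (\<one>\<^bsub>R\<^esub> \<oplus>\<^bsub>R\<^esub> add_pow R (card A) \<one>\<^bsub>R\<^esub>) \<odot>\<^bsub>M\<^esub> t"
    using insert t cring_facts[OF module_cring[OF M]] R.add.nat_pow_closed
    by (simp add: module_facts[OF M])
  also have "\<one>\<^bsub>R\<^esub> \<oplus>\<^bsub>R\<^esub> add_pow R (card A) \<one>\<^bsub>R\<^esub> = add_pow R (card (insert a A)) \<one>\<^bsub>R\<^esub>"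
    using insert cring_facts[OF module_cring[OF M]] by (simp add: R.a_comm)
  finally show ?case .
qed

lemma unit_smult_cancel:
  assumes M: "module R M" and H: "submodule H R M" and c: "c \<in> Units R" and t: "t \<in> carrier M" "c \<odot>\<^bsub>M\<^esub> t \<in> H"
  shows "t \<in> H"
proof -
  obtain c' where c': "c' \<in> carrier R" "c' \<otimes>\<^bsub>R\<^esub> c = \<one>\<^bsub>R\<^esub>" "c \<in> carrier R"
    using c by (auto simp: Units_def)
  have "c' \<odot>\<^bsub>M\<^esub> (c \<odot>\<^bsub>M\<^esub> t) \<in> H"
    by (rule submod_smult[OF H c'(1) t(2)])
  then show ?thesis
    using c' t by (simp add: module.smult_assoc1[OF M, symmetric] module_facts[OF M])
qed

text \<open>The algebraic core, separated from sheaves. \<open>W k\<close> stands for the elements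
  of the tensor power of degree \<open>k * N\<close> that products of sections have generated at the
  point. The hypotheses record what is available: the empty tensor, all permutations of the factors,
  and multiplication by the symmetrization of any word of length \<open>N\<close>.\<close>

context
  fixes R :: "('r, 'x) ring_scheme" and M :: "('r, 'm, 'y) module_scheme" and N :: nat
    and W :: "nat \<Rightarrow> ('m list \<Rightarrow> 'r) set set"
  assumes M: "module R M" and N: "N \<ge> 1"
    and char0: "\<And>n::nat. n \<ge> 1 \<Longrightarrow> add_pow R n \<one>\<^bsub>R\<^esub> \<in> Units R"
    and W: "\<And>k. submodule (W k) R (pw False R M (k * N))"
    and W_0: "pwp False R M 0 [] \<in> W 0"
    and W_perm: "\<And>k f g t. f permutes {..<k * N} \<Longrightarrow> lin R (pw False R M (k * N)) (pw False R M (k * N)) g \<Longrightarrow>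
      (\<And>us. us \<in> tuples M (k * N) \<Longrightarrow> g (pwp False R M (k * N) us) = pwp False R M (k * N) (permute_list f us)) \<Longrightarrow>
      t \<in> W k \<Longrightarrow> g t \<in> W k"
    and W_sym: "\<And>k us vs. us \<in> tuples M N \<Longrightarrow> vs \<in> tuples M (k * N) \<Longrightarrow> pwp False R M (k * N) vs \<in> W k \<Longrightarrow>
      sym_sum R M N (k * N) us vs \<in> W (Suc k)"
begin

abbreviation (input) "TkN k \<equiv> pw False R M (k * N)"
abbreviation (input) "PkN k \<equiv> pwp False R M (k * N)"

text \<open>Invariance under permutations means that membership of a word depends only on the
  multiset of its letters. Words may from now on be rearranged freely.\<close>

lemma W_mset:
  assumes us: "us \<in> tuples M (k * N)" "PkN k us \<in> W k" and eq: "mset us = mset vs"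
  shows "PkN k vs \<in> W k"
proof -
  obtain f where f: "f permutes {..<length us}" "permute_list f us = vs"
    using mset_eq_permutation[OF eq[symmetric]] by blast
  then have f': "f permutes {..<k * N}"
    using tuples_length[OF us(1)] by simp
  obtain g where g: "lin R (TkN k) (TkN k) g" "\<forall>us\<in>tuples M (k * N). g (PkN k us) = PkN k (permute_list f us)"
    using pw_permute[OF M f'] by blast
  have "g (PkN k us) \<in> W k"
    using W_perm[OF f' g(1) _ us(2)] g(2) by blast
  then show ?thesis
    using g(2) us f by simp
qed

text \<open>The symmetrization of a constant word of length \<open>N\<close> is N! times the word,
  and N! is a unit.\<close>

lemma W_block:
  assumes e: "e \<in> carrier M" and vs: "vs \<in> tuples M (k * N)" "PkN k vs \<in> W k"
  shows "PkN (Suc k) (replicate N e @ vs) \<in> W (Suc k)"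
proof -
  let ?A = "{f. f permutes {..<N}}"
  have A: "finite ?A" "card ?A \<ge> 1"
    using card_permutations[of "{..<N}" N] fact_ge_1[of N] by (auto simp: finite_permutations)
  have t: "replicate N e \<in> tuples M N" "replicate N e @ vs \<in> tuples M (Suc k * N)"
    using e vs by (auto simp: tuples_def)
  have p: "permute_list f (replicate N e) = replicate N e" if "f \<in> ?A" for f
    using that by (intro replicate_eqI) auto
  have "sym_sum R M N (k * N) (replicate N e) vs = (\<Oplus>\<^bsub>TkN (Suc k)\<^esub>f\<in>?A. PkN (Suc k) (replicate N e @ vs))"
    unfolding sym_sum_def mult_Suc
    by (rule abelian_monoid.finsum_cong'[OF module_abelian_monoid[OF pw_module[OF M]]])
      (use p pwp_closed[OF M t(2)] in auto)
  also have "\<dots> = add_pow R (card ?A) \<one>\<^bsub>R\<^esub> \<odot>\<^bsub>TkN (Suc k)\<^esub> PkN (Suc k) (replicate N e @ vs)"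
    by (rule finsum_const_smult[OF pw_module[OF M] A(1) pwp_closed[OF M t(2)]])
  finally show ?thesis
    using W_sym[OF t(1) vs] unit_smult_cancel[OF pw_module[OF M] W char0[OF A(2)] pwp_closed[OF M t(2)]] by simp
qed

text \<open>For \<open>j \<le> N\<close> these are the tensors of the overview: \<open>N + 1\<close>
  letters \<open>e\<close>, one of them replaced by \<open>z\<close>, in front of
  \<open>rest\<close>.\<close>

definition shifted where "shifted e z rest j = map (\<lambda>p. if p = j then z else e) [0..<Suc N] @ rest"

lemma shifted_nth:
  "p < Suc N + length rest \<Longrightarrow>
    shifted e z rest j ! p = (if p = j \<and> p \<le> N then z else if p \<le> N then e else rest ! (p - Suc N))"
  by (auto simp: shifted_def nth_append simp del: upt_Suc)

lemma shifted_length: "length (shifted e z rest j) = Suc N + length rest"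
  by (simp add: shifted_def)

text \<open>Composition with a transposition exchanges the two sets. It shows that every position
  receives the letter \<open>z\<close> equally often in a symmetrization.\<close>

lemma card_permutes_at:
  assumes "a \<in> S" "b \<in> S" "c \<in> S"
  shows "card {f. f permutes S \<and> f b = a} = card {f. f permutes S \<and> f c = a}"
proof (rule bij_betw_same_card)
  let ?t = "Transposition.transpose b c"
  have t: "?t permutes S"
    using assms by (intro permutes_swap_id)
  show "bij_betw (\<lambda>f. f \<circ> ?t) {f. f permutes S \<and> f b = a} {f. f permutes S \<and> f c = a}"
    by (rule bij_betwI[where g = "\<lambda>f. f \<circ> ?t"]) (use t in \<open>auto intro: permutes_compose simp: comp_assoc\<close>)
qed

text \<open>The word \<open>e # rest\<close> is multiplied by the symmetrization of \<open>z\<close>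
  followed by \<open>N - 1\<close> letters \<open>e\<close>. Grouping the permutations by the
  position that \<open>z\<close> reaches gives each of the first \<open>N\<close> positions with the
  same multiplicity, a unit.\<close>

lemma W_shifted_sum:
  assumes e: "e \<in> carrier M" and z: "z \<in> carrier M" and rest: "e # rest \<in> tuples M (k * N)" "PkN k (e # rest) \<in> W k"
  shows "(\<Oplus>\<^bsub>TkN (Suc k)\<^esub>j\<in>{..<N}. PkN (Suc k) (shifted e z rest j)) \<in> W (Suc k)"
proof -
  interpret L: abelian_monoid "TkN (Suc k)"
    by (rule module_abelian_monoid[OF pw_module[OF M]])
  let ?X = "\<lambda>j. PkN (Suc k) (shifted e z rest j)"
  let ?z = "z # replicate (N - 1) e"
  \<comment> \<open>The permutations that carry \<open>z\<close>, which stands at index 0 of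
    \<open>?z\<close>, to position \<open>j\<close>.\<close>
  let ?A = "\<lambda>j. {f. f permutes {..<N} \<and> f j = 0}"
  have zt: "?z \<in> tuples M N"
    using e z N by (auto simp: tuples_def)
  have fin: "finite {f. f permutes {..<N}}"
    by (simp add: finite_permutations)
  have finA: "finite (?A j)" for j
    by (rule finite_subset[OF _ fin]) auto
  have len: "Suc (length rest) = k * N"
    using tuples_length[OF rest(1)] by simp
  have st: "shifted e z rest j \<in> tuples M (Suc k * N)" for j
    using e z rest len by (auto simp: tuples_def shifted_def simp del: upt_Suc)
  note X = pwp_closed[OF M st, of False]
  have un: "{f. f permutes {..<N}} = (\<Union>j\<in>{..<N}. ?A j)"
  proof -
    have "\<exists>j<N. f j = 0" if f: "f permutes {..<N}" for f
      using permutes_inverses(1)[OF f, of 0] permutes_in_image[OF permutes_inv[OF f], of 0] N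
      by (intro exI[of _ "Hilbert_Choice.inv f 0"]) simp
    then show ?thesis
      by auto
  qed
  have pz: "permute_list f ?z @ e # rest = shifted e z rest j" if f: "f permutes {..<N}" "f j = 0" "j < N" for f j
  proof (rule nth_equalityI)
    fix p assume "p < length (permute_list f ?z @ e # rest)"
    then have p: "p < Suc N + length rest"
      using N by simp
    have inj: "f p = 0 \<longleftrightarrow> p = j" for p
      using inj_eq[OF permutes_inj[OF f(1)], of p j] f(2) by simp
    show "(permute_list f ?z @ e # rest) ! p = shifted e z rest j ! p"
    proof (cases "p < N")
      case True
      then have "f p < N"
        using permutes_in_image[OF f(1), of p] by simp
      then have "permute_list f ?z ! p = (if p = j then z else e)"
        using True f(1) N inj[of p] by (subst permute_list_nth) (auto simp: nth_Cons split: nat.splits)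
      then show ?thesis
        using True p N by (simp add: shifted_nth nth_append)
    next
      \<comment> \<open>Position \<open>N\<close> carries the \<open>e\<close> in front of
        \<open>rest\<close>. It is the additional letter that makes \<open>N + 1\<close> positions
        available to \<open>z\<close>.\<close>
      case False
      then show ?thesis
        using p N f(3) by (cases "p - N") (auto simp: shifted_nth nth_append Suc_diff_Suc[symmetric] Suc_diff_le)
    qed
  qed (use N in \<open>simp add: shifted_length\<close>)
  define c where "c = card (?A 0)"
  have c: "card (?A j) = c" if "j < N" for j
    unfolding c_def using card_permutes_at[of 0 "{..<N}" j 0] that N by simp
  \<comment> \<open>Hence the multiplicity is positive, and so acts invertibly.\<close>
  have "id \<in> ?A 0"
    by (simp add: permutes_id)
  then have c1: "c \<ge> 1"
    using finA[of 0] unfolding c_def by (metis One_nat_def Suc_leI card_gt_0_iff empty_iff)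
  have "sym_sum R M N (k * N) ?z (e # rest) =
      (\<Oplus>\<^bsub>TkN (Suc k)\<^esub>f\<in>(\<Union>j\<in>{..<N}. ?A j). PkN (Suc k) (permute_list f ?z @ e # rest))"
    by (simp add: sym_sum_def un)
  also have "\<dots> = (\<Oplus>\<^bsub>TkN (Suc k)\<^esub>j\<in>{..<N}. \<Oplus>\<^bsub>TkN (Suc k)\<^esub>f\<in>?A j. PkN (Suc k) (permute_list f ?z @ e # rest))"
  proof (rule L.add.finprod_UN_disjoint)
    have "i = j" if "f \<in> ?A i" "f \<in> ?A j" for f i j
      using that inj_eq[OF permutes_inj[of f], of "{..<N}" i j] by simp
    then show "pairwise (\<lambda>i j. disjnt (?A i) (?A j)) {..<N}"
      unfolding pairwise_def disjnt_def by blast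
  qed (use finA X pz in auto)
  also have "\<dots> = (\<Oplus>\<^bsub>TkN (Suc k)\<^esub>j\<in>{..<N}. add_pow R c \<one>\<^bsub>R\<^esub> \<odot>\<^bsub>TkN (Suc k)\<^esub> ?X j)"
  proof (rule L.finsum_cong')
    fix j assume "j \<in> {..<N}"
    then have j: "j < N"
      by simp
    have "(\<Oplus>\<^bsub>TkN (Suc k)\<^esub>f\<in>?A j. PkN (Suc k) (permute_list f ?z @ e # rest)) = (\<Oplus>\<^bsub>TkN (Suc k)\<^esub>f\<in>?A j. ?X j)"
      using pz j X by (intro L.finsum_cong') auto
    then show "(\<Oplus>\<^bsub>TkN (Suc k)\<^esub>f\<in>?A j. PkN (Suc k) (permute_list f ?z @ e # rest)) = add_pow R c \<one>\<^bsub>R\<^esub> \<odot>\<^bsub>TkN (Suc k)\<^esub> ?X j"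
      using finsum_const_smult[OF pw_module[OF M] finA X] c[OF j] by simp
  next
    show "(\<lambda>j. add_pow R c \<one>\<^bsub>R\<^esub> \<odot>\<^bsub>TkN (Suc k)\<^esub> ?X j) \<in> {..<N} \<rightarrow> carrier (TkN (Suc k))"
      using X char0[OF c1] module.smult_closed[OF pw_module[OF M]] by (auto simp: Units_def)
  qed simp
  also have "\<dots> = add_pow R c \<one>\<^bsub>R\<^esub> \<odot>\<^bsub>TkN (Suc k)\<^esub> (\<Oplus>\<^bsub>TkN (Suc k)\<^esub>j\<in>{..<N}. ?X j)"
    using X char0[OF c1] by (intro module.finsum_smult_ldistr[OF pw_module[OF M], symmetric]) (auto simp: Units_def)
  finally have "add_pow R c \<one>\<^bsub>R\<^esub> \<odot>\<^bsub>TkN (Suc k)\<^esub> (\<Oplus>\<^bsub>TkN (Suc k)\<^esub>j\<in>{..<N}. ?X j) \<in> W (Suc k)"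
    using W_sym[OF zt rest] by simp
  moreover have "(\<Oplus>\<^bsub>TkN (Suc k)\<^esub>j\<in>{..<N}. ?X j) \<in> carrier (TkN (Suc k))"
    using X by (intro L.finsum_closed) auto
  ultimately show ?thesis
    by (rule unit_smult_cancel[OF pw_module[OF M] W char0[OF c1], rotated])
qed

text \<open>Modulo \<open>W (Suc k)\<close>, the sum over any \<open>N\<close> of the
  \<open>N + 1\<close> positions vanishes. Each single term therefore has the class of the sum over
  all positions, so all terms agree; a vanishing sum of \<open>N\<close> of them is \<open>N\<close>
  times the term sought.\<close>

lemma W_shifted:
  assumes e: "e \<in> carrier M" and z: "z \<in> carrier M" and rest: "e # rest \<in> tuples M (k * N)" "PkN k (e # rest) \<in> W k"
  shows "PkN (Suc k) (shifted e z rest 0) \<in> W (Suc k)"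
proof -
  interpret L: abelian_monoid "TkN (Suc k)"
    by (rule module_abelian_monoid[OF pw_module[OF M]])
  let ?X = "\<lambda>j. PkN (Suc k) (shifted e z rest j)"
  let ?Q = "quot_module (TkN (Suc k)) (W (Suc k))" and ?q = "\<lambda>t. W (Suc k) +>\<^bsub>TkN (Suc k)\<^esub> t"
  note TM = pw_module[OF M, of False "Suc k * N"]
  note Q = quot_module_module[OF TM W] and q = quot_lin[OF TM W] and q0 = quot_coset_zero_iff[OF TM W]
  have len: "Suc (length rest) = k * N"
    using tuples_length[OF rest(1)] by simp
  have st: "shifted e z rest j \<in> tuples M (Suc k * N)" for j
    using e z rest len by (auto simp: tuples_def shifted_def simp del: upt_Suc)
  note X = pwp_closed[OF M st, of False]
  have X': "?X \<in> A \<rightarrow> carrier (TkN (Suc k))" for A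
    using X by auto
  have zq: "\<zero>\<^bsub>?Q\<^esub> = W (Suc k)"
    by (simp add: quot_module_simps)
  \<comment> \<open>\<open>W_shifted_sum\<close> is the case in which position \<open>N\<close> is
    left out; the transposition of \<open>i\<close> and \<open>N\<close> moves the gap to
    \<open>i\<close>.\<close>
  have "(\<Oplus>\<^bsub>TkN (Suc k)\<^esub>j\<in>{..N} - {i}. ?X j) \<in> W (Suc k)" if i: "i \<le> N" for i
  proof -
    let ?t = "Transposition.transpose i N"
    have t: "?t permutes {..<Suc k * N}"
    proof (rule permutes_swap_id)
      \<comment> \<open>The word \<open>e # rest\<close> is nonempty, so there is a position after
        the first \<open>N\<close>.\<close>
      have "N < Suc k * N"
        using len unfolding mult_Suc by linarith
      then show "i \<in> {..<Suc k * N}" "N \<in> {..<Suc k * N}"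
        using i by (auto intro: le_less_trans)
    qed
    obtain g where g: "lin R (TkN (Suc k)) (TkN (Suc k)) g"
        "\<forall>us\<in>tuples M (Suc k * N). g (PkN (Suc k) us) = PkN (Suc k) (permute_list ?t us)"
      using pw_permute[OF M t] by blast
    have perm: "permute_list ?t (shifted e z rest j) = shifted e z rest (?t j)" for j
    proof (rule nth_equalityI)
      fix p assume "p < length (permute_list ?t (shifted e z rest j))"
      then have p: "p < Suc N + length rest"
        by (simp add: shifted_length)
      have tp: "?t p < Suc N + length rest" "?t p \<le> N \<longleftrightarrow> p \<le> N" "p > N \<Longrightarrow> ?t p = p"
        using p i by (auto simp: transpose_def)
      have "?t p = j \<longleftrightarrow> p = ?t j"
        by (metis transpose_involutory)
      moreover have "Suc k * N = length (shifted e z rest j)"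
        using len by (simp add: shifted_length)
      ultimately show "permute_list ?t (shifted e z rest j) ! p = shifted e z rest (?t j) ! p"
        using p tp t by (subst permute_list_nth) (auto simp: shifted_length shifted_nth)
    qed (simp add: shifted_length)
    have "g (\<Oplus>\<^bsub>TkN (Suc k)\<^esub>j\<in>{..<N}. ?X j) \<in> W (Suc k)"
      using W_perm[OF t g(1) _ W_shifted_sum[OF e z rest]] g(2) by blast
    also have "g (\<Oplus>\<^bsub>TkN (Suc k)\<^esub>j\<in>{..<N}. ?X j) = (\<Oplus>\<^bsub>TkN (Suc k)\<^esub>j\<in>{..<N}. g (?X j))"
      using X by (intro lin_finsum[OF TM TM g(1)]) auto
    also have "\<dots> = (\<Oplus>\<^bsub>TkN (Suc k)\<^esub>j\<in>{..<N}. ?X (?t j))"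
      using g(2) st X by (intro L.finsum_cong') (auto simp: perm)
    also have "\<dots> = (\<Oplus>\<^bsub>TkN (Suc k)\<^esub>j\<in>?t ` {..<N}. ?X j)"
      using X by (intro L.finsum_reindex[symmetric] inj_on_subset[OF inj_transpose]) auto
    also have "?t ` {..<N} = {..N} - {i}"
    proof -
      have "{..<N} = {..N} - {N}"
        by auto
      then have "?t ` {..<N} = ?t ` {..N} - ?t ` {N}"
        by (simp add: image_set_diff[OF inj_transpose])
      moreover have "?t ` {..N} = {..N}"
        using i by (intro permutes_image permutes_swap_id) auto
      ultimately show ?thesis
        by simp
    qed
    finally show ?thesis .
  qed
  then have q1: "?q (\<Oplus>\<^bsub>TkN (Suc k)\<^esub>j\<in>{..N} - {i}. ?X j) = \<zero>\<^bsub>?Q\<^esub>" if "i \<le> N" for i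
    using q0[OF L.finsum_closed[OF X']] that zq by simp
  \<comment> \<open>The total over all \<open>N + 1\<close> positions is the term at
    \<open>i\<close> plus a sum in \<open>W (Suc k)\<close>.\<close>
  have eq: "?q (?X i) = ?q (\<Oplus>\<^bsub>TkN (Suc k)\<^esub>j\<in>{..N}. ?X j)" if i: "i \<le> N" for i
  proof -
    have "(\<Oplus>\<^bsub>TkN (Suc k)\<^esub>j\<in>insert i ({..N} - {i}). ?X j) = ?X i \<oplus>\<^bsub>TkN (Suc k)\<^esub> (\<Oplus>\<^bsub>TkN (Suc k)\<^esub>j\<in>{..N} - {i}. ?X j)"
      by (rule L.finsum_insert) (use X in auto)
    also have "insert i ({..N} - {i}) = {..N}"
      using i by auto
    finally have "?q (\<Oplus>\<^bsub>TkN (Suc k)\<^esub>j\<in>{..N}. ?X j) = ?q (?X i) \<oplus>\<^bsub>?Q\<^esub> \<zero>\<^bsub>?Q\<^esub>"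
      using lin_add[OF q X L.finsum_closed[OF X']] q1[OF i] by simp
    then show ?thesis
      using module_facts(4)[OF Q lin_closed[OF q X[of i]]] by (simp only:)
  qed
  \<comment> \<open>The original sum over the first \<open>N\<close> positions, now with all its
    terms replaced by the class of the term at 0.\<close>
  have "\<zero>\<^bsub>?Q\<^esub> = ?q (\<Oplus>\<^bsub>TkN (Suc k)\<^esub>j\<in>{..<N}. ?X j)"
    by (simp only: zq q0[OF L.finsum_closed[OF X'], THEN iffD2, OF W_shifted_sum[OF e z rest]])
  also have "\<dots> = (\<Oplus>\<^bsub>?Q\<^esub>j\<in>{..<N}. ?q (?X j))"
    using X by (intro lin_finsum[OF TM Q q]) auto
  also have "\<dots> = (\<Oplus>\<^bsub>?Q\<^esub>j\<in>{..<N}. ?q (?X 0))"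
  proof (rule abelian_monoid.finsum_cong'[OF module_abelian_monoid[OF Q]])
    fix j assume "j \<in> {..<N}"
    then have "j \<le> N"
      by simp
    from eq[OF this] eq[of 0] show "?q (?X j) = ?q (?X 0)"
      by simp
  qed (use lin_closed[OF q X] in auto)
  also have "\<dots> = add_pow R N \<one>\<^bsub>R\<^esub> \<odot>\<^bsub>?Q\<^esub> ?q (?X 0)"
    using finsum_const_smult[OF Q finite_lessThan[of N] lin_closed[OF q X[of 0]]] by (simp only: card_lessThan)
  also have "\<dots> = ?q (add_pow R N \<one>\<^bsub>R\<^esub> \<odot>\<^bsub>TkN (Suc k)\<^esub> ?X 0)"
    using char0[OF N] by (intro lin_smult[OF q _ X, symmetric]) (auto simp: Units_def)
  finally have "add_pow R N \<one>\<^bsub>R\<^esub> \<odot>\<^bsub>TkN (Suc k)\<^esub> ?X 0 \<in> W (Suc k)"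
    using q0[OF module.smult_closed[OF TM _ X]] char0[OF N] zq by (simp add: Units_def)
  then show ?thesis
    by (rule unit_smult_cancel[OF TM W char0[OF N] X])
qed

text \<open>Induction on the number \<open>s\<close> of letters different from \<open>e\<close>.
  \<open>W_shifted\<close> inserts one such letter at the price of raising \<open>k\<close> by one,
  which is why \<open>s < k\<close> is maintained; for \<open>s = 0\<close> the word is a product of
  constant blocks.\<close>

lemma W_few_other_letters:
  assumes e: "e \<in> carrier M"
  shows "vs \<in> tuples M (k * N) \<Longrightarrow> length (filter (\<lambda>x. x \<noteq> e) vs) = s \<Longrightarrow> s < k \<or> s = 0 \<Longrightarrow> PkN k vs \<in> W k"
proof (induction s arbitrary: k vs)
  case 0
  have "PkN k (replicate (k * N) e) \<in> W k" for k
  proof (induction k)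
    case (Suc k)
    have "replicate (k * N) e \<in> tuples M (k * N)"
      using e by (auto simp: tuples_def)
    from W_block[OF e this Suc] show ?case
      by (simp add: replicate_add)
  qed (simp add: W_0)
  moreover have "vs = replicate (k * N) e"
    using 0 by (intro replicate_eqI) (auto simp: tuples_def filter_empty_conv)
  ultimately show ?case
    by simp
next
  case (Suc s)
  then obtain k' where k: "k = Suc k'" "s < k'"
    by (cases k) auto
  have len: "length vs = k * N"
    using tuples_length[OF Suc.prems(1)] .
  obtain z where z: "z \<in> set vs" "z \<noteq> e"
    using Suc.prems(2) by (metis (mono_tags, lifting) filter_False length_0_conv nat.distinct(1))
  have "length vs = length (filter (\<lambda>x. x = e) vs) + length (filter (\<lambda>x. x \<noteq> e) vs)"
    using sum_length_filter_compl[of "\<lambda>x. x = e" vs] by simp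
  moreover have "length (filter (\<lambda>x. x = e) vs) = count (mset vs) e"
    by (induction vs) auto
  ultimately have cnt: "count (mset vs) e = k * N - Suc s"
    using Suc.prems(2) len by simp
  \<comment> \<open>Here \<open>k\<close> is at least \<open>s + 2\<close>, so besides the
    \<open>Suc s\<close> other letters there is room for \<open>N\<close> letters
    \<open>e\<close>.\<close>
  have "N + Suc s \<le> k * N"
  proof -
    have "Suc s + N \<le> Suc s * N + N"
      using N by (cases N) auto
    also have "\<dots> = Suc (Suc s) * N"
      by simp
    also have "\<dots> \<le> k * N"
      using k by (intro mult_le_mono1) simp
    finally show ?thesis
      by simp
  qed
  then have "N \<le> count (mset vs) e"
    using cnt by simp
  then have "mset (z # replicate N e) \<subseteq># mset vs"
    using z by (auto simp: subseteq_mset_def count_greater_eq_one_iff Suc_le_eq)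
  then obtain rest where rest: "mset vs = mset ((z # replicate N e) @ rest)"
    by (metis ex_mset mset_append subset_mset.add_diff_inverse)
  have carr: "z \<in> carrier M" "set rest \<subseteq> carrier M"
    using mset_eq_setD[OF rest] Suc.prems(1) by (auto simp: tuples_def)
  have l: "k * N = Suc N + length rest"
    using mset_eq_length[OF rest] len by simp
  \<comment> \<open>Up to order, \<open>vs\<close> is \<open>z\<close>, then \<open>N\<close>
    letters \<open>e\<close>, then \<open>rest\<close>. Replacing the first \<open>N + 1\<close>
    letters by a single \<open>e\<close> gives a word for \<open>k'\<close> with one foreign letter
    fewer.\<close>
  then have t: "e # rest \<in> tuples M (k' * N)"
    using k carr e by (simp add: tuples_def)
  have "length (filter (\<lambda>x. x \<noteq> e) ((z # replicate N e) @ rest)) = length (filter (\<lambda>x. x \<noteq> e) vs)"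
    by (metis mset_filter size_mset rest)
  then have "length (filter (\<lambda>x. x \<noteq> e) (e # rest)) = s"
    using z Suc.prems(2) by simp
  from W_shifted[OF e carr(1) t Suc.IH[OF t this]] k
  have "PkN k (shifted e z rest 0) \<in> W k"
    by simp
  moreover have "mset (shifted e z rest 0) = mset vs"
  proof -
    have "map (\<lambda>p. if p = 0 then z else e) [0..<Suc N] = z # replicate N e"
      by (rule nth_equalityI) (auto simp: nth_Cons simp del: upt_Suc split: nat.splits)
    then show ?thesis
      by (simp add: shifted_def rest del: upt_Suc)
  qed
  ultimately show ?case
    using W_mset tuples_mset[OF Suc.prems(1)] by metis
qed

text \<open>Constant blocks of letters other than \<open>e\<close> are split off by
  \<open>W_block\<close> while there are any; the number of letters \<open>e\<close> is unaffected.
  In the remaining word every other letter occurs fewer than \<open>N\<close> times, and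
  \<open>W_few_other_letters\<close> applies.\<close>

lemma W_words:
  assumes S: "S \<subseteq> carrier M" "finite S" and e: "e \<in> S"
  shows "length vs = k * N \<Longrightarrow> set vs \<subseteq> S \<Longrightarrow> (card S * N + 1) * N \<le> count (mset vs) e \<Longrightarrow> PkN k vs \<in> W k"
proof (induction k arbitrary: vs)
  case 0
  then show ?case
    by (simp add: W_0)
next
  case (Suc k)
  have vs: "vs \<in> tuples M (Suc k * N)"
    using Suc.prems S by (auto simp: tuples_def)
  show ?case
  proof (cases "\<exists>x\<in>S - {e}. N \<le> count (mset vs) x")
    case True
    then obtain x where x: "x \<in> S" "x \<noteq> e" "N \<le> count (mset vs) x"
      by blast
    then have "mset (replicate N x) \<subseteq># mset vs"
      by (auto simp: subseteq_mset_def)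
    then obtain rest where rest: "mset vs = mset (replicate N x @ rest)"
      by (metis ex_mset mset_append subset_mset.add_diff_inverse)
    have "length rest = k * N" "set rest \<subseteq> S"
      using mset_eq_length[OF rest] mset_eq_setD[OF rest] Suc.prems by auto
    moreover have "count (mset rest) e = count (mset vs) e"
      using x unfolding rest by simp
    ultimately have "PkN k rest \<in> W k" "rest \<in> tuples M (k * N)"
      using Suc.IH[of rest] Suc.prems S by (auto simp: tuples_def)
    then have "PkN (Suc k) (replicate N x @ rest) \<in> W (Suc k)" "replicate N x @ rest \<in> tuples M (Suc k * N)"
      using x S W_block[of x rest k] by (auto simp: tuples_def)
    then show ?thesis
      using W_mset rest by metis
  next
    case False
    \<comment> \<open>No other letter occurs \<open>N\<close> times, so there are at most
      \<open>card S * N\<close> letters different from \<open>e\<close>.\<close>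
    have "length (filter (\<lambda>x. x \<noteq> e) vs) = size (filter_mset (\<lambda>x. x \<noteq> e) (mset vs))"
      by (metis mset_filter size_mset)
    also have "\<dots> = (\<Sum>x\<in>set_mset (filter_mset (\<lambda>x. x \<noteq> e) (mset vs)). count (filter_mset (\<lambda>x. x \<noteq> e) (mset vs)) x)"
      by (rule size_multiset_overloaded_eq)
    also have "\<dots> \<le> (\<Sum>x\<in>set_mset (filter_mset (\<lambda>x. x \<noteq> e) (mset vs)). N)"
    proof (rule sum_mono)
      fix x assume "x \<in> set_mset (filter_mset (\<lambda>x. x \<noteq> e) (mset vs))"
      then have "x \<in> S - {e}"
        using Suc.prems(2) by auto
      then have "\<not> N \<le> count (mset vs) x"
        using False by blast
      then show "count (filter_mset (\<lambda>x. x \<noteq> e) (mset vs)) x \<le> N"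
        by simp
    qed
    also have "\<dots> \<le> card S * N"
      using Suc.prems S by (auto intro!: mult_le_mono1 card_mono)
    finally have *: "length (filter (\<lambda>x. x \<noteq> e) vs) \<le> card S * N" .
    \<comment> \<open>The bound on the occurrences of \<open>e\<close> was chosen for this: it
      forces the number of blocks to exceed \<open>card S * N\<close>.\<close>
    have "(card S * N + 1) * N \<le> Suc k * N"
      using Suc.prems(1,3) count_le_size[of "mset vs" e] unfolding size_mset by linarith
    then have "card S * N + 1 \<le> Suc k"
      using N by simp
    then show ?thesis
      using W_few_other_letters[OF subsetD[OF S(1) e] vs refl] * by simp
  qed
qed

text \<open>Pigeonhole: among \<open>k * N\<close> letters from \<open>S\<close>, with
  \<open>k\<close> at least \<open>card S * (card S * N + 1)\<close>, one occurs
  \<open>(card S * N + 1) * N\<close> times, as \<open>W_words\<close> demands. Words in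
  \<open>S\<close> span the tensor power.\<close>

theorem W_carrier:
  assumes S: "S \<subseteq> carrier M" "finite S" "mspan R M S = carrier M" and k: "card S * (card S * N + 1) \<le> k"
  shows "W k = carrier (TkN k)"
proof
  show "W k \<subseteq> carrier (TkN k)"
    by (rule submod_sub[OF W])
  have "PkN k vs \<in> W k" if vs: "length vs = k * N" "set vs \<subseteq> S" for vs
  proof (cases "vs = []")
    \<comment> \<open>The empty word is set apart because the strict comparison of sums in the other
      case needs \<open>S\<close> to be nonempty.\<close>
    case True
    then have "k = 0"
      using vs N by simp
    then show ?thesis
      using True W_0 by simp
  next
    case False
    have "\<exists>e\<in>S. (card S * N + 1) * N \<le> count (mset vs) e"
    proof (rule ccontr)
      assume "\<not> ?thesis"
      then have less: "count (mset vs) e < (card S * N + 1) * N" if "e \<in> S" for e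
        using that by (simp add: not_le)
      have "k * N = size (mset vs)"
        using vs by simp
      also have "\<dots> = (\<Sum>e\<in>set vs. count (mset vs) e)"
        by (simp add: size_multiset_overloaded_eq)
      also have "\<dots> \<le> (\<Sum>e\<in>S. count (mset vs) e)"
        using vs S by (intro sum_mono2) auto
      also have "\<dots> < (\<Sum>e\<in>S. (card S * N + 1) * N)"
        using less S False vs by (intro sum_strict_mono) auto
      also have "\<dots> = card S * (card S * N + 1) * N"
        by (simp only: sum_constant of_nat_id mult.assoc)
      also have "\<dots> \<le> k * N"
        using k by (rule mult_le_mono1)
      finally show False
        by simp
    qed
    then show ?thesis
      using W_words[OF S(1,2) _ vs] by blast
  qed
  then have "PkN k ` {us. length us = k * N \<and> set us \<subseteq> S} \<subseteq> W k"
    by auto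
  from mspan_least[OF W this] show "carrier (TkN k) \<subseteq> W k"
    using pw_span_set[OF M S(1,3)] by simp
qed

end

section \<open>Sheaves of modules and their morphisms\<close>

lemma germ_module_simps:
  "s \<in> carrier (germ_module N U) \<longleftrightarrow> s \<in> (\<Pi>\<^sub>E x\<in>U. carrier (N x))"
  "\<zero>\<^bsub>germ_module N U\<^esub> = (\<lambda>x\<in>U. \<zero>\<^bsub>N x\<^esub>)"
  "s \<oplus>\<^bsub>germ_module N U\<^esub> t = (\<lambda>x\<in>U. s x \<oplus>\<^bsub>N x\<^esub> t x)"
  "f \<odot>\<^bsub>germ_module N U\<^esub> s = (\<lambda>x\<in>U. f x \<odot>\<^bsub>N x\<^esub> s x)"
  by (simp_all add: germ_module_def)

lemma section_ring_simps:
  "carrier (section_ring X U) = sects X U"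
  "f \<otimes>\<^bsub>section_ring X U\<^esub> g = (\<lambda>x\<in>U. f x \<otimes>\<^bsub>stalk X x\<^esub> g x)"
  "\<one>\<^bsub>section_ring X U\<^esub> = (\<lambda>x\<in>U. \<one>\<^bsub>stalk X x\<^esub>)"
  "\<zero>\<^bsub>section_ring X U\<^esub> = (\<lambda>x\<in>U. \<zero>\<^bsub>stalk X x\<^esub>)"
  "f \<oplus>\<^bsub>section_ring X U\<^esub> g = (\<lambda>x\<in>U. f x \<oplus>\<^bsub>stalk X x\<^esub> g x)"
  by (simp_all add: section_ring_def germ_ring_def)

lemma germ_ring_cring:
  assumes "\<And>x. x \<in> U \<Longrightarrow> cring (stalk X x)"
  shows "cring (germ_ring X U)"
proof (rule cringI)
  note f = cring_facts[OF assms] abelian_ac[OF cring_abelian_group[OF assms]] cring_m_ac[OF assms]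
    ring.ring_simprules(13)[OF cring_ring[OF assms]]
  have simps: "s \<in> carrier (germ_ring X U) \<longleftrightarrow> s \<in> (\<Pi>\<^sub>E x\<in>U. carrier (stalk X x))"
    "\<zero>\<^bsub>germ_ring X U\<^esub> = (\<lambda>x\<in>U. \<zero>\<^bsub>stalk X x\<^esub>)" "\<one>\<^bsub>germ_ring X U\<^esub> = (\<lambda>x\<in>U. \<one>\<^bsub>stalk X x\<^esub>)"
    "s \<oplus>\<^bsub>germ_ring X U\<^esub> t = (\<lambda>x\<in>U. s x \<oplus>\<^bsub>stalk X x\<^esub> t x)"
    "s \<otimes>\<^bsub>germ_ring X U\<^esub> t = (\<lambda>x\<in>U. s x \<otimes>\<^bsub>stalk X x\<^esub> t x)" for s t
    by (simp_all add: germ_ring_def)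
  have mem: "s x \<in> carrier (stalk X x)" if "s \<in> (\<Pi>\<^sub>E x\<in>U. carrier (stalk X x))" "x \<in> U" for s x
    using that by (rule PiE_mem)
  have ext: "restrict s U = s" if "s \<in> (\<Pi>\<^sub>E x\<in>U. carrier (stalk X x))" for s
    using that by (rule PiE_restrict)
  note rc = restrict_PiE_iff
  show "abelian_group (germ_ring X U)"
  proof (rule abelian_groupI)
    fix s assume s: "s \<in> carrier (germ_ring X U)"
    show "\<exists>t\<in>carrier (germ_ring X U). t \<oplus>\<^bsub>germ_ring X U\<^esub> s = \<zero>\<^bsub>germ_ring X U\<^esub>"
      using s by (intro bexI[of _ "\<lambda>x\<in>U. \<ominus>\<^bsub>stalk X x\<^esub> s x"])
        (auto simp: simps mem f rc intro!: restrict_ext)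
    show "\<zero>\<^bsub>germ_ring X U\<^esub> \<oplus>\<^bsub>germ_ring X U\<^esub> s = s"
      using s ext[of s] by (auto simp: simps mem f intro!: trans[OF restrict_ext ext])
  qed (auto simp: simps mem f rc intro!: restrict_ext)
  show "comm_monoid (germ_ring X U)"
  proof (rule comm_monoidI)
    fix s assume s: "s \<in> carrier (germ_ring X U)"
    show "\<one>\<^bsub>germ_ring X U\<^esub> \<otimes>\<^bsub>germ_ring X U\<^esub> s = s"
      using s ext[of s] by (auto simp: simps mem f intro!: trans[OF restrict_ext ext])
  qed (auto simp: simps mem f rc intro!: restrict_ext)
  fix s t r assume "s \<in> carrier (germ_ring X U)" "t \<in> carrier (germ_ring X U)" "r \<in> carrier (germ_ring X U)"
  then show "(s \<oplus>\<^bsub>germ_ring X U\<^esub> t) \<otimes>\<^bsub>germ_ring X U\<^esub> r =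
      s \<otimes>\<^bsub>germ_ring X U\<^esub> r \<oplus>\<^bsub>germ_ring X U\<^esub> t \<otimes>\<^bsub>germ_ring X U\<^esub> r"
    by (auto simp: simps mem cring_facts[OF assms] ring.ring_simprules(13)[OF cring_ring[OF assms]] intro!: restrict_ext)
qed

text \<open>The working notion of a sheaf of modules: stalks, sections, restriction and gluing. It
  is stable under \<open>generated_sheaf\<close> and \<open>dual_sheaf\<close>, so iterated powers
  and twists are handled without returning to local trivializations.\<close>

definition premod :: "('p, 'r) rspace \<Rightarrow> ('p, 'r, 'm) mod_sheaf \<Rightarrow> bool" where
  "premod X M \<longleftrightarrow> (\<forall>x\<in>topspace (pts X). module (stalk X x) (mstalk M x)) \<and>
     (\<forall>U. openin (pts X) U \<longrightarrow> submodule (msects M U) (section_ring X U) (germ_module (mstalk M) U)) \<and>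
     (\<forall>U V s. openin (pts X) U \<and> openin (pts X) V \<and> V \<subseteq> U \<and> s \<in> msects M U \<longrightarrow> restrict s V \<in> msects M V) \<and>
     (\<forall>U s. openin (pts X) U \<and> s \<in> (\<Pi>\<^sub>E x\<in>U. carrier (mstalk M x)) \<and>
        (\<forall>x\<in>U. \<exists>V. openin (pts X) V \<and> x \<in> V \<and> V \<subseteq> U \<and> restrict s V \<in> msects M V) \<longrightarrow> s \<in> msects M U)"

lemma premod_module: "premod X M \<Longrightarrow> x \<in> topspace (pts X) \<Longrightarrow> module (stalk X x) (mstalk M x)"
  and premod_submodule: "premod X M \<Longrightarrow> openin (pts X) U \<Longrightarrow>
    submodule (msects M U) (section_ring X U) (germ_module (mstalk M) U)"
  and premod_restrict: "premod X M \<Longrightarrow> openin (pts X) U \<Longrightarrow> openin (pts X) V \<Longrightarrow> V \<subseteq> U \<Longrightarrow> s \<in> msects M U \<Longrightarrow>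
    restrict s V \<in> msects M V"
  and premod_glue: "premod X M \<Longrightarrow> openin (pts X) U \<Longrightarrow> s \<in> (\<Pi>\<^sub>E x\<in>U. carrier (mstalk M x)) \<Longrightarrow>
    (\<And>x. x \<in> U \<Longrightarrow> \<exists>V. openin (pts X) V \<and> x \<in> V \<and> V \<subseteq> U \<and> restrict s V \<in> msects M V) \<Longrightarrow> s \<in> msects M U"
  by (simp_all add: premod_def)

lemma premod_sect_PiE: "premod X M \<Longrightarrow> openin (pts X) U \<Longrightarrow> s \<in> msects M U \<Longrightarrow> s \<in> (\<Pi>\<^sub>E x\<in>U. carrier (mstalk M x))"
  using submod_carrier[OF premod_submodule] by (metis germ_module_simps(1))

lemma premod_germ: "premod X M \<Longrightarrow> openin (pts X) U \<Longrightarrow> s \<in> msects M U \<Longrightarrow> x \<in> U \<Longrightarrow> s x \<in> carrier (mstalk M x)"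
  using premod_sect_PiE PiE_mem by fast

lemma sheaf_of_modules_premod: "sheaf_of_modules X M \<Longrightarrow> premod X M"
  unfolding sheaf_of_modules_def sheaf_of_germs_def premod_def by (elim conjE, intro conjI) assumption+

lemma open_pt: "openin (pts X) U \<Longrightarrow> x \<in> U \<Longrightarrow> x \<in> topspace (pts X)"
  using openin_subset by fast

text \<open>The conditions on generating sections under which \<open>generated_sheaf\<close>
  satisfies \<open>premod\<close>; restriction of generators makes their spans compatible with
  shrinking the open set.\<close>

definition gen_ok :: "('p, 'r) rspace \<Rightarrow> _" where
  "gen_ok X N G \<longleftrightarrow> (\<forall>x\<in>topspace (pts X). module (stalk X x) (N x)) \<and>
     (\<forall>V. openin (pts X) V \<longrightarrow> G V \<subseteq> (\<Pi>\<^sub>E x\<in>V. carrier (N x))) \<and>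
     (\<forall>U V g. openin (pts X) U \<and> openin (pts X) V \<and> V \<subseteq> U \<and> g \<in> G U \<longrightarrow> restrict g V \<in> G V)"

lemma gen_ok_germs: "gen_ok X N G \<Longrightarrow> openin (pts X) V \<Longrightarrow> G V \<subseteq> carrier (germ_module N V)"
  unfolding gen_ok_def subset_iff germ_module_simps(1) by simp

lemma generated_sheaf_simps:
  "mstalk (generated_sheaf X N G) = N"
  "s \<in> msects (generated_sheaf X N G) U \<longleftrightarrow> s \<in> (\<Pi>\<^sub>E x\<in>U. carrier (N x)) \<and>
        (\<forall>x\<in>U. \<exists>V. openin (pts X) V \<and> x \<in> V \<and> V \<subseteq> U \<and>
          restrict s V \<in> mspan (section_ring X V) (germ_module N V) (G V))"
  by (simp_all add: generated_sheaf_def)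

text \<open>As sections are families of germs, a morphism is a family of stalk maps that carries
  sections to sections.\<close>

definition mor :: "('p, 'r) rspace \<Rightarrow> _" where
  "mor X U M N f \<longleftrightarrow> (\<forall>x\<in>U. lin (stalk X x) (mstalk M x) (mstalk N x) (f x)) \<and>
     (\<forall>V s. openin (pts X) V \<and> V \<subseteq> U \<and> s \<in> msects M V \<longrightarrow> (\<lambda>x\<in>V. f x (s x)) \<in> msects N V)"

lemma mor_lin: "mor X U M N f \<Longrightarrow> x \<in> U \<Longrightarrow> lin (stalk X x) (mstalk M x) (mstalk N x) (f x)"
  and mor_sect: "mor X U M N f \<Longrightarrow> openin (pts X) V \<Longrightarrow> V \<subseteq> U \<Longrightarrow> s \<in> msects M V \<Longrightarrow> (\<lambda>x\<in>V. f x (s x)) \<in> msects N V"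
  by (simp_all add: mor_def)

lemma mor_id:
  assumes M: "premod X M"
  shows "mor X (topspace (pts X)) M M (\<lambda>x u. u)"
  unfolding mor_def
proof (intro conjI ballI allI impI)
  fix V s assume "openin (pts X) V \<and> V \<subseteq> topspace (pts X) \<and> s \<in> msects M V"
  then show "restrict s V \<in> msects M V"
    using PiE_restrict[OF premod_sect_PiE[OF M]] by metis
qed (rule lin_id)

definition bimor :: "('p, 'r) rspace \<Rightarrow> _" where
  "bimor X M N L f \<longleftrightarrow>
     (\<forall>x\<in>topspace (pts X). bilin (stalk X x) (mstalk M x) (mstalk N x) (mstalk L x) (f x)) \<and>
     (\<forall>V s t. openin (pts X) V \<and> s \<in> msects M V \<and> t \<in> msects N V \<longrightarrow> (\<lambda>x\<in>V. f x (s x) (t x)) \<in> msects L V)"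

lemma bimor_bilin: "bimor X M N L f \<Longrightarrow> x \<in> topspace (pts X) \<Longrightarrow>
    bilin (stalk X x) (mstalk M x) (mstalk N x) (mstalk L x) (f x)"
  and bimor_sect: "bimor X M N L f \<Longrightarrow> openin (pts X) V \<Longrightarrow> s \<in> msects M V \<Longrightarrow> t \<in> msects N V \<Longrightarrow>
    (\<lambda>x\<in>V. f x (s x) (t x)) \<in> msects L V"
  by (simp_all add: bimor_def)

text \<open>Multiplication by a fixed global section is a morphism. It serves both for multiplying
  generated germs and for twisting by a section of an ample bundle.\<close>

lemma bimor_mor:
  assumes M: "premod X M" and f: "bimor X M N L f" and s: "s \<in> global_sections X M"
  shows "mor X (topspace (pts X)) N L (\<lambda>y. f y (s y))"
  unfolding mor_def
proof (intro conjI ballI allI impI)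
  show "lin (stalk X y) (mstalk N y) (mstalk L y) (f y (s y))" if "y \<in> topspace (pts X)" for y
    by (rule bilin_lin2[OF bimor_bilin[OF f that] premod_germ[OF M openin_topspace s that]])
  fix V t assume V: "openin (pts X) V \<and> V \<subseteq> topspace (pts X) \<and> t \<in> msects N V"
  have "(\<lambda>y\<in>V. f y (restrict s V y) (t y)) \<in> msects L V"
    using V by (intro bimor_sect[OF f] premod_restrict[OF M openin_topspace _ _ s]) auto
  then show "(\<lambda>y\<in>V. f y (s y) (t y)) \<in> msects L V"
    by (simp cong: restrict_cong)
qed

context
  fixes X :: "('p, 'r) rspace"
  assumes X: "ringed_space X"
begin

lemma stalk_cring: "x \<in> topspace (pts X) \<Longrightarrow> cring (stalk X x)"
  using X by (simp add: ringed_space_def)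

lemma section_cring:
  assumes U: "openin (pts X) U"
  shows "cring (section_ring X U)"
proof -
  have G: "cring (germ_ring X U)"
    by (rule germ_ring_cring) (rule stalk_cring[OF open_pt[OF U]])
  have S: "subring (sects X U) (germ_ring X U)"
    using X U by (simp add: ringed_space_def)
  have R: "ring (section_ring X U)"
    unfolding section_ring_def by (rule ring.subring_is_ring[OF cring_ring[OF G] S])
  show ?thesis
  proof (rule cring.intro[OF R], rule comm_monoid.intro)
    show "monoid (section_ring X U)"
      using R by (rule ring.axioms)
    have sub: "sects X U \<subseteq> carrier (germ_ring X U)"
      by (rule subringE(1)[OF S])
    show "comm_monoid_axioms (section_ring X U)"
    proof
      fix f g assume "f \<in> carrier (section_ring X U)" "g \<in> carrier (section_ring X U)"
      then have "f \<in> carrier (germ_ring X U)" "g \<in> carrier (germ_ring X U)"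
        using sub by (auto simp: section_ring_simps(1))
      from cring_m_ac(2)[OF G this]
      show "f \<otimes>\<^bsub>section_ring X U\<^esub> g = g \<otimes>\<^bsub>section_ring X U\<^esub> f"
        by (simp add: section_ring_def)
    qed
  qed
qed

lemma sect_germ:
  assumes "openin (pts X) U" "f \<in> sects X U" "x \<in> U"
  shows "f x \<in> carrier (stalk X x)"
proof -
  have "\<forall>U. openin (pts X) U \<longrightarrow> sects X U \<subseteq> (\<Pi>\<^sub>E x\<in>U. carrier (stalk X x))"
    using X unfolding ringed_space_def sheaf_of_germs_def by (elim conjE)
  then have "f \<in> (\<Pi>\<^sub>E x\<in>U. carrier (stalk X x))"
    using assms(1,2) by blast
  then show ?thesis
    using assms(3) by (rule PiE_mem)
qed

lemma sect_restrict:
  assumes "openin (pts X) U" "openin (pts X) V" "V \<subseteq> U" "f \<in> sects X U"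
  shows "restrict f V \<in> sects X V"
proof -
  have "\<forall>U V s. openin (pts X) U \<and> openin (pts X) V \<and> V \<subseteq> U \<and> s \<in> sects X U \<longrightarrow> restrict s V \<in> sects X V"
    using X unfolding ringed_space_def sheaf_of_germs_def by (elim conjE)
  then show ?thesis
    using assms by blast
qed

lemma germ_module_module:
  assumes U: "openin (pts X) U" and N: "\<And>x. x \<in> U \<Longrightarrow> module (stalk X x) (N x)"
  shows "module (section_ring X U) (germ_module N U)"
proof (rule moduleI[OF section_cring[OF U]])
  note f = module_facts[OF N] abelian_ac[OF module_abelian_group[OF N]]
  have mem: "s x \<in> carrier (N x)" if "s \<in> (\<Pi>\<^sub>E x\<in>U. carrier (N x))" "x \<in> U" for s x
    using that by (rule PiE_mem)
  have ext: "restrict s U = s" if "s \<in> (\<Pi>\<^sub>E x\<in>U. carrier (N x))" for s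
    using that by (rule PiE_restrict)
  note sg = sect_germ[OF U]
  note simps = germ_module_simps section_ring_simps restrict_PiE_iff
  show "abelian_group (germ_module N U)"
  proof (rule abelian_groupI)
    fix s assume s: "s \<in> carrier (germ_module N U)"
    show "\<exists>t\<in>carrier (germ_module N U). t \<oplus>\<^bsub>germ_module N U\<^esub> s = \<zero>\<^bsub>germ_module N U\<^esub>"
      using s by (intro bexI[of _ "\<lambda>x\<in>U. \<ominus>\<^bsub>N x\<^esub> s x"]) (auto simp: simps mem f intro!: restrict_ext)
    show "\<zero>\<^bsub>germ_module N U\<^esub> \<oplus>\<^bsub>germ_module N U\<^esub> s = s"
      using s ext[of s] by (auto simp: simps mem f intro!: trans[OF restrict_ext ext])
  qed (auto simp: simps mem f intro!: restrict_ext)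
  fix s assume s: "s \<in> carrier (germ_module N U)"
  show "\<one>\<^bsub>section_ring X U\<^esub> \<odot>\<^bsub>germ_module N U\<^esub> s = s"
    using s ext[of s] by (auto simp: simps mem f intro!: trans[OF restrict_ext ext])
  fix a assume a: "a \<in> carrier (section_ring X U)"
  show "a \<odot>\<^bsub>germ_module N U\<^esub> s \<in> carrier (germ_module N U)"
    using a s by (auto simp: simps mem f sg)
  fix b assume b: "b \<in> carrier (section_ring X U)"
  show "(a \<oplus>\<^bsub>section_ring X U\<^esub> b) \<odot>\<^bsub>germ_module N U\<^esub> s =
      a \<odot>\<^bsub>germ_module N U\<^esub> s \<oplus>\<^bsub>germ_module N U\<^esub> b \<odot>\<^bsub>germ_module N U\<^esub> s"
    using a b s by (auto simp: simps mem f sg intro!: restrict_ext)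
  show "(a \<otimes>\<^bsub>section_ring X U\<^esub> b) \<odot>\<^bsub>germ_module N U\<^esub> s = a \<odot>\<^bsub>germ_module N U\<^esub> (b \<odot>\<^bsub>germ_module N U\<^esub> s)"
    using a b s by (auto simp: simps mem f sg module.smult_assoc1[OF N] intro!: restrict_ext)
  fix t assume "t \<in> carrier (germ_module N U)"
  then show "a \<odot>\<^bsub>germ_module N U\<^esub> (s \<oplus>\<^bsub>germ_module N U\<^esub> t) =
      a \<odot>\<^bsub>germ_module N U\<^esub> s \<oplus>\<^bsub>germ_module N U\<^esub> a \<odot>\<^bsub>germ_module N U\<^esub> t"
    using a s by (auto simp: simps mem f sg intro!: restrict_ext)
qed

lemma premod_germ_module:
  "premod X M \<Longrightarrow> openin (pts X) U \<Longrightarrow> module (section_ring X U) (germ_module (mstalk M) U)"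
  by (intro germ_module_module premod_module open_pt)

text \<open>Reduces claims on sections in a span to the generators of the span.\<close>

lemma vimage_sections_submodule:
  assumes U: "openin (pts X) U" and V: "openin (pts X) V" "V \<subseteq> U"
    and N: "\<And>x. x \<in> U \<Longrightarrow> module (stalk X x) (N x)"
    and N': "\<And>x. x \<in> V \<Longrightarrow> module (stalk X x) (N' x)"
    and K: "submodule K (section_ring X V) (germ_module N' V)"
    and f: "\<And>x. x \<in> V \<Longrightarrow> lin (stalk X x) (N x) (N' x) (f x)"
  shows "submodule {s \<in> carrier (germ_module N U). (\<lambda>x\<in>V. f x (s x)) \<in> K} (section_ring X U) (germ_module N U)"
proof (rule submodI)
  have mem: "s x \<in> carrier (N x)" if "s \<in> carrier (germ_module N U)" "x \<in> V" for s x
    using that V by (auto simp: germ_module_simps)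
  have VU: "x \<in> U" if "x \<in> V" for x
    using that V by blast
  show G: "module (section_ring X U) (germ_module N U)"
    by (rule germ_module_module[OF U N])
  have "(\<lambda>x\<in>V. f x (\<zero>\<^bsub>germ_module N U\<^esub> x)) = \<zero>\<^bsub>germ_module N' V\<^esub>"
    using VU lin_zero[OF N N' f] by (auto simp: germ_module_simps intro!: restrict_ext)
  then show "\<zero>\<^bsub>germ_module N U\<^esub> \<in> {s \<in> carrier (germ_module N U). (\<lambda>x\<in>V. f x (s x)) \<in> K}"
    using module_facts(1)[OF G] submod_zero[OF K] by simp
  fix s assume s: "s \<in> {s \<in> carrier (germ_module N U). (\<lambda>x\<in>V. f x (s x)) \<in> K}"
  {
    fix t assume t: "t \<in> {s \<in> carrier (germ_module N U). (\<lambda>x\<in>V. f x (s x)) \<in> K}"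
    have "(\<lambda>x\<in>V. f x ((s \<oplus>\<^bsub>germ_module N U\<^esub> t) x)) = (\<lambda>x\<in>V. f x (s x)) \<oplus>\<^bsub>germ_module N' V\<^esub> (\<lambda>x\<in>V. f x (t x))"
      using VU lin_add[OF f] s t mem by (auto simp: germ_module_simps(2-) intro!: restrict_ext)
    then show "s \<oplus>\<^bsub>germ_module N U\<^esub> t \<in> {s \<in> carrier (germ_module N U). (\<lambda>x\<in>V. f x (s x)) \<in> K}"
      using module_facts(2)[OF G] submod_add[OF K] s t by simp
  }
  fix a assume a: "a \<in> carrier (section_ring X U)"
  then have aV: "restrict a V \<in> carrier (section_ring X V)"
    using sect_restrict[OF U V] by (simp add: section_ring_simps)
  have "(\<lambda>x\<in>V. f x ((a \<odot>\<^bsub>germ_module N U\<^esub> s) x)) = restrict a V \<odot>\<^bsub>germ_module N' V\<^esub> (\<lambda>x\<in>V. f x (s x))"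
    using VU s a mem
    by (auto simp: germ_module_simps(2-) section_ring_simps sect_germ[OF U] intro!: restrict_ext lin_smult[OF f])
  then show "a \<odot>\<^bsub>germ_module N U\<^esub> s \<in> {s \<in> carrier (germ_module N U). (\<lambda>x\<in>V. f x (s x)) \<in> K}"
    using module_facts(9)[OF G a] submod_smult[OF K aV] s by simp
qed auto

text \<open>The families over \<open>U\<close> whose restriction lies in the span over
  \<open>V\<close> form a submodule, and it contains the generators over \<open>U\<close>.\<close>

lemma mspan_restrict:
  assumes G: "gen_ok X N G" and U: "openin (pts X) U" and V: "openin (pts X) V" "V \<subseteq> U"
    and s: "s \<in> mspan (section_ring X U) (germ_module N U) (G U)"
  shows "restrict s V \<in> mspan (section_ring X V) (germ_module N V) (G V)"
proof -
  have N: "module (stalk X x) (N x)" if "x \<in> U" for x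
    using G that open_pt[OF U] by (simp add: gen_ok_def)
  have NV: "module (stalk X x) (N x)" if "x \<in> V" for x
    using N that V by blast
  have GU: "G U \<subseteq> carrier (germ_module N U)"
    by (rule gen_ok_germs[OF G U])
  have GV: "G V \<subseteq> carrier (germ_module N V)"
    by (rule gen_ok_germs[OF G V(1)])
  let ?H = "mspan (section_ring X V) (germ_module N V) (G V)"
  have K: "submodule ?H (section_ring X V) (germ_module N V)"
    by (rule mspan_submodule[OF germ_module_module[OF V(1) NV] GV])
  have "mspan (section_ring X U) (germ_module N U) (G U) \<subseteq> {s \<in> carrier (germ_module N U). (\<lambda>x\<in>V. s x) \<in> ?H}"
  proof (rule mspan_least[OF vimage_sections_submodule[OF U V N NV K lin_id]])
    show "G U \<subseteq> {s \<in> carrier (germ_module N U). (\<lambda>x\<in>V. s x) \<in> ?H}"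
    proof
      fix g assume g: "g \<in> G U"
      then have "restrict g V \<in> G V"
        using G U V by (simp add: gen_ok_def)
      then show "g \<in> {s \<in> carrier (germ_module N U). (\<lambda>x\<in>V. s x) \<in> ?H}"
        using g GU mspan_incl[of "G V"] by auto
    qed
  qed
  then show ?thesis
    using s by auto
qed

lemma generated_sheaf_gen:
  assumes G: "gen_ok X N G" and U: "openin (pts X) U" and g: "g \<in> G U"
  shows "g \<in> msects (generated_sheaf X N G) U"
proof -
  have gP: "g \<in> (\<Pi>\<^sub>E x\<in>U. carrier (N x))"
    using G U g by (auto simp: gen_ok_def)
  then have "restrict g U \<in> mspan (section_ring X U) (germ_module N U) (G U)"
    using g mspan_incl[of "G U"] by (auto simp: PiE_restrict)
  then show ?thesis
    using gP U unfolding generated_sheaf_simps by blast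
qed

text \<open>Being locally in the span is a local condition, which gives gluing. For sums, two
  neighbourhoods are intersected and \<open>mspan_restrict\<close> moves both spans to the
  intersection.\<close>

lemma generated_sheaf_premod:
  assumes G: "gen_ok X N G"
  shows "premod X (generated_sheaf X N G)"
  unfolding premod_def
proof (intro conjI ballI allI impI)
  let ?M = "generated_sheaf X N G"
  have N: "module (stalk X x) (N x)" if "x \<in> topspace (pts X)" for x
    using G that by (simp add: gen_ok_def)
  then show "module (stalk X x) (mstalk ?M x)" if "x \<in> topspace (pts X)" for x
    using that by (simp add: generated_sheaf_simps)
  have rr: "restrict (restrict s U) V = restrict s V" if "V \<subseteq> U" for s :: "'p \<Rightarrow> 'c" and U V
    using that by (auto simp: restrict_def fun_eq_iff)
  have span: "submodule (mspan (section_ring X V) (germ_module N V) (G V)) (section_ring X V) (germ_module N V)"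
    if V: "openin (pts X) V" for V
  proof (rule mspan_submodule[OF germ_module_module[OF V N[OF open_pt[OF V]]]])
    show "G V \<subseteq> carrier (germ_module N V)"
      by (rule gen_ok_germs[OF G V(1)])
  qed
  {
    fix U V s assume h: "openin (pts X) U \<and> openin (pts X) V \<and> V \<subseteq> U \<and> s \<in> msects ?M U"
    show "restrict s V \<in> msects ?M V"
      unfolding generated_sheaf_simps
    proof (intro conjI ballI)
      show "restrict s V \<in> (\<Pi>\<^sub>E x\<in>V. carrier (N x))"
        using h by (auto simp: generated_sheaf_simps)
      fix x assume x: "x \<in> V"
      then obtain W where W: "openin (pts X) W" "x \<in> W" "W \<subseteq> U"
          "restrict s W \<in> mspan (section_ring X W) (germ_module N W) (G W)"
        using h unfolding generated_sheaf_simps by blast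
      have o: "openin (pts X) (W \<inter> V)"
        using W h by auto
      have "restrict s (W \<inter> V) \<in> mspan (section_ring X (W \<inter> V)) (germ_module N (W \<inter> V)) (G (W \<inter> V))"
        using mspan_restrict[OF G W(1) o Int_lower1 W(4)] unfolding rr[OF Int_lower1] .
      then show "\<exists>Va. openin (pts X) Va \<and> x \<in> Va \<and> Va \<subseteq> V \<and> restrict (restrict s V) Va
          \<in> mspan (section_ring X Va) (germ_module N Va) (G Va)"
        using o x W by (intro exI[of _ "W \<inter> V"]) (simp add: Int_left_commute[of V])
    qed
  }
  {
    fix U s assume h: "openin (pts X) U \<and> s \<in> (\<Pi>\<^sub>E x\<in>U. carrier (mstalk ?M x)) \<and>
      (\<forall>x\<in>U. \<exists>V. openin (pts X) V \<and> x \<in> V \<and> V \<subseteq> U \<and> restrict s V \<in> msects ?M V)"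
    show "s \<in> msects ?M U"
      unfolding generated_sheaf_simps
    proof (intro conjI ballI)
      show "s \<in> (\<Pi>\<^sub>E x\<in>U. carrier (N x))"
        using h by (simp add: generated_sheaf_simps)
      fix x assume x: "x \<in> U"
      then obtain V where V: "openin (pts X) V" "x \<in> V" "V \<subseteq> U" "restrict s V \<in> msects ?M V"
        using h by blast
      then obtain W where W: "openin (pts X) W" "x \<in> W" "W \<subseteq> V"
          "restrict (restrict s V) W \<in> mspan (section_ring X W) (germ_module N W) (G W)"
        unfolding generated_sheaf_simps by blast
      then show "\<exists>V. openin (pts X) V \<and> x \<in> V \<and> V \<subseteq> U \<and> restrict s V \<in> mspan (section_ring X V) (germ_module N V) (G V)"
        using V by (intro exI[of _ W]) (auto simp: Int_absorb1)
    qed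
  }
  fix U assume U: "openin (pts X) U"
  note GM = germ_module_module[OF U N[OF open_pt[OF U]]]
  show "submodule (msects ?M U) (section_ring X U) (germ_module (mstalk ?M) U)"
    unfolding generated_sheaf_simps(1)
  proof (rule submodI[OF GM])
    show "msects ?M U \<subseteq> carrier (germ_module N U)"
      by (auto simp: generated_sheaf_simps germ_module_simps)
    have rz: "restrict \<zero>\<^bsub>germ_module N U\<^esub> V = \<zero>\<^bsub>germ_module N V\<^esub>" if "V \<subseteq> U" for V
      using that by (auto simp: germ_module_simps restrict_def fun_eq_iff)
    have ra: "restrict (s \<oplus>\<^bsub>germ_module N U\<^esub> t) V = restrict s V \<oplus>\<^bsub>germ_module N V\<^esub> restrict t V" if "V \<subseteq> U" for V s t
      using that by (auto simp: germ_module_simps restrict_def fun_eq_iff)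
    have rs: "restrict (a \<odot>\<^bsub>germ_module N U\<^esub> s) V = restrict a V \<odot>\<^bsub>germ_module N V\<^esub> restrict s V" if "V \<subseteq> U" for V a s
      using that by (auto simp: germ_module_simps restrict_def fun_eq_iff)
    show "\<zero>\<^bsub>germ_module N U\<^esub> \<in> msects ?M U"
      unfolding generated_sheaf_simps germ_module_simps(1)[symmetric]
      using module_facts(1)[OF GM] rz[of U] submod_zero[OF span[OF U]] U by (auto intro!: exI[of _ U])
    fix s assume s: "s \<in> msects ?M U"
    then have sc: "s \<in> carrier (germ_module N U)"
      by (simp add: generated_sheaf_simps germ_module_simps)
    {
      fix t assume t: "t \<in> msects ?M U"
      then have tc: "t \<in> carrier (germ_module N U)"
        by (simp add: generated_sheaf_simps germ_module_simps)
      show "s \<oplus>\<^bsub>germ_module N U\<^esub> t \<in> msects ?M U"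
        unfolding generated_sheaf_simps germ_module_simps(1)[symmetric]
      proof (intro conjI ballI)
        fix x assume x: "x \<in> U"
        obtain V where V: "openin (pts X) V" "x \<in> V" "V \<subseteq> U"
            "restrict s V \<in> mspan (section_ring X V) (germ_module N V) (G V)"
          using s x unfolding generated_sheaf_simps by blast
        obtain W where W: "openin (pts X) W" "x \<in> W" "W \<subseteq> U"
            "restrict t W \<in> mspan (section_ring X W) (germ_module N W) (G W)"
          using t x unfolding generated_sheaf_simps by blast
        let ?V = "V \<inter> W"
        have o: "openin (pts X) ?V"
          using V W by auto
        have "restrict s ?V \<in> mspan (section_ring X ?V) (germ_module N ?V) (G ?V)"
          using mspan_restrict[OF G V(1) o Int_lower1 V(4)] unfolding rr[OF Int_lower1] .
        moreover have "restrict t ?V \<in> mspan (section_ring X ?V) (germ_module N ?V) (G ?V)"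
          using mspan_restrict[OF G W(1) o Int_lower2 W(4)] unfolding rr[OF Int_lower2] .
        ultimately have "restrict (s \<oplus>\<^bsub>germ_module N U\<^esub> t) ?V \<in> mspan (section_ring X ?V) (germ_module N ?V) (G ?V)"
          using V by (subst ra) (auto intro: submod_add[OF span[OF o]])
        then show "\<exists>V. openin (pts X) V \<and> x \<in> V \<and> V \<subseteq> U \<and>
            restrict (s \<oplus>\<^bsub>germ_module N U\<^esub> t) V \<in> mspan (section_ring X V) (germ_module N V) (G V)"
          using o V W by (intro exI[of _ ?V]) auto
      qed (rule module_facts(2)[OF GM sc tc])
    }
    fix a assume a: "a \<in> carrier (section_ring X U)"
    show "a \<odot>\<^bsub>germ_module N U\<^esub> s \<in> msects ?M U"
      unfolding generated_sheaf_simps germ_module_simps(1)[symmetric]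
    proof (intro conjI ballI)
      fix x assume x: "x \<in> U"
      obtain V where V: "openin (pts X) V" "x \<in> V" "V \<subseteq> U"
          "restrict s V \<in> mspan (section_ring X V) (germ_module N V) (G V)"
        using s x unfolding generated_sheaf_simps by blast
      have "restrict a V \<in> carrier (section_ring X V)"
        using a sect_restrict[OF U V(1,3)] by (simp add: section_ring_simps)
      from submod_smult[OF span[OF V(1)] this V(4)]
      show "\<exists>V. openin (pts X) V \<and> x \<in> V \<and> V \<subseteq> U \<and>
          restrict (a \<odot>\<^bsub>germ_module N U\<^esub> s) V \<in> mspan (section_ring X V) (germ_module N V) (G V)"
        using V by (intro exI[of _ V]) (simp add: rs)
    qed (rule module_facts(9)[OF GM a sc])
  qed
qed

text \<open>Near each point a section is in the span of generators, and the families mapped to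
  sections form a submodule; the images obtained locally are glued in \<open>M'\<close>.\<close>

lemma generated_mor:
  assumes G: "gen_ok X N G" and M': "premod X M'" and U: "openin (pts X) U"
    and f: "\<And>x. x \<in> U \<Longrightarrow> lin (stalk X x) (N x) (mstalk M' x) (f x)"
    and gen: "\<And>V g. openin (pts X) V \<Longrightarrow> V \<subseteq> U \<Longrightarrow> g \<in> G V \<Longrightarrow> (\<lambda>x\<in>V. f x (g x)) \<in> msects M' V"
  shows "mor X U (generated_sheaf X N G) M' f"
  unfolding mor_def
proof (intro conjI ballI allI impI)
  show "lin (stalk X x) (mstalk (generated_sheaf X N G) x) (mstalk M' x) (f x)" if "x \<in> U" for x
    using f[OF that] by (simp add: generated_sheaf_simps)
  fix V s assume h: "openin (pts X) V \<and> V \<subseteq> U \<and> s \<in> msects (generated_sheaf X N G) V"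
  then have V: "openin (pts X) V" and VU: "V \<subseteq> U" and sP: "s \<in> (\<Pi>\<^sub>E x\<in>V. carrier (N x))"
    by (auto simp: generated_sheaf_simps)
  show "(\<lambda>x\<in>V. f x (s x)) \<in> msects M' V"
  proof (rule premod_glue[OF M' V])
    show "(\<lambda>x\<in>V. f x (s x)) \<in> (\<Pi>\<^sub>E x\<in>V. carrier (mstalk M' x))"
      using sP VU by (auto intro!: lin_closed[OF f])
    fix x assume "x \<in> V"
    then obtain W where W: "openin (pts X) W" "x \<in> W" "W \<subseteq> V"
        "restrict s W \<in> mspan (section_ring X W) (germ_module N W) (G W)"
      using h unfolding generated_sheaf_simps by blast
    have NW: "module (stalk X y) (N y)" if "y \<in> W" for y
      using G that open_pt[OF W(1)] by (simp add: gen_ok_def)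
    have fW: "lin (stalk X y) (N y) (mstalk M' y) (f y)" if "y \<in> W" for y
      using that W VU by (intro f) auto
    have "mspan (section_ring X W) (germ_module N W) (G W) \<subseteq>
        {s \<in> carrier (germ_module N W). (\<lambda>y\<in>W. f y (s y)) \<in> msects M' W}"
    proof (rule mspan_least[OF vimage_sections_submodule[OF W(1) W(1) order.refl NW
            premod_module[OF M' open_pt[OF W(1)]] premod_submodule[OF M' W(1)] fW]])
      show "G W \<subseteq> {s \<in> carrier (germ_module N W). (\<lambda>y\<in>W. f y (s y)) \<in> msects M' W}"
        using gen[OF W(1)] W(3) VU gen_ok_germs[OF G W(1)] by blast
    qed
    then have "(\<lambda>y\<in>W. f y (restrict s W y)) \<in> msects M' W"
      using W(4) by blast
    also have "(\<lambda>y\<in>W. f y (restrict s W y)) = restrict (\<lambda>x\<in>V. f x (s x)) W"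
      using W(3) by (auto simp: restrict_def fun_eq_iff)
    finally show "\<exists>W. openin (pts X) W \<and> x \<in> W \<and> W \<subseteq> V \<and> restrict (\<lambda>x\<in>V. f x (s x)) W \<in> msects M' W"
      using W by blast
  qed
qed

text \<open>\<open>generated_mor\<close> is used twice. With \<open>t\<close> fixed, the claim for
  \<open>s\<close> reduces to a generator \<open>g\<close>; with \<open>g\<close> fixed, the claim
  for \<open>t\<close> reduces to a generator \<open>h\<close>.\<close>

lemma generated_bimor:
  assumes G: "gen_ok X N G" and G': "gen_ok X N' G'" and L: "premod X L"
    and f: "\<And>x. x \<in> topspace (pts X) \<Longrightarrow> bilin (stalk X x) (N x) (N' x) (mstalk L x) (f x)"
    and gen: "\<And>V g h. openin (pts X) V \<Longrightarrow> g \<in> G V \<Longrightarrow> h \<in> G' V \<Longrightarrow> (\<lambda>x\<in>V. f x (g x) (h x)) \<in> msects L V"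
  shows "bimor X (generated_sheaf X N G) (generated_sheaf X N' G') L f"
  unfolding bimor_def
proof (intro conjI ballI allI impI)
  show "bilin (stalk X x) (mstalk (generated_sheaf X N G) x) (mstalk (generated_sheaf X N' G') x) (mstalk L x) (f x)"
    if "x \<in> topspace (pts X)" for x
    using f[OF that] by (simp add: generated_sheaf_simps)
  fix U s t assume h: "openin (pts X) U \<and> s \<in> msects (generated_sheaf X N G) U \<and> t \<in> msects (generated_sheaf X N' G') U"
  then have U: "openin (pts X) U" and s: "s \<in> msects (generated_sheaf X N G) U"
    and t: "t \<in> msects (generated_sheaf X N' G') U"
    by auto
  have tc: "t x \<in> carrier (N' x)" if "x \<in> U" for x
    using t that unfolding generated_sheaf_simps by (auto intro: PiE_mem)
  note top = open_pt[OF U]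
  have "mor X U (generated_sheaf X N G) L (\<lambda>x u. f x u (t x))"
  proof (rule generated_mor[OF G L U bilin_lin1[OF f[OF top] tc]])
    fix V g assume V: "openin (pts X) V" "V \<subseteq> U" and g: "g \<in> G V"
    have gP: "g \<in> (\<Pi>\<^sub>E x\<in>V. carrier (N x))"
      using g G V(1) by (auto simp: gen_ok_def)
    have "mor X V (generated_sheaf X N' G') L (\<lambda>x. f x (g x))"
    proof (rule generated_mor[OF G' L V(1)])
      show "lin (stalk X x) (N' x) (mstalk L x) (f x (g x))" if "x \<in> V" for x
        by (rule bilin_lin2[OF f[OF open_pt[OF V(1) that]] PiE_mem[OF gP that]])
      fix W k assume W: "openin (pts X) W" "W \<subseteq> V" and k: "k \<in> G' W"
      have "restrict g W \<in> G W"
        using G V(1) W g by (simp add: gen_ok_def)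
      from gen[OF W(1) this k] show "(\<lambda>x\<in>W. f x (g x) (k x)) \<in> msects L W"
        by (simp cong: restrict_cong)
    qed
    from mor_sect[OF this V(1) order.refl premod_restrict[OF generated_sheaf_premod[OF G'] U V t]]
    show "(\<lambda>x\<in>V. f x (g x) (t x)) \<in> msects L V"
      by (simp cong: restrict_cong)
  qed auto
  from mor_sect[OF this U order.refl s] show "(\<lambda>x\<in>U. f x (s x) (t x)) \<in> msects L U" .
qed

end

section \<open>Operations on sheaves of modules and their morphisms\<close>

definition pws :: "bool \<Rightarrow> ('p, 'r) rspace \<Rightarrow> nat \<Rightarrow> ('p, 'r, 'm) mod_sheaf \<Rightarrow> ('p, 'r, ('m list \<Rightarrow> 'r) set) mod_sheaf" where
  "pws b X m M = generated_sheaf X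
     (\<lambda>x. pw b (stalk X x) (mstalk M x) m)
     (\<lambda>V. {\<lambda>x\<in>V. pwp b (stalk X x) (mstalk M x) m (map (\<lambda>s. s x) ss) | ss.
        length ss = m \<and> set ss \<subseteq> msects M V})"

lemma tpow_pws: "tpow X m M = pws False X m M"
  and spow_pws: "spow X m M = pws True X m M"
  by (simp_all add: tpow_def spow_def pws_def tpow_module_pw spow_module_pw tpow_pure_pwp spow_pure_pwp)

lemma mstalk_pws [simp]: "mstalk (pws b X m M) x = pw b (stalk X x) (mstalk M x) m"
  and mstalk_tensor_sheaf [simp]: "mstalk (tensor_sheaf X M N) x = tensor_module (stalk X x) (mstalk M x) (mstalk N x)"
  by (simp_all add: pws_def tensor_sheaf_def generated_sheaf_def)

definition epi where
  "epi X M N f \<longleftrightarrow> mor X (topspace (pts X)) M N f \<and>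
     (\<forall>x\<in>topspace (pts X). f x ` carrier (mstalk M x) = carrier (mstalk N x))"

context
  fixes X :: "('p, 'r) rspace"
  assumes X: "ringed_space X"
begin

lemma sect_tuples:
  assumes M: "premod X M" and V: "openin (pts X) V" and ss: "length ss = m" "set ss \<subseteq> msects M V" and x: "x \<in> V"
  shows "map (\<lambda>s. s x) ss \<in> tuples (mstalk M x) m"
  using ss premod_germ[OF M V _ x] by (auto simp: tuples_def)

lemma pws_gen_ok:
  assumes M: "premod X M"
  shows "gen_ok X (\<lambda>x. pw b (stalk X x) (mstalk M x) m)
    (\<lambda>V. {\<lambda>x\<in>V. pwp b (stalk X x) (mstalk M x) m (map (\<lambda>s. s x) ss) | ss. length ss = m \<and> set ss \<subseteq> msects M V})"
  unfolding gen_ok_def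
proof (intro conjI ballI allI impI)
  show "module (stalk X x) (pw b (stalk X x) (mstalk M x) m)" if "x \<in> topspace (pts X)" for x
    by (rule pw_module[OF premod_module[OF M that]])
next
  fix V assume V: "openin (pts X) V"
  show "{\<lambda>x\<in>V. pwp b (stalk X x) (mstalk M x) m (map (\<lambda>s. s x) ss) | ss. length ss = m \<and> set ss \<subseteq> msects M V}
      \<subseteq> (\<Pi>\<^sub>E x\<in>V. carrier (pw b (stalk X x) (mstalk M x) m))"
    using pwp_closed[OF premod_module[OF M open_pt[OF V]] sect_tuples[OF M V]] by auto
next
  fix U V g
  assume h: "openin (pts X) U \<and> openin (pts X) V \<and> V \<subseteq> U \<and>
    g \<in> {\<lambda>x\<in>U. pwp b (stalk X x) (mstalk M x) m (map (\<lambda>s. s x) ss) | ss. length ss = m \<and> set ss \<subseteq> msects M U}"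
  then obtain ss where ss: "g = (\<lambda>x\<in>U. pwp b (stalk X x) (mstalk M x) m (map (\<lambda>s. s x) ss))"
      "length ss = m" "set ss \<subseteq> msects M U"
    by blast
  have "restrict g V = (\<lambda>x\<in>V. pwp b (stalk X x) (mstalk M x) m (map (\<lambda>s. s x) (map (\<lambda>s. restrict s V) ss)))"
    using h unfolding ss(1) by (auto simp: restrict_def fun_eq_iff comp_def)
  moreover have "set (map (\<lambda>s. restrict s V) ss) \<subseteq> msects M V"
    using premod_restrict[OF M] h ss(3) by auto
  ultimately show "restrict g V \<in> {\<lambda>x\<in>V. pwp b (stalk X x) (mstalk M x) m (map (\<lambda>s. s x) ss) | ss. length ss = m \<and> set ss \<subseteq> msects M V}"
    using ss(2) by (intro CollectI exI[of _ "map (\<lambda>s. restrict s V) ss"]) simp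
qed

lemma pws_premod: "premod X M \<Longrightarrow> premod X (pws b X m M)"
  unfolding pws_def by (rule generated_sheaf_premod[OF X pws_gen_ok])

lemma pws_pure_sect:
  assumes "premod X M" "openin (pts X) V" "length ss = m" "set ss \<subseteq> msects M V"
  shows "(\<lambda>x\<in>V. pwp b (stalk X x) (mstalk M x) m (map (\<lambda>s. s x) ss)) \<in> msects (pws b X m M) V"
  unfolding pws_def using assms by (intro generated_sheaf_gen[OF X pws_gen_ok]) auto

lemma pws_mor:
  assumes M: "premod X M" and N: "premod X N" and U: "openin (pts X) U"
    and f: "\<And>x. x \<in> U \<Longrightarrow> lin (stalk X x) (pw b (stalk X x) (mstalk M x) m) (mstalk N x) (f x)"
    and gen: "\<And>V ss. openin (pts X) V \<Longrightarrow> V \<subseteq> U \<Longrightarrow> length ss = m \<Longrightarrow> set ss \<subseteq> msects M V \<Longrightarrow>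
      (\<lambda>x\<in>V. f x (pwp b (stalk X x) (mstalk M x) m (map (\<lambda>s. s x) ss))) \<in> msects N V"
  shows "mor X U (pws b X m M) N f"
  unfolding pws_def
proof (rule generated_mor[OF X pws_gen_ok[OF M] N U f])
  fix V g assume V: "openin (pts X) V" "V \<subseteq> U"
    and "g \<in> {\<lambda>x\<in>V. pwp b (stalk X x) (mstalk M x) m (map (\<lambda>s. s x) ss) | ss. length ss = m \<and> set ss \<subseteq> msects M V}"
  then obtain ss where "g = (\<lambda>x\<in>V. pwp b (stalk X x) (mstalk M x) m (map (\<lambda>s. s x) ss))" "length ss = m" "set ss \<subseteq> msects M V"
    by blast
  then show "(\<lambda>x\<in>V. f x (g x)) \<in> msects N V"
    using gen[OF V] by (simp cong: restrict_cong)
qed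

lemma pws_bimor:
  assumes M: "premod X M" and N: "premod X N" and L: "premod X L"
    and f: "\<And>x. x \<in> topspace (pts X) \<Longrightarrow>
      bilin (stalk X x) (pw b (stalk X x) (mstalk M x) m) (pw b' (stalk X x) (mstalk N x) n) (mstalk L x) (f x)"
    and gen: "\<And>V ss ts. openin (pts X) V \<Longrightarrow> length ss = m \<Longrightarrow> set ss \<subseteq> msects M V \<Longrightarrow> length ts = n \<Longrightarrow> set ts \<subseteq> msects N V \<Longrightarrow>
      (\<lambda>x\<in>V. f x (pwp b (stalk X x) (mstalk M x) m (map (\<lambda>s. s x) ss)) (pwp b' (stalk X x) (mstalk N x) n (map (\<lambda>s. s x) ts))) \<in> msects L V"
  shows "bimor X (pws b X m M) (pws b' X n N) L f"
  unfolding pws_def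
proof (rule generated_bimor[OF X pws_gen_ok[OF M] pws_gen_ok[OF N] L f])
  fix V g h assume V: "openin (pts X) V"
    and "g \<in> {\<lambda>x\<in>V. pwp b (stalk X x) (mstalk M x) m (map (\<lambda>s. s x) ss) | ss. length ss = m \<and> set ss \<subseteq> msects M V}"
    and "h \<in> {\<lambda>x\<in>V. pwp b' (stalk X x) (mstalk N x) n (map (\<lambda>s. s x) ss) | ss. length ss = n \<and> set ss \<subseteq> msects N V}"
  then obtain ss ts where "g = (\<lambda>x\<in>V. pwp b (stalk X x) (mstalk M x) m (map (\<lambda>s. s x) ss))" "length ss = m" "set ss \<subseteq> msects M V"
    "h = (\<lambda>x\<in>V. pwp b' (stalk X x) (mstalk N x) n (map (\<lambda>s. s x) ts))" "length ts = n" "set ts \<subseteq> msects N V"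
    by blast
  then show "(\<lambda>x\<in>V. f x (g x) (h x)) \<in> msects L V"
    using gen[OF V] by (simp cong: restrict_cong)
qed

lemma tensor_gen_ok:
  assumes M: "premod X M" and N: "premod X N"
  shows "gen_ok X (\<lambda>x. tensor_module (stalk X x) (mstalk M x) (mstalk N x))
    (\<lambda>V. {\<lambda>x\<in>V. pt (stalk X x) (mstalk M x) (mstalk N x) (s x) (t x) | s t. s \<in> msects M V \<and> t \<in> msects N V})"
  unfolding gen_ok_def
proof (intro conjI ballI allI impI)
  show "module (stalk X x) (tensor_module (stalk X x) (mstalk M x) (mstalk N x))" if "x \<in> topspace (pts X)" for x
    by (rule tensor_module_module[OF premod_module[OF M that] premod_module[OF N that]])
next
  fix V assume V: "openin (pts X) V"
  show "{\<lambda>x\<in>V. pt (stalk X x) (mstalk M x) (mstalk N x) (s x) (t x) | s t. s \<in> msects M V \<and> t \<in> msects N V}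
      \<subseteq> (\<Pi>\<^sub>E x\<in>V. carrier (tensor_module (stalk X x) (mstalk M x) (mstalk N x)))"
    using pt_closed[OF premod_module[OF M open_pt[OF V]] premod_module[OF N open_pt[OF V]]]
      premod_germ[OF M V] premod_germ[OF N V] by auto
next
  fix U V g
  assume h: "openin (pts X) U \<and> openin (pts X) V \<and> V \<subseteq> U \<and>
    g \<in> {\<lambda>x\<in>U. pt (stalk X x) (mstalk M x) (mstalk N x) (s x) (t x) | s t. s \<in> msects M U \<and> t \<in> msects N U}"
  then obtain s t where st: "g = (\<lambda>x\<in>U. pt (stalk X x) (mstalk M x) (mstalk N x) (s x) (t x))"
      "s \<in> msects M U" "t \<in> msects N U"
    by blast
  have "restrict g V = (\<lambda>x\<in>V. pt (stalk X x) (mstalk M x) (mstalk N x) (restrict s V x) (restrict t V x))"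
    using h unfolding st(1) by (auto simp: restrict_def fun_eq_iff)
  moreover have "restrict s V \<in> msects M V" "restrict t V \<in> msects N V"
    using premod_restrict[OF M] premod_restrict[OF N] h st by auto
  ultimately show "restrict g V \<in> {\<lambda>x\<in>V. pt (stalk X x) (mstalk M x) (mstalk N x) (s x) (t x) | s t. s \<in> msects M V \<and> t \<in> msects N V}"
    by blast
qed

lemma tensor_premod: "premod X M \<Longrightarrow> premod X N \<Longrightarrow> premod X (tensor_sheaf X M N)"
  unfolding tensor_sheaf_def by (rule generated_sheaf_premod[OF X tensor_gen_ok])

lemma tensor_pure_sect:
  assumes "premod X M" "premod X N" "openin (pts X) V" "s \<in> msects M V" "t \<in> msects N V"
  shows "(\<lambda>x\<in>V. pt (stalk X x) (mstalk M x) (mstalk N x) (s x) (t x)) \<in> msects (tensor_sheaf X M N) V"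
  unfolding tensor_sheaf_def using assms by (intro generated_sheaf_gen[OF X tensor_gen_ok]) auto

text \<open>The pattern for most maps of sheaves below: stalk maps with prescribed values on pure
  tensors exist and are chosen simultaneously at all points; that they respect sections is checked
  on pure tensors of sections.\<close>

lemma tensor_sheaf_map:
  assumes M: "premod X M" and N: "premod X N" and M': "premod X M'" and N': "premod X N'"
    and f: "mor X (topspace (pts X)) M M' f" and g: "mor X (topspace (pts X)) N N' g"
  shows "\<exists>F. mor X (topspace (pts X)) (tensor_sheaf X M N) (tensor_sheaf X M' N') F \<and>
    (\<forall>x\<in>topspace (pts X). \<forall>u\<in>carrier (mstalk M x). \<forall>v\<in>carrier (mstalk N x).
      F x (pt (stalk X x) (mstalk M x) (mstalk N x) u v) = pt (stalk X x) (mstalk M' x) (mstalk N' x) (f x u) (g x v))"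
proof -
  have "\<forall>x\<in>topspace (pts X). \<exists>F. lin (stalk X x) (tensor_module (stalk X x) (mstalk M x) (mstalk N x))
      (tensor_module (stalk X x) (mstalk M' x) (mstalk N' x)) F \<and>
    (\<forall>u\<in>carrier (mstalk M x). \<forall>v\<in>carrier (mstalk N x).
      F (pt (stalk X x) (mstalk M x) (mstalk N x) u v) = pt (stalk X x) (mstalk M' x) (mstalk N' x) (f x u) (g x v))"
    using tensor_map[OF premod_module[OF M] premod_module[OF N] premod_module[OF M'] premod_module[OF N']
        mor_lin[OF f] mor_lin[OF g]] by blast
  from bchoice[OF this] obtain F where F: "\<forall>x\<in>topspace (pts X). lin (stalk X x) (tensor_module (stalk X x) (mstalk M x) (mstalk N x))
      (tensor_module (stalk X x) (mstalk M' x) (mstalk N' x)) (F x) \<and>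
    (\<forall>u\<in>carrier (mstalk M x). \<forall>v\<in>carrier (mstalk N x).
      F x (pt (stalk X x) (mstalk M x) (mstalk N x) u v) = pt (stalk X x) (mstalk M' x) (mstalk N' x) (f x u) (g x v))" ..
  have "mor X (topspace (pts X)) (tensor_sheaf X M N) (tensor_sheaf X M' N') F"
    unfolding tensor_sheaf_def[of X M N]
  proof (rule generated_mor[OF X tensor_gen_ok[OF M N] tensor_premod[OF M' N'] openin_topspace])
    show "lin (stalk X x) (tensor_module (stalk X x) (mstalk M x) (mstalk N x)) (mstalk (tensor_sheaf X M' N') x) (F x)"
      if "x \<in> topspace (pts X)" for x
      using F that by simp
    fix V h assume V: "openin (pts X) V" "V \<subseteq> topspace (pts X)"
      and "h \<in> {\<lambda>x\<in>V. pt (stalk X x) (mstalk M x) (mstalk N x) (s x) (t x) | s t. s \<in> msects M V \<and> t \<in> msects N V}"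
    then obtain s t where h: "h = (\<lambda>x\<in>V. pt (stalk X x) (mstalk M x) (mstalk N x) (s x) (t x))"
      and s: "s \<in> msects M V" and t: "t \<in> msects N V"
      by blast
    have "(\<lambda>x\<in>V. F x (h x)) = (\<lambda>x\<in>V. pt (stalk X x) (mstalk M' x) (mstalk N' x) ((\<lambda>x\<in>V. f x (s x)) x) ((\<lambda>x\<in>V. g x (t x)) x))"
      unfolding h using F V(2) premod_germ[OF M V(1) s] premod_germ[OF N V(1) t] by (intro restrict_ext) auto
    then show "(\<lambda>x\<in>V. F x (h x)) \<in> msects (tensor_sheaf X M' N') V"
      using tensor_pure_sect[OF M' N' V(1) mor_sect[OF f V s] mor_sect[OF g V t]] by simp
  qed
  then show ?thesis
    using F by blast
qed

text \<open>Multiplies twisted sections: the powers of the bundle by \<open>f\<close>, the twists by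
  \<open>g\<close>.\<close>

lemma tensor_sheaf_mult:
  assumes P: "premod X P" and B: "premod X B" and T: "premod X T" and C: "premod X C"
    and T': "premod X T'" and C': "premod X C'"
    and f: "bimor X P T T' f" and g: "bimor X B C C' g"
  shows "\<exists>F. bimor X (tensor_sheaf X P B) (tensor_sheaf X T C) (tensor_sheaf X T' C') F \<and>
    (\<forall>x\<in>topspace (pts X). \<forall>p\<in>carrier (mstalk P x). \<forall>b\<in>carrier (mstalk B x).
      \<forall>t\<in>carrier (mstalk T x). \<forall>c\<in>carrier (mstalk C x).
      F x (pt (stalk X x) (mstalk P x) (mstalk B x) p b) (pt (stalk X x) (mstalk T x) (mstalk C x) t c) =
        pt (stalk X x) (mstalk T' x) (mstalk C' x) (f x p t) (g x b c))"
proof -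
  let ?Q = "\<lambda>x F. bilin (stalk X x) (tensor_module (stalk X x) (mstalk P x) (mstalk B x))
      (tensor_module (stalk X x) (mstalk T x) (mstalk C x)) (tensor_module (stalk X x) (mstalk T' x) (mstalk C' x)) F \<and>
    (\<forall>p\<in>carrier (mstalk P x). \<forall>b\<in>carrier (mstalk B x). \<forall>t\<in>carrier (mstalk T x). \<forall>c\<in>carrier (mstalk C x).
      F (pt (stalk X x) (mstalk P x) (mstalk B x) p b) (pt (stalk X x) (mstalk T x) (mstalk C x) t c) =
        pt (stalk X x) (mstalk T' x) (mstalk C' x) (f x p t) (g x b c))"
  have "\<forall>x\<in>topspace (pts X). \<exists>F. ?Q x F"
    using tensor_mult[OF premod_module[OF P] premod_module[OF B] premod_module[OF T] premod_module[OF C]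
        premod_module[OF T'] premod_module[OF C'] bimor_bilin[OF f] bimor_bilin[OF g]] by blast
  from bchoice[OF this] obtain F where F: "\<forall>x\<in>topspace (pts X). ?Q x (F x)" ..
  have "bimor X (tensor_sheaf X P B) (tensor_sheaf X T C) (tensor_sheaf X T' C') F"
    unfolding tensor_sheaf_def[of X P B] tensor_sheaf_def[of X T C]
  proof (rule generated_bimor[OF X tensor_gen_ok[OF P B] tensor_gen_ok[OF T C] tensor_premod[OF T' C']])
    show "bilin (stalk X x) (tensor_module (stalk X x) (mstalk P x) (mstalk B x))
        (tensor_module (stalk X x) (mstalk T x) (mstalk C x)) (mstalk (tensor_sheaf X T' C') x) (F x)"
      if "x \<in> topspace (pts X)" for x
      using F that by simp
    fix V h k assume V: "openin (pts X) V"
      and "h \<in> {\<lambda>x\<in>V. pt (stalk X x) (mstalk P x) (mstalk B x) (s x) (t x) | s t. s \<in> msects P V \<and> t \<in> msects B V}"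
      and "k \<in> {\<lambda>x\<in>V. pt (stalk X x) (mstalk T x) (mstalk C x) (s x) (t x) | s t. s \<in> msects T V \<and> t \<in> msects C V}"
    then obtain p b t c where h: "h = (\<lambda>x\<in>V. pt (stalk X x) (mstalk P x) (mstalk B x) (p x) (b x))"
      and k: "k = (\<lambda>x\<in>V. pt (stalk X x) (mstalk T x) (mstalk C x) (t x) (c x))"
      and p: "p \<in> msects P V" and b: "b \<in> msects B V" and t: "t \<in> msects T V" and c: "c \<in> msects C V"
      by blast
    have "(\<lambda>x\<in>V. F x (h x) (k x)) =
        (\<lambda>x\<in>V. pt (stalk X x) (mstalk T' x) (mstalk C' x) ((\<lambda>x\<in>V. f x (p x) (t x)) x) ((\<lambda>x\<in>V. g x (b x) (c x)) x))"
      unfolding h k using F open_pt[OF V] premod_germ[OF P V p] premod_germ[OF B V b] premod_germ[OF T V t] premod_germ[OF C V c]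
      by (intro restrict_ext) auto
    then show "(\<lambda>x\<in>V. F x (h x) (k x)) \<in> msects (tensor_sheaf X T' C') V"
      using tensor_pure_sect[OF T' C' V bimor_sect[OF f V p t] bimor_sect[OF g V b c]] by simp
  qed
  then show ?thesis
    using F by blast
qed

lemma pws_mult:
  assumes M: "premod X M"
  shows "\<exists>mul. (\<forall>x\<in>topspace (pts X). is_mult b (stalk X x) (mstalk M x) (mul x)) \<and>
    (\<forall>m n. bimor X (pws b X m M) (pws b X n M) (pws b X (m + n) M) (\<lambda>x. mul x m n))"
proof -
  have "\<forall>x\<in>topspace (pts X). \<exists>mul. is_mult b (stalk X x) (mstalk M x) mul"
    using ex_is_mult[OF premod_module[OF M]] by blast
  from bchoice[OF this] obtain mul where mul: "\<forall>x\<in>topspace (pts X). is_mult b (stalk X x) (mstalk M x) (mul x)" ..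
  have "bimor X (pws b X m M) (pws b X n M) (pws b X (m + n) M) (\<lambda>x. mul x m n)" for m n
  proof (rule pws_bimor[OF M M pws_premod[OF M]])
    show "bilin (stalk X x) (pw b (stalk X x) (mstalk M x) m) (pw b (stalk X x) (mstalk M x) n)
        (mstalk (pws b X (m + n) M) x) (mul x m n)" if "x \<in> topspace (pts X)" for x
      using is_mult_bilin[OF bspec[OF mul that]] by simp
    fix V ss ts assume V: "openin (pts X) V" and ss: "length ss = m" "set ss \<subseteq> msects M V"
      and ts: "length ts = n" "set ts \<subseteq> msects M V"
    have "(\<lambda>x\<in>V. mul x m n (pwp b (stalk X x) (mstalk M x) m (map (\<lambda>s. s x) ss)) (pwp b (stalk X x) (mstalk M x) n (map (\<lambda>s. s x) ts))) =
        (\<lambda>x\<in>V. pwp b (stalk X x) (mstalk M x) (m + n) (map (\<lambda>s. s x) (ss @ ts)))"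
    proof (rule restrict_ext)
      fix x assume x: "x \<in> V"
      show "mul x m n (pwp b (stalk X x) (mstalk M x) m (map (\<lambda>s. s x) ss)) (pwp b (stalk X x) (mstalk M x) n (map (\<lambda>s. s x) ts)) =
          pwp b (stalk X x) (mstalk M x) (m + n) (map (\<lambda>s. s x) (ss @ ts))"
        using is_mult_pure[OF bspec[OF mul open_pt[OF V x]] sect_tuples[OF M V ss x] sect_tuples[OF M V ts x]] by simp
    qed
    then show "(\<lambda>x\<in>V. mul x m n (pwp b (stalk X x) (mstalk M x) m (map (\<lambda>s. s x) ss)) (pwp b (stalk X x) (mstalk M x) n (map (\<lambda>s. s x) ts)))
        \<in> msects (pws b X (m + n) M) V"
      using pws_pure_sect[OF M V, of "ss @ ts" "m + n" b] ss ts by simp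
  qed
  then show ?thesis
    using mul by blast
qed

lemma germ_module_finsum:
  assumes V: "openin (pts X) V" and N: "\<And>x. x \<in> V \<Longrightarrow> module (stalk X x) (N x)"
    and A: "finite A" and s: "\<And>a. a \<in> A \<Longrightarrow> s a \<in> carrier (germ_module N V)"
  shows "(\<Oplus>\<^bsub>germ_module N V\<^esub>a\<in>A. s a) = (\<lambda>x\<in>V. \<Oplus>\<^bsub>N x\<^esub>a\<in>A. s a x)"
  using A s
proof (induction A)
  case empty
  have "(\<Oplus>\<^bsub>germ_module N V\<^esub>a\<in>{}. s a) = \<zero>\<^bsub>germ_module N V\<^esub>"
    by (rule module_finsum_empty[OF germ_module_module[OF X V N]])
  also have "\<dots> = (\<lambda>x\<in>V. \<Oplus>\<^bsub>N x\<^esub>a\<in>{}. s a x)"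
    unfolding germ_module_simps by (rule restrict_ext) (simp add: module_finsum_empty[OF N])
  finally show ?case .
next
  case (insert a A)
  have "(\<Oplus>\<^bsub>germ_module N V\<^esub>a\<in>insert a A. s a) = s a \<oplus>\<^bsub>germ_module N V\<^esub> (\<Oplus>\<^bsub>germ_module N V\<^esub>a\<in>A. s a)"
    using insert by (intro module_finsum_insert[OF germ_module_module[OF X V N]]) auto
  also have "\<dots> = (\<lambda>x\<in>V. s a x \<oplus>\<^bsub>N x\<^esub> (\<Oplus>\<^bsub>N x\<^esub>a\<in>A. s a x))"
    using insert by (simp add: germ_module_simps(3) cong: restrict_cong)
  also have "\<dots> = (\<lambda>x\<in>V. \<Oplus>\<^bsub>N x\<^esub>a\<in>insert a A. s a x)"
  proof (rule restrict_ext)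
    fix x assume x: "x \<in> V"
    have "s b x \<in> carrier (N x)" if "b \<in> insert a A" for b
      using insert.prems[OF that] x unfolding germ_module_simps(1) by (rule PiE_mem)
    then show "s a x \<oplus>\<^bsub>N x\<^esub> (\<Oplus>\<^bsub>N x\<^esub>a\<in>A. s a x) = (\<Oplus>\<^bsub>N x\<^esub>a\<in>insert a A. s a x)"
      using insert.hyps by (intro module_finsum_insert[OF N[OF x], symmetric]) auto
  qed
  finally show ?case .
qed

text \<open>The symmetrized product is a sum formed in each stalk separately; this shows that such a
  stalkwise sum of sections is again a section.\<close>

lemma finsum_sect:
  assumes M: "premod X M" and V: "openin (pts X) V" and A: "finite A" and s: "\<And>a. a \<in> A \<Longrightarrow> s a \<in> msects M V"
  shows "(\<lambda>x\<in>V. \<Oplus>\<^bsub>mstalk M x\<^esub>a\<in>A. s a x) \<in> msects M V"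
proof -
  have "(\<Oplus>\<^bsub>germ_module (mstalk M) V\<^esub>a\<in>A. s a) \<in> msects M V"
    by (rule submod_finsum[OF premod_germ_module[OF X M V] premod_submodule[OF M V] A s])
  then show ?thesis
    using germ_module_finsum[OF V premod_module[OF M open_pt[OF V]] A submod_carrier[OF premod_submodule[OF M V] s]] by simp
qed

text \<open>On pure sections the product is a finite sum of pure sections, one for each permutation
  of the list \<open>ss\<close>, hence a section.\<close>

lemma pws_sym_mult:
  assumes M: "premod X M"
  shows "\<exists>f. bimor X (pws True X m M) (pws False X n M) (pws False X (m + n) M) f \<and>
    (\<forall>x\<in>topspace (pts X). \<forall>us\<in>tuples (mstalk M x) m. \<forall>vs\<in>tuples (mstalk M x) n.
      f x (pwp True (stalk X x) (mstalk M x) m us) (pwp False (stalk X x) (mstalk M x) n vs) =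
        sym_sum (stalk X x) (mstalk M x) m n us vs)"
proof -
  let ?Q = "\<lambda>x f. bilin (stalk X x) (pw True (stalk X x) (mstalk M x) m) (pw False (stalk X x) (mstalk M x) n)
      (pw False (stalk X x) (mstalk M x) (m + n)) f \<and>
    (\<forall>us\<in>tuples (mstalk M x) m. \<forall>vs\<in>tuples (mstalk M x) n.
      f (pwp True (stalk X x) (mstalk M x) m us) (pwp False (stalk X x) (mstalk M x) n vs) =
        sym_sum (stalk X x) (mstalk M x) m n us vs)"
  have "\<forall>x\<in>topspace (pts X). \<exists>f. ?Q x f"
    using pw_sym_mult[OF premod_module[OF M]] by blast
  from bchoice[OF this] obtain f where f: "\<forall>x\<in>topspace (pts X). ?Q x (f x)" ..
  have "bimor X (pws True X m M) (pws False X n M) (pws False X (m + n) M) f"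
  proof (rule pws_bimor[OF M M pws_premod[OF M]])
    show "bilin (stalk X x) (pw True (stalk X x) (mstalk M x) m) (pw False (stalk X x) (mstalk M x) n)
        (mstalk (pws False X (m + n) M) x) (f x)" if "x \<in> topspace (pts X)" for x
      using f that by simp
    fix V ss ts assume V: "openin (pts X) V" and ss: "length ss = m" "set ss \<subseteq> msects M V"
      and ts: "length ts = n" "set ts \<subseteq> msects M V"
    let ?s = "\<lambda>g. \<lambda>x\<in>V. pwp False (stalk X x) (mstalk M x) (m + n) (map (\<lambda>s. s x) (permute_list g ss @ ts))"
    have "(\<lambda>x\<in>V. \<Oplus>\<^bsub>mstalk (pws False X (m + n) M) x\<^esub>g\<in>{g. g permutes {..<m}}. ?s g x) \<in> msects (pws False X (m + n) M) V"
    proof (rule finsum_sect[OF pws_premod[OF M] V])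
      fix g assume "g \<in> {g. g permutes {..<m}}"
      then show "?s g \<in> msects (pws False X (m + n) M) V"
        using ss ts by (intro pws_pure_sect[OF M V]) auto
    qed (simp add: finite_permutations)
    also have "(\<lambda>x\<in>V. \<Oplus>\<^bsub>mstalk (pws False X (m + n) M) x\<^esub>g\<in>{g. g permutes {..<m}}. ?s g x) =
        (\<lambda>x\<in>V. f x (pwp True (stalk X x) (mstalk M x) m (map (\<lambda>s. s x) ss)) (pwp False (stalk X x) (mstalk M x) n (map (\<lambda>s. s x) ts)))"
    proof (rule restrict_ext)
      fix x assume x: "x \<in> V"
      note t = sect_tuples[OF M V ss x] sect_tuples[OF M V ts x]
      have "f x (pwp True (stalk X x) (mstalk M x) m (map (\<lambda>s. s x) ss)) (pwp False (stalk X x) (mstalk M x) n (map (\<lambda>s. s x) ts)) =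
          sym_sum (stalk X x) (mstalk M x) m n (map (\<lambda>s. s x) ss) (map (\<lambda>s. s x) ts)"
        using f open_pt[OF V x] t by blast
      also have "\<dots> = (\<Oplus>\<^bsub>pw False (stalk X x) (mstalk M x) (m + n)\<^esub>g\<in>{g. g permutes {..<m}}. ?s g x)"
        unfolding sym_sum_def
      proof (rule abelian_monoid.finsum_cong'[OF module_abelian_monoid[OF pw_module[OF premod_module[OF M open_pt[OF V x]]]]])
        fix g assume "g \<in> {g. g permutes {..<m}}"
        then show "pwp False (stalk X x) (mstalk M x) (m + n) (permute_list g (map (\<lambda>s. s x) ss) @ map (\<lambda>s. s x) ts) = ?s g x"
          using x ss by (simp add: permute_list_map)
      next
        show "(\<lambda>g. ?s g x) \<in> {g. g permutes {..<m}} \<rightarrow> carrier (pw False (stalk X x) (mstalk M x) (m + n))"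
        proof
          fix g assume "g \<in> {g. g permutes {..<m}}"
          then have "map (\<lambda>s. s x) (permute_list g ss @ ts) \<in> tuples (mstalk M x) (m + n)"
            using ss ts by (intro sect_tuples[OF M V _ _ x]) auto
          then show "?s g x \<in> carrier (pw False (stalk X x) (mstalk M x) (m + n))"
            using pwp_closed[OF premod_module[OF M open_pt[OF V x]]] x by simp
        qed
      qed simp
      finally show "(\<Oplus>\<^bsub>mstalk (pws False X (m + n) M) x\<^esub>g\<in>{g. g permutes {..<m}}. ?s g x) =
          f x (pwp True (stalk X x) (mstalk M x) m (map (\<lambda>s. s x) ss)) (pwp False (stalk X x) (mstalk M x) n (map (\<lambda>s. s x) ts))"
        by simp
    qed
    finally show "(\<lambda>x\<in>V. f x (pwp True (stalk X x) (mstalk M x) m (map (\<lambda>s. s x) ss)) (pwp False (stalk X x) (mstalk M x) n (map (\<lambda>s. s x) ts)))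
        \<in> msects (pws False X (m + n) M) V" .
  qed
  then show ?thesis
    using f by blast
qed

lemma pws_permute:
  assumes M: "premod X M" and g: "\<And>x. x \<in> topspace (pts X) \<Longrightarrow>
      lin (stalk X x) (pw False (stalk X x) (mstalk M x) m) (pw False (stalk X x) (mstalk M x) m) (g x) \<and>
      (\<forall>us\<in>tuples (mstalk M x) m. g x (pwp False (stalk X x) (mstalk M x) m us) = pwp False (stalk X x) (mstalk M x) m (permute_list f us))"
    and f: "f permutes {..<m}"
  shows "mor X (topspace (pts X)) (pws False X m M) (pws False X m M) g"
proof (rule pws_mor[OF M pws_premod[OF M] openin_topspace])
  fix V ss assume V: "openin (pts X) V" "V \<subseteq> topspace (pts X)" and ss: "length ss = m" "set ss \<subseteq> msects M V"
  have "(\<lambda>x\<in>V. g x (pwp False (stalk X x) (mstalk M x) m (map (\<lambda>s. s x) ss))) =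
      (\<lambda>x\<in>V. pwp False (stalk X x) (mstalk M x) m (map (\<lambda>s. s x) (permute_list f ss)))"
    using g V(2) sect_tuples[OF M V(1) ss] f ss(1) by (intro restrict_ext) (auto simp: permute_list_map)
  then show "(\<lambda>x\<in>V. g x (pwp False (stalk X x) (mstalk M x) m (map (\<lambda>s. s x) ss))) \<in> msects (pws False X m M) V"
    using pws_pure_sect[OF M V(1), of "permute_list f ss" m False] ss f by simp
qed (use g in auto)

end

section \<open>Generation by global sections modulo the maximal ideal\<close>

text \<open>The multiples of the maximal ideal are adjoined so that generation of the fibre can be
  expressed inside the stalk. Morphisms and products then need to be followed on stalks only;
  \<open>Bs_iff_not_gg\<close> makes the link with fibres.\<close>

definition germ_span :: "('p, 'r) rspace \<Rightarrow> 'p \<Rightarrow> ('p, 'r, 'm) mod_sheaf \<Rightarrow> 'm set" where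
  "germ_span X x M = mspan (stalk X x) (mstalk M x)
     ({s x | s. s \<in> global_sections X M} \<union>
      {a \<odot>\<^bsub>mstalk M x\<^esub> u | a u. a \<in> max_ideal X x \<and> u \<in> carrier (mstalk M x)})"

definition gg :: "('p, 'r) rspace \<Rightarrow> 'p \<Rightarrow> ('p, 'r, 'm) mod_sheaf \<Rightarrow> bool" where
  "gg X x M \<longleftrightarrow> carrier (mstalk M x) \<subseteq> germ_span X x M"

context
  fixes X :: "('p, 'r) rspace" and x :: 'p
  assumes X: "ringed_space X" and x: "x \<in> topspace (pts X)"
begin

lemma max_ideal_carrier: "a \<in> max_ideal X x \<Longrightarrow> a \<in> carrier (stalk X x)"
  by (simp add: max_ideal_def)

lemma germ_span_gens:
  assumes M: "premod X M"
  shows "{s x | s. s \<in> global_sections X M} \<union>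
      {a \<odot>\<^bsub>mstalk M x\<^esub> u | a u. a \<in> max_ideal X x \<and> u \<in> carrier (mstalk M x)} \<subseteq> carrier (mstalk M x)"
  using premod_germ[OF M openin_topspace _ x] module.smult_closed[OF premod_module[OF M x]] max_ideal_carrier
  by auto

lemma germ_span_submodule: "premod X M \<Longrightarrow> submodule (germ_span X x M) (stalk X x) (mstalk M x)"
  unfolding germ_span_def by (rule mspan_submodule[OF premod_module[OF _ x] germ_span_gens])

lemma germ_in_span: "s \<in> global_sections X M \<Longrightarrow> s x \<in> germ_span X x M"
  unfolding germ_span_def by (rule subsetD[OF mspan_incl]) blast

lemma max_smult_in_span: "a \<in> max_ideal X x \<Longrightarrow> u \<in> carrier (mstalk M x) \<Longrightarrow> a \<odot>\<^bsub>mstalk M x\<^esub> u \<in> germ_span X x M"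
  unfolding germ_span_def by (rule subsetD[OF mspan_incl]) blast

lemma germ_span_mor:
  assumes M: "premod X M" and N: "premod X N" and f: "mor X (topspace (pts X)) M N f" and u: "u \<in> germ_span X x M"
  shows "f x u \<in> germ_span X x N"
proof (rule lin_mspan_sub[OF premod_module[OF M x] premod_module[OF N x] mor_lin[OF f x] germ_span_submodule[OF N] germ_span_gens[OF M] _ u[unfolded germ_span_def]])
  fix v assume "v \<in> {s x | s. s \<in> global_sections X M} \<union>
      {a \<odot>\<^bsub>mstalk M x\<^esub> u | a u. a \<in> max_ideal X x \<and> u \<in> carrier (mstalk M x)}"
  then consider s where "s \<in> global_sections X M" "v = s x"
    | a w where "a \<in> max_ideal X x" "w \<in> carrier (mstalk M x)" "v = a \<odot>\<^bsub>mstalk M x\<^esub> w"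
    by blast
  then show "f x v \<in> germ_span X x N"
  proof cases
    case 1
    then show ?thesis
      using germ_in_span[OF mor_sect[OF f openin_topspace order.refl 1(1)]] x by simp
  next
    case 2
    then show ?thesis
      using max_smult_in_span[OF 2(1) lin_closed[OF mor_lin[OF f x] 2(2)]]
        lin_smult[OF mor_lin[OF f x] max_ideal_carrier[OF 2(1)] 2(2)] by simp
  qed
qed

text \<open>With \<open>v\<close> fixed, \<open>u\<close> may be taken among the generators. For the
  germ of a section, multiplication by it is a morphism and \<open>germ_span_mor\<close> applies; a
  multiple of the maximal ideal stays one.\<close>

lemma germ_span_bimor:
  assumes M: "premod X M" and N: "premod X N" and L: "premod X L" and f: "bimor X M N L f"
    and u: "u \<in> germ_span X x M" and v: "v \<in> germ_span X x N"
  shows "f x u v \<in> germ_span X x L"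
proof -
  note b = bimor_bilin[OF f x]
  have vc: "v \<in> carrier (mstalk N x)"
    by (rule submod_carrier[OF germ_span_submodule[OF N] v])
  have 1: "f x (s x) v \<in> germ_span X x L" if s: "s \<in> global_sections X M" for s
  proof -
    from germ_span_mor[OF N L bimor_mor[OF M f s] v] show ?thesis .
  qed
  show ?thesis
  proof (rule lin_mspan_sub[OF premod_module[OF M x] premod_module[OF L x] bilin_lin1[OF b vc] germ_span_submodule[OF L] germ_span_gens[OF M] _ u[unfolded germ_span_def]])
    fix w assume "w \<in> {s x | s. s \<in> global_sections X M} \<union>
        {a \<odot>\<^bsub>mstalk M x\<^esub> u | a u. a \<in> max_ideal X x \<and> u \<in> carrier (mstalk M x)}"
    then consider s where "s \<in> global_sections X M" "w = s x"
      | a u' where "a \<in> max_ideal X x" "u' \<in> carrier (mstalk M x)" "w = a \<odot>\<^bsub>mstalk M x\<^esub> u'"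
      by blast
    then show "f x w v \<in> germ_span X x L"
    proof cases
      case 1
      then show ?thesis
        using \<open>\<And>s. s \<in> global_sections X M \<Longrightarrow> f x (s x) v \<in> germ_span X x L\<close> by simp
    next
      case 2
      then show ?thesis
        using max_smult_in_span[OF 2(1) lin_closed[OF bilin_lin1[OF b vc] 2(2)]]
          lin_smult[OF bilin_lin1[OF b vc] max_ideal_carrier[OF 2(1)] 2(2)] by simp
    qed
  qed
qed

lemma gg_mor:
  assumes M: "premod X M" and N: "premod X N" and f: "mor X (topspace (pts X)) M N f"
    and s: "f x ` carrier (mstalk M x) = carrier (mstalk N x)" and g: "gg X x M"
  shows "gg X x N"
  unfolding gg_def
proof
  fix v assume "v \<in> carrier (mstalk N x)"
  then obtain u where u: "u \<in> carrier (mstalk M x)" "v = f x u"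
    using s by blast
  then show "v \<in> germ_span X x N"
    using germ_span_mor[OF M N f] g by (auto simp: gg_def)
qed

lemma ggI:
  assumes M: "premod X M" and S: "carrier (mstalk M x) = mspan (stalk X x) (mstalk M x) S" "S \<subseteq> germ_span X x M"
  shows "gg X x M"
  unfolding gg_def S(1) by (rule mspan_least[OF germ_span_submodule[OF M] S(2)])

text \<open>Surjectivity is kept by tensor products, since pure tensors of the target lift factor by
  factor.\<close>

lemma gg_tensor_map:
  assumes M: "premod X M" and N: "premod X N" and M': "premod X M'" and N': "premod X N'"
    and f: "mor X (topspace (pts X)) M M' f" "f x ` carrier (mstalk M x) = carrier (mstalk M' x)"
    and g: "mor X (topspace (pts X)) N N' g" "g x ` carrier (mstalk N x) = carrier (mstalk N' x)"
    and gg: "gg X x (tensor_sheaf X M N)"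
  shows "gg X x (tensor_sheaf X M' N')"
proof -
  note m = premod_module[OF M x] premod_module[OF N x] and m' = premod_module[OF M' x] premod_module[OF N' x]
  obtain F where F: "mor X (topspace (pts X)) (tensor_sheaf X M N) (tensor_sheaf X M' N') F"
    "\<forall>x\<in>topspace (pts X). \<forall>u\<in>carrier (mstalk M x). \<forall>v\<in>carrier (mstalk N x).
      F x (pt (stalk X x) (mstalk M x) (mstalk N x) u v) = pt (stalk X x) (mstalk M' x) (mstalk N' x) (f x u) (g x v)"
    using tensor_sheaf_map[OF X M N M' N' f(1) g(1)] by blast
  show ?thesis
  proof (rule gg_mor[OF tensor_premod[OF X M N] tensor_premod[OF X M' N'] F(1) _ gg])
    have "F x ` carrier (tensor_module (stalk X x) (mstalk M x) (mstalk N x)) = carrier (tensor_module (stalk X x) (mstalk M' x) (mstalk N' x))"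
    proof (rule lin_surj_mspan[OF tensor_module_module[OF m] tensor_module_module[OF m'] _ _ tensor_span[OF m' order.refl mspan_carrier[OF m'(2)]]])
      show "lin (stalk X x) (tensor_module (stalk X x) (mstalk M x) (mstalk N x)) (tensor_module (stalk X x) (mstalk M' x) (mstalk N' x)) (F x)"
        using mor_lin[OF F(1) x] by simp
      show "{pt (stalk X x) (mstalk M' x) (mstalk N' x) u v |u v. u \<in> carrier (mstalk M' x) \<and> v \<in> carrier (mstalk N' x)}
          \<subseteq> F x ` carrier (tensor_module (stalk X x) (mstalk M x) (mstalk N x))"
      proof
        fix p assume "p \<in> {pt (stalk X x) (mstalk M' x) (mstalk N' x) u v |u v. u \<in> carrier (mstalk M' x) \<and> v \<in> carrier (mstalk N' x)}"
        then obtain u v where p: "p = pt (stalk X x) (mstalk M' x) (mstalk N' x) u v" "u \<in> carrier (mstalk M' x)" "v \<in> carrier (mstalk N' x)"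
          by blast
        obtain u' v' where uv: "u' \<in> carrier (mstalk M x)" "u = f x u'" "v' \<in> carrier (mstalk N x)" "v = g x v'"
          using p f(2) g(2) by blast
        have "p = F x (pt (stalk X x) (mstalk M x) (mstalk N x) u' v')"
          using F(2) x uv p by simp
        then show "p \<in> F x ` carrier (tensor_module (stalk X x) (mstalk M x) (mstalk N x))"
          using pt_closed[OF m uv(1,3)] by blast
      qed
    qed
    then show "F x ` carrier (mstalk (tensor_sheaf X M N) x) = carrier (mstalk (tensor_sheaf X M' N') x)"
      by simp
  qed
qed

lemma pws_zero_pure:
  assumes M: "premod X M"
  shows "pwp b (stalk X x) (mstalk M x) 0 [] \<in> germ_span X x (pws b X 0 M)"
  using germ_in_span[OF pws_pure_sect[OF X M openin_topspace, of "[]" 0 b]] x by simp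

text \<open>A word of length \<open>Suc c * m\<close> is the product of a word of length
  \<open>m\<close> and one of length \<open>c * m\<close>, both generated. The power of degree 0 is
  spanned by the empty tensor, the germ of a global section.\<close>

lemma gg_power:
  assumes M: "premod X M" and g: "gg X x (pws False X m M)"
  shows "gg X x (pws False X (c * m) M)"
proof (induction c)
  case 0
  have "tuples (mstalk M x) 0 = {[]}"
    by (auto simp: tuples_def)
  then have "carrier (mstalk (pws False X 0 M) x) = mspan (stalk X x) (mstalk (pws False X 0 M) x) {pwp False (stalk X x) (mstalk M x) 0 []}"
    using pw_span[OF premod_module[OF M x], of False 0] by simp
  then show ?case
    unfolding mult_0 using pws_zero_pure[OF M] by (intro ggI[OF pws_premod[OF X M]]) auto
next
  case (Suc c)
  obtain mul where mul: "\<forall>x\<in>topspace (pts X). is_mult False (stalk X x) (mstalk M x) (mul x)"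
    "\<forall>m n. bimor X (pws False X m M) (pws False X n M) (pws False X (m + n) M) (\<lambda>x. mul x m n)"
    using pws_mult[OF X M] by blast
  show ?case
  proof (rule ggI[OF pws_premod[OF X M]])
    let ?P = "\<lambda>k. pwp False (stalk X x) (mstalk M x) k"
    show "carrier (mstalk (pws False X (Suc c * m) M) x) =
        mspan (stalk X x) (mstalk (pws False X (Suc c * m) M) x) (?P (Suc c * m) ` tuples (mstalk M x) (Suc c * m))"
      using pw_span[OF premod_module[OF M x], of False "Suc c * m"] by simp
    show "?P (Suc c * m) ` tuples (mstalk M x) (Suc c * m) \<subseteq> germ_span X x (pws False X (Suc c * m) M)"
    proof (rule image_subsetI)
      fix us assume us: "us \<in> tuples (mstalk M x) (Suc c * m)"
      define us1 us2 where "us1 = take m us" and "us2 = drop m us"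
      have u: "us = us1 @ us2" "us1 \<in> tuples (mstalk M x) m" "us2 \<in> tuples (mstalk M x) (c * m)"
        using us by (auto simp: us1_def us2_def tuples_def dest: in_set_takeD in_set_dropD)
      have "?P m us1 \<in> germ_span X x (pws False X m M)" "?P (c * m) us2 \<in> germ_span X x (pws False X (c * m) M)"
        using g Suc.IH pwp_closed[OF premod_module[OF M x]] u(2,3) unfolding gg_def mstalk_pws by blast+
      from germ_span_bimor[OF pws_premod[OF X M] pws_premod[OF X M] pws_premod[OF X M] spec[OF spec[OF mul(2)]] this]
      show "?P (Suc c * m) us \<in> germ_span X x (pws False X (Suc c * m) M)"
        using is_mult_pure[OF bspec[OF mul(1) x] u(2,3)] by (simp add: u(1))
    qed
  qed
qed

text \<open>The passage from symmetric to tensor powers, twist included: \<open>W_carrier\<close>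
  applied to what sections generate at the point.\<close>

lemma gg_sym_power:
  assumes E: "premod X E" and B: "premod X B" and N: "N \<ge> 1"
    and S: "S \<subseteq> carrier (mstalk E x)" "finite S" "mspan (stalk X x) (mstalk E x) S = carrier (mstalk E x)"
    and char0: "\<And>n::nat. n \<ge> 1 \<Longrightarrow> add_pow (stalk X x) n \<one>\<^bsub>stalk X x\<^esub> \<in> Units (stalk X x)"
    and gg: "gg X x (tensor_sheaf X (pws True X N E) (pws False X n B))"
    and k: "card S * (card S * N + 1) \<le> k"
  shows "gg X x (tensor_sheaf X (pws False X (k * N) E) (pws False X (k * n) B))"
proof -
  let ?R = "stalk X x" and ?E = "mstalk E x" and ?B = "mstalk B x"
  let ?pt = "\<lambda>k. pt ?R (pw False ?R ?E (k * N)) (pw False ?R ?B (k * n))"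
  let ?T = "\<lambda>k. tensor_sheaf X (pws False X (k * N) E) (pws False X (k * n) B)"
  \<comment> \<open>The twist is carried along by requiring the product with every tensor of
    \<open>B\<close> of the matching degree to be generated. This makes \<open>W k\<close> a
    submodule of the untwisted tensor power.\<close>
  define W where "W = (\<lambda>k. {t \<in> carrier (pw False ?R ?E (k * N)). \<forall>\<beta>\<in>carrier (pw False ?R ?B (k * n)).
    ?pt k t \<beta> \<in> germ_span X x (?T k)})"
  note Em = premod_module[OF E x] and Bm = premod_module[OF B x]
  note pE = pws_premod[OF X E] and pB = pws_premod[OF X B]
  have pT: "premod X (?T k)" for k
    by (rule tensor_premod[OF X pE pB])
  note H = germ_span_submodule[OF pT, unfolded mstalk_tensor_sheaf mstalk_pws]
  note TE = pw_module[OF Em, of False] and TB = pw_module[OF Bm, of False]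
  note ptb = pt_bilin[OF TE TB]
  obtain mulB where mulB: "\<forall>x\<in>topspace (pts X). is_mult False (stalk X x) (mstalk B x) (mulB x)"
    "\<forall>m n. bimor X (pws False X m B) (pws False X n B) (pws False X (m + n) B) (\<lambda>x. mulB x m n)"
    using pws_mult[OF X B] by blast
  have "W k = carrier (pw False ?R ?E (k * N))"
  proof (rule W_carrier[OF Em N char0 _ _ _ _ S k])
    fix k
    show "submodule (W k) ?R (pw False ?R ?E (k * N))"
    proof (rule submodI[OF TE])
      show "\<zero>\<^bsub>pw False ?R ?E (k * N)\<^esub> \<in> W k"
        unfolding W_def
        using module_facts(1)[OF TE] lin_zero[OF TE tensor_module_module[OF TE TB] bilin_lin1[OF ptb]] submod_zero[OF H] by simp
      fix t assume t: "t \<in> W k"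
      {
        fix t' assume "t' \<in> W k"
        then show "t \<oplus>\<^bsub>pw False ?R ?E (k * N)\<^esub> t' \<in> W k"
          using t lin_add[OF bilin_lin1[OF ptb]] submod_add[OF H] module_facts(2)[OF TE] unfolding W_def by simp
      }
      fix a assume "a \<in> carrier ?R"
      then show "a \<odot>\<^bsub>pw False ?R ?E (k * N)\<^esub> t \<in> W k"
        using t lin_smult[OF bilin_lin1[OF ptb]] submod_smult[OF H] module_facts(9)[OF TE] unfolding W_def by simp
    qed (auto simp: W_def)
  next
    have "?pt 0 (pwp False ?R ?E (0 * N) []) \<beta> \<in> germ_span X x (?T 0)" if \<beta>: "\<beta> \<in> carrier (pw False ?R ?B (0 * n))" for \<beta>
    proof (rule pw_sub[OF Bm tensor_module_module[OF TE TB] bilin_lin2[OF ptb] H _ \<beta>])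
      show e: "pwp False ?R ?E (0 * N) [] \<in> carrier (pw False ?R ?E (0 * N))"
        by (rule pwp_closed[OF Em]) (simp add: tuples_def)
      fix us assume "us \<in> tuples ?B (0 * n)"
      then have us: "us = []"
        by (simp add: tuples_def)
      have s: "(\<lambda>x\<in>topspace (pts X). pwp False (stalk X x) (mstalk E x) (0 * N) (map (\<lambda>s. s x) [])) \<in> global_sections X (pws False X (0 * N) E)"
        "(\<lambda>x\<in>topspace (pts X). pwp False (stalk X x) (mstalk B x) (0 * n) (map (\<lambda>s. s x) [])) \<in> global_sections X (pws False X (0 * n) B)"
        by (rule pws_pure_sect[OF X E openin_topspace] pws_pure_sect[OF X B openin_topspace]; simp)+
      from germ_in_span[OF tensor_pure_sect[OF X pE pB openin_topspace s]] x
      show "?pt 0 (pwp False ?R ?E (0 * N) []) (pwp False ?R ?B (0 * n) us) \<in> germ_span X x (?T 0)"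
        by (simp add: us)
    qed
    moreover have "pwp False ?R ?E (0 * N) [] \<in> carrier (pw False ?R ?E (0 * N))"
      by (rule pwp_closed[OF Em]) (simp add: tuples_def)
    ultimately show "pwp False ?R ?E 0 [] \<in> W 0"
      unfolding W_def by simp
  next
    fix k f g t
    assume f: "f permutes {..<k * N}" and g: "lin ?R (pw False ?R ?E (k * N)) (pw False ?R ?E (k * N)) g"
      and gp: "\<And>us. us \<in> tuples ?E (k * N) \<Longrightarrow> g (pwp False ?R ?E (k * N) us) = pwp False ?R ?E (k * N) (permute_list f us)"
      and t: "t \<in> W k"
    \<comment> \<open>The map \<open>g\<close> lives on the stalk at \<open>x\<close> only. The same
      permutation acts on every stalk, and the family of these actions is a morphism that agrees
      with \<open>g\<close> at \<open>x\<close>.\<close>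
    have "\<forall>y\<in>topspace (pts X). \<exists>G. lin (stalk X y) (pw False (stalk X y) (mstalk E y) (k * N)) (pw False (stalk X y) (mstalk E y) (k * N)) G \<and>
        (\<forall>us\<in>tuples (mstalk E y) (k * N). G (pwp False (stalk X y) (mstalk E y) (k * N) us) = pwp False (stalk X y) (mstalk E y) (k * N) (permute_list f us))"
      using pw_permute[OF premod_module[OF E] f] by blast
    from bchoice[OF this] obtain G where G: "\<And>y. y \<in> topspace (pts X) \<Longrightarrow> lin (stalk X y) (pw False (stalk X y) (mstalk E y) (k * N)) (pw False (stalk X y) (mstalk E y) (k * N)) (G y) \<and>
        (\<forall>us\<in>tuples (mstalk E y) (k * N). G y (pwp False (stalk X y) (mstalk E y) (k * N) us) = pwp False (stalk X y) (mstalk E y) (k * N) (permute_list f us))"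
      by blast
    have tc: "t \<in> carrier (pw False ?R ?E (k * N))"
      using t by (simp add: W_def)
    have gG: "g t = G x t"
      by (rule pw_ext[OF Em TE g _ _ tc]) (use G[OF x] gp in auto)
    note mid = mor_id[OF pB, of False "k * n"]
    obtain F where F: "mor X (topspace (pts X)) (?T k) (?T k) F"
      "\<forall>x\<in>topspace (pts X). \<forall>u\<in>carrier (mstalk (pws False X (k * N) E) x). \<forall>v\<in>carrier (mstalk (pws False X (k * n) B) x).
        F x (pt (stalk X x) (mstalk (pws False X (k * N) E) x) (mstalk (pws False X (k * n) B) x) u v) =
          pt (stalk X x) (mstalk (pws False X (k * N) E) x) (mstalk (pws False X (k * n) B) x) (G x u) v"
      using tensor_sheaf_map[OF X pE pB pE pB pws_permute[OF X E G f] mid] by blast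
    have "?pt k (G x t) \<beta> \<in> germ_span X x (?T k)" if \<beta>: "\<beta> \<in> carrier (pw False ?R ?B (k * n))" for \<beta>
      using germ_span_mor[OF pT pT F(1), of "?pt k t \<beta>"] F(2) x t \<beta> by (simp add: W_def)
    then show "g t \<in> W k"
      using lin_closed[OF g tc] unfolding gG W_def by simp
  next
    fix k us vs
    assume us: "us \<in> tuples ?E N" and vs: "vs \<in> tuples ?E (k * N)" and vW: "pwp False ?R ?E (k * N) vs \<in> W k"
    obtain f where f: "bimor X (pws True X N E) (pws False X (k * N) E) (pws False X (N + k * N) E) f"
      "\<forall>x\<in>topspace (pts X). \<forall>us\<in>tuples (mstalk E x) N. \<forall>vs\<in>tuples (mstalk E x) (k * N).
        f x (pwp True (stalk X x) (mstalk E x) N us) (pwp False (stalk X x) (mstalk E x) (k * N) vs) =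
          sym_sum (stalk X x) (mstalk E x) N (k * N) us vs"
      using pws_sym_mult[OF X E] by blast
    note mB = spec[OF spec[OF mulB(2)], of n "k * n"]
    obtain F where F: "bimor X (tensor_sheaf X (pws True X N E) (pws False X n B)) (?T k) (?T (Suc k)) F"
      "\<forall>x\<in>topspace (pts X). \<forall>p\<in>carrier (mstalk (pws True X N E) x). \<forall>b\<in>carrier (mstalk (pws False X n B) x).
        \<forall>t\<in>carrier (mstalk (pws False X (k * N) E) x). \<forall>c\<in>carrier (mstalk (pws False X (k * n) B) x).
        F x (pt (stalk X x) (mstalk (pws True X N E) x) (mstalk (pws False X n B) x) p b)
            (pt (stalk X x) (mstalk (pws False X (k * N) E) x) (mstalk (pws False X (k * n) B) x) t c) =
          pt (stalk X x) (mstalk (pws False X (Suc k * N) E) x) (mstalk (pws False X (Suc k * n) B) x) (f x p t) (mulB x n (k * n) b c)"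
      using tensor_sheaf_mult[OF X pE pB pE pB pE pB f(1) mB] unfolding mult_Suc by blast
    have uc: "pwp True ?R ?E N us \<in> carrier (pw True ?R ?E N)" and vc: "pwp False ?R ?E (k * N) vs \<in> carrier (pw False ?R ?E (k * N))"
      by (rule pwp_closed[OF Em us] pwp_closed[OF Em vs])+
    have fe: "f x (pwp True ?R ?E N us) (pwp False ?R ?E (k * N) vs) = sym_sum ?R ?E N (k * N) us vs"
      using f(2) x us vs by blast
    have sc: "sym_sum ?R ?E N (k * N) us vs \<in> carrier (pw False ?R ?E (Suc k * N))"
      using bilin_closed[OF bimor_bilin[OF f(1) x, unfolded mstalk_pws] uc vc] fe by simp
    have "?pt (Suc k) (sym_sum ?R ?E N (k * N) us vs) \<beta> \<in> germ_span X x (?T (Suc k))"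
      if \<beta>: "\<beta> \<in> carrier (pw False ?R ?B (Suc k * n))" for \<beta>
    proof (rule pw_sub[OF Bm tensor_module_module[OF TE TB] bilin_lin2[OF ptb sc] H _ \<beta>])
      fix bs assume bs: "bs \<in> tuples ?B (Suc k * n)"
      define bs1 bs2 where "bs1 = take n bs" and "bs2 = drop n bs"
      have b: "bs = bs1 @ bs2" "bs1 \<in> tuples ?B n" "bs2 \<in> tuples ?B (k * n)"
        using bs by (auto simp: bs1_def bs2_def tuples_def dest: in_set_takeD in_set_dropD)
      have bc: "pwp False ?R ?B n bs1 \<in> carrier (pw False ?R ?B n)" "pwp False ?R ?B (k * n) bs2 \<in> carrier (pw False ?R ?B (k * n))"
        by (rule pwp_closed[OF Bm b(2)] pwp_closed[OF Bm b(3)])+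
      \<comment> \<open>The tensor of \<open>B\<close> is split into degrees \<open>n\<close> and
        \<open>k * n\<close>. The hypothesis \<open>gg\<close> generates the first factor and
        \<open>W k\<close> the second; their product is the symmetrized product tensored with
        \<open>bs\<close>.\<close>
      have 1: "pt ?R (pw True ?R ?E N) (pw False ?R ?B n) (pwp True ?R ?E N us) (pwp False ?R ?B n bs1)
          \<in> germ_span X x (tensor_sheaf X (pws True X N E) (pws False X n B))"
        using gg pt_closed[OF pw_module[OF Em] pw_module[OF Bm] uc bc(1)] unfolding gg_def mstalk_tensor_sheaf mstalk_pws by blast
      have 2: "?pt k (pwp False ?R ?E (k * N) vs) (pwp False ?R ?B (k * n) bs2) \<in> germ_span X x (?T k)"
        using vW bc(2) unfolding W_def by blast
      from germ_span_bimor[OF tensor_premod[OF X pE pB] pT pT F(1) 1 2]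
      show "?pt (Suc k) (sym_sum ?R ?E N (k * N) us vs) (pwp False ?R ?B (Suc k * n) bs) \<in> germ_span X x (?T (Suc k))"
        using bspec[OF F(2) x, unfolded mstalk_pws] uc vc bc fe is_mult_pure[OF bspec[OF mulB(1) x] b(2,3)] by (simp add: b(1))
    qed
    then show "sym_sum ?R ?E N (k * N) us vs \<in> W (Suc k)"
      unfolding W_def using sc by blast
  qed
  then have sub: "{?pt k u v | u v. u \<in> carrier (pw False ?R ?E (k * N)) \<and> v \<in> carrier (pw False ?R ?B (k * n))} \<subseteq> germ_span X x (?T k)"
    unfolding W_def by blast
  show ?thesis
    by (rule ggI[OF pT _ sub]) (use tensor_span[OF TE TB order.refl mspan_carrier[OF TB]] in simp)
qed

end

section \<open>Tensorial sheaves\<close>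

text \<open>
  A sheaf is tensorial of weight \<open>w\<close> over \<open>E\<close> if it lies between the tensor power and the
  symmetric power of degree \<open>w\<close>, as do \<open>E\<close>, \<open>T\<^sup>w E\<close>, \<open>S\<^sup>w E\<close> and iterated powers of these.
\<close>

definition tensorial where
  "tensorial X E w V \<longleftrightarrow> premod X V \<and> (\<exists>d. epi X V (pws True X w E) d) \<and> (\<exists>u. epi X (pws False X w E) V u)"

lemma epi_mor: "epi X M N f \<Longrightarrow> mor X (topspace (pts X)) M N f"
  and epi_surj: "epi X M N f \<Longrightarrow> x \<in> topspace (pts X) \<Longrightarrow> f x ` carrier (mstalk M x) = carrier (mstalk N x)"
  by (simp_all add: epi_def)

lemma epi_id: "premod X M \<Longrightarrow> epi X M M (\<lambda>x u. u)"
  by (simp add: epi_def mor_id)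

context
  fixes X :: "('p, 'r) rspace"
  assumes X: "ringed_space X"
begin

lemma mult_list_sect:
  assumes E: "premod X E" and V: "premod X V" and d: "mor X (topspace (pts X)) V (pws b X w E) d"
    and mul: "\<And>m n. bimor X (pws b X m E) (pws b X n E) (pws b X (m + n) E) (\<lambda>x. mul x m n)"
    and U: "openin (pts X) U"
  shows "set ss \<subseteq> msects V U \<Longrightarrow>
    (\<lambda>x\<in>U. mult_list (mul x) (d x) (pwp b (stalk X x) (mstalk E x) 0 []) w (map (\<lambda>s. s x) ss))
      \<in> msects (pws b X (length ss * w) E) U"
proof (induction ss)
  case Nil
  have "(\<lambda>x\<in>U. pwp b (stalk X x) (mstalk E x) 0 []) \<in> msects (pws b X 0 E) U"
    using pws_pure_sect[OF X E U, of "[]" 0 b] by simp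
  then show ?case
    by (simp only: list.map mult_list.simps list.size mult_0)
next
  case (Cons s ss)
  have Us: "U \<subseteq> topspace (pts X)"
    by (rule openin_subset[OF U])
  have s: "s \<in> msects V U" and ss: "set ss \<subseteq> msects V U"
    using Cons.prems by auto
  have "(\<lambda>x\<in>U. mul x w (length ss * w) (d x (s x))
      (mult_list (mul x) (d x) (pwp b (stalk X x) (mstalk E x) 0 []) w (map (\<lambda>s. s x) ss)))
    \<in> msects (pws b X (w + length ss * w) E) U"
    using bimor_sect[OF mul U mor_sect[OF d U Us s] Cons.IH[OF ss]] by (simp cong: restrict_cong)
  then show ?case
    by (simp only: list.map mult_list.simps length_map length_Cons mult_Suc)
qed

text \<open>The map multiplies the images under \<open>d\<close> of the entries; it is well defined
  on symmetric powers because the product is commutative there.\<close>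

lemma flatten_epi:
  assumes E: "premod X E" and V: "premod X V" and d: "epi X V (pws b X w E) d"
  shows "\<exists>F. epi X (pws b X q V) (pws b X (q * w) E) F"
proof -
  obtain mul where mul: "\<forall>x\<in>topspace (pts X). is_mult b (stalk X x) (mstalk E x) (mul x)"
    "\<forall>m n. bimor X (pws b X m E) (pws b X n E) (pws b X (m + n) E) (\<lambda>x. mul x m n)"
    using pws_mult[OF X E] by blast
  let ?ml = "\<lambda>x. mult_list (mul x) (d x) (pwp b (stalk X x) (mstalk E x) 0 []) w"
  note Em = premod_module[OF E] and Vm = premod_module[OF V]
  have dl: "lin (stalk X x) (mstalk V x) (pw b (stalk X x) (mstalk E x) w) (d x)" if "x \<in> topspace (pts X)" for x
    using mor_lin[OF epi_mor[OF d] that] by simp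
  have "\<forall>x\<in>topspace (pts X). \<exists>F. lin (stalk X x) (pw b (stalk X x) (mstalk V x) q) (pw b (stalk X x) (mstalk E x) (q * w)) F \<and>
      (\<forall>vs\<in>tuples (mstalk V x) q. F (pwp b (stalk X x) (mstalk V x) q vs) = ?ml x vs)"
  proof
    fix x assume x: "x \<in> topspace (pts X)"
    note mx = bspec[OF mul(1) x]
    have sy: "symm_on (mstalk V x) q (?ml x)" if b
      using mult_list_symm[OF Em[OF x] Vm[OF x] dl[OF x] mx that] .
    from pw_lift[OF Vm[OF x] pw_module[OF Em[OF x]] mult_list_multilin[OF Em[OF x] Vm[OF x] dl[OF x] mx] sy]
    show "\<exists>F. lin (stalk X x) (pw b (stalk X x) (mstalk V x) q) (pw b (stalk X x) (mstalk E x) (q * w)) F \<and>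
      (\<forall>vs\<in>tuples (mstalk V x) q. F (pwp b (stalk X x) (mstalk V x) q vs) = ?ml x vs)"
      by metis
  qed
  from bchoice[OF this] obtain F where F: "\<And>x. x \<in> topspace (pts X) \<Longrightarrow>
      lin (stalk X x) (pw b (stalk X x) (mstalk V x) q) (pw b (stalk X x) (mstalk E x) (q * w)) (F x)"
    "\<And>x vs. x \<in> topspace (pts X) \<Longrightarrow> vs \<in> tuples (mstalk V x) q \<Longrightarrow> F x (pwp b (stalk X x) (mstalk V x) q vs) = ?ml x vs"
    by blast
  have "mor X (topspace (pts X)) (pws b X q V) (pws b X (q * w) E) F"
  proof (rule pws_mor[OF X V pws_premod[OF X E] openin_topspace])
    fix U ss assume U: "openin (pts X) U" "U \<subseteq> topspace (pts X)" and ss: "length ss = q" "set ss \<subseteq> msects V U"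
    have "(\<lambda>x\<in>U. F x (pwp b (stalk X x) (mstalk V x) q (map (\<lambda>s. s x) ss))) = (\<lambda>x\<in>U. ?ml x (map (\<lambda>s. s x) ss))"
      using F(2) U(2) sect_tuples[OF X V U(1) ss] by (intro restrict_ext) auto
    then show "(\<lambda>x\<in>U. F x (pwp b (stalk X x) (mstalk V x) q (map (\<lambda>s. s x) ss))) \<in> msects (pws b X (q * w) E) U"
      using mult_list_sect[OF E V epi_mor[OF d] spec[OF spec[OF mul(2)]] U(1) ss(2)] ss(1) by simp
  qed (use F(1) in simp)
  moreover have "F x ` carrier (mstalk (pws b X q V) x) = carrier (mstalk (pws b X (q * w) E) x)" if x: "x \<in> topspace (pts X)" for x
    unfolding mstalk_pws
  proof (rule lin_surj_mspan[OF pw_module[OF Vm[OF x]] pw_module[OF Em[OF x]] F(1)[OF x] _ pw_span[OF Em[OF x]]], rule image_subsetI)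
    fix us assume "us \<in> tuples (mstalk E x) (q * w)"
    then obtain vs where vs: "vs \<in> tuples (mstalk V x) q" "?ml x vs = pwp b (stalk X x) (mstalk E x) (q * w) us"
      using mult_list_surj[OF Em[OF x] Vm[OF x] dl[OF x] bspec[OF mul(1) x] epi_surj[OF d x, unfolded mstalk_pws]] by blast
    then have "pwp b (stalk X x) (mstalk E x) (q * w) us = F x (pwp b (stalk X x) (mstalk V x) q vs)"
      using F(2)[OF x] by simp
    then show "pwp b (stalk X x) (mstalk E x) (q * w) us \<in> F x ` carrier (pw b (stalk X x) (mstalk V x) q)"
      using pwp_closed[OF Vm[OF x] vs(1)] by blast
  qed
  ultimately show ?thesis
    unfolding epi_def by blast
qed

text \<open>A tensor of degree \<open>q * w\<close> is cut into \<open>q\<close> blocks, and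
  \<open>u\<close> is applied to each. The target may be a tensor or a symmetric power.\<close>

lemma chunk_epi:
  assumes E: "premod X E" and V: "premod X V" and u: "epi X (pws False X w E) V u"
  shows "\<exists>F. epi X (pws False X (q * w) E) (pws b X q V) F"
proof -
  note Em = premod_module[OF E] and Vm = premod_module[OF V]
  let ?c = "\<lambda>x us. map (\<lambda>c. u x (pwp False (stalk X x) (mstalk E x) w c)) (chunks w q us)"
  have ul: "lin (stalk X x) (pw False (stalk X x) (mstalk E x) w) (mstalk V x) (u x)" if "x \<in> topspace (pts X)" for x
    using mor_lin[OF epi_mor[OF u] that] by simp
  have "\<forall>x\<in>topspace (pts X). \<exists>F. lin (stalk X x) (pw False (stalk X x) (mstalk E x) (q * w)) (pw b (stalk X x) (mstalk V x) q) F \<and>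
      (\<forall>us\<in>tuples (mstalk E x) (q * w). F (pwp False (stalk X x) (mstalk E x) (q * w) us) = pwp b (stalk X x) (mstalk V x) q (?c x us))"
    using chunk_map_lift[OF Em Vm ul] by blast
  from bchoice[OF this] obtain F where F: "\<And>x. x \<in> topspace (pts X) \<Longrightarrow>
      lin (stalk X x) (pw False (stalk X x) (mstalk E x) (q * w)) (pw b (stalk X x) (mstalk V x) q) (F x)"
    "\<And>x us. x \<in> topspace (pts X) \<Longrightarrow> us \<in> tuples (mstalk E x) (q * w) \<Longrightarrow>
      F x (pwp False (stalk X x) (mstalk E x) (q * w) us) = pwp b (stalk X x) (mstalk V x) q (?c x us)"
    by blast
  have "mor X (topspace (pts X)) (pws False X (q * w) E) (pws b X q V) F"
  proof (rule pws_mor[OF X E pws_premod[OF X V] openin_topspace])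
    fix U ss assume U: "openin (pts X) U" "U \<subseteq> topspace (pts X)" and ss: "length ss = q * w" "set ss \<subseteq> msects E U"
    let ?vs = "map (\<lambda>c. \<lambda>x\<in>U. u x ((\<lambda>x\<in>U. pwp False (stalk X x) (mstalk E x) w (map (\<lambda>s. s x) c)) x)) (chunks w q ss)"
    have "set ?vs \<subseteq> msects V U"
    proof
      fix v assume "v \<in> set ?vs"
      then obtain c where c: "c \<in> set (chunks w q ss)"
        "v = (\<lambda>x\<in>U. u x ((\<lambda>x\<in>U. pwp False (stalk X x) (mstalk E x) w (map (\<lambda>s. s x) c)) x))"
        by auto
      have "length c = w" "set c \<subseteq> msects E U"
        using chunks_length[OF c(1) ss(1)] set_chunks[OF c(1)] ss(2) by auto
      from mor_sect[OF epi_mor[OF u] U pws_pure_sect[OF X E U(1) this]] show "v \<in> msects V U"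
        unfolding c(2) .
    qed
    moreover have "length ?vs = q"
      by (simp add: chunks_def)
    ultimately have "(\<lambda>x\<in>U. pwp b (stalk X x) (mstalk V x) q (map (\<lambda>s. s x) ?vs)) \<in> msects (pws b X q V) U"
      by (intro pws_pure_sect[OF X V U(1)])
    also have "(\<lambda>x\<in>U. pwp b (stalk X x) (mstalk V x) q (map (\<lambda>s. s x) ?vs)) =
        (\<lambda>x\<in>U. F x (pwp False (stalk X x) (mstalk E x) (q * w) (map (\<lambda>s. s x) ss)))"
      using F(2) U(2) sect_tuples[OF X E U(1) ss] by (intro restrict_ext) (auto simp: chunks_map comp_def)
    finally show "(\<lambda>x\<in>U. F x (pwp False (stalk X x) (mstalk E x) (q * w) (map (\<lambda>s. s x) ss))) \<in> msects (pws b X q V) U" .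
  qed (use F(1) in simp)
  moreover have "F x ` carrier (mstalk (pws False X (q * w) E) x) = carrier (mstalk (pws b X q V) x)" if x: "x \<in> topspace (pts X)" for x
    unfolding mstalk_pws
    by (rule chunk_map_surj[OF Em[OF x] Vm[OF x] ul[OF x] F(1)[OF x] F(2)[OF x]])
      (use epi_surj[OF u x] in simp_all)
  ultimately show ?thesis
    unfolding epi_def by blast
qed

lemma pws_quot_epi:
  assumes E: "premod X E"
  shows "\<exists>F. epi X (pws False X m E) (pws True X m E) F"
proof -
  note Em = premod_module[OF E]
  have "\<forall>x\<in>topspace (pts X). \<exists>F. lin (stalk X x) (pw False (stalk X x) (mstalk E x) m) (pw True (stalk X x) (mstalk E x) m) F \<and>
      (\<forall>us\<in>tuples (mstalk E x) m. F (pwp False (stalk X x) (mstalk E x) m us) = pwp True (stalk X x) (mstalk E x) m us)"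
    using pw_quot_lift[OF Em] by blast
  from bchoice[OF this] obtain F where F: "\<And>x. x \<in> topspace (pts X) \<Longrightarrow>
      lin (stalk X x) (pw False (stalk X x) (mstalk E x) m) (pw True (stalk X x) (mstalk E x) m) (F x)"
    "\<And>x us. x \<in> topspace (pts X) \<Longrightarrow> us \<in> tuples (mstalk E x) m \<Longrightarrow>
      F x (pwp False (stalk X x) (mstalk E x) m us) = pwp True (stalk X x) (mstalk E x) m us"
    by blast
  have "mor X (topspace (pts X)) (pws False X m E) (pws True X m E) F"
  proof (rule pws_mor[OF X E pws_premod[OF X E] openin_topspace])
    fix U ss assume U: "openin (pts X) U" "U \<subseteq> topspace (pts X)" and ss: "length ss = m" "set ss \<subseteq> msects E U"
    have "(\<lambda>x\<in>U. F x (pwp False (stalk X x) (mstalk E x) m (map (\<lambda>s. s x) ss))) =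
        (\<lambda>x\<in>U. pwp True (stalk X x) (mstalk E x) m (map (\<lambda>s. s x) ss))"
      using F(2) U(2) sect_tuples[OF X E U(1) ss] by (intro restrict_ext) auto
    then show "(\<lambda>x\<in>U. F x (pwp False (stalk X x) (mstalk E x) m (map (\<lambda>s. s x) ss))) \<in> msects (pws True X m E) U"
      using pws_pure_sect[OF X E U(1) ss] by simp
  qed (use F(1) in simp)
  moreover have "F x ` carrier (mstalk (pws False X m E) x) = carrier (mstalk (pws True X m E) x)" if x: "x \<in> topspace (pts X)" for x
    unfolding mstalk_pws
  proof (rule lin_surj_mspan[OF pw_module[OF Em[OF x]] pw_module[OF Em[OF x]] F(1)[OF x] _ pw_span[OF Em[OF x]]], rule image_subsetI)
    fix us assume us: "us \<in> tuples (mstalk E x) m"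
    then show "pwp True (stalk X x) (mstalk E x) m us \<in> F x ` carrier (pw False (stalk X x) (mstalk E x) m)"
      using F(2)[OF x us] pwp_closed[OF Em[OF x] us, of False] by (metis imageI)
  qed
  ultimately show ?thesis
    unfolding epi_def by blast
qed

lemma pws_one_epi:
  assumes E: "premod X E"
  shows "\<exists>F. epi X (pws False X 1 E) E F"
proof -
  note Em = premod_module[OF E]
  have "\<forall>x\<in>topspace (pts X). \<exists>F. lin (stalk X x) (pw False (stalk X x) (mstalk E x) 1) (mstalk E x) F \<and>
      (\<forall>us\<in>tuples (mstalk E x) 1. F (pwp False (stalk X x) (mstalk E x) 1 us) = hd us)"
    using pw_one_lift[OF Em] by blast
  from bchoice[OF this] obtain F where F: "\<And>x. x \<in> topspace (pts X) \<Longrightarrow>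
      lin (stalk X x) (pw False (stalk X x) (mstalk E x) 1) (mstalk E x) (F x)"
    "\<And>x us. x \<in> topspace (pts X) \<Longrightarrow> us \<in> tuples (mstalk E x) 1 \<Longrightarrow>
      F x (pwp False (stalk X x) (mstalk E x) 1 us) = hd us"
    by blast
  have "mor X (topspace (pts X)) (pws False X 1 E) E F"
  proof (rule pws_mor[OF X E E openin_topspace F(1)])
    fix U ss assume U: "openin (pts X) U" "U \<subseteq> topspace (pts X)" and ss: "length ss = 1" "set ss \<subseteq> msects E U"
    then obtain s where s: "ss = [s]" "s \<in> msects E U"
      by (cases ss) auto
    have "(\<lambda>x\<in>U. F x (pwp False (stalk X x) (mstalk E x) 1 (map (\<lambda>s. s x) ss))) = restrict s U"
    proof (rule restrict_ext)
      fix x assume xU: "x \<in> U"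
      then have "x \<in> topspace (pts X)"
        using U(2) by blast
      from F(2)[OF this sect_tuples[OF X E U(1) ss xU]]
      show "F x (pwp False (stalk X x) (mstalk E x) 1 (map (\<lambda>s. s x) ss)) = s x"
        by (simp add: s(1))
    qed
    then show "(\<lambda>x\<in>U. F x (pwp False (stalk X x) (mstalk E x) 1 (map (\<lambda>s. s x) ss))) \<in> msects E U"
      using PiE_restrict[OF premod_sect_PiE[OF E U(1) s(2)]] s(2) by simp
  qed
  moreover have "F x ` carrier (mstalk (pws False X 1 E) x) = carrier (mstalk E x)" if x: "x \<in> topspace (pts X)" for x
  proof
    show "F x ` carrier (mstalk (pws False X 1 E) x) \<subseteq> carrier (mstalk E x)"
      using lin_closed[OF F(1)[OF x]] by auto
    show "carrier (mstalk E x) \<subseteq> F x ` carrier (mstalk (pws False X 1 E) x)"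
    proof
      fix e assume e: "e \<in> carrier (mstalk E x)"
      then have t: "[e] \<in> tuples (mstalk E x) 1"
        by (simp add: tuples_def)
      have "e = F x (pwp False (stalk X x) (mstalk E x) 1 [e])"
        using F(2)[OF x t] by simp
      then show "e \<in> F x ` carrier (mstalk (pws False X 1 E) x)"
        using pwp_closed[OF Em[OF x] t, of False] by (metis imageI mstalk_pws)
    qed
  qed
  ultimately show ?thesis
    unfolding epi_def by blast
qed

lemma one_pws_epi:
  assumes E: "premod X E"
  shows "epi X E (pws b X 1 E) (\<lambda>x u. pwp b (stalk X x) (mstalk E x) 1 [u])"
  unfolding epi_def mor_def mstalk_pws
proof (intro conjI ballI allI impI)
  fix U s assume U: "openin (pts X) U \<and> U \<subseteq> topspace (pts X) \<and> s \<in> msects E U"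
  then show "(\<lambda>x\<in>U. pwp b (stalk X x) (mstalk E x) 1 [s x]) \<in> msects (pws b X 1 E) U"
    using pws_pure_sect[OF X E, of U "[s]" 1 b] by simp
qed (rule pw_one_lin pw_one_surj; rule premod_module[OF E]; assumption)+

lemma tensorial_self: "premod X E \<Longrightarrow> tensorial X E 1 E"
  using one_pws_epi pws_one_epi unfolding tensorial_def by blast

lemma tensorial_spow: "premod X E \<Longrightarrow> tensorial X E c (spow X c E)"
  unfolding tensorial_def spow_pws using pws_premod[OF X] epi_id pws_quot_epi by blast

lemma tensorial_tpow: "premod X E \<Longrightarrow> tensorial X E c (tpow X c E)"
  unfolding tensorial_def tpow_pws using pws_premod[OF X] epi_id pws_quot_epi by blast

text \<open>\<open>chunk_epi\<close> and \<open>flatten_epi\<close> place S^q V between the tensor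
  and the symmetric power of degree \<open>q * w\<close>; weights multiply.\<close>

lemma tensorial_spow_tensorial:
  assumes E: "premod X E" and V: "tensorial X E w V"
  shows "tensorial X E (q * w) (spow X q V)"
proof -
  obtain d u where V': "premod X V" and d: "epi X V (pws True X w E) d" and u: "epi X (pws False X w E) V u"
    using V unfolding tensorial_def by blast
  show ?thesis
    unfolding tensorial_def spow_pws
    using pws_premod[OF X V'] flatten_epi[OF E V' d] chunk_epi[OF E V' u] by blast
qed

end

section \<open>Base loci\<close>

lemma self_module_module: "cring R \<Longrightarrow> module R (self_module R)"
proof (rule moduleI)
  assume R: "cring R"
  note f = cring_facts[OF R] abelian_ac[OF cring_abelian_group[OF R]]
  show "abelian_group (self_module R)"
  proof (rule abelian_groupI)
    fix a assume "a \<in> carrier (self_module R)"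
    then show "\<exists>b\<in>carrier (self_module R). b \<oplus>\<^bsub>self_module R\<^esub> a = \<zero>\<^bsub>self_module R\<^esub>"
      by (intro bexI[of _ "\<ominus>\<^bsub>R\<^esub> a"]) (simp_all add: self_module_def f)
  qed (simp_all add: self_module_def f)
qed (simp_all add: self_module_def cring_facts ring.ring_simprules(13,23)[OF cring_ring] cring_m_ac(1))

context
  fixes X :: "('p, 'r) rspace" and x :: 'p
  assumes X: "ringed_space X" and x: "x \<in> topspace (pts X)"
    and I: "ideal (max_ideal X x) (stalk X x)"
begin

lemma max_ideal_submodule: "submodule (max_ideal X x) (stalk X x) (self_module (stalk X x))"
proof (rule submodI[OF self_module_module[OF stalk_cring[OF X x]]])
  note a = ideal.axioms(1)[OF I]
  show "\<zero>\<^bsub>self_module (stalk X x)\<^esub> \<in> max_ideal X x"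
    using additive_subgroup.zero_closed[OF a] by (simp add: self_module_def)
  fix u assume u: "u \<in> max_ideal X x"
  {
    fix v assume "v \<in> max_ideal X x"
    then show "u \<oplus>\<^bsub>self_module (stalk X x)\<^esub> v \<in> max_ideal X x"
      using additive_subgroup.a_closed[OF a u] by (simp add: self_module_def)
  }
  fix c assume "c \<in> carrier (stalk X x)"
  then show "c \<odot>\<^bsub>self_module (stalk X x)\<^esub> u \<in> max_ideal X x"
    using ideal.I_l_closed[OF I u] by (simp add: self_module_def)
qed (auto simp: max_ideal_def self_module_def)

lemma residue_module: "module (stalk X x) (residue_field X x)"
  unfolding residue_field_def
  by (rule quot_module_module[OF self_module_module[OF stalk_cring[OF X x]] max_ideal_submodule])

abbreviation (input) "res a \<equiv> max_ideal X x +>\<^bsub>stalk X x\<^esub> a"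

lemma res_self: "res a = max_ideal X x +>\<^bsub>self_module (stalk X x)\<^esub> a"
  by (simp add: a_r_coset_def' self_module_def)

lemma res_lin: "lin (stalk X x) (self_module (stalk X x)) (residue_field X x) (\<lambda>a. res a)"
  unfolding residue_field_def res_self
  by (rule quot_lin[OF self_module_module[OF stalk_cring[OF X x]] max_ideal_submodule])

lemma residueE:
  assumes "k \<in> carrier (residue_field X x)"
  obtains a where "a \<in> carrier (stalk X x)" "k = a \<odot>\<^bsub>residue_field X x\<^esub> res \<one>\<^bsub>stalk X x\<^esub>"
proof -
  obtain a where a: "a \<in> carrier (stalk X x)" "k = res a"
    using assms quot_carrierE[OF self_module_module[OF stalk_cring[OF X x]] max_ideal_submodule, of k]
    unfolding residue_field_def res_self by (auto simp: self_module_def)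
  have "res (a \<odot>\<^bsub>self_module (stalk X x)\<^esub> \<one>\<^bsub>stalk X x\<^esub>) = a \<odot>\<^bsub>residue_field X x\<^esub> res \<one>\<^bsub>stalk X x\<^esub>"
    using a(1) cring_facts[OF stalk_cring[OF X x]] by (intro lin_smult[OF res_lin]) (simp_all add: self_module_def)
  then show thesis
    using a cring_facts[OF stalk_cring[OF X x]] by (intro that[OF a(1)]) (simp add: self_module_def)
qed

lemma res_one: "res \<one>\<^bsub>stalk X x\<^esub> \<in> carrier (residue_field X x)"
  using cring_facts[OF stalk_cring[OF X x]] by (intro lin_closed[OF res_lin]) (simp add: self_module_def)

lemma res_max:
  assumes a: "a \<in> max_ideal X x"
  shows "a \<odot>\<^bsub>residue_field X x\<^esub> res \<one>\<^bsub>stalk X x\<^esub> = \<zero>\<^bsub>residue_field X x\<^esub>"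
proof -
  note f = cring_facts[OF stalk_cring[OF X x]]
  have ac: "a \<in> carrier (stalk X x)"
    using a by (simp add: max_ideal_def)
  have "a \<odot>\<^bsub>residue_field X x\<^esub> res \<one>\<^bsub>stalk X x\<^esub> = res (a \<odot>\<^bsub>self_module (stalk X x)\<^esub> \<one>\<^bsub>stalk X x\<^esub>)"
    using ac f by (intro lin_smult[OF res_lin, symmetric]) (simp_all add: self_module_def)
  also have "\<dots> = res a"
    using ac f by (simp add: self_module_def)
  also have "\<dots> = max_ideal X x"
    unfolding res_self
    by (rule quot_coset_zero_iff[OF self_module_module[OF stalk_cring[OF X x]] max_ideal_submodule, THEN iffD2])
      (use a ac in \<open>simp_all add: self_module_def\<close>)
  finally show ?thesis
    by (simp add: residue_field_def quot_module_simps)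
qed

text \<open>The scalar moves across the tensor product to the residue class of one, where it acts as
  zero.\<close>

lemma fibre_max:
  assumes M: "module (stalk X x) (mstalk M x)" and a: "a \<in> max_ideal X x" and u: "u \<in> carrier (mstalk M x)"
  shows "pt (stalk X x) (mstalk M x) (residue_field X x) (a \<odot>\<^bsub>mstalk M x\<^esub> u) (res \<one>\<^bsub>stalk X x\<^esub>) = \<zero>\<^bsub>fibre X M x\<^esub>"
proof -
  note b = pt_bilin[OF M residue_module]
  have ac: "a \<in> carrier (stalk X x)"
    using a by (simp add: max_ideal_def)
  have "pt (stalk X x) (mstalk M x) (residue_field X x) (a \<odot>\<^bsub>mstalk M x\<^esub> u) (res \<one>\<^bsub>stalk X x\<^esub>) =
      pt (stalk X x) (mstalk M x) (residue_field X x) u (a \<odot>\<^bsub>residue_field X x\<^esub> res \<one>\<^bsub>stalk X x\<^esub>)"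
    using lin_smult[OF bilin_lin1[OF b res_one] ac u] lin_smult[OF bilin_lin2[OF b u] ac res_one] by simp
  then show ?thesis
    using lin_zero[OF residue_module tensor_module_module[OF M residue_module] bilin_lin2[OF b u]]
    by (simp add: res_max[OF a] fibre_def)
qed

text \<open>The fibre is identified with the stalk modulo the maximal ideal, as far as spans are
  concerned: u maps to u tensored with one in one direction, and back to the quotient by
  \<open>germ_span\<close> in the other.\<close>

lemma Bs_iff_not_gg:
  assumes M: "premod X M"
  shows "x \<in> Bs X M \<longleftrightarrow> \<not> gg X x M"
proof -
  let ?R = "stalk X x" and ?M = "mstalk M x" and ?K = "residue_field X x" and ?F = "fibre X M x"
  let ?S = "fibre_value X M x ` global_sections X M" and ?H = "germ_span X x M"
  let ?pt = "\<lambda>u. pt ?R ?M ?K u (res \<one>\<^bsub>?R\<^esub>)"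
  note Mm = premod_module[OF M x] and K = residue_module
  have F: "module ?R ?F"
    unfolding fibre_def by (rule tensor_module_module[OF Mm K])
  have b: "bilin ?R ?M ?K ?F (pt ?R ?M ?K)"
    unfolding fibre_def by (rule pt_bilin[OF Mm K])
  note l1 = bilin_lin1[OF b res_one]
  have germ: "s x \<in> carrier ?M" if "s \<in> global_sections X M" for s
    by (rule premod_germ[OF M openin_topspace that x])
  have fv: "fibre_value X M x s = ?pt (s x)" for s
    by (simp add: fibre_value_def)
  have S: "?S \<subseteq> carrier ?F"
    using lin_closed[OF l1 germ] by (auto simp: fv)
  note H = germ_span_submodule[OF X x M]
  note Ssub = mspan_submodule[OF F S]
  have "mspan ?R ?F ?S = carrier ?F \<longleftrightarrow> gg X x M"
  proof
    assume g: "gg X x M"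
    \<comment> \<open>On germs of sections this is the value in the fibre, and on multiples of the
      maximal ideal it is zero.\<close>
    have 1: "?pt u \<in> mspan ?R ?F ?S" if u: "u \<in> carrier ?M" for u
    proof (rule lin_mspan_sub[OF Mm F l1 Ssub germ_span_gens[OF X x M]])
      show "u \<in> mspan ?R ?M ({s x |s. s \<in> global_sections X M} \<union> {a \<odot>\<^bsub>?M\<^esub> u |a u. a \<in> max_ideal X x \<and> u \<in> carrier ?M})"
        using g u unfolding gg_def germ_span_def by blast
      fix v assume "v \<in> {s x |s. s \<in> global_sections X M} \<union> {a \<odot>\<^bsub>?M\<^esub> u |a u. a \<in> max_ideal X x \<and> u \<in> carrier ?M}"
      then consider s where "s \<in> global_sections X M" "v = s x"
        | a w where "a \<in> max_ideal X x" "w \<in> carrier ?M" "v = a \<odot>\<^bsub>?M\<^esub> w"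
        by blast
      then show "?pt v \<in> mspan ?R ?F ?S"
      proof cases
        case 1
        then show ?thesis
          using fv[of s] by (intro subsetD[OF mspan_incl]) (metis imageI)
      next
        case 2
        then show ?thesis
          using fibre_max[OF Mm 2(1,2)] submod_zero[OF Ssub] by simp
      qed
    qed
    have "{pt ?R ?M ?K u k |u k. u \<in> carrier ?M \<and> k \<in> carrier ?K} \<subseteq> mspan ?R ?F ?S"
    proof
      fix p assume "p \<in> {pt ?R ?M ?K u k |u k. u \<in> carrier ?M \<and> k \<in> carrier ?K}"
      then obtain u k where p: "p = pt ?R ?M ?K u k" "u \<in> carrier ?M" "k \<in> carrier ?K"
        by blast
      obtain a where a: "a \<in> carrier ?R" "k = a \<odot>\<^bsub>?K\<^esub> res \<one>\<^bsub>?R\<^esub>"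
        by (rule residueE[OF p(3)])
      have "p = a \<odot>\<^bsub>?F\<^esub> ?pt u"
        unfolding p(1) a(2) by (rule lin_smult[OF bilin_lin2[OF b p(2)] a(1) res_one])
      then show "p \<in> mspan ?R ?F ?S"
        using submod_smult[OF Ssub a(1) 1[OF p(2)]] by simp
    qed
    from mspan_least[OF Ssub this] show "mspan ?R ?F ?S = carrier ?F"
      using tensor_span[OF Mm K order.refl mspan_carrier[OF K]] mspan_sub[OF F S] unfolding fibre_def by blast
  next
    assume eq: "mspan ?R ?F ?S = carrier ?F"
    \<comment> \<open>A linear map from the fibre to this quotient is built with u tensored with the
      class of a going to a u. It is well defined as \<open>?H\<close> absorbs the maximal ideal. It
      kills the values of sections, hence everything, so each u is in \<open>?H\<close>.\<close>
    let ?Q = "quot_module ?M ?H"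
    note Q = quot_module_module[OF Mm H] and ql = quot_lin[OF Mm H] and q0 = quot_coset_zero_iff[OF Mm H]
    note Self = self_module_module[OF stalk_cring[OF X x]]
    have "\<exists>g. lin ?R ?K ?Q g \<and> (\<forall>a\<in>carrier ?R. g (res a) = ?H +>\<^bsub>?M\<^esub> (a \<odot>\<^bsub>?M\<^esub> u))" if u: "u \<in> carrier ?M" for u
    proof -
      have "lin ?R (self_module ?R) ?M (\<lambda>a. a \<odot>\<^bsub>?M\<^esub> u)"
        using u by (intro linI) (simp_all add: self_module_def module_facts[OF Mm] module.smult_assoc1[OF Mm])
      from lin_comp[OF this ql] have l: "lin ?R (self_module ?R) ?Q (\<lambda>a. ?H +>\<^bsub>?M\<^esub> (a \<odot>\<^bsub>?M\<^esub> u))" .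
      have "?H +>\<^bsub>?M\<^esub> (a \<odot>\<^bsub>?M\<^esub> u) = \<zero>\<^bsub>?Q\<^esub>" if a: "a \<in> max_ideal X x" for a
        using q0[OF module.smult_closed[OF Mm max_ideal_carrier[OF X x a] u]] max_smult_in_span[OF X x a u]
        by (simp add: quot_module_simps)
      from quot_lift[OF Self max_ideal_submodule Q l this] show ?thesis
        unfolding residue_field_def res_self by (simp add: self_module_def)
    qed
    then obtain g where g: "\<And>u. u \<in> carrier ?M \<Longrightarrow> lin ?R ?K ?Q (g u)"
      and gp: "\<And>u a. u \<in> carrier ?M \<Longrightarrow> a \<in> carrier ?R \<Longrightarrow> g u (res a) = ?H +>\<^bsub>?M\<^esub> (a \<odot>\<^bsub>?M\<^esub> u)"
      by metis
    have one: "\<one>\<^bsub>?R\<^esub> \<in> carrier ?R"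
      using cring_facts[OF stalk_cring[OF X x]] by simp
    have "carrier ?K \<subseteq> mspan ?R ?K {res \<one>\<^bsub>?R\<^esub>}"
    proof
      fix k assume "k \<in> carrier ?K"
      then obtain a where a: "a \<in> carrier ?R" "k = a \<odot>\<^bsub>?K\<^esub> res \<one>\<^bsub>?R\<^esub>"
        by (rule residueE)
      have "res \<one>\<^bsub>?R\<^esub> \<in> mspan ?R ?K {res \<one>\<^bsub>?R\<^esub>}"
        using mspan_incl[of "{res \<one>\<^bsub>?R\<^esub>}"] by blast
      then show "k \<in> mspan ?R ?K {res \<one>\<^bsub>?R\<^esub>}"
        unfolding a(2) using res_one by (intro submod_smult[OF mspan_submodule[OF K] a(1)]) auto
    qed
    then have Kspan: "mspan ?R ?K {res \<one>\<^bsub>?R\<^esub>} = carrier ?K"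
      using res_one by (intro mspan_eqI[OF K]) auto
    \<comment> \<open>Linearity in \<open>u\<close> needs to be checked only at the class of one,
      which spans the residue field; there the map is the projection to the quotient.\<close>
    have gb: "bilin ?R ?K ?M ?Q (\<lambda>k u. g u k)"
    proof (rule bilin_family[OF K Mm Q _ Kspan g])
      fix k assume "k \<in> {res \<one>\<^bsub>?R\<^esub>}"
      then have k: "k = res \<one>\<^bsub>?R\<^esub>"
        by simp
      show "lin ?R ?M ?Q (\<lambda>u. g u k)"
        by (rule lin_cong[OF Mm ql]) (use gp one in \<open>simp add: k module_facts[OF Mm]\<close>)
    qed (use res_one in auto)
    have "bilin ?R ?M ?K ?Q g"
      by (rule bilinI[OF bilin_lin2[OF gb] bilin_lin1[OF gb]])
    from tensor_lift[OF Mm K Q this] obtain f where f: "lin ?R ?F ?Q f"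
        "\<And>u k. u \<in> carrier ?M \<Longrightarrow> k \<in> carrier ?K \<Longrightarrow> f (pt ?R ?M ?K u k) = g u k"
      unfolding fibre_def by blast
    have fp: "f (?pt u) = ?H +>\<^bsub>?M\<^esub> u" if "u \<in> carrier ?M" for u
      using f(2)[OF that res_one] gp[OF that one] that by (simp add: module_facts[OF Mm])
    have Z: "submodule {\<zero>\<^bsub>?Q\<^esub>} ?R ?Q"
      by (rule submodI[OF Q]) (simp_all add: module_facts[OF Q])
    show "gg X x M"
      unfolding gg_def
    proof
      fix u assume u: "u \<in> carrier ?M"
      have "f (?pt u) \<in> {\<zero>\<^bsub>?Q\<^esub>}"
      proof (rule lin_mspan_sub[OF F Q f(1) Z S])
        show "?pt u \<in> mspan ?R ?F ?S"
          unfolding eq by (rule lin_closed[OF l1 u])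
        fix v assume "v \<in> ?S"
        then obtain s where s: "s \<in> global_sections X M" "v = ?pt (s x)"
          by (auto simp: fv)
        then show "f v \<in> {\<zero>\<^bsub>?Q\<^esub>}"
          using fp[OF germ[OF s(1)]] q0[OF germ[OF s(1)]] germ_in_span[OF X x s(1)] by (simp add: quot_module_simps)
      qed
      then show "u \<in> ?H"
        using fp[OF u] q0[OF u] by (simp add: quot_module_simps)
    qed
  qed
  then show ?thesis
    using x unfolding Bs_def by simp
qed

end

section \<open>Stalks of projective varieties\<close>

definition mono_deg :: "(nat \<Rightarrow>\<^sub>0 nat) \<Rightarrow> nat" where
  "mono_deg \<alpha> = (\<Sum>i\<in>Poly_Mapping.keys \<alpha>. Poly_Mapping.lookup \<alpha> i)"

lemma mono_deg_add: "mono_deg (\<alpha> + \<beta>) = mono_deg \<alpha> + mono_deg \<beta>"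
proof -
  let ?A = "Poly_Mapping.keys \<alpha> \<union> Poly_Mapping.keys \<beta>"
  have sup: "mono_deg \<gamma> = (\<Sum>i\<in>?A. Poly_Mapping.lookup \<gamma> i)" if "Poly_Mapping.keys \<gamma> \<subseteq> ?A" for \<gamma>
    unfolding mono_deg_def by (rule sum.mono_neutral_left) (use that in \<open>auto simp: in_keys_iff\<close>)
  show ?thesis
    using keys_add[of \<alpha> \<beta>] by (simp add: sup lookup_add sum.distrib)
qed

lemma homog_iff: "homog d f \<longleftrightarrow> (\<forall>\<alpha>\<in>Poly_Mapping.keys f. mono_deg \<alpha> = d)"
  by (simp add: homog_def mono_deg_def)

lemma homog_mult: "homog d f \<Longrightarrow> homog e g \<Longrightarrow> homog (d + e) (f * g)"
  using keys_mult[of f g] by (fastforce simp: homog_iff mono_deg_add)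

lemma homog_add: "homog d f \<Longrightarrow> homog d g \<Longrightarrow> homog d (f + g)"
  using keys_add[of f g] by (auto simp: homog_iff)

lemma homog_const: "homog 0 (Poly_Mapping.single 0 c)"
  by (auto simp: homog_iff mono_deg_def)

lemma poly_ring_simps:
  "a \<otimes>\<^bsub>poly_ring n\<^esub> b = a * b" "a \<oplus>\<^bsub>poly_ring n\<^esub> b = a + b" "\<one>\<^bsub>poly_ring n\<^esub> = 1" "\<zero>\<^bsub>poly_ring n\<^esub> = 0"
  by (simp_all add: poly_ring_def)

lemma poly_ring_const: "Poly_Mapping.single 0 c \<in> carrier (poly_ring n)"
  by (auto simp: poly_ring_def)

text \<open>The set of admissible pairs at the point \<open>Q\<close> in the definition of
  \<open>Proj\<close>.\<close>

definition dom_frac :: "nat \<Rightarrow> 'k::field polyn set \<Rightarrow> ('k polyn \<times> 'k polyn) set" where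
  "dom_frac n Q = {(f, g). f \<in> carrier (poly_ring n) \<and> g \<in> carrier (poly_ring n) - Q \<and> (\<exists>d. homog d f \<and> homog d g)}"

section \<open>Arithmetic of fractions of degree zero at a point of Proj\<close>

context
  fixes n :: nat and P Q :: "'k::field_char_0 polyn set"
  assumes P: "homog_prime n P" and Q: "homog_prime n Q" and PQ: "P \<subseteq> Q"
begin

abbreviation (input) "PR \<equiv> (poly_ring n :: 'k polyn ring)"

abbreviation (input) "fr \<equiv> frac PR P (dom_frac n Q)"
abbreviation (input) "FR \<equiv> frac_ring PR P (dom_frac n Q)"

lemma P_prime: "primeideal P PR" and Q_prime: "primeideal Q PR"
  using P Q by (auto simp: homog_prime_def)

lemma PR_cring: "cring PR"
  using P_prime by (rule primeideal.axioms)

lemma PR_closed: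
  "a \<in> carrier PR \<Longrightarrow> b \<in> carrier PR \<Longrightarrow> a * b \<in> carrier PR"
  "a \<in> carrier PR \<Longrightarrow> b \<in> carrier PR \<Longrightarrow> a + b \<in> carrier PR"
  "1 \<in> carrier PR" "0 \<in> carrier PR"
  using cring_facts(9,2,10,1)[OF PR_cring] by (simp_all add: poly_ring_simps)

lemma PR_minus:
  assumes "a \<in> carrier PR" "b \<in> carrier PR"
  shows "a \<ominus>\<^bsub>PR\<^esub> b = a - b"
proof -
  have "- b \<in> carrier PR"
    using assms(2) by (simp add: poly_ring_def)
  then have "\<ominus>\<^bsub>PR\<^esub> b = - b"
    using assms(2) by (intro abelian_group.minus_equality[OF cring_abelian_group[OF PR_cring]])
      (simp_all add: poly_ring_simps)
  then show ?thesis
    by (simp add: a_minus_def poly_ring_simps)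
qed

lemma PR_diff_closed: "a \<in> carrier PR \<Longrightarrow> b \<in> carrier PR \<Longrightarrow> a - b \<in> carrier PR"
  using PR_minus cring_facts(8)[OF PR_cring] by metis

lemma prime_facts:
  assumes "J \<in> {P, Q}"
  shows "a \<in> J \<Longrightarrow> b \<in> J \<Longrightarrow> a + b \<in> J"
    and "c \<in> carrier PR \<Longrightarrow> a \<in> J \<Longrightarrow> c * a \<in> J"
    and "a \<in> carrier PR \<Longrightarrow> b \<in> carrier PR \<Longrightarrow> a * b \<in> J \<Longrightarrow> a \<in> J \<or> b \<in> J"
    and "0 \<in> J" and "1 \<notin> J" and "a \<in> J \<Longrightarrow> a \<in> carrier PR"
proof -
  have J: "primeideal J PR"
    using assms P_prime Q_prime by auto
  note I = primeideal.axioms(1)[OF J]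
  note A = ideal.axioms(1)[OF I]
  show "a \<in> J \<Longrightarrow> b \<in> J \<Longrightarrow> a + b \<in> J"
    using additive_subgroup.a_closed[OF A] by (simp add: poly_ring_simps)
  show "c \<in> carrier PR \<Longrightarrow> a \<in> J \<Longrightarrow> c * a \<in> J"
    using ideal.I_l_closed[OF I] by (simp add: poly_ring_simps)
  show "a \<in> carrier PR \<Longrightarrow> b \<in> carrier PR \<Longrightarrow> a * b \<in> J \<Longrightarrow> a \<in> J \<or> b \<in> J"
    using primeideal.I_prime[OF J] by (simp add: poly_ring_simps)
  show "0 \<in> J"
    using additive_subgroup.zero_closed[OF A] by (simp add: poly_ring_simps)
  show "a \<in> J \<Longrightarrow> a \<in> carrier PR"
    using additive_subgroup.a_Hcarr[OF A] .
  show "1 \<notin> J"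
    using ideal.one_imp_carrier[OF I] primeideal.I_notcarr[OF J] by (auto simp: poly_ring_simps)
qed

lemmas P_facts = prime_facts[of P, simplified] and Q_facts = prime_facts[of Q, simplified]

lemma dom_fracD:
  assumes "(a, b) \<in> (dom_frac n Q)"
  shows "a \<in> carrier PR" "b \<in> carrier PR" "b \<notin> Q" "b \<notin> P"
  using assms PQ by (auto simp: dom_frac_def)

lemma dom_frac_const: "(Poly_Mapping.single 0 c, 1) \<in> (dom_frac n Q)"
  using poly_ring_const PR_closed Q_facts(5) homog_const[of c] homog_const[of 1]
  by (auto simp: dom_frac_def)

lemma dom_frac_mult:
  assumes "(a, b) \<in> (dom_frac n Q)" "(c, d) \<in> (dom_frac n Q)"
  shows "(a * c, b * d) \<in> (dom_frac n Q)"
  using assms Q_facts(3)[of b d] PR_closed homog_mult by (fastforce simp: dom_frac_def)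

lemma dom_frac_add:
  assumes "(a, b) \<in> (dom_frac n Q)" "(c, d) \<in> (dom_frac n Q)"
  shows "(a * d + c * b, b * d) \<in> (dom_frac n Q)"
proof -
  obtain e e' where "homog e a" "homog e b" "homog e' c" "homog e' d"
    using assms by (auto simp: dom_frac_def)
  then have "homog (e + e') (a * d + c * b)" "homog (e + e') (b * d)"
    using homog_mult[of e a e' d] homog_mult[of e' c e b] homog_mult[of e b e' d]
    by (auto simp: add.commute intro: homog_add)
  then show ?thesis
    using assms Q_facts(3)[of b d] PR_closed by (auto simp: dom_frac_def)
qed

text \<open>The auxiliary denominator \<open>t\<close> in \<open>frac\<close> lies outside
  \<open>Q\<close>, hence outside the smaller prime \<open>P\<close>, and can be cancelled.\<close>

lemma fr_iff:
  assumes "(a, b) \<in> (dom_frac n Q)"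
  shows "(c, d) \<in> fr a b \<longleftrightarrow> (c, d) \<in> (dom_frac n Q) \<and> a * d - c * b \<in> P"
proof (cases "(c, d) \<in> (dom_frac n Q)")
  case True
  note ab = dom_fracD[OF assms] and cd = dom_fracD[OF True]
  have cl: "a * d \<in> carrier PR" "c * b \<in> carrier PR"
    using PR_closed ab cd by auto
  have "(\<exists>t\<in>snd ` (dom_frac n Q). t * (a * d - c * b) \<in> P) \<longleftrightarrow> a * d - c * b \<in> P"
  proof
    assume "\<exists>t\<in>snd ` (dom_frac n Q). t * (a * d - c * b) \<in> P"
    then obtain s t where t: "(s, t) \<in> (dom_frac n Q)" "t * (a * d - c * b) \<in> P"
      by auto
    then show "a * d - c * b \<in> P"
      using P_facts(3)[OF dom_fracD(2)[OF t(1)] PR_diff_closed[OF cl] t(2)] dom_fracD(4)[OF t(1)] by blast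
  next
    assume "a * d - c * b \<in> P"
    then have "d * (a * d - c * b) \<in> P"
      using P_facts(2) cd by blast
    then show "\<exists>t\<in>snd ` (dom_frac n Q). t * (a * d - c * b) \<in> P"
      using True by (intro bexI[of _ d]) (auto intro: image_eqI[of _ _ "(c, d)"])
  qed
  then show ?thesis
    using True by (simp add: frac_def PR_minus[OF cl] poly_ring_simps)
qed (simp add: frac_def)

text \<open>Transitivity of the cross-multiplication relation: for a third fraction e/f, a
  combination of the two cross differences is b times the third, and the denominator b is not in the
  prime \<open>P\<close>.\<close>

lemma fr_eqI:
  assumes ab: "(a, b) \<in> (dom_frac n Q)" and cd: "(c, d) \<in> (dom_frac n Q)" and eq: "a * d - c * b \<in> P"
  shows "fr a b = fr c d"
proof -
  have sub: "fr a b \<subseteq> fr c d" if ab: "(a, b) \<in> (dom_frac n Q)" and cd: "(c, d) \<in> (dom_frac n Q)" and eq: "a * d - c * b \<in> P" for a b c d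
  proof
    fix p assume p: "p \<in> fr a b"
    obtain e f where ef: "p = (e, f)"
      by (cases p)
    have D: "(e, f) \<in> (dom_frac n Q)" and P1: "a * f - e * b \<in> P"
      using p fr_iff[OF ab] unfolding ef by auto
    note c1 = dom_fracD[OF ab] and c2 = dom_fracD[OF cd] and c3 = dom_fracD[OF D]
    have "- f \<in> carrier PR"
      using c3(2) by (simp add: poly_ring_def)
    then have "d * (a * f - e * b) + (- f) * (a * d - c * b) \<in> P"
      using P_facts(1,2) P1 eq c2 by blast
    also have "d * (a * f - e * b) + (- f) * (a * d - c * b) = b * (c * f - e * d)"
      by (simp add: algebra_simps)
    finally have "b * (c * f - e * d) \<in> P" .
    moreover have "c * f - e * d \<in> carrier PR"
      by (intro PR_diff_closed PR_closed c2 c3)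
    ultimately have "c * f - e * d \<in> P"
      using P_facts(3)[OF c1(2)] c1(4) by blast
    then show "p \<in> fr c d"
      using D fr_iff[OF cd] by (simp add: ef)
  qed
  have "- 1 \<in> carrier PR"
    using PR_closed(3) by (simp add: poly_ring_def)
  then have "(- 1) * (a * d - c * b) \<in> P"
    using P_facts(2) eq by blast
  then have "c * b - a * d \<in> P"
    by simp
  then show ?thesis
    using sub[OF ab cd eq] sub[OF cd ab] by blast
qed

lemma fr_self: "(a, b) \<in> (dom_frac n Q) \<Longrightarrow> (a, b) \<in> fr a b"
  using fr_iff P_facts(4) by simp

text \<open>The union in \<open>frac_ring\<close> runs over all representatives of both fractions;
  all give the same class.\<close>

lemma FR_mult:
  assumes ab: "(a, b) \<in> (dom_frac n Q)" and cd: "(c, d) \<in> (dom_frac n Q)"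
  shows "fr a b \<otimes>\<^bsub>FR\<^esub> fr c d = fr (a * c) (b * d)"
proof -
  have eq: "fr (a' * c') (b' * d') = fr (a * c) (b * d)" if "(a', b') \<in> fr a b" "(c', d') \<in> fr c d" for a' b' c' d'
  proof (rule fr_eqI[symmetric])
    have h: "(a', b') \<in> (dom_frac n Q)" "a * b' - a' * b \<in> P" "(c', d') \<in> (dom_frac n Q)" "c * d' - c' * d \<in> P"
      using that fr_iff[OF ab] fr_iff[OF cd] by auto
    show "(a * c, b * d) \<in> (dom_frac n Q)" "(a' * c', b' * d') \<in> (dom_frac n Q)"
      using dom_frac_mult ab cd h by auto
    have "c * d' \<in> carrier PR" "a' * b \<in> carrier PR"
      by (intro PR_closed(1) dom_fracD[OF ab] dom_fracD[OF cd] dom_fracD[OF h(1)] dom_fracD[OF h(3)])+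
    then have "(c * d') * (a * b' - a' * b) + (a' * b) * (c * d' - c' * d) \<in> P"
      using P_facts(1,2) h by blast
    also have "(c * d') * (a * b' - a' * b) + (a' * b) * (c * d' - c' * d) = a * c * (b' * d') - a' * c' * (b * d)"
      by (simp add: algebra_simps)
    finally show "a * c * (b' * d') - a' * c' * (b * d) \<in> P" .
  qed
  have "fr a b \<otimes>\<^bsub>FR\<^esub> fr c d = (\<Union>(a', b')\<in>fr a b. \<Union>(c', d')\<in>fr c d. fr (a' * c') (b' * d'))"
    by (simp add: frac_ring_def poly_ring_simps)
  also have "\<dots> = fr (a * c) (b * d)"
  proof
    show "(\<Union>(a', b')\<in>fr a b. \<Union>(c', d')\<in>fr c d. fr (a' * c') (b' * d')) \<subseteq> fr (a * c) (b * d)"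
      using eq by fast
    show "fr (a * c) (b * d) \<subseteq> (\<Union>(a', b')\<in>fr a b. \<Union>(c', d')\<in>fr c d. fr (a' * c') (b' * d'))"
      using fr_self[OF ab] fr_self[OF cd] by fast
  qed
  finally show ?thesis .
qed

lemma FR_add:
  assumes ab: "(a, b) \<in> (dom_frac n Q)" and cd: "(c, d) \<in> (dom_frac n Q)"
  shows "fr a b \<oplus>\<^bsub>FR\<^esub> fr c d = fr (a * d + c * b) (b * d)"
proof -
  have eq: "fr (a' * d' + c' * b') (b' * d') = fr (a * d + c * b) (b * d)" if "(a', b') \<in> fr a b" "(c', d') \<in> fr c d" for a' b' c' d'
  proof (rule fr_eqI[symmetric])
    have h: "(a', b') \<in> (dom_frac n Q)" "a * b' - a' * b \<in> P" "(c', d') \<in> (dom_frac n Q)" "c * d' - c' * d \<in> P"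
      using that fr_iff[OF ab] fr_iff[OF cd] by auto
    show "(a * d + c * b, b * d) \<in> (dom_frac n Q)" "(a' * d' + c' * b', b' * d') \<in> (dom_frac n Q)"
      using dom_frac_add ab cd h by auto
    have "d * d' \<in> carrier PR" "b * b' \<in> carrier PR"
      by (intro PR_closed(1) dom_fracD[OF ab] dom_fracD[OF cd] dom_fracD[OF h(1)] dom_fracD[OF h(3)])+
    then have "(d * d') * (a * b' - a' * b) + (b * b') * (c * d' - c' * d) \<in> P"
      using P_facts(1,2) h by blast
    also have "(d * d') * (a * b' - a' * b) + (b * b') * (c * d' - c' * d) =
        (a * d + c * b) * (b' * d') - (a' * d' + c' * b') * (b * d)"
      by (simp add: algebra_simps)
    finally show "(a * d + c * b) * (b' * d') - (a' * d' + c' * b') * (b * d) \<in> P" .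
  qed
  have "fr a b \<oplus>\<^bsub>FR\<^esub> fr c d = (\<Union>(a', b')\<in>fr a b. \<Union>(c', d')\<in>fr c d. fr (a' * d' + c' * b') (b' * d'))"
    by (simp add: frac_ring_def poly_ring_simps)
  also have "\<dots> = fr (a * d + c * b) (b * d)"
  proof
    show "(\<Union>(a', b')\<in>fr a b. \<Union>(c', d')\<in>fr c d. fr (a' * d' + c' * b') (b' * d')) \<subseteq> fr (a * d + c * b) (b * d)"
      using eq by fast
    show "fr (a * d + c * b) (b * d) \<subseteq> (\<Union>(a', b')\<in>fr a b. \<Union>(c', d')\<in>fr c d. fr (a' * d' + c' * b') (b' * d'))"
      using fr_self[OF ab] fr_self[OF cd] by fast
  qed
  finally show ?thesis .
qed

section \<open>Transport to a ring isomorphic to the local ring\<close>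

context
  fixes R :: "'r ring" and \<phi>
  assumes R: "cring R" and \<phi>: "\<phi> \<in> ring_iso FR R"
begin

lemma \<phi>_closed: "(a, b) \<in> (dom_frac n Q) \<Longrightarrow> \<phi> (fr a b) \<in> carrier R"
  and \<phi>_mult: "(a, b) \<in> (dom_frac n Q) \<Longrightarrow> (c, d) \<in> (dom_frac n Q) \<Longrightarrow> \<phi> (fr a b) \<otimes>\<^bsub>R\<^esub> \<phi> (fr c d) = \<phi> (fr (a * c) (b * d))"
  and \<phi>_add: "(a, b) \<in> (dom_frac n Q) \<Longrightarrow> (c, d) \<in> (dom_frac n Q) \<Longrightarrow> \<phi> (fr a b) \<oplus>\<^bsub>R\<^esub> \<phi> (fr c d) = \<phi> (fr (a * d + c * b) (b * d))"
  and \<phi>_one: "\<phi> (fr 1 1) = \<one>\<^bsub>R\<^esub>"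
proof -
  have cl: "fr a b \<in> carrier FR" if "(a, b) \<in> (dom_frac n Q)" for a b
    using that by (auto simp: frac_ring_def)
  have hom: "\<phi> \<in> ring_hom FR R"
    using \<phi> by (simp add: ring_iso_def)
  show "(a, b) \<in> (dom_frac n Q) \<Longrightarrow> \<phi> (fr a b) \<in> carrier R"
    using ring_hom_closed[OF hom cl] .
  show "(a, b) \<in> (dom_frac n Q) \<Longrightarrow> (c, d) \<in> (dom_frac n Q) \<Longrightarrow> \<phi> (fr a b) \<otimes>\<^bsub>R\<^esub> \<phi> (fr c d) = \<phi> (fr (a * c) (b * d))"
    using ring_hom_mult[OF hom cl cl] FR_mult by metis
  show "(a, b) \<in> (dom_frac n Q) \<Longrightarrow> (c, d) \<in> (dom_frac n Q) \<Longrightarrow> \<phi> (fr a b) \<oplus>\<^bsub>R\<^esub> \<phi> (fr c d) = \<phi> (fr (a * d + c * b) (b * d))"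
    using ring_hom_add[OF hom cl cl] FR_add by metis
  show "\<phi> (fr 1 1) = \<one>\<^bsub>R\<^esub>"
    using ring_hom_one[OF hom] by (simp add: frac_ring_def poly_ring_simps)
qed

lemma \<phi>_surj: "u \<in> carrier R \<Longrightarrow> \<exists>a b. (a, b) \<in> (dom_frac n Q) \<and> u = \<phi> (fr a b)"
proof -
  assume u: "u \<in> carrier R"
  have "\<phi> ` carrier FR = carrier R"
    using \<phi> by (auto simp: ring_iso_def bij_betw_def)
  then obtain p where "p \<in> carrier FR" "u = \<phi> p"
    using u by blast
  then show ?thesis
    by (auto simp: frac_ring_def)
qed

lemma one_dom: "(1, 1) \<in> (dom_frac n Q)"
  using dom_frac_const[of 1] by simp

text \<open>If \<open>a\<close> is outside \<open>Q\<close>, the inverse is b/a. Conversely an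
  inverse c/d gives a c - b d in \<open>P\<close>, so in \<open>Q\<close>; with \<open>a\<close> in
  \<open>Q\<close> this would put the product of the denominators b and d into the prime
  \<open>Q\<close>.\<close>

lemma unit_iff:
  assumes ab: "(a, b) \<in> (dom_frac n Q)"
  shows "\<phi> (fr a b) \<in> Units R \<longleftrightarrow> a \<notin> Q"
proof
  assume "a \<notin> Q"
  then have ba: "(b, a) \<in> (dom_frac n Q)"
    using ab by (auto simp: dom_frac_def)
  have "fr (a * b) (b * a) = fr 1 1"
    by (rule fr_eqI[OF dom_frac_mult[OF ab ba] one_dom]) (simp add: P_facts(4) mult.commute)
  then have "\<phi> (fr a b) \<otimes>\<^bsub>R\<^esub> \<phi> (fr b a) = \<one>\<^bsub>R\<^esub>"
    using \<phi>_mult[OF ab ba] \<phi>_one by simp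
  then show "\<phi> (fr a b) \<in> Units R"
    using \<phi>_closed[OF ab] \<phi>_closed[OF ba] cring_m_ac(2)[OF R] unfolding Units_def by fastforce
next
  assume "\<phi> (fr a b) \<in> Units R"
  then obtain v where v: "v \<in> carrier R" "\<phi> (fr a b) \<otimes>\<^bsub>R\<^esub> v = \<one>\<^bsub>R\<^esub>"
    by (auto simp: Units_def)
  then obtain c d where cd: "(c, d) \<in> (dom_frac n Q)" "v = \<phi> (fr c d)"
    using \<phi>_surj by blast
  have "\<phi> (fr (a * c) (b * d)) = \<phi> (fr 1 1)"
    using v cd \<phi>_mult[OF ab cd(1)] \<phi>_one by simp
  moreover have "inj_on \<phi> (carrier FR)"
    using \<phi> by (auto simp: ring_iso_def bij_betw_def)
  moreover have "fr (a * c) (b * d) \<in> carrier FR" "fr 1 1 \<in> carrier FR"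
    using dom_frac_mult[OF ab cd(1)] one_dom by (auto simp: frac_ring_def)
  ultimately have "fr (a * c) (b * d) = fr 1 1"
    by (meson inj_onD)
  then have "(1, 1) \<in> fr (a * c) (b * d)"
    using fr_self[OF one_dom] by simp
  then have "a * c - b * d \<in> P"
    using fr_iff[OF dom_frac_mult[OF ab cd(1)]] by simp
  then have m: "a * c - b * d \<in> Q"
    using PQ by blast
  show "a \<notin> Q"
  proof
    assume "a \<in> Q"
    then have "c * a \<in> Q"
      using Q_facts(2) dom_fracD[OF cd(1)] by blast
    moreover have "- 1 \<in> carrier PR"
      using PR_closed(3) by (simp add: poly_ring_def)
    then have "(- 1) * (a * c - b * d) \<in> Q"
      using Q_facts(2) m by blast
    ultimately have "c * a + (- 1) * (a * c - b * d) \<in> Q"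
      by (rule Q_facts(1))
    then have "b * d \<in> Q"
      by (simp add: algebra_simps)
    then show False
      using Q_facts(3) dom_fracD[OF ab] dom_fracD[OF cd(1)] by blast
  qed
qed

lemma \<phi>_zero: "\<phi> (fr 0 1) = \<zero>\<^bsub>R\<^esub>"
proof -
  have z: "(0, 1) \<in> (dom_frac n Q)"
    using dom_frac_const[of 0] by simp
  interpret abelian_group R
    by (rule cring_abelian_group[OF R])
  have "\<phi> (fr 0 1) \<oplus>\<^bsub>R\<^esub> \<phi> (fr 0 1) = \<phi> (fr 0 1)"
    using \<phi>_add[OF z z] by simp
  then show ?thesis
    using add.r_cancel_one \<phi>_closed[OF z] by metis
qed

text \<open>By \<open>unit_iff\<close> the nonunits are the fractions with numerator in
  \<open>Q\<close>, and \<open>Q\<close> is an ideal.\<close>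

lemma local_ring: "ideal (carrier R - Units R) R"
proof (rule idealI[OF cring_ring[OF R]])
  have z: "(0, 1) \<in> (dom_frac n Q)"
    using dom_frac_const[of 0] by simp
  have mult: "c \<otimes>\<^bsub>R\<^esub> u \<in> carrier R - Units R" if u: "u \<in> carrier R - Units R" and c: "c \<in> carrier R" for u c
  proof -
    obtain a b where ab: "(a, b) \<in> (dom_frac n Q)" "u = \<phi> (fr a b)"
      using \<phi>_surj u by blast
    obtain a' b' where ab': "(a', b') \<in> (dom_frac n Q)" "c = \<phi> (fr a' b')"
      using \<phi>_surj c by blast
    have "a \<in> Q"
      using u unit_iff[OF ab(1)] ab(2) by blast
    then have "a' * a \<in> Q"
      using Q_facts(2) dom_fracD[OF ab'(1)] by blast
    then show ?thesis
      using \<phi>_mult[OF ab'(1) ab(1)] unit_iff[OF dom_frac_mult[OF ab'(1) ab(1)]]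
        \<phi>_closed[OF dom_frac_mult[OF ab'(1) ab(1)]] ab ab' by simp
  qed
  have add: "u \<oplus>\<^bsub>R\<^esub> v \<in> carrier R - Units R" if u: "u \<in> carrier R - Units R" and v: "v \<in> carrier R - Units R" for u v
  proof -
    obtain a b where ab: "(a, b) \<in> (dom_frac n Q)" "u = \<phi> (fr a b)"
      using \<phi>_surj u by blast
    obtain c d where cd: "(c, d) \<in> (dom_frac n Q)" "v = \<phi> (fr c d)"
      using \<phi>_surj v by blast
    have "a \<in> Q" "c \<in> Q"
      using u v unit_iff[OF ab(1)] ab(2) unit_iff[OF cd(1)] cd(2) by blast+
    then have "d * a + b * c \<in> Q"
      using Q_facts(1,2) dom_fracD[OF ab(1)] dom_fracD[OF cd(1)] by blast
    then have "a * d + c * b \<in> Q"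
      by (simp add: mult.commute)
    then show ?thesis
      using \<phi>_add[OF ab(1) cd(1)] unit_iff[OF dom_frac_add[OF ab(1) cd(1)]]
        \<phi>_closed[OF dom_frac_add[OF ab(1) cd(1)]] ab cd by simp
  qed
  have zero: "\<zero>\<^bsub>R\<^esub> \<in> carrier R - Units R"
    using unit_iff[OF z] \<phi>_zero \<phi>_closed[OF z] Q_facts(4) by auto
  show "c \<otimes>\<^bsub>R\<^esub> u \<in> carrier R - Units R" if "u \<in> carrier R - Units R" "c \<in> carrier R" for u c
    using mult that .
  then show "u \<otimes>\<^bsub>R\<^esub> c \<in> carrier R - Units R" if "u \<in> carrier R - Units R" "c \<in> carrier R" for u c
    using that cring_m_ac(2)[OF R, of u c] by simp
  show "subgroup (carrier R - Units R) (add_monoid R)"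
  proof (rule group.subgroupI[OF abelian_group.a_group[OF cring_abelian_group[OF R]]])
    fix u assume u: "u \<in> carrier R - Units R"
    have m: "\<ominus>\<^bsub>R\<^esub> \<one>\<^bsub>R\<^esub> \<in> carrier R"
      using cring_facts[OF R] by simp
    have "(\<ominus>\<^bsub>R\<^esub> \<one>\<^bsub>R\<^esub>) \<otimes>\<^bsub>R\<^esub> u = \<ominus>\<^bsub>R\<^esub> u"
      using u cring_facts[OF R] ring.ring_simprules(26)[OF cring_ring[OF R], of "\<one>\<^bsub>R\<^esub>" u] by simp
    then show "inv\<^bsub>add_monoid R\<^esub> u \<in> carrier R - Units R"
      using mult[OF u m] by (simp add: a_inv_def)
  qed (use zero add in auto)
qed

text \<open>A positive integer corresponds to a nonzero constant over 1. The constant has an inverse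
  constant because the field has characteristic zero, so it cannot lie in \<open>Q\<close>.\<close>

lemma nat_units:
  assumes "m \<ge> (1::nat)"
  shows "add_pow R m \<one>\<^bsub>R\<^esub> \<in> Units R"
proof -
  let ?c = "\<lambda>c. Poly_Mapping.single 0 c :: 'k polyn"
  interpret abelian_group R
    by (rule cring_abelian_group[OF R])
  have eq: "add_pow R m \<one>\<^bsub>R\<^esub> = \<phi> (fr (?c (of_nat m)) 1)" for m :: nat
  proof (induction m)
    case 0
    then show ?case
      using \<phi>_zero by simp
  next
    case (Suc m)
    then show ?case
      using \<phi>_add[OF dom_frac_const[of "of_nat m"] one_dom] \<phi>_one
      by (simp add: single_add add.commute)
  qed
  have "?c (of_nat m) \<notin> Q"
  proof
    assume "?c (of_nat m) \<in> Q"
    then have "?c (1 / of_nat m) * ?c (of_nat m) \<in> Q"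
      using Q_facts(2) poly_ring_const by blast
    also have "?c (1 / of_nat m) * ?c (of_nat m) = 1"
      using assms by (simp add: mult_single del: single_of_nat)
    finally show False
      using Q_facts(5) by simp
  qed
  then show ?thesis
    unfolding eq unit_iff[OF dom_frac_const] .
qed

end

end

text \<open>Read off at the point \<open>h x\<close> of Proj corresponding to \<open>x\<close>. The
  two properties enter the comparison of base loci as \<open>loc\<close> and
  \<open>char0\<close>.\<close>

lemma projective_variety_stalk:
  assumes X: "projective_variety TYPE('k::{alg_closed_field, field_char_0}) X" and x: "x \<in> topspace (pts X)"
  shows "ideal (max_ideal X x) (stalk X x)"
    and "\<And>m::nat. m \<ge> 1 \<Longrightarrow> add_pow (stalk X x) m \<one>\<^bsub>stalk X x\<^esub> \<in> Units (stalk X x)"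
proof -
  have R: "cring (stalk X x)"
    using X x by (simp add: projective_variety_def ringed_space_def)
  obtain n and P :: "'k polyn set" where P: "homog_prime n P" and iso: "iso_rspace X (Proj n P)"
    using X by (auto simp: projective_variety_def)
  then obtain h \<phi> where h: "homeomorphic_map (pts X) (pts (Proj n P)) h"
    and \<phi>: "\<phi> x \<in> ring_iso (stalk (Proj n P) (h x)) (stalk X x)"
    using x by (auto simp: iso_rspace_def)
  have "h x \<in> topspace (pts (Proj n P))"
    using homeomorphic_imp_surjective_map[OF h] x by blast
  then have Q: "homog_prime n (h x)" "P \<subseteq> h x"
    by (auto simp: Proj_def frac_space_def Let_def)
  have st: "stalk (Proj n P) (h x) = frac_ring (poly_ring n) P (dom_frac n (h x))"
    by (simp add: Proj_def frac_space_def Let_def dom_frac_def)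
  note \<phi>' = \<phi>[unfolded st]
  show "ideal (max_ideal X x) (stalk X x)"
    unfolding max_ideal_def by (rule local_ring[OF P Q R \<phi>'])
  show "add_pow (stalk X x) m \<one>\<^bsub>stalk X x\<^esub> \<in> Units (stalk X x)" if "m \<ge> 1" for m :: nat
    by (rule nat_units[OF P Q R \<phi>' that])
qed

section \<open>Locally free sheaves and duals\<close>

lemma mspan_singleton:
  assumes M: "module R M" and u: "u \<in> carrier M" and v: "v \<in> mspan R M {u}"
  shows "\<exists>c\<in>carrier R. v = c \<odot>\<^bsub>M\<^esub> u"
proof -
  note f = module_facts[OF M] and r = cring_facts[OF module_cring[OF M]]
  have "submodule {c \<odot>\<^bsub>M\<^esub> u | c. c \<in> carrier R} R M"
  proof (rule submodI[OF M])
    show "\<zero>\<^bsub>M\<^esub> \<in> {c \<odot>\<^bsub>M\<^esub> u | c. c \<in> carrier R}"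
      using f(13)[OF u] r(1) by (intro CollectI exI[of _ "\<zero>\<^bsub>R\<^esub>"]) simp
    fix x assume "x \<in> {c \<odot>\<^bsub>M\<^esub> u | c. c \<in> carrier R}"
    then obtain c where c: "c \<in> carrier R" "x = c \<odot>\<^bsub>M\<^esub> u"
      by blast
    {
      fix y assume "y \<in> {c \<odot>\<^bsub>M\<^esub> u | c. c \<in> carrier R}"
      then obtain d where d: "d \<in> carrier R" "y = d \<odot>\<^bsub>M\<^esub> u"
        by blast
      show "x \<oplus>\<^bsub>M\<^esub> y \<in> {c \<odot>\<^bsub>M\<^esub> u | c. c \<in> carrier R}"
        using c d u r(2) f(10) by (intro CollectI exI[of _ "c \<oplus>\<^bsub>R\<^esub> d"]) simp
    }
    fix a assume "a \<in> carrier R"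
    then show "a \<odot>\<^bsub>M\<^esub> x \<in> {c \<odot>\<^bsub>M\<^esub> u | c. c \<in> carrier R}"
      using c u r(9) module.smult_assoc1[OF M] by (intro CollectI exI[of _ "a \<otimes>\<^bsub>R\<^esub> c"]) simp
  qed (use u f(9) in auto)
  moreover have "u \<in> {c \<odot>\<^bsub>M\<^esub> u | c. c \<in> carrier R}"
    using f(12)[OF u] r(10) by (intro CollectI exI[of _ "\<one>\<^bsub>R\<^esub>"]) simp
  ultimately have "mspan R M {u} \<subseteq> {c \<odot>\<^bsub>M\<^esub> u | c. c \<in> carrier R}"
    by (intro mspan_least) auto
  then show ?thesis
    using v by blast
qed

lemma lin_image_span:
  assumes M: "module R M" and N: "module R N" and f: "lin R M N f" and s: "f ` carrier M = carrier N"
    and G: "G \<subseteq> carrier M" "mspan R M G = carrier M"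
  shows "mspan R N (f ` G) = carrier N"
proof (rule mspan_eqI[OF N])
  show fG: "f ` G \<subseteq> carrier N"
    using G(1) s by blast
  show "carrier N \<subseteq> mspan R N (f ` G)"
  proof
    fix v assume "v \<in> carrier N"
    then obtain u where u: "u \<in> carrier M" "v = f u"
      using s by blast
    have "f u \<in> mspan R N (f ` G)"
      by (rule lin_mspan_sub[OF M N f mspan_submodule[OF N fG] G(1)], rule subsetD[OF mspan_incl imageI])
        (use u G in simp_all)
    then show "v \<in> mspan R N (f ` G)"
      using u by simp
  qed
qed

lemma linear_maps_lin: "f \<in> linear_maps R M N \<Longrightarrow> lin R M N f"
  by (auto simp: linear_maps_def lin_def)

lemma linear_maps_iff: "f \<in> linear_maps R M N \<longleftrightarrow> lin R M N f \<and> f \<in> extensional (carrier M)"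
  by (auto simp: linear_maps_def lin_def PiE_def)

lemma locally_free_frame:
  assumes M: "locally_free X r M" and x: "x \<in> topspace (pts X)"
  shows "\<exists>\<phi>. lin (stalk X x) (free_module (stalk X x) {..<r}) (mstalk M x) \<phi> \<and>
    bij_betw \<phi> (carrier (free_module (stalk X x) {..<r})) (carrier (mstalk M x))"
proof -
  obtain U where U: "x \<in> U" "iso_mod_sheaf_on X U (free_sheaf X r) M"
    using M x unfolding locally_free_def by blast
  then obtain \<phi> where "\<forall>x\<in>U. \<phi> x \<in> linear_maps (stalk X x) (mstalk (free_sheaf X r) x) (mstalk M x) \<and>
      bij_betw (\<phi> x) (carrier (mstalk (free_sheaf X r) x)) (carrier (mstalk M x))"
    unfolding iso_mod_sheaf_on_def by blast
  then show ?thesis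
    using U(1) by (intro exI[of _ "\<phi> x"]) (simp add: free_sheaf_def linear_maps_lin)
qed

lemma locally_free_premod: "locally_free X r M \<Longrightarrow> premod X M"
  by (simp add: locally_free_def sheaf_of_modules_premod)

lemma line_bundle_premod: "line_bundle X A \<Longrightarrow> premod X A"
  by (simp add: line_bundle_def locally_free_premod)

lemma vector_bundle_premod: "vector_bundle X E \<Longrightarrow> premod X E"
  using locally_free_premod by (auto simp: vector_bundle_def)

lemma free_module_span_eq:
  assumes R: "cring R"
  shows "mspan R (free_module R G) (gen R ` G) = carrier (free_module R G)"
  by (rule mspan_eqI[OF free_module_module[OF R]])
    (auto intro: gen_carrier[OF R] free_module_span[OF R])

text \<open>The images of the standard basis under a local trivialization. Finiteness of this set is
  what the counting of letters in \<open>W_carrier\<close> relies on.\<close>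

lemma vector_bundle_finite_span:
  assumes E: "vector_bundle X E" and x: "x \<in> topspace (pts X)"
  obtains S where "S \<subseteq> carrier (mstalk E x)" "finite S" "mspan (stalk X x) (mstalk E x) S = carrier (mstalk E x)"
proof -
  obtain r where r: "locally_free X r E"
    using E by (auto simp: vector_bundle_def)
  note Em = premod_module[OF locally_free_premod[OF r] x]
  note R = module_cring[OF Em]
  obtain \<phi> where \<phi>: "lin (stalk X x) (free_module (stalk X x) {..<r}) (mstalk E x) \<phi>"
      "bij_betw \<phi> (carrier (free_module (stalk X x) {..<r})) (carrier (mstalk E x))"
    using locally_free_frame[OF r x] by blast
  let ?S = "\<phi> ` gen (stalk X x) ` {..<r}"
  have G: "gen (stalk X x) ` {..<r} \<subseteq> carrier (free_module (stalk X x) {..<r})"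
    by (auto intro: gen_carrier[OF R])
  show thesis
  proof (rule that)
    show "?S \<subseteq> carrier (mstalk E x)"
      using G lin_closed[OF \<phi>(1)] by blast
    show "mspan (stalk X x) (mstalk E x) ?S = carrier (mstalk E x)"
      by (rule lin_image_span[OF free_module_module[OF R] Em \<phi>(1) bij_betw_imp_surj_on[OF \<phi>(2)] G free_module_span_eq[OF R]])
  qed simp
qed

text \<open>\<open>e\<close> is the image of the basis vector under a trivialization, and
  \<open>\<kappa>\<close> is the coordinate with respect to it, an element dual to
  \<open>e\<close>.\<close>

lemma line_bundle_generator:
  assumes A: "line_bundle X A" and x: "x \<in> topspace (pts X)"
  obtains e \<kappa> where "e \<in> carrier (mstalk A x)" "mspan (stalk X x) (mstalk A x) {e} = carrier (mstalk A x)"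
    "lin (stalk X x) (mstalk A x) (self_module (stalk X x)) \<kappa>" "\<kappa> e = \<one>\<^bsub>stalk X x\<^esub>"
proof -
  let ?R = "stalk X x"
  have r: "locally_free X 1 A"
    using A by (simp add: line_bundle_def)
  note Am = premod_module[OF locally_free_premod[OF r] x]
  note R = module_cring[OF Am]
  let ?F = "free_module ?R {..<1::nat}"
  note F = free_module_module[OF R, of "{..<1::nat}"]
  obtain \<phi> where \<phi>: "lin ?R ?F (mstalk A x) \<phi>" "bij_betw \<phi> (carrier ?F) (carrier (mstalk A x))"
    using locally_free_frame[OF r x] by blast
  let ?\<psi> = "inv_into (carrier ?F) \<phi>"
  have g: "gen ?R 0 \<in> carrier ?F"
    by (rule gen_carrier[OF R]) simp
  have \<psi>: "?\<psi> u \<in> carrier ?F" "\<phi> (?\<psi> u) = u" if "u \<in> carrier (mstalk A x)" for u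
  proof -
    have "u \<in> \<phi> ` carrier ?F"
      using that bij_betw_imp_surj_on[OF \<phi>(2)] by blast
    then show "?\<psi> u \<in> carrier ?F" "\<phi> (?\<psi> u) = u"
      by (rule inv_into_into, rule f_inv_into_f)
  qed
  have \<psi>': "?\<psi> (\<phi> f) = f" if "f \<in> carrier ?F" for f
    using that bij_betw_imp_inj_on[OF \<phi>(2)] by simp
  show thesis
  proof (rule that)
    show "\<phi> (gen ?R 0) \<in> carrier (mstalk A x)"
      by (rule lin_closed[OF \<phi>(1) g])
    have "mspan ?R (mstalk A x) (\<phi> ` gen ?R ` {..<1::nat}) = carrier (mstalk A x)"
      by (rule lin_image_span[OF F Am \<phi>(1) bij_betw_imp_surj_on[OF \<phi>(2)] _ free_module_span_eq[OF R]])
        (use g in auto)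
    then show "mspan ?R (mstalk A x) {\<phi> (gen ?R 0)} = carrier (mstalk A x)"
      by (simp add: lessThan_Suc)
    show "lin ?R (mstalk A x) (self_module ?R) (\<lambda>u. ?\<psi> u 0)"
    proof (rule linI)
      fix u assume u: "u \<in> carrier (mstalk A x)"
      show "?\<psi> u 0 \<in> carrier (self_module ?R)"
        using \<psi>(1)[OF u] by (simp add: free_module_simps self_module_def)
      {
        fix v assume v: "v \<in> carrier (mstalk A x)"
        have "?\<psi> (u \<oplus>\<^bsub>mstalk A x\<^esub> v) = ?\<psi> (\<phi> (?\<psi> u \<oplus>\<^bsub>?F\<^esub> ?\<psi> v))"
          using lin_add[OF \<phi>(1) \<psi>(1)[OF u] \<psi>(1)[OF v]] \<psi>(2)[OF u] \<psi>(2)[OF v] by simp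
        also have "\<dots> = ?\<psi> u \<oplus>\<^bsub>?F\<^esub> ?\<psi> v"
          by (rule \<psi>'[OF module_facts(2)[OF F \<psi>(1)[OF u] \<psi>(1)[OF v]]])
        finally show "?\<psi> (u \<oplus>\<^bsub>mstalk A x\<^esub> v) 0 = ?\<psi> u 0 \<oplus>\<^bsub>self_module ?R\<^esub> ?\<psi> v 0"
          by (simp add: free_module_simps self_module_def)
      }
      fix a assume a: "a \<in> carrier ?R"
      have "?\<psi> (a \<odot>\<^bsub>mstalk A x\<^esub> u) = ?\<psi> (\<phi> (a \<odot>\<^bsub>?F\<^esub> ?\<psi> u))"
        using lin_smult[OF \<phi>(1) a \<psi>(1)[OF u]] \<psi>(2)[OF u] by simp
      also have "\<dots> = a \<odot>\<^bsub>?F\<^esub> ?\<psi> u"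
        by (rule \<psi>'[OF module_facts(9)[OF F a \<psi>(1)[OF u]]])
      finally show "?\<psi> (a \<odot>\<^bsub>mstalk A x\<^esub> u) 0 = a \<odot>\<^bsub>self_module ?R\<^esub> ?\<psi> u 0"
        by (simp add: free_module_simps self_module_def)
    qed
    show "?\<psi> (\<phi> (gen ?R 0)) 0 = \<one>\<^bsub>?R\<^esub>"
      unfolding \<psi>'[OF g] by (simp add: gen_def)
  qed
qed

section \<open>Dual modules and contraction\<close>

lemma dual_module_simps:
  "f \<in> carrier (dual_module R M) \<longleftrightarrow> lin R M (self_module R) f \<and> f \<in> extensional (carrier M)"
  "\<zero>\<^bsub>dual_module R M\<^esub> = (\<lambda>u\<in>carrier M. \<zero>\<^bsub>R\<^esub>)"
  "f \<oplus>\<^bsub>dual_module R M\<^esub> g = (\<lambda>u\<in>carrier M. f u \<oplus>\<^bsub>R\<^esub> g u)"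
  "a \<odot>\<^bsub>dual_module R M\<^esub> f = (\<lambda>u\<in>carrier M. a \<otimes>\<^bsub>R\<^esub> f u)"
  by (simp_all add: dual_module_def linear_maps_iff)

lemma self_module_simps:
  "carrier (self_module R) = carrier R" "\<zero>\<^bsub>self_module R\<^esub> = \<zero>\<^bsub>R\<^esub>"
  "a \<oplus>\<^bsub>self_module R\<^esub> b = a \<oplus>\<^bsub>R\<^esub> b" "a \<odot>\<^bsub>self_module R\<^esub> b = a \<otimes>\<^bsub>R\<^esub> b"
  by (simp_all add: self_module_def)

context
  fixes R :: "('r, 'x) ring_scheme" and M :: "('r, 'm) module"
  assumes M: "module R M"
begin

lemma dual_eval: "f \<in> carrier (dual_module R M) \<Longrightarrow> u \<in> carrier M \<Longrightarrow> f u \<in> carrier R"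
  using lin_closed[of R M "self_module R" f u] by (simp add: dual_module_simps self_module_simps)

lemma dual_restrict:
  assumes "lin R M (self_module R) f"
  shows "restrict f (carrier M) \<in> carrier (dual_module R M)"
  using lin_cong[OF M assms, of "restrict f (carrier M)"] by (simp add: dual_module_simps)

lemma dual_module_module: "module R (dual_module R M)"
proof -
  note R = module_cring[OF M]
  note Self = self_module_module[OF R]
  have add: "f \<oplus>\<^bsub>dual_module R M\<^esub> g \<in> carrier (dual_module R M)"
    if "f \<in> carrier (dual_module R M)" "g \<in> carrier (dual_module R M)" for f g
    using dual_restrict[OF lin_sum[OF M Self, of f g]] that
    by (simp add: dual_module_simps(1,3) self_module_simps)
  have sm: "a \<odot>\<^bsub>dual_module R M\<^esub> f \<in> carrier (dual_module R M)"
    if "f \<in> carrier (dual_module R M)" "a \<in> carrier R" for f a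
    using dual_restrict[OF lin_scale[OF M Self, of f a]] that
    by (simp add: dual_module_simps(1,4) self_module_simps)
  have zero: "\<zero>\<^bsub>dual_module R M\<^esub> \<in> carrier (dual_module R M)"
    using dual_restrict[OF lin_zero_map[OF M Self]] by (simp add: dual_module_simps(2) self_module_simps)
  have ext: "(\<lambda>u\<in>carrier M. f u) = f" if "f \<in> carrier (dual_module R M)" for f
    using that by (simp add: dual_module_simps extensional_restrict)
  note fs = cring_facts[OF R] ring.ring_simprules(13,23)[OF cring_ring[OF R]] cring_m_ac(1)[OF R]
  note ac = abelian_ac[OF cring_abelian_group[OF R]]
  note simps = dual_module_simps(2-4)
  show ?thesis
  proof (rule moduleI[OF R])
    show "abelian_group (dual_module R M)"
    proof (rule abelian_groupI)
      fix f assume f: "f \<in> carrier (dual_module R M)"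
      note fc = dual_eval[OF f]
      show "\<zero>\<^bsub>dual_module R M\<^esub> \<oplus>\<^bsub>dual_module R M\<^esub> f = f"
        unfolding simps by (rule trans[OF restrict_ext ext[OF f]]) (simp add: fc fs)
      have m: "\<ominus>\<^bsub>R\<^esub> \<one>\<^bsub>R\<^esub> \<in> carrier R"
        by (simp add: fs)
      have "(\<ominus>\<^bsub>R\<^esub> \<one>\<^bsub>R\<^esub>) \<odot>\<^bsub>dual_module R M\<^esub> f \<oplus>\<^bsub>dual_module R M\<^esub> f = \<zero>\<^bsub>dual_module R M\<^esub>"
        unfolding simps by (rule restrict_ext) (simp add: fc fs ring.ring_simprules(26)[OF cring_ring[OF R]])
      then show "\<exists>g\<in>carrier (dual_module R M). g \<oplus>\<^bsub>dual_module R M\<^esub> f = \<zero>\<^bsub>dual_module R M\<^esub>"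
        using sm[OF f m] by blast
      fix g assume g: "g \<in> carrier (dual_module R M)"
      note gc = dual_eval[OF g]
      show "f \<oplus>\<^bsub>dual_module R M\<^esub> g = g \<oplus>\<^bsub>dual_module R M\<^esub> f"
        unfolding simps by (rule restrict_ext) (simp add: fc gc ac)
      fix h assume h: "h \<in> carrier (dual_module R M)"
      show "(f \<oplus>\<^bsub>dual_module R M\<^esub> g) \<oplus>\<^bsub>dual_module R M\<^esub> h = f \<oplus>\<^bsub>dual_module R M\<^esub> (g \<oplus>\<^bsub>dual_module R M\<^esub> h)"
        unfolding simps by (rule restrict_ext) (simp add: fc gc dual_eval[OF h] ac)
    qed (use add zero in auto)
    fix f assume f: "f \<in> carrier (dual_module R M)"
    note fc = dual_eval[OF f]
    show "\<one>\<^bsub>R\<^esub> \<odot>\<^bsub>dual_module R M\<^esub> f = f"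
      unfolding simps by (rule trans[OF restrict_ext ext[OF f]]) (simp add: fc fs)
    fix a assume a: "a \<in> carrier R"
    show "a \<odot>\<^bsub>dual_module R M\<^esub> f \<in> carrier (dual_module R M)"
      by (rule sm[OF f a])
    {
      fix b assume b: "b \<in> carrier R"
      show "(a \<oplus>\<^bsub>R\<^esub> b) \<odot>\<^bsub>dual_module R M\<^esub> f = a \<odot>\<^bsub>dual_module R M\<^esub> f \<oplus>\<^bsub>dual_module R M\<^esub> b \<odot>\<^bsub>dual_module R M\<^esub> f"
        unfolding simps by (rule restrict_ext) (simp add: fc fs a b)
      show "(a \<otimes>\<^bsub>R\<^esub> b) \<odot>\<^bsub>dual_module R M\<^esub> f = a \<odot>\<^bsub>dual_module R M\<^esub> (b \<odot>\<^bsub>dual_module R M\<^esub> f)"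
        unfolding simps by (rule restrict_ext) (simp add: fc fs a b)
    }
    fix g assume g: "g \<in> carrier (dual_module R M)"
    show "a \<odot>\<^bsub>dual_module R M\<^esub> (f \<oplus>\<^bsub>dual_module R M\<^esub> g) = a \<odot>\<^bsub>dual_module R M\<^esub> f \<oplus>\<^bsub>dual_module R M\<^esub> a \<odot>\<^bsub>dual_module R M\<^esub> g"
      unfolding simps by (rule restrict_ext) (simp add: fc dual_eval[OF g] fs a)
  qed
qed

lemma dual_eval_lin: "u \<in> carrier M \<Longrightarrow> lin R (dual_module R M) (self_module R) (\<lambda>f. f u)"
  by (rule linI) (simp_all add: dual_eval dual_module_simps(3,4) self_module_simps)

end

text \<open>The second list may be longer than the first: its remaining entries are not read.\<close>

primrec pairing :: "('r, 'x) ring_scheme \<Rightarrow> 'm list \<Rightarrow> ('m \<Rightarrow> 'r) list \<Rightarrow> 'r" where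
  "pairing R [] \<phi>s = \<one>\<^bsub>R\<^esub>"
| "pairing R (u # us) \<phi>s = hd \<phi>s u \<otimes>\<^bsub>R\<^esub> pairing R us (tl \<phi>s)"

lemma lin_smult_const:
  assumes M: "module R M" and N: "module R N" and f: "lin R M (self_module R) f" and p: "p \<in> carrier N"
  shows "lin R M N (\<lambda>u. f u \<odot>\<^bsub>N\<^esub> p)"
proof (rule linI)
  have c: "f u \<in> carrier R" if "u \<in> carrier M" for u
    using lin_closed[OF f that] by (simp add: self_module_simps)
  note h = module_facts(9,10)[OF N] module.smult_assoc1[OF N]
  fix u assume u: "u \<in> carrier M"
  show "f u \<odot>\<^bsub>N\<^esub> p \<in> carrier N"
    by (rule h(1)[OF c[OF u] p])
  show "f (u \<oplus>\<^bsub>M\<^esub> v) \<odot>\<^bsub>N\<^esub> p = f u \<odot>\<^bsub>N\<^esub> p \<oplus>\<^bsub>N\<^esub> f v \<odot>\<^bsub>N\<^esub> p" if v: "v \<in> carrier M" for v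
    unfolding lin_add[OF f u v] self_module_simps by (rule h(2)[OF c[OF u] c[OF v] p])
  show "f (a \<odot>\<^bsub>M\<^esub> u) \<odot>\<^bsub>N\<^esub> p = a \<odot>\<^bsub>N\<^esub> (f u \<odot>\<^bsub>N\<^esub> p)" if a: "a \<in> carrier R" for a
    unfolding lin_smult[OF f a u] self_module_simps by (rule h(3)[OF a c[OF u] p])
qed

lemma lin_mult_const:
  assumes M: "module R M" and f: "lin R M (self_module R) f" and c: "c \<in> carrier R"
  shows "lin R M (self_module R) (\<lambda>u. f u \<otimes>\<^bsub>R\<^esub> c)" "lin R M (self_module R) (\<lambda>u. c \<otimes>\<^bsub>R\<^esub> f u)"
  using lin_smult_const[OF M self_module_module[OF module_cring[OF M]] f, of c]
    lin_scale[OF M self_module_module[OF module_cring[OF M]] f, of c] c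
  by (simp_all add: self_module_simps)

context
  fixes R :: "('r, 'x) ring_scheme" and M :: "('r, 'm) module"
  assumes M: "module R M"
begin

lemma pairing_closed:
  "set us \<subseteq> carrier M \<Longrightarrow> length us \<le> length \<phi>s \<Longrightarrow> set \<phi>s \<subseteq> carrier (dual_module R M) \<Longrightarrow> pairing R us \<phi>s \<in> carrier R"
proof (induction us arbitrary: \<phi>s)
  case Nil
  then show ?case
    by (simp add: cring_facts[OF module_cring[OF M]])
next
  case (Cons u us)
  then obtain \<phi> \<psi>s where "\<phi>s = \<phi> # \<psi>s"
    by (cases \<phi>s) auto
  then show ?case
    using Cons by (simp add: cring_facts[OF module_cring[OF M]] dual_eval[OF M])
qed

lemma pairing_lin1:
  "set us \<subseteq> carrier M \<Longrightarrow> length us \<le> length \<phi>s \<Longrightarrow> set \<phi>s \<subseteq> carrier (dual_module R M) \<Longrightarrow> i < length us \<Longrightarrow>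
    lin R M (self_module R) (\<lambda>u. pairing R (us[i := u]) \<phi>s)"
proof (induction us arbitrary: \<phi>s i)
  case (Cons v us)
  then obtain \<phi> \<psi>s where \<phi>: "\<phi>s = \<phi> # \<psi>s"
    by (cases \<phi>s) auto
  show ?case
  proof (cases i)
    case 0
    have "lin R M (self_module R) \<phi>" "pairing R us \<psi>s \<in> carrier R"
      using Cons.prems by (auto simp: dual_module_simps \<phi> intro!: pairing_closed)
    from lin_mult_const(1)[OF M this] show ?thesis
      by (simp add: 0 \<phi>)
  next
    case (Suc k)
    have "lin R M (self_module R) (\<lambda>u. pairing R (us[k := u]) \<psi>s)" "\<phi> v \<in> carrier R"
      using Cons.prems by (simp_all add: Suc \<phi> Cons.IH dual_eval[OF M])
    from lin_mult_const(2)[OF M this] show ?thesis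
      by (simp add: Suc \<phi>)
  qed
qed simp

lemma pairing_lin2:
  "set us \<subseteq> carrier M \<Longrightarrow> length us \<le> length \<phi>s \<Longrightarrow> set \<phi>s \<subseteq> carrier (dual_module R M) \<Longrightarrow> i < length us \<Longrightarrow>
    lin R (dual_module R M) (self_module R) (\<lambda>\<phi>. pairing R us (\<phi>s[i := \<phi>]))"
proof (induction us arbitrary: \<phi>s i)
  case (Cons v us)
  then obtain \<phi> \<psi>s where \<phi>: "\<phi>s = \<phi> # \<psi>s"
    by (cases \<phi>s) auto
  note D = dual_module_module[OF M]
  show ?case
  proof (cases i)
    case 0
    have "lin R (dual_module R M) (self_module R) (\<lambda>\<phi>. \<phi> v)" "pairing R us \<psi>s \<in> carrier R"
      using Cons.prems by (auto simp: \<phi> intro!: pairing_closed dual_eval_lin[OF M])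
    from lin_mult_const(1)[OF D this] show ?thesis
      by (simp add: 0 \<phi>)
  next
    case (Suc k)
    have "lin R (dual_module R M) (self_module R) (\<lambda>\<phi>. pairing R us (\<psi>s[k := \<phi>]))" "\<phi> v \<in> carrier R"
      using Cons.prems by (simp_all add: Suc \<phi> Cons.IH dual_eval[OF M])
    from lin_mult_const(2)[OF D this] show ?thesis
      by (simp add: Suc \<phi>)
  qed
qed simp

lemma pairing_update_ge: "length us \<le> i \<Longrightarrow> i < length \<phi>s \<Longrightarrow> pairing R us (\<phi>s[i := \<phi>]) = pairing R us \<phi>s"
proof (induction us arbitrary: \<phi>s i)
  case (Cons v us)
  then show ?case
    by (cases \<phi>s; cases i) auto
qed simp

text \<open>Contraction: the first \<open>j\<close> of the \<open>j + n\<close> linear forms are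
  evaluated on the \<open>j\<close> vectors, and the resulting scalar multiplies the tensor of the
  remaining \<open>n\<close> forms.\<close>

lemma contraction_bilin:
  "\<exists>f. bilin R (pw False R M j) (pw False R (dual_module R M) (j + n)) (pw False R (dual_module R M) n) f \<and>
    (\<forall>us\<in>tuples M j. \<forall>\<phi>s\<in>tuples (dual_module R M) (j + n).
      f (pwp False R M j us) (pwp False R (dual_module R M) (j + n) \<phi>s) =
        pairing R us \<phi>s \<odot>\<^bsub>pw False R (dual_module R M) n\<^esub> pwp False R (dual_module R M) n (drop j \<phi>s))"
proof (rule pw_pw_bilin[OF M])
  let ?D = "dual_module R M"
  let ?P = "pw False R ?D n"
  show D: "module R ?D"
    by (rule dual_module_module[OF M])
  show P: "module R ?P"
    by (rule pw_module[OF D])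
  have dr: "drop j \<phi>s \<in> tuples ?D n" if "\<phi>s \<in> tuples ?D (j + n)" for \<phi>s
    using that set_drop_subset[of j \<phi>s] by (auto simp: tuples_def)
  have pc: "pwp False R ?D n (drop j \<phi>s) \<in> carrier ?P" if "\<phi>s \<in> tuples ?D (j + n)" for \<phi>s
    by (rule pwp_closed[OF D dr[OF that]])
  have pr: "pairing R us \<phi>s \<in> carrier R" if "us \<in> tuples M j" "\<phi>s \<in> tuples ?D (j + n)" for us \<phi>s
    by (rule pairing_closed) (use that in \<open>simp_all add: tuples_def\<close>)
  show "multilin R M j ?P (\<lambda>us. pairing R us \<phi>s \<odot>\<^bsub>?P\<^esub> pwp False R ?D n (drop j \<phi>s))"
    if \<phi>: "\<phi>s \<in> tuples ?D (j + n)" for \<phi>s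
  proof (rule multilinI)
    fix us assume us: "us \<in> tuples M j"
    show "pairing R us \<phi>s \<odot>\<^bsub>?P\<^esub> pwp False R ?D n (drop j \<phi>s) \<in> carrier ?P"
      by (rule module_facts(9)[OF P pr[OF us \<phi>] pc[OF \<phi>]])
    show "lin R M ?P (\<lambda>u. pairing R (us[i := u]) \<phi>s \<odot>\<^bsub>?P\<^esub> pwp False R ?D n (drop j \<phi>s))" if "i < j" for i
      by (rule lin_smult_const[OF M P pairing_lin1 pc[OF \<phi>]]) (use us \<phi> that in \<open>simp_all add: tuples_def\<close>)
  qed
  show "multilin R ?D (j + n) ?P (\<lambda>\<phi>s. pairing R us \<phi>s \<odot>\<^bsub>?P\<^esub> pwp False R ?D n (drop j \<phi>s))"
    if us: "us \<in> tuples M j" for us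
  proof (rule multilinI)
    fix \<phi>s assume \<phi>: "\<phi>s \<in> tuples ?D (j + n)"
    show "pairing R us \<phi>s \<odot>\<^bsub>?P\<^esub> pwp False R ?D n (drop j \<phi>s) \<in> carrier ?P"
      by (rule module_facts(9)[OF P pr[OF us \<phi>] pc[OF \<phi>]])
    fix i assume i: "i < j + n"
    show "lin R ?D ?P (\<lambda>\<phi>. pairing R us (\<phi>s[i := \<phi>]) \<odot>\<^bsub>?P\<^esub> pwp False R ?D n (drop j (\<phi>s[i := \<phi>])))"
    \<comment> \<open>A form among the first \<open>j\<close> enters through the scalar only, a
      later one through the remaining tensor only; so the expression is linear in each.\<close>
    proof (cases "i < j")
      case True
      have "lin R ?D (self_module R) (\<lambda>\<phi>. pairing R us (\<phi>s[i := \<phi>]))"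
        by (rule pairing_lin2) (use us \<phi> True in \<open>simp_all add: tuples_def\<close>)
      from lin_smult_const[OF D P this pc[OF \<phi>]] True show ?thesis
        by simp
    next
      case False
      have "lin R ?D ?P (\<lambda>\<phi>. pwp False R ?D n ((drop j \<phi>s)[i - j := \<phi>]))"
        by (rule multilin_lin[OF pwp_multilin[OF D] dr[OF \<phi>]]) (use i False in simp)
      from lin_scale[OF D P this pr[OF us \<phi>]] show ?thesis
        using False i us \<phi> by (simp add: drop_update_swap pairing_update_ge tuples_def)
    qed
  qed
qed simp_all

end

section \<open>The dual sheaf and contraction with sections\<close>

lemma dual_sheaf_simps:
  "mstalk (dual_sheaf X M) x = dual_module (stalk X x) (mstalk M x)"
  "\<phi> \<in> msects (dual_sheaf X M) U \<longleftrightarrow> \<phi> \<in> (\<Pi>\<^sub>E x\<in>U. carrier (dual_module (stalk X x) (mstalk M x))) \<and>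
     (\<forall>V s. openin (pts X) V \<and> V \<subseteq> U \<and> s \<in> msects M V \<longrightarrow> (\<lambda>x\<in>V. \<phi> x (s x)) \<in> sects X V)"
  by (simp_all add: dual_sheaf_def)

context
  fixes X :: "('p, 'r) rspace"
  assumes X: "ringed_space X"
begin

lemma sect_glue:
  assumes "openin (pts X) U" "s \<in> (\<Pi>\<^sub>E x\<in>U. carrier (stalk X x))"
    and "\<And>x. x \<in> U \<Longrightarrow> \<exists>V. openin (pts X) V \<and> x \<in> V \<and> V \<subseteq> U \<and> restrict s V \<in> sects X V"
  shows "s \<in> sects X U"
proof -
  have "\<forall>U s. openin (pts X) U \<and> s \<in> (\<Pi>\<^sub>E x\<in>U. carrier (stalk X x)) \<and>
        (\<forall>x\<in>U. \<exists>V. openin (pts X) V \<and> x \<in> V \<and> V \<subseteq> U \<and> restrict s V \<in> sects X V) \<longrightarrow> s \<in> sects X U"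
    using X unfolding ringed_space_def sheaf_of_germs_def by (elim conjE)
  then show ?thesis
    using assms by simp
qed

lemma dual_sheaf_premod:
  assumes M: "premod X M"
  shows "premod X (dual_sheaf X M)"
  unfolding premod_def
proof (intro conjI ballI allI impI)
  let ?D = "dual_sheaf X M"
  have dm: "module (stalk X x) (mstalk ?D x)" if "x \<in> topspace (pts X)" for x
    unfolding dual_sheaf_simps by (rule dual_module_module[OF premod_module[OF M that]])
  then show "module (stalk X x) (mstalk ?D x)" if "x \<in> topspace (pts X)" for x
    using that .
  {
    fix U V \<phi> assume h: "openin (pts X) U \<and> openin (pts X) V \<and> V \<subseteq> U \<and> \<phi> \<in> msects ?D U"
    show "restrict \<phi> V \<in> msects ?D V"
      unfolding dual_sheaf_simps
    proof (intro conjI allI impI)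
      show "restrict \<phi> V \<in> (\<Pi>\<^sub>E x\<in>V. carrier (dual_module (stalk X x) (mstalk M x)))"
      proof (simp only: restrict_PiE_iff, rule ballI)
        fix x assume "x \<in> V"
        then have x: "x \<in> U"
          using h by (elim conjE) (rule subsetD)
        have "\<phi> \<in> (\<Pi>\<^sub>E x\<in>U. carrier (dual_module (stalk X x) (mstalk M x)))"
          using h unfolding dual_sheaf_simps by (elim conjE)
        then show "\<phi> x \<in> carrier (dual_module (stalk X x) (mstalk M x))"
          using x by (rule PiE_mem)
      qed
      fix W s assume W: "openin (pts X) W \<and> W \<subseteq> V \<and> s \<in> msects M W"
      then have "(\<lambda>x\<in>W. restrict \<phi> V x (s x)) = (\<lambda>x\<in>W. \<phi> x (s x))"
        by (intro restrict_ext) auto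
      then show "(\<lambda>x\<in>W. restrict \<phi> V x (s x)) \<in> sects X W"
        using h W order_trans[of W V U] unfolding dual_sheaf_simps by simp
    qed
  }
  {
    fix U \<phi> assume h: "openin (pts X) U \<and> \<phi> \<in> (\<Pi>\<^sub>E x\<in>U. carrier (mstalk ?D x)) \<and>
      (\<forall>x\<in>U. \<exists>V. openin (pts X) V \<and> x \<in> V \<and> V \<subseteq> U \<and> restrict \<phi> V \<in> msects ?D V)"
    show "\<phi> \<in> msects ?D U"
      unfolding dual_sheaf_simps
    proof (intro conjI allI impI)
      show P: "\<phi> \<in> (\<Pi>\<^sub>E x\<in>U. carrier (dual_module (stalk X x) (mstalk M x)))"
        using h by (simp add: dual_sheaf_simps)
      fix V s assume V: "openin (pts X) V \<and> V \<subseteq> U \<and> s \<in> msects M V"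
      show "(\<lambda>x\<in>V. \<phi> x (s x)) \<in> sects X V"
      \<comment> \<open>The given local data lives on neighbourhoods \<open>W\<close> in
        \<open>U\<close>, the test section \<open>s\<close> on \<open>V\<close>. The values are
        sections over the intersections, which cover \<open>V\<close>.\<close>
      proof (rule sect_glue)
        show "(\<lambda>x\<in>V. \<phi> x (s x)) \<in> (\<Pi>\<^sub>E x\<in>V. carrier (stalk X x))"
        proof (simp only: restrict_PiE_iff, rule ballI)
          fix x assume x: "x \<in> V"
          have V': "openin (pts X) V" "x \<in> U" "s \<in> msects M V"
            using V x by auto
          show "\<phi> x (s x) \<in> carrier (stalk X x)"
            by (rule dual_eval[OF premod_module[OF M open_pt[OF V'(1) x]] PiE_mem[OF P V'(2)] premod_germ[OF M V'(1,3) x]])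
        qed
        fix x assume x: "x \<in> V"
        then obtain W where W: "openin (pts X) W" "x \<in> W" "W \<subseteq> U" "restrict \<phi> W \<in> msects ?D W"
          using h V by blast
        have o: "openin (pts X) (W \<inter> V)"
          using W V by blast
        have "restrict s (W \<inter> V) \<in> msects M (W \<inter> V)"
          using V o by (intro premod_restrict[OF M, of V]) auto
        then have "(\<lambda>x\<in>W \<inter> V. restrict \<phi> W x (restrict s (W \<inter> V) x)) \<in> sects X (W \<inter> V)"
          using W(4) o unfolding dual_sheaf_simps by blast
        moreover have "(\<lambda>x\<in>W \<inter> V. restrict \<phi> W x (restrict s (W \<inter> V) x)) = restrict (\<lambda>x\<in>V. \<phi> x (s x)) (W \<inter> V)"
          by (rule ext) simp
        ultimately show "\<exists>Va. openin (pts X) Va \<and> x \<in> Va \<and> Va \<subseteq> V \<and> restrict (\<lambda>x\<in>V. \<phi> x (s x)) Va \<in> sects X Va"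
          using o x W(2) by (intro exI[of _ "W \<inter> V"]) simp
      qed (use V in simp)
    qed
  }
  fix U assume U: "openin (pts X) U"
  note Mx = premod_module[OF M open_pt[OF U]]
  note GM = germ_module_module[OF X U dm[OF open_pt[OF U]]]
  show "submodule (msects ?D U) (section_ring X U) (germ_module (mstalk ?D) U)"
  proof (rule submodI[OF GM])
    have mem: "\<phi> \<in> msects ?D U" if "\<phi> \<in> carrier (germ_module (mstalk ?D) U)"
      and "\<And>V s. openin (pts X) V \<Longrightarrow> V \<subseteq> U \<Longrightarrow> s \<in> msects M V \<Longrightarrow> (\<lambda>x\<in>V. \<phi> x (s x)) \<in> sects X V" for \<phi>
      using that unfolding germ_module_simps(1) dual_sheaf_simps by simp
    have sc: "\<phi> \<in> carrier (germ_module (mstalk ?D) U)" if "\<phi> \<in> msects ?D U" for \<phi>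
      using that unfolding germ_module_simps(1) dual_sheaf_simps by simp
    have ev: "(\<lambda>x\<in>V. \<phi> x (s x)) \<in> sects X V"
      if "\<phi> \<in> msects ?D U" "openin (pts X) V" "V \<subseteq> U" "s \<in> msects M V" for \<phi> V s
      using that unfolding dual_sheaf_simps by blast
    have germ: "s x \<in> carrier (mstalk M x)" if "openin (pts X) V" "s \<in> msects M V" "x \<in> V" for s V x
      by (rule premod_germ[OF M that])
    show "msects ?D U \<subseteq> carrier (germ_module (mstalk ?D) U)"
      using sc by blast
    show "\<zero>\<^bsub>germ_module (mstalk ?D) U\<^esub> \<in> msects ?D U"
    proof (rule mem[OF module_facts(1)[OF GM]])
      fix V s assume V: "openin (pts X) V" "V \<subseteq> U" "s \<in> msects M V"
      have "(\<lambda>x\<in>V. \<zero>\<^bsub>germ_module (mstalk ?D) U\<^esub> x (s x)) = \<zero>\<^bsub>section_ring X V\<^esub>"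
        using V by (simp only: section_ring_simps, intro restrict_ext)
          (auto simp: germ_module_simps(2) dual_sheaf_simps(1) dual_module_simps(2) germ[OF V(1,3)])
      then show "(\<lambda>x\<in>V. \<zero>\<^bsub>germ_module (mstalk ?D) U\<^esub> x (s x)) \<in> sects X V"
        using cring_facts(1)[OF section_cring[OF X V(1)]] by (simp add: section_ring_simps(1))
    qed
    fix \<phi> assume \<phi>: "\<phi> \<in> msects ?D U"
    {
      fix \<psi> assume \<psi>: "\<psi> \<in> msects ?D U"
      show "\<phi> \<oplus>\<^bsub>germ_module (mstalk ?D) U\<^esub> \<psi> \<in> msects ?D U"
      proof (rule mem[OF module_facts(2)[OF GM sc[OF \<phi>] sc[OF \<psi>]]])
        fix V s assume V: "openin (pts X) V" "V \<subseteq> U" "s \<in> msects M V"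
        have "(\<lambda>x\<in>V. (\<phi> \<oplus>\<^bsub>germ_module (mstalk ?D) U\<^esub> \<psi>) x (s x)) =
            (\<lambda>x\<in>V. \<phi> x (s x)) \<oplus>\<^bsub>section_ring X V\<^esub> (\<lambda>x\<in>V. \<psi> x (s x))"
          using V by (simp only: section_ring_simps, intro restrict_ext)
            (auto simp: germ_module_simps(3) dual_sheaf_simps(1) dual_module_simps(3) germ[OF V(1,3)])
        then show "(\<lambda>x\<in>V. (\<phi> \<oplus>\<^bsub>germ_module (mstalk ?D) U\<^esub> \<psi>) x (s x)) \<in> sects X V"
          using cring_facts(2)[OF section_cring[OF X V(1)]] ev[OF \<phi> V] ev[OF \<psi> V] by (simp add: section_ring_simps(1))
      qed
    }
    fix a assume a: "a \<in> carrier (section_ring X U)"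
    show "a \<odot>\<^bsub>germ_module (mstalk ?D) U\<^esub> \<phi> \<in> msects ?D U"
    proof (rule mem[OF module_facts(9)[OF GM a sc[OF \<phi>]]])
      fix V s assume V: "openin (pts X) V" "V \<subseteq> U" "s \<in> msects M V"
      have aV: "restrict a V \<in> sects X V"
        using sect_restrict[OF X U V(1,2)] a by (simp add: section_ring_simps(1))
      have "(\<lambda>x\<in>V. (a \<odot>\<^bsub>germ_module (mstalk ?D) U\<^esub> \<phi>) x (s x)) =
          restrict a V \<otimes>\<^bsub>section_ring X V\<^esub> (\<lambda>x\<in>V. \<phi> x (s x))"
        using V by (simp only: section_ring_simps, intro restrict_ext)
          (auto simp: germ_module_simps(4) dual_sheaf_simps(1) dual_module_simps(4) germ[OF V(1,3)])
      then show "(\<lambda>x\<in>V. (a \<odot>\<^bsub>germ_module (mstalk ?D) U\<^esub> \<phi>) x (s x)) \<in> sects X V"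
        using cring_facts(9)[OF section_cring[OF X V(1)]] aV ev[OF \<phi> V] by (simp add: section_ring_simps(1))
    qed
  qed
qed

lemma pairing_sect:
  assumes M: "premod X M" and U: "openin (pts X) U"
  shows "set ss \<subseteq> msects M U \<Longrightarrow> length ss \<le> length ts \<Longrightarrow> set ts \<subseteq> msects (dual_sheaf X M) U \<Longrightarrow>
    (\<lambda>x\<in>U. pairing (stalk X x) (map (\<lambda>s. s x) ss) (map (\<lambda>t. t x) ts)) \<in> sects X U"
proof (induction ss arbitrary: ts)
  case Nil
  then show ?case
    using cring_facts(10)[OF section_cring[OF X U]] by (simp only: section_ring_simps list.map pairing.simps)
next
  case (Cons s ss)
  then obtain t rs where t: "ts = t # rs"
    by (cases ts) auto
  have "(\<lambda>x\<in>U. t x (s x)) \<in> sects X U"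
    using Cons.prems U by (auto simp: t dual_sheaf_simps)
  moreover have "(\<lambda>x\<in>U. pairing (stalk X x) (map (\<lambda>s. s x) ss) (map (\<lambda>t. t x) rs)) \<in> sects X U"
    using Cons.prems by (intro Cons.IH) (auto simp: t)
  ultimately have "(\<lambda>x\<in>U. t x (s x)) \<otimes>\<^bsub>section_ring X U\<^esub>
      (\<lambda>x\<in>U. pairing (stalk X x) (map (\<lambda>s. s x) ss) (map (\<lambda>t. t x) rs)) \<in> sects X U"
    using cring_facts(9)[OF section_cring[OF X U]] by (simp add: section_ring_simps(1))
  moreover have "(\<lambda>x\<in>U. t x (s x)) \<otimes>\<^bsub>section_ring X U\<^esub>
      (\<lambda>x\<in>U. pairing (stalk X x) (map (\<lambda>s. s x) ss) (map (\<lambda>t. t x) rs)) =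
      (\<lambda>x\<in>U. pairing (stalk X x) (map (\<lambda>s. s x) (s # ss)) (map (\<lambda>t. t x) ts))"
    unfolding section_ring_simps(2) by (rule restrict_ext) (simp add: t)
  ultimately show ?case
    by (simp only:)
qed

text \<open>On pure sections the contraction is the regular function given by
  \<open>pairing_sect\<close> times a pure section, hence a section.\<close>

lemma contraction_bimor:
  assumes M: "premod X M"
  shows "\<exists>f. bimor X (pws False X j M) (pws False X (j + n) (dual_sheaf X M)) (pws False X n (dual_sheaf X M)) f \<and>
    (\<forall>x\<in>topspace (pts X). \<forall>us\<in>tuples (mstalk M x) j. \<forall>\<phi>s\<in>tuples (mstalk (dual_sheaf X M) x) (j + n).
      f x (pwp False (stalk X x) (mstalk M x) j us) (pwp False (stalk X x) (mstalk (dual_sheaf X M) x) (j + n) \<phi>s) =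
        pairing (stalk X x) us \<phi>s \<odot>\<^bsub>pw False (stalk X x) (mstalk (dual_sheaf X M) x) n\<^esub>
          pwp False (stalk X x) (mstalk (dual_sheaf X M) x) n (drop j \<phi>s))"
proof -
  let ?D = "dual_sheaf X M"
  note D = dual_sheaf_premod[OF M]
  let ?P = "\<lambda>x f. bilin (stalk X x) (pw False (stalk X x) (mstalk M x) j) (pw False (stalk X x) (mstalk ?D x) (j + n))
      (pw False (stalk X x) (mstalk ?D x) n) f \<and>
    (\<forall>us\<in>tuples (mstalk M x) j. \<forall>\<phi>s\<in>tuples (mstalk ?D x) (j + n).
      f (pwp False (stalk X x) (mstalk M x) j us) (pwp False (stalk X x) (mstalk ?D x) (j + n) \<phi>s) =
        pairing (stalk X x) us \<phi>s \<odot>\<^bsub>pw False (stalk X x) (mstalk ?D x) n\<^esub>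
          pwp False (stalk X x) (mstalk ?D x) n (drop j \<phi>s))"
  have "\<forall>x\<in>topspace (pts X). \<exists>f. ?P x f"
    unfolding dual_sheaf_simps(1) by (intro ballI contraction_bilin premod_module[OF M])
  then obtain f where f: "\<forall>x\<in>topspace (pts X). ?P x (f x)"
    by (rule bchoice[THEN exE])
  have "bimor X (pws False X j M) (pws False X (j + n) ?D) (pws False X n ?D) f"
  proof (rule pws_bimor[OF X M D pws_premod[OF X D]])
    show "bilin (stalk X x) (pw False (stalk X x) (mstalk M x) j) (pw False (stalk X x) (mstalk ?D x) (j + n))
      (mstalk (pws False X n ?D) x) (f x)" if "x \<in> topspace (pts X)" for x
      using f that by simp
    fix V ss ts
    assume V: "openin (pts X) V" and ss: "length ss = j" "set ss \<subseteq> msects M V"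
      and ts: "length ts = j + n" "set ts \<subseteq> msects ?D V"
    let ?c = "\<lambda>x\<in>V. pairing (stalk X x) (map (\<lambda>s. s x) ss) (map (\<lambda>t. t x) ts)"
    let ?t = "\<lambda>x\<in>V. pwp False (stalk X x) (mstalk ?D x) n (map (\<lambda>t. t x) (drop j ts))"
    have "?c \<in> carrier (section_ring X V)"
      unfolding section_ring_simps(1) by (rule pairing_sect[OF M V]) (use ss ts in simp_all)
    moreover have "?t \<in> msects (pws False X n ?D) V"
      by (rule pws_pure_sect[OF X D V]) (use ts set_drop_subset[of j ts] in auto)
    ultimately have "?c \<odot>\<^bsub>germ_module (mstalk (pws False X n ?D)) V\<^esub> ?t \<in> msects (pws False X n ?D) V"
      by (rule submod_smult[OF premod_submodule[OF pws_premod[OF X D] V]])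
    moreover have "?c \<odot>\<^bsub>germ_module (mstalk (pws False X n ?D)) V\<^esub> ?t =
      (\<lambda>x\<in>V. f x (pwp False (stalk X x) (mstalk M x) j (map (\<lambda>s. s x) ss))
        (pwp False (stalk X x) (mstalk ?D x) (j + n) (map (\<lambda>s. s x) ts)))"
      unfolding germ_module_simps(4)
    proof (rule restrict_ext)
      fix x assume x: "x \<in> V"
      have "map (\<lambda>s. s x) ss \<in> tuples (mstalk M x) j" "map (\<lambda>s. s x) ts \<in> tuples (mstalk ?D x) (j + n)"
        by (rule sect_tuples[OF X M V ss x], rule sect_tuples[OF X D V ts x])
      then show "?c x \<odot>\<^bsub>mstalk (pws False X n ?D) x\<^esub> ?t x = f x (pwp False (stalk X x) (mstalk M x) j (map (\<lambda>s. s x) ss))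
        (pwp False (stalk X x) (mstalk ?D x) (j + n) (map (\<lambda>s. s x) ts))"
        using f open_pt[OF V x] x by (simp add: drop_map)
    qed
    ultimately show "(\<lambda>x\<in>V. f x (pwp False (stalk X x) (mstalk M x) j (map (\<lambda>s. s x) ss))
        (pwp False (stalk X x) (mstalk ?D x) (j + n) (map (\<lambda>s. s x) ts))) \<in> msects (pws False X n ?D) V"
      by simp
  qed
  then show ?thesis
    using f by blast
qed

end

section \<open>Twisting by a section of an ample line bundle\<close>

text \<open>A generator that is the product of p and q is also the product of c p and c^(-1)
  q.\<close>

lemma bilin_unit_surj:
  assumes P: "module R P" and Q: "module R Q" and L: "module R L" and f: "bilin R P Q L f"
    and p: "p \<in> carrier P" and c: "c \<in> Units R"
    and N: "N \<subseteq> f p ` carrier Q" "mspan R L N = carrier L"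
  shows "f (c \<odot>\<^bsub>P\<^esub> p) ` carrier Q = carrier L"
proof -
  note R = module_cring[OF P]
  note mon = comm_monoid.axioms(1)[OF cring_monoid[OF R]]
  have c': "c \<in> carrier R" "inv\<^bsub>R\<^esub> c \<in> carrier R"
    using c monoid.Units_closed[OF mon] monoid.Units_inv_closed[OF mon] by auto
  have cp: "c \<odot>\<^bsub>P\<^esub> p \<in> carrier P"
    by (rule module_facts(9)[OF P c'(1) p])
  show ?thesis
  proof (rule lin_surj_mspan[OF Q L bilin_lin2[OF f cp] _ N(2)])
    show "N \<subseteq> f (c \<odot>\<^bsub>P\<^esub> p) ` carrier Q"
    proof
      fix v assume "v \<in> N"
      then obtain q where q: "q \<in> carrier Q" "v = f p q"
        using N(1) by blast
      have q': "inv\<^bsub>R\<^esub> c \<odot>\<^bsub>Q\<^esub> q \<in> carrier Q"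
        by (rule module_facts(9)[OF Q c'(2) q(1)])
      have v: "f p q \<in> carrier L"
        by (rule bilin_closed[OF f p q(1)])
      have "f (c \<odot>\<^bsub>P\<^esub> p) (inv\<^bsub>R\<^esub> c \<odot>\<^bsub>Q\<^esub> q) = c \<odot>\<^bsub>L\<^esub> (inv\<^bsub>R\<^esub> c \<odot>\<^bsub>L\<^esub> f p q)"
        by (simp only: lin_smult[OF bilin_lin1[OF f q'] c'(1) p] lin_smult[OF bilin_lin2[OF f p] c'(2) q(1)])
      also have "\<dots> = (c \<otimes>\<^bsub>R\<^esub> inv\<^bsub>R\<^esub> c) \<odot>\<^bsub>L\<^esub> f p q"
        by (rule module.smult_assoc1[OF L c' v, symmetric])
      also have "\<dots> = v"
        by (simp add: monoid.Units_r_inv[OF mon c] module_facts(12)[OF L v] q(2))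
      finally show "v \<in> f (c \<odot>\<^bsub>P\<^esub> p) ` carrier Q"
        using q' by (metis image_eqI)
    qed
  qed
qed

lemma lists_singleton: "{us. length us = j \<and> set us \<subseteq> {e}} = {replicate j e}"
proof -
  have "us = replicate (length us) e" if "set us \<subseteq> {e}" for us
    using that by (intro replicate_eqI) auto
  then show ?thesis
    by auto
qed

lemma pairing_replicate:
  assumes "cring R" "\<kappa> e = \<one>\<^bsub>R\<^esub>"
  shows "pairing R (replicate j e) (replicate j \<kappa> @ \<phi>s) = \<one>\<^bsub>R\<^esub>"
  by (induction j) (simp_all add: assms cring_facts)

context
  fixes X :: "('p, 'r) rspace" and x :: 'p
  assumes X: "ringed_space X" and x: "x \<in> topspace (pts X)"
begin

text \<open>Multiplication by the section is a morphism that is surjective on the stalk at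
  \<open>x\<close>, and this is preserved by tensoring with \<open>V\<close>.\<close>

lemma gg_twist:
  assumes V: "premod X V" and P: "premod X P" and M: "premod X M" and N: "premod X N" and f: "bimor X P M N f"
    and s: "s \<in> global_sections X P" "f x (s x) ` carrier (mstalk M x) = carrier (mstalk N x)"
    and g: "gg X x (tensor_sheaf X V M)"
  shows "gg X x (tensor_sheaf X V N)"
  by (rule gg_tensor_map[OF X x V M V N mor_id[OF V] _ bimor_mor[OF P f s(1)] s(2) g]) simp

context
  fixes A :: "('p, 'r, 'a) mod_sheaf" and j :: nat and s
  assumes I: "ideal (max_ideal X x) (stalk X x)" and A: "line_bundle X A"
    and s: "s \<in> global_sections X (tpow X j A)" "x \<in> nonvanishing X (tpow X j A) s"
begin

text \<open>The only word of length \<open>j\<close> in the single letter \<open>e\<close> spans the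
  stalk of T^j A, so the germ is a multiple of it. A coefficient in the maximal ideal would make the
  value in the fibre zero.\<close>

lemma nonvanishing_unit:
  assumes e: "e \<in> carrier (mstalk A x)" "mspan (stalk X x) (mstalk A x) {e} = carrier (mstalk A x)"
  shows "\<exists>c\<in>Units (stalk X x). s x =
    c \<odot>\<^bsub>pw False (stalk X x) (mstalk A x) j\<^esub> pwp False (stalk X x) (mstalk A x) j (replicate j e)"
proof -
  let ?R = "stalk X x" and ?A = "mstalk A x"
  let ?P = "pw False ?R ?A j" and ?p = "pwp False ?R ?A j (replicate j e)"
  note Am = premod_module[OF line_bundle_premod[OF A] x]
  have r: "replicate j e \<in> tuples ?A j"
    using e(1) unfolding tuples_def by (simp add: subset_iff)
  have p: "?p \<in> carrier ?P"
    by (rule pwp_closed[OF Am r])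
  have T: "tpow X j A = pws False X j A"
    by (rule tpow_pws)
  have sx: "s x \<in> carrier ?P"
    using premod_germ[OF pws_premod[OF X line_bundle_premod[OF A]] openin_topspace s(1)[unfolded T] x] by simp
  have "mspan ?R ?P {?p} = carrier ?P"
    using pw_span_set[OF Am _ e(2), of False j] e(1) by (simp add: lists_singleton)
  then have "s x \<in> mspan ?R ?P {?p}"
    using sx by simp
  from mspan_singleton[OF pw_module[OF Am] p this]
  obtain c where c: "c \<in> carrier ?R" "s x = c \<odot>\<^bsub>?P\<^esub> ?p"
    by (rule bexE)
  have "c \<in> Units ?R"
  proof (rule ccontr)
    assume "c \<notin> Units ?R"
    then have "c \<in> max_ideal X x"
      using c(1) by (simp add: max_ideal_def)
    then have "pt ?R ?P (residue_field X x) (c \<odot>\<^bsub>?P\<^esub> ?p) (max_ideal X x +>\<^bsub>?R\<^esub> \<one>\<^bsub>?R\<^esub>) = \<zero>\<^bsub>fibre X (pws False X j A) x\<^esub>"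
      using fibre_max[OF X x I, of "pws False X j A" c ?p] pw_module[OF Am] p by simp
    then have "fibre_value X (tpow X j A) x s = \<zero>\<^bsub>fibre X (tpow X j A) x\<^esub>"
      unfolding fibre_value_def T c(2) mstalk_pws .
    moreover have "fibre_value X (tpow X j A) x s \<noteq> \<zero>\<^bsub>fibre X (tpow X j A) x\<^esub>"
      using s(2) unfolding nonvanishing_def mem_Collect_eq by (rule conjunct2)
    ultimately show False
      by (rule notE[rotated])
  qed
  then show ?thesis
    by (rule bexI[rotated]) (rule c(2))
qed

text \<open>At \<open>x\<close> the section is a unit times the j-th power of the generator
  \<open>e\<close>, so multiplying by it reaches the generator of T^(j + n) A.\<close>

lemma gg_twist_ample:
  assumes V: "premod X V" and g: "gg X x (tensor_sheaf X V (tpow X n A))"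
  shows "gg X x (tensor_sheaf X V (tpow X (j + n) A))"
proof -
  let ?R = "stalk X x" and ?A = "mstalk A x"
  note Am = premod_module[OF line_bundle_premod[OF A] x]
  obtain e where e: "e \<in> carrier ?A" "mspan ?R ?A {e} = carrier ?A"
    by (rule line_bundle_generator[OF A x]) blast
  obtain c where c: "c \<in> Units ?R" "s x = c \<odot>\<^bsub>pw False ?R ?A j\<^esub> pwp False ?R ?A j (replicate j e)"
    using nonvanishing_unit[OF e] by blast
  have r: "replicate i e \<in> tuples ?A i" for i
    using e(1) unfolding tuples_def by (simp add: subset_iff)
  note pr = pwp_closed[OF Am r, of False]
  obtain mul where mul: "\<forall>x\<in>topspace (pts X). is_mult False (stalk X x) (mstalk A x) (mul x)"
      "\<forall>m n. bimor X (pws False X m A) (pws False X n A) (pws False X (m + n) A) (\<lambda>x. mul x m n)"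
    using pws_mult[OF X line_bundle_premod[OF A], of False] by blast
  have mx: "is_mult False ?R ?A (mul x)"
    using mul(1) x by blast
  have "mul x j n (s x) ` carrier (pw False ?R ?A n) = carrier (pw False ?R ?A (j + n))"
    unfolding c(2)
  proof (rule bilin_unit_surj[OF pw_module[OF Am] pw_module[OF Am] pw_module[OF Am] is_mult_bilin[OF mx] pr c(1)])
    show "mspan ?R (pw False ?R ?A (j + n)) {pwp False ?R ?A (j + n) (replicate (j + n) e)} = carrier (pw False ?R ?A (j + n))"
      using pw_span_set[OF Am _ e(2), of False "j + n"] e(1) by (simp add: lists_singleton)
    have "pwp False ?R ?A (j + n) (replicate (j + n) e) =
        mul x j n (pwp False ?R ?A j (replicate j e)) (pwp False ?R ?A n (replicate n e))"
      by (simp only: is_mult_pure[OF mx r r] replicate_add)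
    then show "{pwp False ?R ?A (j + n) (replicate (j + n) e)} \<subseteq>
        mul x j n (pwp False ?R ?A j (replicate j e)) ` carrier (pw False ?R ?A n)"
      using pr by simp
  qed
  then show ?thesis
    unfolding tpow_pws
    by (intro gg_twist[OF V pws_premod[OF X line_bundle_premod[OF A]] pws_premod[OF X line_bundle_premod[OF A]] pws_premod[OF X line_bundle_premod[OF A]]
          mul(2)[rule_format, of j n] s(1)[unfolded tpow_pws] _ g[unfolded tpow_pws]]) simp
qed

text \<open>Contraction with the section lowers the power of the dual. It is surjective at
  \<open>x\<close> because the section is, up to a unit, a power of \<open>e\<close>, on which a
  power of the dual element takes the value one.\<close>

lemma gg_untwist_ample:
  assumes V: "premod X V" and g: "gg X x (tensor_sheaf X V (tpow X (j + n) (dual_sheaf X A)))"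
  shows "gg X x (tensor_sheaf X V (tpow X n (dual_sheaf X A)))"
proof -
  let ?R = "stalk X x" and ?A = "mstalk A x" and ?D = "mstalk (dual_sheaf X A) x"
  note Am = premod_module[OF line_bundle_premod[OF A] x]
  note DX = dual_sheaf_premod[OF X line_bundle_premod[OF A]]
  note Dm = premod_module[OF DX x]
  obtain e \<kappa> where e: "e \<in> carrier ?A" "mspan ?R ?A {e} = carrier ?A"
      and \<kappa>: "lin ?R ?A (self_module ?R) \<kappa>" "\<kappa> e = \<one>\<^bsub>?R\<^esub>"
    by (rule line_bundle_generator[OF A x]) blast
  \<comment> \<open>Elements of the dual module are extensional, hence the restriction.\<close>
  let ?k = "restrict \<kappa> (carrier ?A)"
  have k: "?k \<in> carrier ?D" "?k e = \<one>\<^bsub>?R\<^esub>"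
    using dual_restrict[OF Am \<kappa>(1)] e(1) \<kappa>(2) by (simp_all add: dual_sheaf_simps)
  obtain c where c: "c \<in> Units ?R" "s x = c \<odot>\<^bsub>pw False ?R ?A j\<^esub> pwp False ?R ?A j (replicate j e)"
    using nonvanishing_unit[OF e] by blast
  have r: "replicate j e \<in> tuples ?A j"
    using e(1) unfolding tuples_def by (simp add: subset_iff)
  obtain f where f: "bimor X (pws False X j A) (pws False X (j + n) (dual_sheaf X A)) (pws False X n (dual_sheaf X A)) f"
    and fp: "\<forall>x\<in>topspace (pts X). \<forall>us\<in>tuples (mstalk A x) j. \<forall>\<phi>s\<in>tuples (mstalk (dual_sheaf X A) x) (j + n).
      f x (pwp False (stalk X x) (mstalk A x) j us) (pwp False (stalk X x) (mstalk (dual_sheaf X A) x) (j + n) \<phi>s) =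
        pairing (stalk X x) us \<phi>s \<odot>\<^bsub>pw False (stalk X x) (mstalk (dual_sheaf X A) x) n\<^esub>
          pwp False (stalk X x) (mstalk (dual_sheaf X A) x) n (drop j \<phi>s)"
    using contraction_bimor[OF X line_bundle_premod[OF A], of j n] by blast
  have fb: "bilin ?R (pw False ?R ?A j) (pw False ?R ?D (j + n)) (pw False ?R ?D n) (f x)"
    using bimor_bilin[OF f x] by simp
  have "f x (s x) ` carrier (pw False ?R ?D (j + n)) = carrier (pw False ?R ?D n)"
    unfolding c(2)
  proof (rule bilin_unit_surj[OF pw_module[OF Am] pw_module[OF Dm] pw_module[OF Dm] fb pwp_closed[OF Am r] c(1) _ pw_span[OF Dm]])
    show "pwp False ?R ?D n ` tuples ?D n \<subseteq> f x (pwp False ?R ?A j (replicate j e)) ` carrier (pw False ?R ?D (j + n))"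
    proof (rule image_subsetI)
      fix \<phi>s assume \<phi>: "\<phi>s \<in> tuples ?D n"
      \<comment> \<open>The preimage: \<open>j\<close> copies of the dual element in front are
        consumed by the contraction and leave the given forms.\<close>
      have t: "replicate j ?k @ \<phi>s \<in> tuples ?D (j + n)"
        using \<phi> k(1) by (auto simp: tuples_def)
      have "f x (pwp False ?R ?A j (replicate j e)) (pwp False ?R ?D (j + n) (replicate j ?k @ \<phi>s)) =
          \<one>\<^bsub>?R\<^esub> \<odot>\<^bsub>pw False ?R ?D n\<^esub> pwp False ?R ?D n \<phi>s"
        using fp x r t by (simp add: pairing_replicate[of ?R ?k e, OF module_cring[OF Am] k(2)])
      also have "\<dots> = pwp False ?R ?D n \<phi>s"
        by (rule module_facts(12)[OF pw_module[OF Dm] pwp_closed[OF Dm \<phi>]])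
      finally show "pwp False ?R ?D n \<phi>s \<in> f x (pwp False ?R ?A j (replicate j e)) ` carrier (pw False ?R ?D (j + n))"
        using pwp_closed[OF Dm t] by (metis image_eqI)
    qed
  qed
  then show ?thesis
    unfolding tpow_pws
    by (intro gg_twist[OF V pws_premod[OF X line_bundle_premod[OF A]] pws_premod[OF X DX] pws_premod[OF X DX]
          f s(1)[unfolded tpow_pws] _ g[unfolded tpow_pws]]) simp
qed

lemma gg_twist_ample_iter:
  "premod X V \<Longrightarrow> gg X x (tensor_sheaf X V (tpow X n A)) \<Longrightarrow> gg X x (tensor_sheaf X V (tpow X (l * j + n) A))"
  by (induction l) (simp_all add: gg_twist_ample add.assoc)

lemma gg_untwist_ample_iter:
  "premod X V \<Longrightarrow> gg X x (tensor_sheaf X V (tpow X (l * j + n) (dual_sheaf X A))) \<Longrightarrow>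
    gg X x (tensor_sheaf X V (tpow X n (dual_sheaf X A)))"
proof (induction l)
  case (Suc l)
  have "gg X x (tensor_sheaf X V (tpow X (j + (l * j + n)) (dual_sheaf X A)))"
    using Suc.prems(2) by (simp add: add.assoc)
  then show ?case
    by (rule Suc.IH[OF Suc.prems(1) gg_untwist_ample[OF Suc.prems(1)]])
qed simp

end

text \<open>Uses the lower end of a tensorial sheaf, its quotient S^N E: the entry into the passage
  from symmetric to tensor powers.\<close>

lemma gg_flatten:
  assumes E: "premod X E" and B: "premod X B" and V: "tensorial X E N V" and g: "gg X x (tensor_sheaf X V B)"
  shows "gg X x (tensor_sheaf X (pws True X N E) B)"
proof -
  obtain d where d: "epi X V (pws True X N E) d"
    using V unfolding tensorial_def by blast
  have "premod X V"
    using V unfolding tensorial_def by blast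
  from gg_tensor_map[OF X x this B pws_premod[OF X E] B epi_mor[OF d] epi_surj[OF d x] mor_id[OF B] _ g] show ?thesis
    by simp
qed

text \<open>Uses the upper end, by which \<open>V\<close> is a quotient of T^N E: the way back once
  a tensor power is generated.\<close>

lemma gg_chunk:
  assumes E: "premod X E" and B: "premod X B" and V: "tensorial X E N V"
    and g: "gg X x (tensor_sheaf X (pws False X N E) B)"
  shows "gg X x (tensor_sheaf X V B)"
proof -
  obtain u where u: "epi X (pws False X N E) V u"
    using V unfolding tensorial_def by blast
  have "premod X V"
    using V unfolding tensorial_def by blast
  from gg_tensor_map[OF X x pws_premod[OF X E] B this B epi_mor[OF u] epi_surj[OF u x] mor_id[OF B] _ g] show ?thesis
    by simp
qed

end

section \<open>Comparison of the base loci\<close>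

context
  fixes X :: "('p, 'r) rspace" and E :: "('p, 'r, 'e) mod_sheaf"
  assumes X: "ringed_space X" and E: "vector_bundle X E"
    and loc: "\<And>x. x \<in> topspace (pts X) \<Longrightarrow> ideal (max_ideal X x) (stalk X x)"
    and char0: "\<And>x m::nat. x \<in> topspace (pts X) \<Longrightarrow> m \<ge> 1 \<Longrightarrow> add_pow (stalk X x) m \<one>\<^bsub>stalk X x\<^esub> \<in> Units (stalk X x)"
begin

lemma E_premod: "premod X E"
  by (rule vector_bundle_premod[OF E])

lemma not_Bs_iff: "premod X M \<Longrightarrow> x \<in> topspace (pts X) \<Longrightarrow> x \<notin> Bs X M \<longleftrightarrow> gg X x M"
  using Bs_iff_not_gg[OF X _ loc] by blast

text \<open>The bound depends on the stalk of \<open>E\<close> and on \<open>N\<close>, and is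
  uniform in \<open>n\<close>. All large \<open>k\<close> are allowed, which leaves freedom to make
  \<open>k\<close> divisible by prescribed numbers.\<close>

lemma ex_gg_power:
  fixes B :: "('p, 'r, 'b) mod_sheaf"
  assumes x: "x \<in> topspace (pts X)" and V: "tensorial X E N V" "N \<ge> 1" and B: "premod X B"
  shows "\<exists>K\<ge>1. \<forall>k\<ge>K. \<forall>n. gg X x (tensor_sheaf X V (tpow X n B)) \<longrightarrow>
    gg X x (tensor_sheaf X (pws False X (k * N) E) (tpow X (k * n) B))"
proof -
  obtain S where S: "S \<subseteq> carrier (mstalk E x)" "finite S" "mspan (stalk X x) (mstalk E x) S = carrier (mstalk E x)"
    by (rule vector_bundle_finite_span[OF E x])
  have "gg X x (tensor_sheaf X (pws False X (k * N) E) (tpow X (k * n) B))"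
    if k: "card S * (card S * N + 1) + 1 \<le> k" and g: "gg X x (tensor_sheaf X V (tpow X n B))" for k n
    unfolding tpow_pws
  proof (rule gg_sym_power[OF X x E_premod B V(2) S char0[OF x]])
    show "gg X x (tensor_sheaf X (pws True X N E) (pws False X n B))"
      by (rule gg_flatten[OF X x E_premod pws_premod[OF X B] V(1) g[unfolded tpow_pws]])
  qed (use k in auto)
  \<comment> \<open>The added 1 only ensures that the bound is positive.\<close>
  then show ?thesis
    by (intro exI[of _ "card S * (card S * N + 1) + 1"]) auto
qed

context
  fixes A :: "('p, 'r, 'a) mod_sheaf" and W :: "('p, 'r, 'm) mod_sheaf" and W' :: "('p, 'r, 'n) mod_sheaf" and w w' :: nat
  assumes A: "ample_line_bundle X A"
    and W: "tensorial X E w W" "w \<ge> 1" and W': "tensorial X E w' W'" "w' \<ge> 1"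
begin

lemma ample_section:
  assumes x: "x \<in> topspace (pts X)"
  obtains j s where "j \<ge> 1" "s \<in> global_sections X (tpow X j A)" "x \<in> nonvanishing X (tpow X j A) s"
  using A x unfolding ample_line_bundle_def by blast

lemma A_line: "line_bundle X A"
  using A unfolding ample_line_bundle_def by blast

lemma spow_spow_tensorial: "tensorial X E v V \<Longrightarrow> tensorial X E (m * (q * v)) (spow X m (spow X q V))"
  by (intro tensorial_spow_tensorial[OF X E_premod])

lemma spow_spow_premod:
  "tensorial X E v V \<Longrightarrow> premod X B \<Longrightarrow> premod X (tensor_sheaf X (spow X m (spow X q V)) (tpow X n B))"
  unfolding tpow_pws spow_pws tensorial_def by (elim conjE) (intro tensor_premod[OF X] pws_premod[OF X])

text \<open>Generation for one pair \<open>q\<close>, \<open>m\<close> and \<open>W\<close> must be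
  turned into generation for some pair and \<open>W'\<close>. Both exponents on the side of
  \<open>W'\<close> may be chosen, so q w is taken as the inner one.\<close>

lemma B_plus_subset: "B_plus X A W' \<subseteq> B_plus X A W"
proof (rule subsetI, rule ccontr)
  fix x assume x': "x \<in> B_plus X A W'" and "x \<notin> B_plus X A W"
  let ?D = "dual_sheaf X A"
  note D = dual_sheaf_premod[OF X line_bundle_premod[OF A_line]]
  have x: "x \<in> topspace (pts X)"
    using x' by (auto simp: B_plus_def Bs_def)
  obtain q m where q: "q \<ge> 1" "m \<ge> 1" "x \<notin> Bs X (tensor_sheaf X (spow X m (spow X q W)) (tpow X m ?D))"
    using \<open>x \<notin> B_plus X A W\<close> by (auto simp: B_plus_def)
  let ?N = "m * (q * w)"
  have N: "?N \<ge> 1"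
    using q W by simp
  obtain K where K: "K \<ge> 1" "\<forall>k\<ge>K. \<forall>n. gg X x (tensor_sheaf X (spow X m (spow X q W)) (tpow X n ?D)) \<longrightarrow>
      gg X x (tensor_sheaf X (pws False X (k * ?N) E) (tpow X (k * n) ?D))"
    using ex_gg_power[OF x spow_spow_tensorial[OF W(1)] N D] by blast
  obtain j s where j: "j \<ge> 1" "s \<in> global_sections X (tpow X j A)" "x \<in> nonvanishing X (tpow X j A) s"
    by (rule ample_section[OF x])
  \<comment> \<open>The factor \<open>w'\<close> makes \<open>?k * ?N\<close> equal to the weight of
    the target, \<open>?m * (q * w * w')\<close>. The factor \<open>j\<close> makes the surplus in
    the twist a multiple of \<open>j\<close>.\<close>
  let ?k = "K * j * w'" and ?m = "K * j * m"
  have "K * 1 * 1 \<le> ?k"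
    by (intro mult_le_mono order.refl j W')
  then have "gg X x (tensor_sheaf X (pws False X (?k * ?N) E) (tpow X (?k * m) ?D))"
    using K(2) q(3) unfolding not_Bs_iff[OF spow_spow_premod[OF W(1) D] x] by simp
  \<comment> \<open>The dual of A occurs to a power at least as high as required, since
    \<open>w'\<close> is positive; the surplus is contracted away.\<close>
  moreover have "?k * m = (K * m * (w' - 1)) * j + ?m"
    using W'(2) by (cases w') (simp_all add: algebra_simps)
  ultimately have "gg X x (tensor_sheaf X (pws False X (?k * ?N) E) (tpow X ?m ?D))"
    using gg_untwist_ample_iter[OF X x loc[OF x] A_line j(2,3) pws_premod[OF X E_premod], of False "?k * ?N" "K * m * (w' - 1)" ?m]
    by simp
  moreover have "?k * ?N = ?m * (q * w * w')"
    by (simp add: algebra_simps)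
  ultimately have "gg X x (tensor_sheaf X (spow X ?m (spow X (q * w) W')) (tpow X ?m ?D))"
    using gg_chunk[OF X x E_premod _ spow_spow_tensorial[OF W'(1)], of "tpow X ?m ?D" ?m "q * w"] pws_premod[OF X D]
    by (simp add: tpow_pws)
  then have "x \<notin> Bs X (tensor_sheaf X (spow X ?m (spow X (q * w) W')) (tpow X ?m ?D))"
    unfolding not_Bs_iff[OF spow_spow_premod[OF W'(1) D] x] .
  moreover have "?m \<ge> 1" "q * w \<ge> 1"
    using K(1) j(1) q(1,2) W(2) by simp_all
  ultimately show False
    using x' unfolding B_plus_def by blast
qed

text \<open>Now the inner exponent \<open>q'\<close> on the side of \<open>W'\<close> is given, and
  only the outer one may be chosen. Being outside the locus of \<open>W\<close> provides a generated
  twist for every inner exponent, in particular for \<open>q' * w'\<close>.\<close>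

lemma B_minus_subset: "B_minus X A W' \<subseteq> B_minus X A W"
proof (rule subsetI, rule ccontr)
  fix x assume x': "x \<in> B_minus X A W'" and x'': "x \<notin> B_minus X A W"
  obtain q' where q': "q' \<ge> 1" "\<And>m. m \<ge> 1 \<Longrightarrow> x \<in> Bs X (tensor_sheaf X (spow X m (spow X q' W')) (tpow X m A))"
    using x' by (auto simp: B_minus_def)
  have x: "x \<in> topspace (pts X)"
    using q'(2)[of 1] by (auto simp: Bs_def)
  \<comment> \<open>With this choice the weight on the side of \<open>W\<close> is divisible by
    \<open>q' * w'\<close>, the weight of S^q' W'.\<close>
  let ?q = "q' * w'"
  have q: "?q \<ge> 1"
    using q'(1) W' by simp
  then obtain m where m: "m \<ge> 1" "x \<notin> Bs X (tensor_sheaf X (spow X m (spow X ?q W)) (tpow X m A))"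
    using x'' unfolding B_minus_def by blast
  let ?N = "m * (?q * w)"
  have N: "?N \<ge> 1"
    using q m W by simp
  obtain K where K: "K \<ge> 1" "\<forall>k\<ge>K. \<forall>n. gg X x (tensor_sheaf X (spow X m (spow X ?q W)) (tpow X n A)) \<longrightarrow>
      gg X x (tensor_sheaf X (pws False X (k * ?N) E) (tpow X (k * n) A))"
    using ex_gg_power[OF x spow_spow_tensorial[OF W(1)] N line_bundle_premod[OF A_line]] by blast
  obtain j s where j: "j \<ge> 1" "s \<in> global_sections X (tpow X j A)" "x \<in> nonvanishing X (tpow X j A) s"
    by (rule ample_section[OF x])
  \<comment> \<open>The factor \<open>w\<close> in \<open>?m\<close> balances the weights:
    \<open>?k * ?N\<close> is \<open>?m * (q' * w')\<close>.\<close>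
  let ?k = "K * j" and ?m = "K * j * m * w"
  have "K * 1 \<le> ?k"
    by (intro mult_le_mono order.refl j)
  then have "gg X x (tensor_sheaf X (pws False X (?k * ?N) E) (tpow X (?k * m) A))"
    using K(2) m(2) unfolding not_Bs_iff[OF spow_spow_premod[OF W(1) line_bundle_premod[OF A_line]] x] by simp
  \<comment> \<open>The target needs at least as high a power of A as has been obtained; what is
    missing is a multiple of \<open>j\<close> and is supplied by the section.\<close>
  moreover have "(K * m * (w - 1)) * j + ?k * m = ?m"
    using W(2) by (cases w) (simp_all add: algebra_simps)
  ultimately have "gg X x (tensor_sheaf X (pws False X (?k * ?N) E) (tpow X ?m A))"
    using gg_twist_ample_iter[OF X x loc[OF x] A_line j(2,3) pws_premod[OF X E_premod], of False "?k * ?N" "?k * m" "K * m * (w - 1)"]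
    by simp
  moreover have "?k * ?N = ?m * (q' * w')"
    by (simp add: algebra_simps)
  ultimately have "gg X x (tensor_sheaf X (spow X ?m (spow X q' W')) (tpow X ?m A))"
    using gg_chunk[OF X x E_premod _ spow_spow_tensorial[OF W'(1)], of "tpow X ?m A" ?m q'] pws_premod[OF X line_bundle_premod[OF A_line]]
    by (simp add: tpow_pws)
  then have "x \<notin> Bs X (tensor_sheaf X (spow X ?m (spow X q' W')) (tpow X ?m A))"
    unfolding not_Bs_iff[OF spow_spow_premod[OF W'(1) line_bundle_premod[OF A_line]] x] .
  moreover have "?m \<ge> 1"
    using K(1) j(1) m(1) W(2) by simp
  ultimately show False
    using q'(2) by blast
qed

end

text \<open>T^m T^c E and T^(m c) E are quotients of each other. This gives one inclusion directly;
  for the other, generation of T^m E is first raised to its c-fold power by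
  \<open>gg_power\<close>.\<close>

lemma B_tensor_tpow:
  assumes c: "c \<ge> 1"
  shows "B_tensor X E = B_tensor X (tpow X c E)"
proof -
  note T = pws_premod[OF X E_premod, of False]
  have "x \<in> Bs X (tpow X m (tpow X c E))" if x: "x \<in> B_tensor X E" and m: "m \<ge> 1" for x m
  proof (rule ccontr)
    assume n: "x \<notin> Bs X (tpow X m (tpow X c E))"
    have "m * c \<ge> 1"
      using m c by simp
    then have xB: "x \<in> Bs X (pws False X (m * c) E)"
      using x unfolding B_tensor_def tpow_pws by blast
    then have xt: "x \<in> topspace (pts X)"
      by (simp add: Bs_def)
    obtain F where F: "epi X (pws False X m (pws False X c E)) (pws False X (m * c) E) F"
      using flatten_epi[OF X E_premod T epi_id[OF T]] by blast
    have "gg X x (pws False X m (pws False X c E))"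
      using n unfolding tpow_pws not_Bs_iff[OF pws_premod[OF X T] xt] .
    from gg_mor[OF X xt pws_premod[OF X T] T epi_mor[OF F] epi_surj[OF F xt] this] show False
      using xB not_Bs_iff[OF T xt] by blast
  qed
  moreover have "x \<in> Bs X (tpow X m E)" if x: "x \<in> B_tensor X (tpow X c E)" and m: "m \<ge> 1" for x m
  proof (rule ccontr)
    assume n: "x \<notin> Bs X (tpow X m E)"
    have xB: "x \<in> Bs X (pws False X m (pws False X c E))"
      using x m unfolding B_tensor_def tpow_pws by blast
    then have xt: "x \<in> topspace (pts X)"
      by (simp add: Bs_def)
    obtain F where F: "epi X (pws False X (m * c) E) (pws False X m (pws False X c E)) F"
      using chunk_epi[OF X E_premod T epi_id[OF T]] by blast
    have "gg X x (pws False X m E)"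
      using n unfolding tpow_pws not_Bs_iff[OF T xt] .
    then have "gg X x (pws False X (m * c) E)"
      unfolding mult.commute[of m c] by (rule gg_power[OF X xt E_premod])
    from gg_mor[OF X xt T pws_premod[OF X T] epi_mor[OF F] epi_surj[OF F xt] this] show False
      using xB not_Bs_iff[OF pws_premod[OF X T] xt] by blast
  qed
  ultimately show ?thesis
    unfolding B_tensor_def by (intro equalityI subsetI INT_I) auto
qed

end

text \<open>E, S^c E and T^c E are tensorial over E of weights 1, c and c, so the inclusions between
  their augmented and diminished loci are instances of \<open>B_plus_subset\<close> and
  \<open>B_minus_subset\<close>.\<close>

theorem corollary2p12:
  fixes X :: "('p, 'r) rspace"
    and E :: "('p, 'r, 'e) mod_sheaf"
    and c :: nat
  assumes "projective_variety TYPE('k::{alg_closed_field, field_char_0}) X"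
    and "vector_bundle X E"
    and "c \<ge> 1"
  shows "B_tensor X E = B_tensor X (tpow X c E) \<and>
    (\<forall>A :: ('p, 'r, 'a) mod_sheaf. ample_line_bundle X A \<longrightarrow>
       (B_plus X A E = B_plus X A (spow X c E) \<and>
        B_plus X A (spow X c E) = B_plus X A (tpow X c E)) \<and>
       (B_minus X A E = B_minus X A (spow X c E) \<and>
        B_minus X A (spow X c E) = B_minus X A (tpow X c E)) \<and>
       ((V_big X A (tpow X c E) \<longleftrightarrow> V_big X A E) \<and>
        (V_big X A E \<longleftrightarrow> V_big X A (spow X c E))) \<and>
       ((V_psef X A (tpow X c E) \<longleftrightarrow> V_psef X A E) \<and>
        (V_psef X A E \<longleftrightarrow> V_psef X A (spow X c E))))"
proof -
  have X: "ringed_space X"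
    using assms(1) by (simp add: projective_variety_def)
  note hyps = X assms(2) projective_variety_stalk[OF assms(1)]
  note Em = vector_bundle_premod[OF assms(2)]
  note t = tensorial_self[OF X Em] tensorial_spow[OF X Em, of c] tensorial_tpow[OF X Em, of c]
  have plus: "B_plus X A E = B_plus X A (spow X c E)" "B_plus X A (spow X c E) = B_plus X A (tpow X c E)"
    and minus: "B_minus X A E = B_minus X A (spow X c E)" "B_minus X A (spow X c E) = B_minus X A (tpow X c E)"
    if A: "ample_line_bundle X A" for A :: "('p, 'r, 'a) mod_sheaf"
  proof -
    show "B_plus X A E = B_plus X A (spow X c E)" "B_minus X A E = B_minus X A (spow X c E)"
      using B_plus_subset[OF hyps A t(1) order.refl t(2) assms(3)] B_plus_subset[OF hyps A t(2) assms(3) t(1) order.refl]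
        B_minus_subset[OF hyps A t(1) order.refl t(2) assms(3)] B_minus_subset[OF hyps A t(2) assms(3) t(1) order.refl]
      by (simp_all add: subset_antisym)
    show "B_plus X A (spow X c E) = B_plus X A (tpow X c E)" "B_minus X A (spow X c E) = B_minus X A (tpow X c E)"
      using B_plus_subset[OF hyps A t(2) assms(3) t(3) assms(3)] B_plus_subset[OF hyps A t(3) assms(3) t(2) assms(3)]
        B_minus_subset[OF hyps A t(2) assms(3) t(3) assms(3)] B_minus_subset[OF hyps A t(3) assms(3) t(2) assms(3)]
      by (simp_all add: subset_antisym)
  qed
  show ?thesis
    using B_tensor_tpow[OF hyps assms(3)] by (simp add: V_big_def V_psef_def plus[symmetric] minus[symmetric])
qed

end
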